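(* Let $F$ be a $p$-adic field with $p\ne2,3$, whose residue field has $q$ elements. If $\pi$ is an irreducible admissible representation of $GL_3(F)$, then for every integer $n\ge1$, \[ \dim\pi^{K_n}\le 9n^2q^{4n}(1+1/q)^3. \]
   Context: $R$ is the ring of integers of $F$, $\varpi$ a uniformizer, $K=GL_3(R)$, and $K_n$ is the subgroup of $K$ of elements congruent to the identity modulo $\varpi^n$. *)

theory Defs
  imports "HOL-Analysis.Analysis"
begin

text \<open>A valuation v on the nonzero elements of F (value at 0 irrelevant).\<close>

definition val_ring :: "('f::field \<Rightarrow> int) \<Rightarrow> 'f set" where
  "val_ring v = {x. x = 0 \<or> 0 \<le> v x}"

definition val_ideal :: "('f::field \<Rightarrow> int) \<Rightarrow> nat \<Rightarrow> 'f set" where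
  "val_ideal v n = {x. x = 0 \<or> int n \<le> v x}"

definition residue_rel :: "('f::field \<Rightarrow> int) \<Rightarrow> ('f \<times> 'f) set" where
  "residue_rel v = {(x, y). x \<in> val_ring v \<and> y \<in> val_ring v \<and> x - y \<in> val_ideal v 1}"

text \<open>F is a p-adic field (finite extension of Q_p), described intrinsically as a
 field of characteristic 0, complete w.r.t. a normalized discrete valuation v,
 whose residue field R/varpi R is finite with q elements and has characteristic p.\<close>
definition p_adic_field :: "('f::field \<Rightarrow> int) \<Rightarrow> nat \<Rightarrow> nat \<Rightarrow> bool" where
  "p_adic_field v p q \<longleftrightarrow>
     CHAR('f) = 0 \<and> prime p \<and>
     (\<forall>x y. x \<noteq> 0 \<longrightarrow> y \<noteq> 0 \<longrightarrow> v (x * y) = v x + v y) \<and>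
     (\<forall>x y. x \<noteq> 0 \<longrightarrow> y \<noteq> 0 \<longrightarrow> x + y \<noteq> 0 \<longrightarrow> min (v x) (v y) \<le> v (x + y)) \<and>
     (\<forall>k. \<exists>x. x \<noteq> 0 \<and> v x = k) \<and>
     (\<forall>X :: nat \<Rightarrow> 'f.
        (\<forall>m::int. \<exists>N. \<forall>i\<ge>N. \<forall>j\<ge>N. X i = X j \<or> m \<le> v (X i - X j)) \<longrightarrow>
        (\<exists>L. \<forall>m::int. \<exists>N. \<forall>i\<ge>N. X i = L \<or> m \<le> v (X i - L))) \<and>
     finite (val_ring v // residue_rel v) \<and>
     card (val_ring v // residue_rel v) = q \<and>
     (of_nat p :: 'f) \<in> val_ideal v 1"

definition GL3 :: "('f::field ^ 3 ^ 3) set" where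
  "GL3 = {g. det g \<noteq> 0}"

definition Kmax :: "('f::field \<Rightarrow> int) \<Rightarrow> ('f ^ 3 ^ 3) set" where
  "Kmax v = {g. (\<forall>i j. g $ i $ j \<in> val_ring v) \<and> det g \<noteq> 0 \<and> v (det g) = 0}"

definition Kn :: "('f::field \<Rightarrow> int) \<Rightarrow> nat \<Rightarrow> ('f ^ 3 ^ 3) set" where
  "Kn v n = {g \<in> Kmax v. \<forall>i j. (g - mat 1) $ i $ j \<in> val_ideal v n}"

definition fixed_vectors ::
  "('f::field \<Rightarrow> int) \<Rightarrow> ('f ^ 3 ^ 3 \<Rightarrow> 'v \<Rightarrow> 'v) \<Rightarrow> nat \<Rightarrow> 'v set" where
  "fixed_vectors v \<pi> n = {x. \<forall>k \<in> Kn v n. \<pi> k x = x}"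

definition smooth_rep ::
  "('f::field \<Rightarrow> int) \<Rightarrow> (complex \<Rightarrow> 'v::ab_group_add \<Rightarrow> 'v) \<Rightarrow> ('f ^ 3 ^ 3 \<Rightarrow> 'v \<Rightarrow> 'v) \<Rightarrow> bool" where
  "smooth_rep v smul \<pi> \<longleftrightarrow>
     vector_space smul \<and>
     (\<forall>g \<in> GL3. Vector_Spaces.linear smul smul (\<pi> g)) \<and>
     \<pi> (mat 1) = id \<and>
     (\<forall>g \<in> GL3. \<forall>h \<in> GL3. \<pi> (g ** h) = \<pi> g \<circ> \<pi> h) \<and>
     (\<forall>x. \<exists>n\<ge>1. x \<in> fixed_vectors v \<pi> n)"

definition admissible_rep ::
  "('f::field \<Rightarrow> int) \<Rightarrow> (complex \<Rightarrow> 'v::ab_group_add \<Rightarrow> 'v) \<Rightarrow> ('f ^ 3 ^ 3 \<Rightarrow> 'v \<Rightarrow> 'v) \<Rightarrow> bool" where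
  "admissible_rep v smul \<pi> \<longleftrightarrow>
     smooth_rep v smul \<pi> \<and>
     (\<forall>n\<ge>1. \<exists>B. finite B \<and> fixed_vectors v \<pi> n \<subseteq> module.span smul B)"

definition irreducible_rep ::
  "(complex \<Rightarrow> 'v::ab_group_add \<Rightarrow> 'v) \<Rightarrow> ('f::field ^ 3 ^ 3 \<Rightarrow> 'v \<Rightarrow> 'v) \<Rightarrow> bool" where
  "irreducible_rep smul \<pi> \<longleftrightarrow>
     (\<exists>x::'v. x \<noteq> 0) \<and>
     (\<forall>W. module.subspace smul W \<and> (\<forall>g \<in> GL3. \<pi> g ` W \<subseteq> W) \<longrightarrow>
          W = {0} \<or> W = UNIV)"

end

theory Submission
  imports Defs "HOL-Library.Function_Algebras" "HOL-Computational_Algebra.Fundamental_Theorem_Algebra"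
begin

text \<open>Let \<open>V\<close> be the space of \<open>K\<^sub>n\<close>-fixed vectors and \<open>e\<close> the averaging projection onto it. A Burnside argument
  bounds \<open>(dim V)\<^sup>2\<close> by the number of \<open>g\<close> needed to obtain every operator \<open>e g\<close> on \<open>V\<close> up to a scalar. Write
  \<open>g = k a k'\<close> by the Cartan decomposition; for fixed \<open>a\<close> an LDU count leaves at most \<open>16 q\<^bsup>8n\<^esup>\<close> classes.
  Suppose that every vector, in \<open>\<pi>\<close> and in its twist by the inverse transpose, is killed by averaging over a
  large compact piece of the unipotent radical of type (2,1). A descent through groups of Iwahori type shows that \<open>e a = 0\<close>
  on \<open>V\<close> unless both gaps of \<open>a\<close> are less than \<open>3n - 2\<close>, hence \<open>dim V \<le> 4 (3n - 2) q\<^bsup>4n\<^esup> \<le> 9 n\<^sup>2 q\<^bsup>4n\<^esup>\<close>.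
  Otherwise a non-nilpotent Hecke operator has an eigenvector, which yields a nonzero functional invariant under the
  unipotent radical; by the Iwasawa decomposition \<open>dim V \<le> 3 q\<^bsup>2n\<^esup> d\<close>, where \<open>d\<close> is the dimension of the invariants
  of an irreducible representation of \<open>GL\<^sub>2 \<times> GL\<^sub>1\<close>, and the same dichotomy gives \<open>d\<^sup>2 \<le> 4 (2n - 1) q\<^bsup>4n\<^esup>\<close>.\<close>

section \<open>Discretely valued fields\<close>

text \<open>Averages over compact groups are means over finite orbits, in place of Haar integrals.
  The obstacle is uniformity: the vanishing hypothesis lets the size of the compact piece depend on
  the vector, while the count needs one size for all vectors of level n. The descent supplies it: a
  nonzero vector with enough invariance would keep nonzero averages over ever larger pieces. The
  radical of type (2,1) controls only the gap between the last two entries of a; the inverse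
  transpose reverses the entries and so controls the other gap. At level n the last row has depth n,
  and a vanishing bound s + t <= 1 on depths would give the threshold 2n - 1, as it does for GL_2;
  for GL_3 each level above the first costs one more, which makes 3n - 2. The factor 16 is 2^4: four
  of the ten parameters that move a pair (k, k') without changing its operator up to a scalar are
  units, and units are at least half of R modulo the n-th power of the uniformizer. The last
  inequality 4 (3n - 2) <= 9 n^2 follows from (3n - 2)^2 >= 0.\<close>

locale dvf =
  fixes v :: "'f::field \<Rightarrow> int" and q :: nat
  assumes v_mult: "x \<noteq> 0 \<Longrightarrow> y \<noteq> 0 \<Longrightarrow> v (x * y) = v x + v y"
    and v_add: "x \<noteq> 0 \<Longrightarrow> y \<noteq> 0 \<Longrightarrow> x + y \<noteq> 0 \<Longrightarrow> min (v x) (v y) \<le> v (x + y)"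
    and v_surj: "\<exists>x. x \<noteq> 0 \<and> v x = k"
    and fin_res: "finite (val_ring v // residue_rel v)"
    and card_res: "card (val_ring v // residue_rel v) = q"
begin

definition P :: "int \<Rightarrow> 'f set" where "P k = {x. x = 0 \<or> k \<le> v x}"

lemma val_ring_P: "val_ring v = P 0" by (simp add: P_def val_ring_def)
lemma val_ideal_P: "val_ideal v n = P (int n)" by (simp add: P_def val_ideal_def)

lemma P_0 [simp]: "0 \<in> P k" by (simp add: P_def)
lemma v_1 [simp]: "v 1 = 0" using v_mult[of 1 1] by simp
lemma v_m1 [simp]: "v (- 1) = 0" using v_mult[of "-1" "-1"] by simp
lemma v_minus [simp]: "x \<noteq> 0 \<Longrightarrow> v (- x) = v x" using v_mult[of "-1" x] by simp
lemma v_inverse: "x \<noteq> 0 \<Longrightarrow> v (inverse x) = - v x" using v_mult[of x "inverse x"] by simp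
lemma v_divide: "x \<noteq> 0 \<Longrightarrow> y \<noteq> 0 \<Longrightarrow> v (x / y) = v x - v y"
  by (simp add: divide_inverse v_mult v_inverse)

lemma P_minus [simp]: "- x \<in> P k \<longleftrightarrow> x \<in> P k" by (cases "x = 0") (auto simp: P_def)
lemma P_add: "x \<in> P k \<Longrightarrow> y \<in> P k \<Longrightarrow> x + y \<in> P k"
  using v_add[of x y] by (cases "x = 0"; cases "y = 0"; cases "x + y = 0") (auto simp: P_def)
lemma P_diff: "x \<in> P k \<Longrightarrow> y \<in> P k \<Longrightarrow> x - y \<in> P k"
  using P_add[of x k "- y"] by simp
lemma P_mult: "x \<in> P a \<Longrightarrow> y \<in> P b \<Longrightarrow> x * y \<in> P (a + b)"
  by (cases "x = 0"; cases "y = 0") (auto simp: P_def v_mult)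
lemma P_mono: "x \<in> P a \<Longrightarrow> b \<le> a \<Longrightarrow> x \<in> P b" by (auto simp: P_def)
lemma P_mult': "x \<in> P a \<Longrightarrow> y \<in> P b \<Longrightarrow> c \<le> a + b \<Longrightarrow> x * y \<in> P c"
  using P_mult P_mono by blast
lemma P_1 [simp]: "1 \<in> P k \<longleftrightarrow> k \<le> 0" by (auto simp: P_def)
lemma P_sum: "(\<And>i. i \<in> I \<Longrightarrow> f i \<in> P k) \<Longrightarrow> sum f I \<in> P k"
  by (induction I rule: infinite_finite_induct) (auto intro: P_add)

section \<open>Units, units congruent to 1, and powers of a uniformizer\<close>

definition un :: "'f set" where "un = {x. x \<noteq> 0 \<and> v x = 0}"

lemma un_P: "x \<in> un \<Longrightarrow> x \<in> P 0" by (simp add: un_def P_def)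
lemma un_1 [simp]: "1 \<in> un" by (simp add: un_def)
lemma un_mult: "x \<in> un \<Longrightarrow> y \<in> un \<Longrightarrow> x * y \<in> un" by (simp add: un_def v_mult)
lemma un_minus [simp]: "- x \<in> un \<longleftrightarrow> x \<in> un" by (cases "x = 0") (auto simp: un_def)
lemma un_inverse: "x \<in> un \<Longrightarrow> inverse x \<in> un" by (simp add: un_def v_inverse)
lemma un_divide: "x \<in> un \<Longrightarrow> y \<in> un \<Longrightarrow> x / y \<in> un" by (simp add: un_def v_divide)
lemma un_nz: "x \<in> un \<Longrightarrow> x \<noteq> 0" by (simp add: un_def)
lemma un_iff: "x \<in> un \<longleftrightarrow> x \<in> P 0 \<and> x \<notin> P 1" by (auto simp: un_def P_def)
lemma P_divide_un: "y \<in> un \<Longrightarrow> x / y \<in> P k \<longleftrightarrow> x \<in> P k"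
  by (cases "x = 0") (auto simp: P_def un_def v_divide)
lemma P_mult_un: "y \<in> un \<Longrightarrow> x * y \<in> P k \<longleftrightarrow> x \<in> P k" "y \<in> un \<Longrightarrow> y * x \<in> P k \<longleftrightarrow> x \<in> P k"
  by (cases "x = 0"; auto simp: P_def un_def v_mult)+
lemma un_add: assumes "x \<in> un" "y \<in> P 1" shows "x + y \<in> un"
proof -
  have "x + y \<in> P 0" using assms by (meson P_add P_mono un_P zero_le_one)
  moreover have "x + y \<notin> P 1" using P_diff[of "x + y" 1 y] assms by (auto simp: un_iff)
  ultimately show ?thesis by (simp add: un_iff)
qed
lemma un_1p: "y \<in> P k \<Longrightarrow> 1 \<le> k \<Longrightarrow> 1 + y \<in> un" using un_add P_mono un_1 by blast

definition O1 :: "int \<Rightarrow> 'f set" where "O1 k = {x. x - 1 \<in> P k}"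

lemma O1_un: "x \<in> O1 k \<Longrightarrow> 1 \<le> k \<Longrightarrow> x \<in> un" using un_1p[of "x - 1" k] by (simp add: O1_def)
lemma O1_1 [simp]: "1 \<in> O1 k" by (simp add: O1_def)
lemma O1_I: "y \<in> P k \<Longrightarrow> 1 + y \<in> O1 k" by (simp add: O1_def)
lemma O1_mult: assumes "x \<in> O1 k" "y \<in> O1 k" "1 \<le> k" shows "x * y \<in> O1 k"
proof -
  have "(x - 1) * y \<in> P k" using assms O1_un[of y k] by (simp add: P_mult_un O1_def)
  hence "(x - 1) * y + (y - 1) \<in> P k" using assms P_add by (simp add: O1_def)
  thus ?thesis by (simp add: O1_def algebra_simps)
qed
lemma O1_inverse: assumes "x \<in> O1 k" "1 \<le> k" shows "inverse x \<in> O1 k"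
proof -
  have u: "x \<in> un" using assms O1_un by blast
  have "x - 1 \<in> P k" using assms by (simp add: O1_def)
  hence "- (x - 1) \<in> P k" by (simp only: P_minus)
  hence "- (x - 1) / x \<in> P k" by (simp only: P_divide_un[OF u])
  moreover have "- (x - 1) / x = inverse x - 1" using un_nz[OF u] by (simp add: field_simps)
  ultimately show ?thesis by (simp add: O1_def)
qed
lemma O1_divide: "x \<in> O1 k \<Longrightarrow> y \<in> O1 k \<Longrightarrow> 1 \<le> k \<Longrightarrow> x / y \<in> O1 k"
  by (simp add: divide_inverse O1_mult O1_inverse)

definition uf :: 'f where "uf = (SOME x. x \<noteq> 0 \<and> v x = 1)"
lemma Pi: "uf \<noteq> 0" "v uf = 1" using someI_ex[OF v_surj[of 1]] by (auto simp: uf_def)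

definition pw :: "int \<Rightarrow> 'f" where "pw k = uf powi k"
lemma pw_nz [simp]: "pw k \<noteq> 0" using Pi by (simp add: pw_def)
lemma pw_add: "pw (a + b) = pw a * pw b" using Pi by (simp add: pw_def power_int_add)
lemma pw_0 [simp]: "pw 0 = 1" by (simp add: pw_def)
lemma pw_minus: "pw (- a) = inverse (pw a)" by (simp add: pw_def power_int_minus)
lemma pw_diff: "pw (a - b) = pw a / pw b" using Pi by (simp add: pw_def power_int_diff)
lemma v_pown: "v (uf ^ n) = int n" using Pi by (induction n) (auto simp: v_mult)
lemma v_pw [simp]: "v (pw k) = k"
  using Pi by (cases "k \<ge> 0") (auto simp: pw_def power_int_def v_pown v_inverse power_inverse)
lemma pw_P [simp]: "pw k \<in> P l \<longleftrightarrow> l \<le> k" by (simp add: P_def)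
lemma pw_mult_P: "pw k * x \<in> P l \<longleftrightarrow> x \<in> P (l - k)" "x * pw k \<in> P l \<longleftrightarrow> x \<in> P (l - k)"
  by (cases "x = 0"; auto simp: P_def v_mult)+
lemma pw_divide_P: "x / pw k \<in> P l \<longleftrightarrow> x \<in> P (l + k)"
  by (cases "x = 0") (auto simp: P_def v_divide)
lemma P_divide: "x \<in> P a \<Longrightarrow> y \<noteq> 0 \<Longrightarrow> b + v y \<le> a \<Longrightarrow> x / y \<in> P b"
  by (cases "x = 0") (auto simp: P_def v_divide)
lemma v_exact: "x \<in> P k \<Longrightarrow> x \<notin> P (k + 1) \<Longrightarrow> x \<noteq> 0 \<and> v x = k" by (auto simp: P_def)

section \<open>Residue classes and digit expansions\<close>

lemma res_equiv: "equiv (P 0) (residue_rel v)"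
proof (rule equivI)
  show "residue_rel v \<subseteq> P 0 \<times> P 0" by (auto simp: residue_rel_def val_ring_P)
  show "refl_on (P 0) (residue_rel v)" by (auto simp: refl_on_def residue_rel_def val_ring_P val_ideal_P)
  show "sym (residue_rel v)"
  proof (rule symI)
    fix x y assume "(x, y) \<in> residue_rel v"
    hence h: "x \<in> P 0" "y \<in> P 0" "x - y \<in> P 1" by (auto simp: residue_rel_def val_ring_P val_ideal_P)
    have "- (x - y) \<in> P 1" using h(3) by (simp only: P_minus)
    thus "(y, x) \<in> residue_rel v" using h by (simp add: residue_rel_def val_ring_P val_ideal_P)
  qed
  show "trans (residue_rel v)"
  proof (rule transI)
    fix x y z assume "(x, y) \<in> residue_rel v" "(y, z) \<in> residue_rel v"
    hence h: "x \<in> P 0" "z \<in> P 0" "x - y \<in> P 1" "y - z \<in> P 1" by (auto simp: residue_rel_def val_ring_P val_ideal_P)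
    have "x - z \<in> P 1" using P_add[OF h(3,4)] by simp
    thus "(x, z) \<in> residue_rel v" using h by (simp add: residue_rel_def val_ring_P val_ideal_P)
  qed
qed

text \<open>One representative for each residue class. The choice is arbitrary, so the class of 0
  need not be represented by 0; hence the element \<open>c0\<close> that recurs below.\<close>

definition Tm :: "'f set" where "Tm = (\<lambda>X. SOME x. x \<in> X) ` (P 0 // residue_rel v)"

lemma Tm_pick: "X \<in> P 0 // residue_rel v \<Longrightarrow> (SOME x. x \<in> X) \<in> X"
  using in_quotient_imp_non_empty[OF res_equiv, of X] some_in_eq[of X] by simp

lemma Tm_P: "c \<in> Tm \<Longrightarrow> c \<in> P 0"
  using Tm_pick in_quotient_imp_subset[OF res_equiv] by (auto simp: Tm_def)

lemma Tm_ex: assumes "r \<in> P 0" shows "\<exists>c\<in>Tm. r - c \<in> P 1"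
proof -
  let ?X = "residue_rel v `` {r}"
  have X: "?X \<in> P 0 // residue_rel v" using assms by (rule quotientI)
  have "(SOME x. x \<in> ?X) \<in> ?X" using Tm_pick[OF X] .
  then obtain c where c: "c = (SOME x. x \<in> ?X)" "(r, c) \<in> residue_rel v" by blast
  have "r - c \<in> P 1" using c(2) by (simp add: residue_rel_def val_ideal_P)
  moreover have "c \<in> Tm" unfolding Tm_def c(1) using X by blast
  ultimately show ?thesis by blast
qed

lemma Tm_uniq: assumes "c \<in> Tm" "c' \<in> Tm" "c - c' \<in> P 1" shows "c = c'"
proof -
  obtain X where X: "X \<in> P 0 // residue_rel v" "c = (SOME x. x \<in> X)" using assms by (auto simp: Tm_def)
  obtain Y where Y: "Y \<in> P 0 // residue_rel v" "c' = (SOME x. x \<in> Y)" using assms by (auto simp: Tm_def)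
  have "c \<in> X" "c' \<in> Y" using Tm_pick X Y by auto
  moreover have "(c, c') \<in> residue_rel v" using assms Tm_P by (auto simp: residue_rel_def val_ring_P val_ideal_P)
  ultimately have "X = Y" using quotient_eqI[OF res_equiv X(1) Y(1)] by blast
  thus ?thesis using X Y by simp
qed

lemma Tm_finite: "finite Tm" using fin_res by (simp add: Tm_def val_ring_P)

lemma Tm_card: "card Tm = q"
proof -
  have "inj_on (\<lambda>X. SOME x. x \<in> X) (P 0 // residue_rel v)"
  proof (rule inj_onI)
    fix X Y assume h: "X \<in> P 0 // residue_rel v" "Y \<in> P 0 // residue_rel v" "(SOME x. x \<in> X) = (SOME x. x \<in> Y)"
    have "(SOME x. x \<in> X) \<in> X \<inter> Y" using Tm_pick[OF h(1)] Tm_pick[OF h(2)] h(3) by simp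
    thus "X = Y" using quotient_disj[OF res_equiv h(1,2)] by blast
  qed
  thus ?thesis using card_res by (simp add: Tm_def card_image val_ring_P)
qed

lemma q_ge2: "2 \<le> q"
proof -
  obtain c d where c: "c \<in> Tm" "0 - c \<in> P 1" and d: "d \<in> Tm" "1 - d \<in> P 1"
    using Tm_ex[of 0] Tm_ex[of 1] by auto
  have "c \<noteq> d" using c d P_add[of "1 - d" 1 d] by auto
  hence "card {c, d} = 2" by simp
  moreover have "card {c, d} \<le> card Tm" using c d by (intro card_mono Tm_finite) auto
  ultimately show ?thesis by (simp add: Tm_card)
qed

text \<open>Expansions of length k in the uniformizer with digits in \<open>Tm\<close>: a
  transversal of R modulo the k-th power of the maximal ideal (\<open>Dig_ex\<close>,
  \<open>Dig_uniq\<close>).\<close>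

primrec Dig :: "nat \<Rightarrow> 'f set" where
  "Dig 0 = {0}"
| "Dig (Suc k) = (\<lambda>(c, a). c + uf * a) ` (Tm \<times> Dig k)"

lemma Pi_P: "uf * x \<in> P k \<longleftrightarrow> x \<in> P (k - 1)" using pw_mult_P(1)[of 1 x k] by (simp add: pw_def)

lemma Dig_P: "a \<in> Dig k \<Longrightarrow> a \<in> P 0"
proof (induction k arbitrary: a)
  case (Suc k)
  then obtain c b where cb: "c \<in> Tm" "b \<in> Dig k" "a = c + uf * b" by auto
  moreover have "uf * b \<in> P 0" using Suc.IH[OF cb(2)] P_mono by (auto simp: Pi_P)
  ultimately show ?case using P_add Tm_P by blast
qed simp

lemma Dig_finite: "finite (Dig k)" by (induction k) (auto simp: Tm_finite)

lemma Dig_ex: "r \<in> P 0 \<Longrightarrow> \<exists>a\<in>Dig k. r - a \<in> P (int k)"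
proof (induction k arbitrary: r)
  case 0 thus ?case by simp
next
  case (Suc k)
  obtain c where c: "c \<in> Tm" "r - c \<in> P 1" using Tm_ex Suc by blast
  have "(r - c) / uf \<in> P 0" using c(2) pw_divide_P[of "r - c" 1 0] by (simp add: pw_def)
  then obtain a where a: "a \<in> Dig k" "(r - c) / uf - a \<in> P (int k)" using Suc.IH by blast
  have "uf * ((r - c) / uf - a) \<in> P (int (Suc k))" using a by (simp add: Pi_P)
  moreover have "uf * ((r - c) / uf - a) = r - (c + uf * a)" using Pi by (simp add: field_simps)
  ultimately show ?case using c a by (intro bexI[of _ "c + uf * a"]) auto
qed

lemma Dig_uniq: "a \<in> Dig k \<Longrightarrow> b \<in> Dig k \<Longrightarrow> a - b \<in> P (int k) \<Longrightarrow> a = b"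
proof (induction k arbitrary: a b)
  case (Suc k)
  obtain c a' where a: "c \<in> Tm" "a' \<in> Dig k" "a = c + uf * a'" using Suc.prems by auto
  obtain d b' where b: "d \<in> Tm" "b' \<in> Dig k" "b = d + uf * b'" using Suc.prems by auto
  have "uf * (a' - b') \<in> P 1" using a b Dig_P P_diff by (simp add: Pi_P)
  moreover have "a - b \<in> P 1" using Suc.prems(3) P_mono by fastforce
  ultimately have "(a - b) - uf * (a' - b') \<in> P 1" using P_diff by blast
  moreover have "(a - b) - uf * (a' - b') = c - d" using a b by (simp add: algebra_simps)
  ultimately have "c - d \<in> P 1" by (simp only:)
  hence "c = d" using Tm_uniq a b by blast
  hence "a - b = uf * (a' - b')" using a b by (simp add: algebra_simps)
  hence "a' - b' \<in> P (int k)" using Suc.prems(3) by (simp add: Pi_P)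
  thus ?case using Suc.IH a b \<open>c = d\<close> by simp
qed simp

lemma Dig_Suc_inj: "inj_on (\<lambda>(c, a). c + uf * a) (Tm \<times> Dig k)"
proof (rule inj_onI, clarify)
  fix c a d b assume h: "c \<in> Tm" "a \<in> Dig k" "d \<in> Tm" "b \<in> Dig k" "c + uf * a = d + uf * b"
  have "uf * (b - a) \<in> P 1" using h Dig_P P_diff by (simp add: Pi_P)
  moreover have "uf * (b - a) = c - d" using h(5) by (simp add: algebra_simps)
  ultimately have "c = d" using Tm_uniq h by simp
  thus "c = d \<and> a = b" using h Pi by simp
qed

lemma Dig_card: "card (Dig k) = q ^ k"
proof (induction k)
  case (Suc k)
  have "card (Dig (Suc k)) = card (Tm \<times> Dig k)" unfolding Dig.simps by (rule card_image[OF Dig_Suc_inj])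
  thus ?case using Suc by (simp only: card_cartesian_product Tm_card power_Suc)
qed simp

text \<open>An expansion is a non-unit exactly when its constant digit is the representative
  \<open>c0\<close> of the zero class; the other k - 1 digits are free.\<close>

lemma Dig_un_card: assumes "1 \<le> k" shows "card (Dig k \<inter> un) = q ^ k - q ^ (k - 1)"
proof -
  obtain l where l: "k = Suc l" using assms by (cases k) auto
  obtain c0 where c0: "c0 \<in> Tm" "c0 \<in> P 1" using Tm_ex[of 0] by auto
  have "Dig k - un = (\<lambda>(c, a). c + uf * a) ` ({c0} \<times> Dig l)" (is "?L = ?R")
  proof
    show "?L \<subseteq> ?R"
    proof
      fix x assume x: "x \<in> ?L"
      then obtain c a where ca: "c \<in> Tm" "a \<in> Dig l" "x = c + uf * a" by (auto simp: l)
      have "x \<in> P 1" using x Dig_P un_iff by blast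
      moreover have "uf * a \<in> P 1" using ca Dig_P by (simp add: Pi_P)
      ultimately have "x - uf * a \<in> P 1" using P_diff by blast
      hence "c \<in> P 1" using ca by simp
      hence "c = c0" using c0 ca Tm_uniq P_diff by blast
      thus "x \<in> ?R" using ca by auto
    qed
    show "?R \<subseteq> ?L"
    proof
      fix x assume "x \<in> ?R"
      then obtain a where a: "a \<in> Dig l" "x = c0 + uf * a" by auto
      have "uf * a \<in> P 1" using a Dig_P by (simp add: Pi_P)
      hence "x \<in> P 1" using a c0 P_add by blast
      moreover have "x \<in> Dig k" using a c0 by (auto simp: l)
      ultimately show "x \<in> ?L" by (simp add: un_iff)
    qed
  qed
  moreover have "inj_on (\<lambda>(c, a). c + uf * a) ({c0} \<times> Dig l)"
    by (rule inj_on_subset[OF Dig_Suc_inj[of l]]) (use c0 in auto)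
  ultimately have c1: "card (Dig k - un) = q ^ l" by (simp only: card_image card_cartesian_product Dig_card) simp
  have "card (Dig k - un) = card (Dig k) - card (Dig k \<inter> un)"
    by (rule card_Diff_subset_Int) (simp add: Dig_finite)
  moreover have "card (Dig k \<inter> un) \<le> card (Dig k)" by (intro card_mono Dig_finite) auto
  moreover have "k - 1 = l" using l by simp
  moreover have "card (Dig k) = q ^ k" by (rule Dig_card)
  ultimately have "q ^ l = q ^ k - card (Dig k \<inter> un)" "card (Dig k \<inter> un) \<le> q ^ k" "k - 1 = l"
    using c1 by simp_all
  thus ?thesis by simp
qed

definition red :: "nat \<Rightarrow> 'f \<Rightarrow> 'f" where "red k r = (SOME a. a \<in> Dig k \<and> r - a \<in> P (int k))"
lemma red: assumes "r \<in> P 0" shows "red k r \<in> Dig k" "r - red k r \<in> P (int k)"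
proof -
  have "\<exists>a. a \<in> Dig k \<and> r - a \<in> P (int k)" using Dig_ex[OF assms, of k] by blast
  hence "red k r \<in> Dig k \<and> r - red k r \<in> P (int k)" unfolding red_def by (rule someI_ex)
  thus "red k r \<in> Dig k" "r - red k r \<in> P (int k)" by auto
qed
lemma red_eqD: assumes "r \<in> P 0" "s \<in> P 0" "red k r = red k s" shows "r - s \<in> P (int k)"
  using P_diff[OF red(2)[OF assms(1)] red(2)[OF assms(2)], of k] assms(3) by simp

end

lemma p_adic_dvf: assumes "p_adic_field v p q" shows "dvf v q"
proof -
  note h = assms[unfolded p_adic_field_def]
  note h2 = h[THEN conjunct2, THEN conjunct2]
  note h3 = h2[THEN conjunct2]
  note h4 = h3[THEN conjunct2]
  note h5 = h4[THEN conjunct2, THEN conjunct2]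
  show ?thesis
    by (rule dvf.intro[OF h2[THEN conjunct1, rule_format] h3[THEN conjunct1, rule_format] h4[THEN conjunct1, rule_format]
        h5[THEN conjunct1] h5[THEN conjunct2, THEN conjunct1]])
qed

section \<open>Linear algebra over the complex numbers\<close>

text \<open>Gaussian elimination by induction on the number of equations: a nonzero coefficient
  \<open>a j0 i0\<close> of the new equation is the pivot that removes the unknown \<open>i0\<close>
  from the others.\<close>

lemma homogeneous_system:
  fixes a :: "'j \<Rightarrow> 'i \<Rightarrow> 'k::field"
  assumes "finite J" "finite I" "card J < card I"
  shows "\<exists>c. (\<exists>i\<in>I. c i \<noteq> 0) \<and> (\<forall>j\<in>J. (\<Sum>i\<in>I. a j i * c i) = 0)"
  using assms
proof (induction J arbitrary: I a rule: finite_induct)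
  case empty
  then obtain i where "i \<in> I" by fastforce
  thus ?case by (intro exI[of _ "\<lambda>_. 1"]) auto
next
  case (insert j0 J)
  show ?case
  proof (cases "\<forall>i\<in>I. a j0 i = 0")
    case True
    have "card J < card I" using insert by simp
    then obtain c where "\<exists>i\<in>I. c i \<noteq> 0" "\<forall>j\<in>J. (\<Sum>i\<in>I. a j i * c i) = 0"
      using insert.IH[of I a] insert.prems by blast
    thus ?thesis using True by (intro exI[of _ c]) auto
  next
    case False
    then obtain i0 where i0: "i0 \<in> I" "a j0 i0 \<noteq> 0" by blast
    define I' where "I' = I - {i0}"
    have I': "finite I'" "i0 \<notin> I'" "I = insert i0 I'" using insert.prems i0 by (auto simp: I'_def)
    have "card J < card I'" using insert I' by simp
    then obtain c where c: "\<exists>i\<in>I'. c i \<noteq> 0"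
      "\<forall>j\<in>J. (\<Sum>i\<in>I'. (a j i - a j i0 * a j0 i / a j0 i0) * c i) = 0"
      using insert.IH[of I' "\<lambda>j i. a j i - a j i0 * a j0 i / a j0 i0"] I' by blast
    define s where "s = (\<Sum>i\<in>I'. a j0 i * c i)"
    \<comment> \<open>The value of the eliminated unknown is forced by equation
      \<open>j0\<close>.\<close>
    define c' where "c' = c(i0 := - s / a j0 i0)"
    have eq: "(\<Sum>i\<in>I. a j i * c' i) = a j i0 * (- s / a j0 i0) + (\<Sum>i\<in>I'. a j i * c i)" for j
    proof -
      have "(\<Sum>i\<in>I'. a j i * c' i) = (\<Sum>i\<in>I'. a j i * c i)" using I' by (intro sum.cong) (auto simp: c'_def)
      thus ?thesis using I' by (simp add: c'_def)
    qed
    have "(\<Sum>i\<in>I. a j i * c' i) = 0" if "j \<in> insert j0 J" for j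
    proof (cases "j = j0")
      case True
      thus ?thesis using i0 by (simp add: eq s_def)
    next
      case False
      hence "(\<Sum>i\<in>I'. (a j i - a j i0 * a j0 i / a j0 i0) * c i) = 0" using c that by blast
      moreover have "(\<Sum>i\<in>I'. (a j i - a j i0 * a j0 i / a j0 i0) * c i)
          = (\<Sum>i\<in>I'. a j i * c i) - a j i0 / a j0 i0 * s"
        by (simp add: s_def sum_distrib_left sum_subtractf algebra_simps)
      ultimately show ?thesis by (simp add: eq)
    qed
    moreover have "\<exists>i\<in>I. c' i \<noteq> 0" using c I' by (auto simp: c'_def)
    ultimately show ?thesis by blast
  qed
qed

locale cvs = vector_space smul for smul :: "complex \<Rightarrow> 'v::ab_group_add \<Rightarrow> 'v" (infixr "\<odot>" 75)
begin

text \<open>Linearity is taken relative to a subset because group elements and averages are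
  controlled only on the representation space \<open>W\<close>, in general a proper subspace of its
  type.\<close>

definition lin_on :: "'v set \<Rightarrow> ('v \<Rightarrow> 'v) \<Rightarrow> bool" where
  "lin_on V T \<longleftrightarrow> (\<forall>x\<in>V. \<forall>y\<in>V. T (x + y) = T x + T y) \<and> (\<forall>c. \<forall>x\<in>V. T (c \<odot> x) = c \<odot> T x)"

definition fun_on :: "'v set \<Rightarrow> ('v \<Rightarrow> complex) \<Rightarrow> bool" where
  "fun_on V T \<longleftrightarrow> (\<forall>x\<in>V. \<forall>y\<in>V. T (x + y) = T x + T y) \<and> (\<forall>c. \<forall>x\<in>V. T (c \<odot> x) = c * T x)"

lemma lin_on_0: "lin_on V T \<Longrightarrow> subspace V \<Longrightarrow> T 0 = 0"
  using scale_zero_left subspace_0 unfolding lin_on_def by metis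
lemma fun_on_0: "fun_on V T \<Longrightarrow> subspace V \<Longrightarrow> T 0 = 0"
  using scale_zero_left subspace_0 mult_zero_left unfolding fun_on_def by metis

lemma lin_on_sum: assumes "lin_on V T" "subspace V" "\<And>i. i \<in> I \<Longrightarrow> f i \<in> V"
  shows "T (\<Sum>i\<in>I. c i \<odot> f i) = (\<Sum>i\<in>I. c i \<odot> T (f i))"
  using assms(3)
proof (induction I rule: infinite_finite_induct)
  case (insert i I)
  have "(\<Sum>i\<in>I. c i \<odot> f i) \<in> V" using insert assms(2) by (intro subspace_sum subspace_scale) auto
  thus ?case using insert assms by (simp add: lin_on_def subspace_scale)
qed (use lin_on_0[OF assms(1,2)] in auto)

lemma fun_on_sum: assumes "fun_on V T" "subspace V" "\<And>i. i \<in> I \<Longrightarrow> f i \<in> V"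
  shows "T (\<Sum>i\<in>I. c i \<odot> f i) = (\<Sum>i\<in>I. c i * T (f i))"
  using assms(3)
proof (induction I rule: infinite_finite_induct)
  case (insert i I)
  have "(\<Sum>i\<in>I. c i \<odot> f i) \<in> V" using insert assms(2) by (intro subspace_sum subspace_scale) auto
  thus ?case using insert assms by (simp add: fun_on_def subspace_scale)
qed (use fun_on_0[OF assms(1,2)] in auto)

lemma lin_on_subset: "lin_on W T \<Longrightarrow> V \<subseteq> W \<Longrightarrow> lin_on V T" unfolding lin_on_def by blast

lemma lin_on_diff: assumes "lin_on V T" "subspace V" "x \<in> V" "y \<in> V" shows "T (x - y) = T x - T y"
proof -
  have "T (x - y + y) = T (x - y) + T y"
    using assms(1) subspace_diff[OF assms(2-4)] assms(4) unfolding lin_on_def by blast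
  thus ?thesis by simp
qed

lemma subspace_pullback: "lin_on V T \<Longrightarrow> subspace V \<Longrightarrow> subspace E \<Longrightarrow> subspace {y\<in>V. T y \<in> E}"
  using lin_on_0[of V T] by (simp add: subspace_def lin_on_def)
lemma subspace_eigenspace: "lin_on V T \<Longrightarrow> subspace V \<Longrightarrow> subspace {y\<in>V. T y = c \<odot> y}"
  using lin_on_0[of V T] by (simp add: subspace_def lin_on_def scale_right_distrib mult.commute)
lemma subspace_kernel: "fun_on V f \<Longrightarrow> subspace V \<Longrightarrow> subspace {y\<in>V. f y = 0}"
  using fun_on_0[of V f] by (simp add: subspace_def fun_on_def)
lemma fun_on_lincomb: "(\<And>b. b \<in> B \<Longrightarrow> fun_on V (f b)) \<Longrightarrow> fun_on V (\<lambda>x. \<Sum>b\<in>B. c b * f b x)"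
  by (simp add: fun_on_def distrib_left sum.distrib sum_distrib_left mult.left_commute)

definition fd :: "'v set \<Rightarrow> bool" where "fd V \<longleftrightarrow> (\<exists>B. finite B \<and> V \<subseteq> span B)"

lemma fd_basis: assumes "fd V"
  obtains B where "B \<subseteq> V" "independent B" "V \<subseteq> span B" "finite B" "card B = dim V"
proof -
  obtain C where C: "finite C" "V \<subseteq> span C" using assms by (auto simp: fd_def)
  obtain B where B: "B \<subseteq> V" "independent B" "V \<subseteq> span B" using maximal_independent_subset by blast
  have "finite B" using independent_span_bound[OF C(1) B(2)] B C by auto
  thus thesis using B basis_card_eq_dim that by blast
qed

lemma fd_subset: "fd W \<Longrightarrow> V \<subseteq> W \<Longrightarrow> fd V" by (auto simp: fd_def)

lemma fd_span: assumes "finite B" "V \<subseteq> span B" obtains u where "\<And>y. y \<in> V \<Longrightarrow> y = (\<Sum>b\<in>B. u y b \<odot> b)"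
proof -
  have "\<forall>y\<in>V. \<exists>u. y = (\<Sum>b\<in>B. u b \<odot> b)" using assms span_finite[OF assms(1)] by auto
  thus thesis using that by metis
qed

text \<open>An independent set larger than \<open>I\<close> would have a nontrivial combination
  killed by every functional, and separation makes that combination 0. The argument runs over finite
  subsets of a basis, so it yields finite dimension as well.\<close>

lemma dim_le_functionals:
  assumes I: "finite I" and V: "subspace V" and \<phi>: "\<And>i. i \<in> I \<Longrightarrow> fun_on V (\<phi> i)"
    and sep: "\<And>x. x \<in> V \<Longrightarrow> (\<And>i. i \<in> I \<Longrightarrow> \<phi> i x = 0) \<Longrightarrow> x = 0"
  shows "fd V" "dim V \<le> card I"
proof -
  obtain B where B: "B \<subseteq> V" "independent B" "V \<subseteq> span B" using maximal_independent_subset by blast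
  have le: "card C \<le> card I" if C: "finite C" "C \<subseteq> B" for C
  proof (rule ccontr)
    assume "\<not> ?thesis"
    then obtain c where c: "\<exists>b\<in>C. c b \<noteq> 0" "\<forall>i\<in>I. (\<Sum>b\<in>C. \<phi> i b * c b) = 0"
      using homogeneous_system[OF I C(1), of "\<lambda>i b. \<phi> i b"] by auto
    have CV: "b \<in> V" if "b \<in> C" for b using that C(2) B(1) by blast
    have "\<phi> i (\<Sum>b\<in>C. c b \<odot> b) = 0" if "i \<in> I" for i
      using fun_on_sum[OF \<phi>[OF that] V CV, of C "\<lambda>b. b" c] c(2) that by (simp add: mult.commute)
    moreover have "(\<Sum>b\<in>C. c b \<odot> b) \<in> V" by (intro subspace_sum subspace_scale V CV)
    ultimately have "(\<Sum>b\<in>C. c b \<odot> b) = 0" by (intro sep)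
    thus False using independentD[OF B(2) C] c(1) by blast
  qed
  have fin: "finite B"
  proof (rule ccontr)
    assume "infinite B"
    then obtain C where "finite C" "card C = Suc (card I)" "C \<subseteq> B" using infinite_arbitrarily_large by metis
    thus False using le[of C] by simp
  qed
  thus "fd V" using B(3) by (auto simp: fd_def)
  show "dim V \<le> card I" using basis_card_eq_dim[OF B(1,3,2)] le[OF fin] by simp
qed

section \<open>Polynomials in an operator, eigenvectors and eigenfunctionals\<close>

definition ap :: "('v \<Rightarrow> 'v) \<Rightarrow> complex poly \<Rightarrow> 'v \<Rightarrow> 'v" where
  "ap T p x = (\<Sum>i\<le>degree p. coeff p i \<odot> (T ^^ i) x)"

lemma ap_N: "degree p \<le> N \<Longrightarrow> ap T p x = (\<Sum>i\<le>N. coeff p i \<odot> (T ^^ i) x)"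
  unfolding ap_def by (rule sum.mono_neutral_left) (auto simp: coeff_eq_0)

context
  fixes V T assumes V: "subspace V" and T: "lin_on V T" and TV: "\<And>x. x \<in> V \<Longrightarrow> T x \<in> V"
begin

lemma iter_V: "x \<in> V \<Longrightarrow> (T ^^ i) x \<in> V" by (induction i) (auto simp: TV)

lemma ap_V: "x \<in> V \<Longrightarrow> ap T p x \<in> V"
  unfolding ap_def by (intro subspace_sum subspace_scale iter_V V)

lemma ap_linfactor: assumes x: "x \<in> V"
  shows "ap T ([:-l, 1:] * r) x = T (ap T r x) - l \<odot> ap T r x"
proof -
  define N where "N = Suc (degree r)"
  have e: "[:-l, 1:] * r = pCons 0 r - smult l r" by simp
  have d: "degree ([:-l, 1:] * r) \<le> N" unfolding e N_def
    by (intro degree_diff_le) (auto simp: degree_pCons_le intro: le_trans[OF degree_smult_le])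
  have "ap T ([:-l, 1:] * r) x = (\<Sum>i\<le>N. coeff (pCons 0 r) i \<odot> (T ^^ i) x) - (\<Sum>i\<le>N. (l * coeff r i) \<odot> (T ^^ i) x)"
    unfolding ap_N[OF d] unfolding e by (simp add: scale_left_diff_distrib sum_subtractf)
  also have "(\<Sum>i\<le>N. coeff (pCons 0 r) i \<odot> (T ^^ i) x) = (\<Sum>i\<le>degree r. coeff r i \<odot> T ((T ^^ i) x))"
    unfolding N_def by (simp add: sum.atMost_Suc_shift del: sum.atMost_Suc)
  also have "\<dots> = T (ap T r x)"
    unfolding ap_def by (rule lin_on_sum[OF T V, symmetric]) (rule iter_V[OF x])
  also have "(\<Sum>i\<le>N. (l * coeff r i) \<odot> (T ^^ i) x) = l \<odot> ap T r x"
    using ap_N[of r N T x] by (simp add: N_def scale_sum_right del: sum.atMost_Suc)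
  finally show ?thesis .
qed

text \<open>Among all nonzero polynomials that kill some iterate of \<open>x0\<close>, take one of
  least degree and split off a root \<open>l\<close>. The cofactor applied to that iterate is an
  eigenvector by minimality, and \<open>l = 0\<close> would make the cofactor kill the next
  iterate.\<close>

lemma eigenvector_nonzero:
  assumes fdV: "fd V" and x0: "x0 \<in> V" "\<And>j. (T ^^ j) x0 \<noteq> 0"
  shows "\<exists>l x. l \<noteq> 0 \<and> x \<in> V \<and> x \<noteq> 0 \<and> T x = l \<odot> x"
proof -
  obtain B where B: "finite B" "V \<subseteq> span B" using fdV by (auto simp: fd_def)
  obtain u where u: "\<And>y. y \<in> V \<Longrightarrow> y = (\<Sum>b\<in>B. u y b \<odot> b)" using fd_span[OF B] by blast
  \<comment> \<open>There are N + 1 iterates of exponent at most N in the span of N vectors, so they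
    satisfy a linear relation, read below as a polynomial \<open>p\<close>.\<close>
  define N where "N = card B"
  obtain c where c: "\<exists>i\<in>{..N}. c i \<noteq> 0" "\<forall>b\<in>B. (\<Sum>i\<le>N. u ((T ^^ i) x0) b * c i) = 0"
    using homogeneous_system[OF B(1), of "{..N}" "\<lambda>b i. u ((T ^^ i) x0) b"] by (auto simp: N_def)
  define p where "p = (\<Sum>i\<le>N. monom (c i) i)"
  have cp: "coeff p k = (if k \<le> N then c k else 0)" for k
    by (simp add: p_def coeff_sum)
  have "degree p \<le> N" by (rule degree_le) (simp add: cp)
  have "ap T p x0 = (\<Sum>i\<le>N. c i \<odot> (\<Sum>b\<in>B. u ((T ^^ i) x0) b \<odot> b))"
    unfolding ap_N[OF \<open>degree p \<le> N\<close>] using u[OF iter_V[OF x0(1)]] by (intro sum.cong) (auto simp: cp)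
  also have "\<dots> = (\<Sum>b\<in>B. (\<Sum>i\<le>N. u ((T ^^ i) x0) b * c i) \<odot> b)"
    unfolding scale_sum_right scale_scale scale_sum_left
    by (subst sum.swap) (simp add: mult.commute)
  also have "\<dots> = 0" using c by simp
  finally have ap0: "ap T p x0 = 0" .
  have p0: "p \<noteq> 0" using c(1) cp by (metis coeff_0 atMost_iff)
  let ?Q = "\<lambda>n. \<exists>p j. p \<noteq> 0 \<and> degree p = n \<and> ap T p ((T ^^ j) x0) = 0"
  have "?Q (degree p)" using p0 ap0 by (intro exI[of _ p] exI[of _ 0]) auto
  then obtain n where n: "?Q n" "\<And>m. m < n \<Longrightarrow> \<not> ?Q m" using exists_least_iff[of ?Q] by blast
  then obtain p j where p: "p \<noteq> 0" "degree p = n" "ap T p ((T ^^ j) x0) = 0" by blast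
  let ?y = "(T ^^ j) x0"
  have yV: "?y \<in> V" using iter_V x0 by blast
  have "n \<noteq> 0"
  proof
    assume "n = 0"
    then obtain a where "p = [:a:]" using p degree_eq_zeroE by blast
    thus False using p x0(2)[of j] by (simp add: ap_def)
  qed
  hence "\<not> constant (poly p)" using p constant_degree[of p] by simp
  then obtain l where "poly p l = 0" using fundamental_theorem_of_algebra by blast
  then obtain r where r: "p = [:-l, 1:] * r" using poly_eq_0_iff_dvd by (auto simp: dvd_def)
  have r0: "r \<noteq> 0" using p r by auto
  have "degree p = degree [:-l, 1:] + degree r" unfolding r by (rule degree_mult_eq) (use r0 in auto)
  hence dr: "degree r < n" using p by simp
  have y: "ap T r ?y \<noteq> 0" using n(2)[OF dr] r0 by blast
  have eq: "T (ap T r ?y) = l \<odot> ap T r ?y" using ap_linfactor[OF yV, of l r] p(3) r by simp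
  have "l \<noteq> 0"
  proof
    assume l: "l = 0"
    have "T (ap T r ?y) = ap T r ((T ^^ Suc j) x0)"
      unfolding ap_def by (subst lin_on_sum[OF T V iter_V[OF yV]])
        (simp add: funpow_swap1[symmetric])
    hence "ap T r ((T ^^ Suc j) x0) = 0" using eq l by simp
    thus False using n(2)[OF dr] r0 by blast
  qed
  thus ?thesis using eq y ap_V[OF yV] by blast
qed

text \<open>If some iterate of \<open>x0\<close> vanishes, the last nonzero iterate has eigenvalue
  0.\<close>

lemma eigenvector:
  assumes fdV: "fd V" and x0: "x0 \<in> V" "x0 \<noteq> 0"
  shows "\<exists>l x. x \<in> V \<and> x \<noteq> 0 \<and> T x = l \<odot> x"
proof (cases "\<forall>j. (T ^^ j) x0 \<noteq> 0")
  case True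
  thus ?thesis using eigenvector_nonzero[OF fdV x0(1)] by blast
next
  case False
  then obtain j where j: "(T ^^ j) x0 = 0" "\<And>i. i < j \<Longrightarrow> (T ^^ i) x0 \<noteq> 0"
    using exists_least_iff[of "\<lambda>j. (T ^^ j) x0 = 0"] by auto
  then obtain k where k: "j = Suc k" using x0 by (cases j) auto
  have "T ((T ^^ k) x0) = 0 \<odot> ((T ^^ k) x0)" using j k by simp
  thus ?thesis using j k iter_V[OF x0(1)] by blast
qed

text \<open>The operator \<open>T - l\<close> kills \<open>x0\<close>, so its image \<open>S\<close>
  on \<open>V\<close> has smaller dimension than \<open>V\<close>; a functional that vanishes on
  \<open>S\<close> but not on \<open>V\<close> is an eigenfunctional.\<close>

lemma eigenfunctional:
  assumes fdV: "fd V" and x0: "x0 \<in> V" "x0 \<noteq> 0" "T x0 = l \<odot> x0"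
  shows "\<exists>g. fun_on UNIV g \<and> (\<exists>x\<in>V. g x \<noteq> 0) \<and> (\<forall>x\<in>V. g (T x) = l * g x)"
proof -
  interpret vp: vector_space_pair smul "(*) :: complex \<Rightarrow> complex \<Rightarrow> complex"
    by unfold_locales (auto simp: algebra_simps)
  define S where "S = (\<lambda>x. T x - l \<odot> x) ` V"
  have Tl: "lin_on V (\<lambda>x. T x - l \<odot> x)"
    using T by (auto simp: lin_on_def scale_right_distrib scale_right_diff_distrib scale_left_commute)
  \<comment> \<open>A basis of \<open>V\<close> through \<open>x0\<close>: this basis vector
    contributes nothing to the image of \<open>T - l\<close>.\<close>
  obtain C where C: "{x0} \<subseteq> C" "C \<subseteq> V" "independent C" "V \<subseteq> span C"
    using maximal_independent_subset_extend[of "{x0}" V] x0 by (auto simp: dependent_single)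
  have finC: "finite C" using fdV C independent_span_bound by (auto simp: fd_def)
  have cardC: "card C = dim V" using basis_card_eq_dim C by blast
  have "S \<subseteq> span ((\<lambda>x. T x - l \<odot> x) ` (C - {x0}))"
  proof
    fix y assume "y \<in> S"
    then obtain x where x: "x \<in> V" "y = T x - l \<odot> x" by (auto simp: S_def)
    then obtain u where "x = (\<Sum>b\<in>C. u b \<odot> b)" using C(4) span_finite[OF finC] by auto
    hence "y = (\<Sum>b\<in>C. u b \<odot> (T b - l \<odot> b))"
      using lin_on_sum[OF Tl V, of C "\<lambda>b. b" u] C x by auto
    also have "\<dots> = (\<Sum>b\<in>C - {x0}. u b \<odot> (T b - l \<odot> b))"
      using x0 by (intro sum.mono_neutral_right finC) auto
    also have "\<dots> \<in> span ((\<lambda>x. T x - l \<odot> x) ` (C - {x0}))"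
      by (intro span_sum span_scale span_base) auto
    finally show "y \<in> span ((\<lambda>x. T x - l \<odot> x) ` (C - {x0}))" .
  qed
  hence "dim S \<le> card (C - {x0})"
    using dim_le_card[of S "(\<lambda>x. T x - l \<odot> x) ` (C - {x0})"] finC card_image_le[of "C - {x0}"]
    by (meson finite_Diff finite_imageI le_trans)
  hence dS: "dim S < dim V" using C finC cardC by (metis card_Diff1_less insert_subset le_less_trans)
  obtain B where B: "B \<subseteq> S" "independent B" "S \<subseteq> span B" using maximal_independent_subset by blast
  have "\<not> V \<subseteq> span B"
  proof
    assume VB: "V \<subseteq> span B"
    have "card B = dim S" using B basis_card_eq_dim by blast
    moreover have "B \<subseteq> V" using B(1) V TV by (auto simp: S_def intro: subspace_diff subspace_scale)
    hence "finite B" using fdV B independent_span_bound by (auto simp: fd_def)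
    ultimately show False using dim_le_card[OF VB] dS by simp
  qed
  then obtain b where b: "b \<in> V" "b \<notin> span B" by blast
  have "independent (insert b B)" using b B independent_insert by (simp add: span_base)
  from vp.linear_independent_extend[OF this, of "\<lambda>x. if x = b then 1 else 0"]
  obtain g where g: "Vector_Spaces.linear smul (*) g" "\<forall>x\<in>insert b B. g x = (if x = b then 1 else 0)" by blast
  have gadd: "g (x + y) = g x + g y" and gsc: "g (c \<odot> x) = c * g x" for x y c
    using Vector_Spaces.linear.axioms(3)[OF g(1)] by (auto simp: module_hom_def module_hom_axioms_def linear_iff[OF ] intro: module_hom.add module_hom.scale)
  have gB: "g x = 0" if "x \<in> B" for x using g(2) that b span_base by auto
  have "g x = 0" if "x \<in> span B" for x
    using that by (induction rule: span_induct_alt) (use gB gadd gsc in \<open>auto simp: gsc[of 0, simplified]\<close>)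
  hence gS: "g (T x - l \<odot> x) = 0" if "x \<in> V" for x using that B(3) by (auto simp: S_def)
  have "g (T x) = l * g x" if "x \<in> V" for x
    using gadd[of "T x - l \<odot> x" "l \<odot> x"] gS[OF that] gsc by simp
  moreover have "g b \<noteq> 0" using g(2) by simp
  ultimately show ?thesis using b gadd gsc by (intro exI[of _ g]) (auto simp: fun_on_def)
qed

end
end

section \<open>Three by three matrices\<close>

definition mat3 :: "'f::field \<Rightarrow> 'f \<Rightarrow> 'f \<Rightarrow> 'f \<Rightarrow> 'f \<Rightarrow> 'f \<Rightarrow> 'f \<Rightarrow> 'f \<Rightarrow> 'f \<Rightarrow> 'f ^ 3 ^ 3" where
  "mat3 a b c d e f g h i = vector [vector [a, b, c], vector [d, e, f], vector [g, h, i]]"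

lemma mat3_nth [simp]:
  "mat3 a b c d e f g h i $ 1 $ 1 = a" "mat3 a b c d e f g h i $ 1 $ 2 = b" "mat3 a b c d e f g h i $ 1 $ 3 = c"
  "mat3 a b c d e f g h i $ 2 $ 1 = d" "mat3 a b c d e f g h i $ 2 $ 2 = e" "mat3 a b c d e f g h i $ 2 $ 3 = f"
  "mat3 a b c d e f g h i $ 3 $ 1 = g" "mat3 a b c d e f g h i $ 3 $ 2 = h" "mat3 a b c d e f g h i $ 3 $ 3 = i"
  by (simp_all add: mat3_def vector_3)

lemma mat3_eta: "A = mat3 (A$1$1) (A$1$2) (A$1$3) (A$2$1) (A$2$2) (A$2$3) (A$3$1) (A$3$2) (A$3$3)"
  by (simp add: vec_eq_iff forall_3)

lemma mat3_cases: obtains a b c d e f g h i where "A = mat3 a b c d e f g h i"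
  using mat3_eta by blast

lemma mat3_eq: "mat3 a b c d e f g h i = mat3 a' b' c' d' e' f' g' h' i' \<longleftrightarrow>
   a = a' \<and> b = b' \<and> c = c' \<and> d = d' \<and> e = e' \<and> f = f' \<and> g = g' \<and> h = h' \<and> i = i'"
  by (auto simp: vec_eq_iff forall_3)

lemma mat3_mult: "mat3 a b c d e f g h i ** mat3 a' b' c' d' e' f' g' h' i' =
  mat3 (a*a' + b*d' + c*g') (a*b' + b*e' + c*h') (a*c' + b*f' + c*i')
       (d*a' + e*d' + f*g') (d*b' + e*e' + f*h') (d*c' + e*f' + f*i')
       (g*a' + h*d' + i*g') (g*b' + h*e' + i*h') (g*c' + h*f' + i*i')"
  by (simp add: vec_eq_iff forall_3 matrix_matrix_mult_def sum_3)

lemma mat_mult_diff: fixes A B C :: "'f::field ^ 3 ^ 3"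
  shows "A ** (B - C) = A ** B - A ** C" "(B - C) ** A = B ** A - C ** A"
  by (simp_all add: vec_eq_iff matrix_matrix_mult_def sum_subtractf algebra_simps)

lemma mat3_1: "mat 1 = mat3 1 0 0 0 1 0 0 0 1"
  by (simp add: vec_eq_iff forall_3 mat_def)

lemma mat3_det: "det (mat3 a b c d e f g h i) = a*e*i + b*f*g + c*d*h - a*f*h - b*d*i - c*e*g"
  by (simp add: det_3)

lemma mat3_transpose: "transpose (mat3 a b c d e f g h i) = mat3 a d g b e h c f i"
  by (simp add: vec_eq_iff forall_3 transpose_def)

text \<open>The adjugate divided by the determinant, written out so that integrality and vanishing
  of the entries of an inverse can be read off.\<close>

definition inv3 :: "'f::field ^ 3 ^ 3 \<Rightarrow> 'f ^ 3 ^ 3" where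
  "inv3 A = (let D = det A; a = A$1$1; b = A$1$2; c = A$1$3; d = A$2$1; e = A$2$2; f = A$2$3;
      g = A$3$1; h = A$3$2; i = A$3$3 in
    mat3 ((e*i - f*h)/D) ((c*h - b*i)/D) ((b*f - c*e)/D)
         ((f*g - d*i)/D) ((a*i - c*g)/D) ((c*d - a*f)/D)
         ((d*h - e*g)/D) ((b*g - a*h)/D) ((a*e - b*d)/D))"

lemma inv3_mat3: "inv3 (mat3 a b c d e f g h i) = (let D = det (mat3 a b c d e f g h i) in
    mat3 ((e*i - f*h)/D) ((c*h - b*i)/D) ((b*f - c*e)/D)
         ((f*g - d*i)/D) ((a*i - c*g)/D) ((c*d - a*f)/D)
         ((d*h - e*g)/D) ((b*g - a*h)/D) ((a*e - b*d)/D))"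
  by (simp add: inv3_def Let_def)

lemma inv3: assumes "det A \<noteq> 0" shows "A ** inv3 A = mat 1" "inv3 A ** A = mat 1"
proof -
  obtain a b c d e f g h i where A: "A = mat3 a b c d e f g h i" by (rule mat3_cases)
  define D where "D = det A"
  have D: "D \<noteq> 0" "D = a*e*i + b*f*g + c*d*h - a*f*h - b*d*i - c*e*g" using assms by (auto simp: D_def A mat3_det)
  have *: "(x / D = 1) = (x = D)" "(y / D = 0) = (y = 0)" for x y using D(1) by auto
  show "A ** inv3 A = mat 1"
    unfolding A inv3_mat3 Let_def D_def[unfolded A, symmetric] mat3_mult mat3_1 mat3_eq
    by (simp only: times_divide_eq_right add_divide_distrib[symmetric] *) (simp add: D(2) algebra_simps)
  show "inv3 A ** A = mat 1"
    unfolding A inv3_mat3 Let_def D_def[unfolded A, symmetric] mat3_mult mat3_1 mat3_eq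
    by (simp only: times_divide_eq_left add_divide_distrib[symmetric] *) (simp add: D(2) algebra_simps)
qed

lemma GL3_mult: "g \<in> GL3 \<Longrightarrow> h \<in> GL3 \<Longrightarrow> g ** h \<in> GL3" by (simp add: GL3_def det_mul)
lemma GL3_1 [simp]: "mat 1 \<in> GL3" by (simp add: GL3_def)
lemma GL3_inv: "g \<in> GL3 \<Longrightarrow> inv3 g \<in> GL3"
  using inv3(1)[of g] det_mul[of g "inv3 g"] by (auto simp: GL3_def)
lemma GL3_inv1: "g \<in> GL3 \<Longrightarrow> g ** inv3 g = mat 1" "g \<in> GL3 \<Longrightarrow> inv3 g ** g = mat 1"
  using inv3 by (auto simp: GL3_def)
lemma inv3_unique: assumes "g ** h = mat 1" shows "inv3 g = h"
proof -
  have "g \<in> GL3" using assms det_mul[of g h] by (auto simp: GL3_def)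
  hence "inv3 g = inv3 g ** (g ** h)" by (simp add: assms)
  thus ?thesis using GL3_inv1(2)[OF \<open>g \<in> GL3\<close>] by (simp add: matrix_mul_assoc)
qed
lemma inv3_mult: "g \<in> GL3 \<Longrightarrow> h \<in> GL3 \<Longrightarrow> inv3 (g ** h) = inv3 h ** inv3 g"
  by (rule inv3_unique) (metis GL3_inv1(1) matrix_mul_assoc matrix_mul_rid)
lemma inv3_inv3: "g \<in> GL3 \<Longrightarrow> inv3 (inv3 g) = g"
  by (rule inv3_unique) (rule GL3_inv1)
lemma inv3_1 [simp]: "inv3 (mat 1) = mat 1" by (rule inv3_unique) simp
lemma GL3_cancel: assumes "g \<in> GL3" shows "inv3 g ** (g ** h) = h" "g ** (inv3 g ** h) = h"
  using GL3_inv1[OF assms] by (simp_all add: matrix_mul_assoc)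

definition subgrp :: "('f::field ^ 3 ^ 3) set \<Rightarrow> bool" where
  "subgrp J \<longleftrightarrow> J \<subseteq> GL3 \<and> mat 1 \<in> J \<and> (\<forall>g\<in>J. \<forall>h\<in>J. g ** h \<in> J) \<and> (\<forall>g\<in>J. inv3 g \<in> J)"

lemma subgrp_GL3: "subgrp GL3" by (simp add: subgrp_def GL3_mult GL3_inv)
lemma subgrp_Int: "subgrp J \<Longrightarrow> subgrp H \<Longrightarrow> subgrp (J \<inter> H)" by (auto simp: subgrp_def)
lemma subgrp_D: assumes "subgrp J"
  shows "g \<in> J \<Longrightarrow> g \<in> GL3" "mat 1 \<in> J" "g \<in> J \<Longrightarrow> h \<in> J \<Longrightarrow> g ** h \<in> J" "g \<in> J \<Longrightarrow> inv3 g \<in> J"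
  using assms by (auto simp: subgrp_def)

section \<open>Integral matrices and congruence subgroups\<close>

context dvf begin

definition intm :: "int \<Rightarrow> ('f ^ 3 ^ 3) set" where "intm k = {A. \<forall>i j. A $ i $ j \<in> P k}"

lemma intm_mat3: "mat3 a b c d e f g h i \<in> intm k \<longleftrightarrow> a \<in> P k \<and> b \<in> P k \<and> c \<in> P k \<and> d \<in> P k \<and> e \<in> P k \<and> f \<in> P k
   \<and> g \<in> P k \<and> h \<in> P k \<and> i \<in> P k"
  by (auto simp: intm_def forall_3)

lemma intm_add: "A \<in> intm k \<Longrightarrow> B \<in> intm k \<Longrightarrow> A + B \<in> intm k" by (simp add: intm_def P_add)
lemma intm_mult: "A \<in> intm k \<Longrightarrow> B \<in> intm l \<Longrightarrow> A ** B \<in> intm (k + l)"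
  by (auto simp: intm_def matrix_matrix_mult_def intro!: P_sum P_mult)
lemma intm_mono: "A \<in> intm k \<Longrightarrow> l \<le> k \<Longrightarrow> A \<in> intm l" using P_mono unfolding intm_def by blast
lemma intm_1: "mat 1 \<in> intm 0" by (simp add: intm_def mat_def)
lemma intm_ex: "\<exists>k. k \<le> 0 \<and> A \<in> intm k"
proof -
  obtain a b c d e f g h i where A: "A = mat3 a b c d e f g h i" by (rule mat3_cases)
  define k where "k = Min {0, v a, v b, v c, v d, v e, v f, v g, v h, v i}"
  have "k \<le> x" if "x \<in> {0, v a, v b, v c, v d, v e, v f, v g, v h, v i}" for x
    unfolding k_def by (rule Min_le) (use that in auto)
  hence "k \<le> 0 \<and> A \<in> intm k" by (simp add: A intm_mat3 P_def)
  thus ?thesis by blast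
qed

text \<open>For positive \<open>m\<close> the determinant of such a matrix is automatically a unit
  (\<open>Kc_det\<close>), so this is the principal congruence subgroup
  (\<open>Kn_Kc\<close>).\<close>

definition Kc :: "nat \<Rightarrow> ('f ^ 3 ^ 3) set" where "Kc m = {A. A - mat 1 \<in> intm (int m)}"

lemma mat3_diff: "mat3 a b c d e f g h i - mat3 a' b' c' d' e' f' g' h' i' =
   mat3 (a-a') (b-b') (c-c') (d-d') (e-e') (f-f') (g-g') (h-h') (i-i')"
  by (simp add: vec_eq_iff forall_3)

lemma Kc_mat3: "mat3 a b c d e f g h i \<in> Kc m \<longleftrightarrow> a \<in> O1 (int m) \<and> e \<in> O1 (int m) \<and> i \<in> O1 (int m) \<and>
   b \<in> P (int m) \<and> c \<in> P (int m) \<and> d \<in> P (int m) \<and> f \<in> P (int m) \<and> g \<in> P (int m) \<and> h \<in> P (int m)"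
  by (auto simp: Kc_def mat3_1 mat3_diff intm_mat3 O1_def)

lemma Kc_det: assumes "A \<in> Kc m" "1 \<le> m" shows "det A \<in> O1 (int m)"
proof -
  obtain a b c d e f g h i where A: "A = mat3 a b c d e f g h i" by (rule mat3_cases)
  note h = assms(1)[unfolded A Kc_mat3]
  have u: "a \<in> P 0" "e \<in> P 0" "i \<in> P 0" "c \<in> P 0" "b \<in> P 0" "f \<in> P 0"
    using h assms(2) O1_un[of _ "int m"] un_P P_mono[of _ "int m" 0] by auto
  have m: "x * y \<in> P (int m)" if "x \<in> P 0" "y \<in> P (int m)" for x y using P_mult[OF that] by simp
  have "a * e * i \<in> O1 (int m)" using h assms(2) by (intro O1_mult) auto
  hence 1: "a * e * i - 1 \<in> P (int m)" by (simp add: O1_def)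
  have h0: "d \<in> P 0" using h P_mono[of d "int m" 0] by simp
  have 2: "b * f * g \<in> P (int m)" "a * f * h \<in> P (int m)" "c * e * g \<in> P (int m)" "c * d * h \<in> P (int m)" "b * d * i \<in> P (int m)"
    using h m[of "b * f" g] m[of "a * f" h] m[of "c * e" g] m[of "c * d" h] m[of "b * d" i] m[of i "b * d"] m[of b d]
      P_mult[of b 0 f 0] P_mult[of a 0 f 0] P_mult[of c 0 e 0] P_mult[of c 0 d 0] u h0 by (simp_all add: mult.commute)
  have "(a * e * i - 1) + b * f * g + c * d * h - a * f * h - b * d * i - c * e * g \<in> P (int m)"
    by (intro P_add P_diff 1 2)
  thus ?thesis by (simp add: O1_def A mat3_det algebra_simps)
qed

lemma Kc_intm: "A \<in> Kc m \<Longrightarrow> A \<in> intm 0"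
  using intm_add[of "A - mat 1" 0 "mat 1"] intm_mono[of "A - mat 1" "int m" 0] intm_1 by (simp add: Kc_def)

lemma Kmax_iff: "A \<in> Kmax v \<longleftrightarrow> A \<in> intm 0 \<and> det A \<in> un"
  by (simp add: Kmax_def intm_def val_ring_P un_def)

lemma Kn_Kc: assumes "1 \<le> m" shows "Kn v m = Kc m"
proof
  show "Kn v m \<subseteq> Kc m" by (auto simp: Kn_def Kc_def intm_def val_ideal_P)
  show "Kc m \<subseteq> Kn v m"
  proof
    fix A assume A: "A \<in> Kc m"
    have "det A \<in> un" using Kc_det[OF A assms] O1_un assms by fastforce
    thus "A \<in> Kn v m" using A Kc_intm[OF A] by (auto simp: Kn_def Kmax_iff Kc_def intm_def val_ideal_P)
  qed
qed

lemma Kc_mono: "A \<in> Kc m \<Longrightarrow> l \<le> m \<Longrightarrow> A \<in> Kc l" using intm_mono by (auto simp: Kc_def)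

lemma Kmax_GL3: "A \<in> Kmax v \<Longrightarrow> A \<in> GL3" by (auto simp: Kmax_iff GL3_def un_def)

lemma intm_inv3: assumes "A \<in> intm 0" "det A \<in> un" shows "inv3 A \<in> intm 0"
proof -
  obtain a b c d e f g h i where A: "A = mat3 a b c d e f g h i" by (rule mat3_cases)
  have D: "det (mat3 a b c d e f g h i) \<in> un" using assms A by simp
  have m: "x \<in> P 0 \<Longrightarrow> y \<in> P 0 \<Longrightarrow> z \<in> P 0 \<Longrightarrow> w \<in> P 0 \<Longrightarrow> x * y - z * w \<in> P 0" for x y z w
    using P_diff P_mult[of _ 0 _ 0] by simp
  show ?thesis using assms(1)
    unfolding A inv3_mat3 Let_def intm_mat3 P_divide_un[OF D] by (auto intro!: m)
qed

lemma Kmax_inv: "A \<in> Kmax v \<Longrightarrow> inv3 A \<in> Kmax v"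
proof -
  assume A: "A \<in> Kmax v"
  have "det A * det (inv3 A) = 1" using GL3_inv1(1)[OF Kmax_GL3[OF A]] det_mul[of A "inv3 A"] by simp
  hence "det (inv3 A) = inverse (det A)" by (metis inverse_unique)
  thus ?thesis using A intm_inv3 un_inverse by (simp add: Kmax_iff)
qed

lemma subgrp_Kmax: "subgrp (Kmax v)"
  unfolding subgrp_def using Kmax_GL3 Kmax_inv intm_1 intm_mult[of _ 0 _ 0]
  by (auto simp: Kmax_iff det_mul un_mult)

lemma Kc_Kmax: "1 \<le> m \<Longrightarrow> A \<in> Kc m \<Longrightarrow> A \<in> Kmax v"
  using Kn_Kc[of m] by (auto simp: Kn_def)

lemma Kc_congI: assumes "g \<in> Kmax v" "h - g \<in> intm (int m)" shows "inv3 g ** h \<in> Kc m"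
proof -
  have "inv3 g ** h - mat 1 = inv3 g ** (h - g)"
    using GL3_inv1(2)[OF Kmax_GL3[OF assms(1)]] by (simp add: mat_mult_diff)
  moreover have "inv3 g ** (h - g) \<in> intm (int m)"
    using intm_mult[of "inv3 g" 0 "h - g" "int m"] assms Kmax_inv[OF assms(1)] by (simp add: Kmax_iff)
  ultimately show ?thesis by (simp add: Kc_def)
qed

lemma Kc_conj_gen:
  assumes "g \<in> GL3" "inv3 g \<in> intm a" "g \<in> intm b" "k \<in> Kc m'" "int m \<le> int m' + a + b"
  shows "inv3 g ** k ** g \<in> Kc m"
proof -
  have "inv3 g ** k ** g - mat 1 = inv3 g ** (k - mat 1) ** g"
    using GL3_inv1(2)[OF assms(1)] by (simp add: mat_mult_diff)
  moreover have "inv3 g ** (k - mat 1) ** g \<in> intm (a + int m' + b)"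
    using assms by (intro intm_mult) (auto simp: Kc_def)
  ultimately show ?thesis using intm_mono assms(5) by (simp add: Kc_def) 
qed

text \<open>Conjugation by \<open>g\<close> loses at most the pole orders of \<open>g\<close> and of
  its inverse, so a deep enough congruence subgroup is carried into any given one.\<close>

lemma Kc_conj: assumes "g \<in> GL3" obtains m' where "1 \<le> m'" "\<And>k. k \<in> Kc m' \<Longrightarrow> inv3 g ** k ** g \<in> Kc m"
proof -
  obtain a b where a: "a \<le> 0" "inv3 g \<in> intm a" and b: "b \<le> 0" "g \<in> intm b" using intm_ex by blast
  \<comment> \<open>The extra 1 in the witness only keeps the depth positive.\<close>
  show thesis
    by (rule that[of "nat (int m - a - b) + 1"], simp)
      (rule Kc_conj_gen[OF assms a(2) b(2)], assumption, use a b in simp)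
qed

lemma Kc_normal: "g \<in> Kmax v \<Longrightarrow> k \<in> Kc m \<Longrightarrow> inv3 g ** k ** g \<in> Kc m"
  using Kc_conj_gen[of g 0 0 k m m] Kmax_GL3[of g] Kmax_inv[of g] by (simp add: Kmax_iff)

lemma Kc_normal': assumes "g \<in> Kmax v" "k \<in> Kc m" shows "g ** k ** inv3 g \<in> Kc m"
  using Kc_normal[OF Kmax_inv[OF assms(1)] assms(2)] inv3_inv3[OF Kmax_GL3[OF assms(1)]] by simp

lemma subgrp_Kc: assumes "1 \<le> m" shows "subgrp (Kc m)"
  unfolding subgrp_def
proof (intro conjI ballI subsetI)
  show "mat 1 \<in> Kc m" by (simp add: Kc_def intm_def)
  fix g assume g: "g \<in> Kc m"
  show "g \<in> GL3" using g Kc_Kmax[OF assms] Kmax_GL3 by blast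
  have 1: "mat 1 - g \<in> intm (int m)" using g P_minus by (auto simp: Kc_def intm_def) (metis P_minus minus_diff_eq)
  show "inv3 g \<in> Kc m" using Kc_congI[OF Kc_Kmax[OF assms g] 1] by simp
  fix h assume h: "h \<in> Kc m"
  have "g ** h - mat 1 = g ** (h - mat 1) + (g - mat 1)" by (simp add: mat_mult_diff)
  moreover have "g ** (h - mat 1) \<in> intm (int m)" using intm_mult[of g 0 "h - mat 1" "int m"] Kc_intm[OF g] h by (simp add: Kc_def)
  ultimately have "g ** h - mat 1 \<in> intm (int m)" using g intm_add by (simp only: Kc_def mem_Collect_eq)
  thus "g ** h \<in> Kc m" by (simp add: Kc_def)
qed

end

section \<open>The parabolic subgroup of type (2,1), its Levi factor, and the GL_2, Borel and torus
  inside the Levi\<close>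

definition P3 :: "('f::field ^ 3 ^ 3) set" where "P3 = {g \<in> GL3. g$3$1 = 0 \<and> g$3$2 = 0}"
definition LG :: "('f::field ^ 3 ^ 3) set" where "LG = {g \<in> P3. g$1$3 = 0 \<and> g$2$3 = 0}"
definition G2 :: "('f::field ^ 3 ^ 3) set" where "G2 = {g \<in> LG. g$3$3 = 1}"
definition B2 :: "('f::field ^ 3 ^ 3) set" where "B2 = {g \<in> LG. g$2$1 = 0}"
definition T3 :: "('f::field ^ 3 ^ 3) set" where "T3 = {g \<in> B2. g$1$2 = 0}"

lemma P3_mat3: "mat3 a b c d e f g h i \<in> P3 \<longleftrightarrow> g = 0 \<and> h = 0 \<and> a*e - b*d \<noteq> 0 \<and> i \<noteq> 0"
  by (auto simp: P3_def GL3_def mat3_det algebra_simps)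
lemma LG_mat3: "mat3 a b c d e f g h i \<in> LG \<longleftrightarrow> c = 0 \<and> f = 0 \<and> g = 0 \<and> h = 0 \<and> a*e - b*d \<noteq> 0 \<and> i \<noteq> 0"
  by (auto simp: LG_def P3_mat3)

lemma P3_E: assumes "g \<in> P3" obtains a b c d e f i where "g = mat3 a b c d e f 0 0 i" "a*e - b*d \<noteq> 0" "i \<noteq> 0"
  using assms by (cases g rule: mat3_cases) (auto simp: P3_mat3 intro: that)
lemma LG_E: assumes "g \<in> LG" obtains a b c d e where "g = mat3 a b 0 c d 0 0 0 e" "a*d - b*c \<noteq> 0" "e \<noteq> 0"
  using assms by (cases g rule: mat3_cases) (auto simp: LG_mat3 intro: that)
lemma B2_E: assumes "g \<in> B2" obtains a b d e where "g = mat3 a b 0 0 d 0 0 0 e" "a \<noteq> 0" "d \<noteq> 0" "e \<noteq> 0"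
  using assms by (cases g rule: mat3_cases) (auto simp: B2_def LG_mat3 intro: that)
lemma T3_E: assumes "g \<in> T3" obtains a b c where "g = mat3 a 0 0 0 b 0 0 0 c" "a \<noteq> 0" "b \<noteq> 0" "c \<noteq> 0"
  using assms by (cases g rule: mat3_cases) (auto simp: T3_def B2_def LG_mat3 intro: that)

lemma LG_I: "a*d - b*c \<noteq> 0 \<Longrightarrow> e \<noteq> 0 \<Longrightarrow> mat3 a b 0 c d 0 0 0 e \<in> LG" by (simp add: LG_mat3)
lemma G2_I: "a*d - b*c \<noteq> 0 \<Longrightarrow> mat3 a b 0 c d 0 0 0 1 \<in> G2" by (simp add: G2_def LG_mat3)
lemma B2_I: "a \<noteq> 0 \<Longrightarrow> d \<noteq> 0 \<Longrightarrow> e \<noteq> 0 \<Longrightarrow> mat3 a b 0 0 d 0 0 0 e \<in> B2" by (simp add: B2_def LG_mat3)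
lemma T3_I: "a \<noteq> 0 \<Longrightarrow> b \<noteq> 0 \<Longrightarrow> c \<noteq> 0 \<Longrightarrow> mat3 a 0 0 0 b 0 0 0 c \<in> T3" by (simp add: T3_def B2_I)

lemma G2_LG: "G2 \<subseteq> LG" and B2_LG: "B2 \<subseteq> LG" and T3_LG: "T3 \<subseteq> LG" by (auto simp: G2_def B2_def T3_def)

lemma mat_mult_nth: "(g ** h)$i$j = g$i$1 * h$1$j + g$i$2 * h$2$j + g$i$3 * h$3$j" for g h :: "'f::field ^ 3 ^ 3"
  by (simp add: matrix_matrix_mult_def sum_3)

lemma inv3_nth: fixes g :: "'f::field ^ 3 ^ 3"
  shows "(inv3 g)$3$1 = (g$2$1 * g$3$2 - g$2$2 * g$3$1) / det g" "(inv3 g)$3$2 = (g$1$2 * g$3$1 - g$1$1 * g$3$2) / det g"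
    "(inv3 g)$1$3 = (g$1$2 * g$2$3 - g$1$3 * g$2$2) / det g" "(inv3 g)$2$3 = (g$1$3 * g$2$1 - g$1$1 * g$2$3) / det g"
    "(inv3 g)$2$1 = (g$2$3 * g$3$1 - g$2$1 * g$3$3) / det g" "(inv3 g)$1$2 = (g$1$3 * g$3$2 - g$1$2 * g$3$3) / det g"
    "(inv3 g)$3$3 = (g$1$1 * g$2$2 - g$1$2 * g$2$1) / det g"
  by (simp_all add: inv3_def Let_def)

lemma inv3_diag: "a \<noteq> 0 \<Longrightarrow> b \<noteq> 0 \<Longrightarrow> c \<noteq> 0 \<Longrightarrow> inv3 (mat3 a 0 0 0 b 0 0 0 c) = mat3 (1/a) 0 0 0 (1/b) 0 0 0 (1/c)"
  by (rule inv3_unique) (simp add: mat3_mult mat3_1)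

lemma diag_conj: assumes "x \<noteq> 0" "y \<noteq> 0" "z \<noteq> 0"
  shows "mat3 x 0 0 0 y 0 0 0 z ** mat3 a b c d e f g h i ** inv3 (mat3 x 0 0 0 y 0 0 0 z) = mat3 a (x*b/y) (x*c/z) (y*d/x) e (y*f/z) (z*g/x) (z*h/y) i"
    "inv3 (mat3 x 0 0 0 y 0 0 0 z) ** mat3 a b c d e f g h i ** mat3 x 0 0 0 y 0 0 0 z = mat3 a (b*y/x) (c*z/x) (d*x/y) e (f*z/y) (g*x/z) (h*y/z) i"
  using assms by (simp_all add: inv3_diag mat3_mult mat3_eq)

lemma det_conj: assumes "g \<in> GL3" shows "det (inv3 g ** x ** g) = det x" "det (g ** x ** inv3 g) = det x"
proof -
  have "det g * det (inv3 g) = 1" using GL3_inv1(1)[OF assms] by (metis det_mul det_I)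
  thus "det (inv3 g ** x ** g) = det x" "det (g ** x ** inv3 g) = det x" by (simp_all add: det_mul mult_ac)
qed

lemma subgrp_patterns: "subgrp P3" "subgrp LG" "subgrp G2" "subgrp B2" "subgrp T3"
proof -
  show "subgrp P3" "subgrp LG" "subgrp B2" "subgrp T3"
    by (auto simp: subgrp_def P3_def LG_def B2_def T3_def GL3_mult GL3_inv mat_mult_nth mat_def GL3_1[unfolded mat_def] inv3_nth)
  show "subgrp G2"
    by (auto simp: subgrp_def P3_def LG_def G2_def GL3_mult GL3_inv mat_mult_nth mat_def GL3_1[unfolded mat_def] inv3_nth) (simp_all add: GL3_def det_3)
qed

section \<open>Averaging over compact groups\<close>

text \<open>A smooth representation of a subgroup of GL_3 on a subspace. This generality is used:
  besides GL_3 on the given space, the Levi factor and the diagonal torus act on spaces of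
  functionals.\<close>

locale mrep = dvf v q + cvs smul
  for v :: "'f::field \<Rightarrow> int" and q :: nat and smul :: "complex \<Rightarrow> 'v::ab_group_add \<Rightarrow> 'v" (infixr "\<odot>" 75) +
  fixes G :: "('f ^ 3 ^ 3) set" and W :: "'v set" and \<pi> :: "'f ^ 3 ^ 3 \<Rightarrow> 'v \<Rightarrow> 'v"
  assumes G: "subgrp G" and W: "subspace W"
    and pi_lin: "g \<in> G \<Longrightarrow> lin_on W (\<pi> g)"
    and pi_W: "g \<in> G \<Longrightarrow> x \<in> W \<Longrightarrow> \<pi> g x \<in> W"
    and pi_1: "x \<in> W \<Longrightarrow> \<pi> (mat 1) x = x"
    and pi_mult: "g \<in> G \<Longrightarrow> h \<in> G \<Longrightarrow> x \<in> W \<Longrightarrow> \<pi> (g ** h) x = \<pi> g (\<pi> h x)"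
    and smooth: "x \<in> W \<Longrightarrow> \<exists>m\<ge>1. \<forall>k\<in>G \<inter> Kc m. \<pi> k x = x"
begin

lemmas GD = subgrp_D[OF G]

lemma pi_add: "g \<in> G \<Longrightarrow> x \<in> W \<Longrightarrow> y \<in> W \<Longrightarrow> \<pi> g (x + y) = \<pi> g x + \<pi> g y"
  using pi_lin[of g] unfolding lin_on_def by blast
lemma pi_scale: "g \<in> G \<Longrightarrow> x \<in> W \<Longrightarrow> \<pi> g (c \<odot> x) = c \<odot> \<pi> g x"
  using pi_lin[of g] unfolding lin_on_def by blast
lemma pi_0: "g \<in> G \<Longrightarrow> \<pi> g 0 = 0" using lin_on_0[OF pi_lin W] .
lemma pi_inv: "g \<in> G \<Longrightarrow> x \<in> W \<Longrightarrow> \<pi> (inv3 g) (\<pi> g x) = x" "g \<in> G \<Longrightarrow> x \<in> W \<Longrightarrow> \<pi> g (\<pi> (inv3 g) x) = x"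
proof -
  assume h: "g \<in> G" "x \<in> W"
  show "\<pi> (inv3 g) (\<pi> g x) = x"
    using pi_mult[OF GD(4)[OF h(1)] h] GL3_inv1(2)[OF GD(1)[OF h(1)]] pi_1[OF h(2)] by simp
  show "\<pi> g (\<pi> (inv3 g) x) = x"
    using pi_mult[OF h(1) GD(4)[OF h(1)] h(2)] GL3_inv1(1)[OF GD(1)[OF h(1)]] pi_1[OF h(2)] by simp
qed
lemma pi_inj: assumes "g \<in> G" "x \<in> W" "y \<in> W" "\<pi> g x = \<pi> g y" shows "x = y"
proof -
  have "x = \<pi> (inv3 g) (\<pi> g x)" using pi_inv(1)[OF assms(1,2)] by (rule sym)
  also have "\<dots> = y" unfolding assms(4) using pi_inv(1)[OF assms(1,3)] .
  finally show ?thesis .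
qed
lemma pi_nz: assumes "g \<in> G" "x \<in> W" "x \<noteq> 0" shows "\<pi> g x \<noteq> 0"
proof
  assume "\<pi> g x = 0"
  hence "\<pi> g x = \<pi> g 0" using pi_0[OF assms(1)] by (simp only:)
  thus False using pi_inj[OF assms(1,2) subspace_0[OF W]] assms(3) by blast
qed
lemma W_diff: "x \<in> W \<Longrightarrow> y \<in> W \<Longrightarrow> x - y \<in> W" using subspace_diff[OF W] .

text \<open>Boundedness stands for compactness: together with smoothness it makes orbits finite
  (\<open>finite_orb\<close>), which is what averaging rests on.\<close>

definition cpt :: "('f ^ 3 ^ 3) set \<Rightarrow> bool" where
  "cpt J \<longleftrightarrow> subgrp J \<and> J \<subseteq> G \<and> (\<exists>c. J \<subseteq> intm c)"

lemma cptD: assumes "cpt J" shows "j \<in> J \<Longrightarrow> j \<in> G" "mat 1 \<in> J" "j \<in> J \<Longrightarrow> k \<in> J \<Longrightarrow> j ** k \<in> J" "j \<in> J \<Longrightarrow> inv3 j \<in> J"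
  "j \<in> J \<Longrightarrow> j \<in> GL3"
  using assms subgrp_D[of J] by (auto simp: cpt_def)

definition fx :: "('f ^ 3 ^ 3) set \<Rightarrow> 'v set" where "fx J = {x\<in>W. \<forall>j\<in>J. \<pi> j x = x}"

lemma fxI: "x \<in> W \<Longrightarrow> (\<And>j. j \<in> J \<Longrightarrow> \<pi> j x = x) \<Longrightarrow> x \<in> fx J" by (simp add: fx_def)
lemma fxD: "x \<in> fx J \<Longrightarrow> j \<in> J \<Longrightarrow> \<pi> j x = x" by (simp add: fx_def)
lemma fxW: "x \<in> fx J \<Longrightarrow> x \<in> W" by (simp add: fx_def)
lemma fx_anti: "x \<in> fx J \<Longrightarrow> H \<subseteq> J \<Longrightarrow> x \<in> fx H" by (auto simp: fx_def)
lemma subspace_fx: "J \<subseteq> G \<Longrightarrow> subspace (fx J)"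
proof (rule subspaceI)
  assume J: "J \<subseteq> G"
  hence G: "\<And>j. j \<in> J \<Longrightarrow> j \<in> G" by blast
  show "0 \<in> fx J" using pi_0[OF G] subspace_0[OF W] by (simp add: fx_def)
  show "x + y \<in> fx J" if "x \<in> fx J" "y \<in> fx J" for x y
    using that pi_add[OF G] subspace_add[OF W] by (simp add: fx_def)
  show "c \<odot> x \<in> fx J" if "x \<in> fx J" for c x
    using that pi_scale[OF G] subspace_scale[OF W] by (simp add: fx_def)
qed
lemma subspace_fx_cpt: "cpt J \<Longrightarrow> subspace (fx J)" using subspace_fx by (simp add: cpt_def)

definition orb :: "('f ^ 3 ^ 3) set \<Rightarrow> 'v \<Rightarrow> 'v set" where "orb J x = (\<lambda>j. \<pi> j x) ` J"
text \<open>The mean over the orbit plays the role of the Haar integral. Its linearity is not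
  evident, since the orbits of x, y and x + y may have different sizes;
  \<open>avg_transversal\<close> settles this.\<close>

definition avg :: "('f ^ 3 ^ 3) set \<Rightarrow> 'v \<Rightarrow> 'v" where "avg J x = inverse (of_nat (card (orb J x))) \<odot> \<Sum>(orb J x)"

lemma avg_eqI: assumes "\<And>h. h \<in> H \<Longrightarrow> \<exists>j\<in>J. \<pi> h x = \<pi> j y" "\<And>j. j \<in> J \<Longrightarrow> \<exists>h\<in>H. \<pi> j y = \<pi> h x"
  shows "avg H x = avg J y"
proof -
  have "orb H x = orb J y" using assms unfolding orb_def by (auto simp: image_iff)
  thus ?thesis by (simp add: avg_def)
qed

lemma span_orbit_stable: assumes x: "x \<in> W" and g: "g \<in> G" and y: "y \<in> span ((\<lambda>g. \<pi> g x) ` G)"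
  shows "\<pi> g y \<in> span ((\<lambda>g. \<pi> g x) ` G)"
proof -
  have "(\<lambda>g. \<pi> g x) ` G \<subseteq> {y \<in> W. \<pi> g y \<in> span ((\<lambda>g. \<pi> g x) ` G)}"
  proof (rule image_subsetI)
    fix h assume h: "h \<in> G"
    have "\<pi> g (\<pi> h x) = \<pi> (g ** h) x" by (rule pi_mult[symmetric, OF g h x])
    thus "\<pi> h x \<in> {y \<in> W. \<pi> g y \<in> span ((\<lambda>g. \<pi> g x) ` G)}" using pi_W[OF h x] GD(3)[OF g h] by (auto intro: span_base)
  qed
  from span_minimal[OF this subspace_pullback[OF pi_lin[OF g] W subspace_span]] show ?thesis using y by blast
qed

lemma orb_W: "cpt J \<Longrightarrow> x \<in> W \<Longrightarrow> y \<in> orb J x \<Longrightarrow> y \<in> W" using cptD(1) pi_W by (auto simp: orb_def)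
lemma orb_self: "cpt J \<Longrightarrow> x \<in> W \<Longrightarrow> x \<in> orb J x" unfolding orb_def by (rule image_eqI[where x = "mat 1"]) (auto simp: cptD(2) pi_1)

lemma finite_image_factor: assumes "finite (f ` J)" "\<And>i j. i \<in> J \<Longrightarrow> j \<in> J \<Longrightarrow> f i = f j \<Longrightarrow> g i = g j" shows "finite (g ` J)"
proof -
  have "g ` J \<subseteq> (\<lambda>y. g (SOME j. j \<in> J \<and> f j = y)) ` (f ` J)"
  proof
    fix z assume "z \<in> g ` J"
    then obtain i where i: "i \<in> J" "z = g i" by blast
    have "\<exists>j. j \<in> J \<and> f j = f i" using i by blast
    hence "(SOME j. j \<in> J \<and> f j = f i) \<in> J \<and> f (SOME j. j \<in> J \<and> f j = f i) = f i" by (rule someI_ex)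
    hence "g (SOME j. j \<in> J \<and> f j = f i) = z" using assms(2) i by blast
    thus "z \<in> (\<lambda>y. g (SOME j. j \<in> J \<and> f j = y)) ` (f ` J)" using i by blast
  qed
  thus ?thesis using assms(1) finite_subset by blast
qed

text \<open>If two elements of \<open>J\<close> are congruent entry by entry, deeply enough to
  survive multiplication by a bounded inverse, their quotient lies in a congruence subgroup that
  fixes \<open>x\<close>. So the orbit factors through finitely many tuples of digits.\<close>

lemma finite_orb: assumes J: "cpt J" and x: "x \<in> W" shows "finite (orb J x)"
proof -
  obtain m where m: "1 \<le> m" "\<And>k. k \<in> G \<Longrightarrow> k \<in> Kc m \<Longrightarrow> \<pi> k x = x" using smooth[OF x] by auto
  obtain c0 where c0: "J \<subseteq> intm c0" using J by (auto simp: cpt_def)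
  define c where "c = min c0 0"
  have c: "J \<subseteq> intm c" "c \<le> 0" using c0 intm_mono[of _ c0 c] by (auto simp: c_def)
  \<comment> \<open>Scaling by \<open>pw (-c)\<close> makes the entries integral and turns
    congruence modulo \<open>P (m - c)\<close> into congruence modulo \<open>P (m - 2 * c)\<close>;
    the remaining \<open>c\<close> pays for the inverse, which is only in
    \<open>intm c\<close>.\<close>
  define N where "N = nat (int m - 2 * c)"
  define r where "r = (\<lambda>a. red N (pw (-c) * a))"
  define f where "f = (\<lambda>j::'f^3^3. (r (j$1$1), r (j$1$2), r (j$1$3), r (j$2$1), r (j$2$2), r (j$2$3), r (j$3$1), r (j$3$2), r (j$3$3)))"
  have en: "pw (-c) * j $ a $ b \<in> P 0" if "j \<in> J" for j a b
    using that c by (auto simp: pw_mult_P intm_def)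
  have "f ` J \<subseteq> Dig N \<times> Dig N \<times> Dig N \<times> Dig N \<times> Dig N \<times> Dig N \<times> Dig N \<times> Dig N \<times> Dig N"
    using red(1)[OF en] by (auto simp: f_def r_def)
  hence fin: "finite (f ` J)" by (rule finite_subset) (simp add: Dig_finite)
  show ?thesis unfolding orb_def
  proof (rule finite_image_factor[OF fin])
    fix i j assume i: "i \<in> J" and j: "j \<in> J" and eq: "f i = f j"
    have eqs: "\<forall>a b. r (i $ a $ b) = r (j $ a $ b)"
      using eq unfolding f_def forall_3 prod.inject by blast
    have ent: "i $ a $ b - j $ a $ b \<in> P (int m - c)" for a b
    proof -
      have "r (i $ a $ b) = r (j $ a $ b)" using eqs by blast
      hence "pw (-c) * i $ a $ b - pw (-c) * j $ a $ b \<in> P (int N)"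
        using red_eqD[OF en[OF i] en[OF j]] by (simp add: r_def)
      hence "pw (-c) * (i $ a $ b - j $ a $ b) \<in> P (int N)" by (simp add: right_diff_distrib)
      thus ?thesis using c by (simp add: pw_mult_P N_def)
    qed
    have jG: "j \<in> GL3" using cptD(5)[OF J j] .
    have "inv3 j ** i - mat 1 = inv3 j ** (i - j)" using GL3_inv1(2)[OF jG] by (simp add: mat_mult_diff)
    moreover have "inv3 j ** (i - j) \<in> intm (c + (int m - c))"
      using cptD(4)[OF J j] c ent by (intro intm_mult) (auto simp: intm_def)
    ultimately have "inv3 j ** i \<in> Kc m" by (simp add: Kc_def)
    hence 1: "\<pi> (inv3 j ** i) x = x"
      by (intro m(2)) (auto intro: cptD(1)[OF J] cptD(3)[OF J] cptD(4)[OF J] i j)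
    have "\<pi> (inv3 j ** i) x = \<pi> (inv3 j) (\<pi> i x)"
      using i j x by (intro pi_mult cptD(1)[OF J] cptD(4)[OF J])
    hence 2: "\<pi> (inv3 j) (\<pi> i x) = x" using 1 by (simp only:)
    have "\<pi> j (\<pi> (inv3 j) (\<pi> i x)) = \<pi> i x"
      by (rule pi_inv(2)[OF cptD(1)[OF J j] pi_W[OF cptD(1)[OF J i] x]])
    thus "\<pi> i x = \<pi> j x" unfolding 2 by (rule sym)
  qed
qed

lemma card_orb: "cpt J \<Longrightarrow> x \<in> W \<Longrightarrow> card (orb J x) \<noteq> 0"
  using finite_orb[of J x] orb_self[of J x] by auto

lemma avg_const: assumes J: "cpt J" "x \<in> W" and \<phi>: "lin_on W \<phi>" "\<And>j. j \<in> J \<Longrightarrow> \<phi> (\<pi> j x) = z"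
  shows "\<phi> (avg J x) = z"
proof -
  have s: "\<Sum>(orb J x) = (\<Sum>o'\<in>orb J x. 1 \<odot> o')" by simp
  have sW: "\<Sum>(orb J x) \<in> W" using orb_W[OF J] by (intro subspace_sum W)
  have "\<phi> (\<Sum>(orb J x)) = (\<Sum>o'\<in>orb J x. 1 \<odot> \<phi> o')"
    unfolding s by (rule lin_on_sum[OF \<phi>(1) W orb_W[OF J]])
  also have "\<dots> = (\<Sum>o'\<in>orb J x. z)" using \<phi>(2) by (intro sum.cong) (auto simp: orb_def)
  also have "\<dots> = of_nat (card (orb J x)) \<odot> z" by (simp add: sum_constant_scale)
  finally show ?thesis using \<phi>(1) sW card_orb[OF J] by (simp add: avg_def lin_on_def)
qed

lemma avg_const_fun: assumes J: "cpt J" "x \<in> W" and \<phi>: "fun_on W \<phi>" "\<And>j. j \<in> J \<Longrightarrow> \<phi> (\<pi> j x) = z"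
  shows "\<phi> (avg J x) = z"
proof -
  have s: "\<Sum>(orb J x) = (\<Sum>o'\<in>orb J x. 1 \<odot> o')" by simp
  have sW: "\<Sum>(orb J x) \<in> W" using orb_W[OF J] by (intro subspace_sum W)
  have "\<phi> (\<Sum>(orb J x)) = (\<Sum>o'\<in>orb J x. 1 * \<phi> o')"
    unfolding s by (rule fun_on_sum[OF \<phi>(1) W orb_W[OF J]])
  also have "\<dots> = (\<Sum>o'\<in>orb J x. z)" using \<phi>(2) by (intro sum.cong) (auto simp: orb_def)
  also have "\<dots> = of_nat (card (orb J x)) * z" by simp
  finally show ?thesis using \<phi>(1) sW card_orb[OF J] by (simp add: avg_def fun_on_def)
qed

lemma lin_on_id: "lin_on W (\<lambda>x. x)" by (simp add: lin_on_def)
lemma lin_on_comp: "lin_on W S \<Longrightarrow> lin_on W T \<Longrightarrow> (\<And>x. x \<in> W \<Longrightarrow> T x \<in> W) \<Longrightarrow> lin_on W (\<lambda>x. S (T x))"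
  by (simp add: lin_on_def)

lemma avg_W: "cpt J \<Longrightarrow> x \<in> W \<Longrightarrow> avg J x \<in> W"
  unfolding avg_def using orb_W by (intro subspace_scale subspace_sum W)

lemma avg_id: "cpt J \<Longrightarrow> x \<in> fx J \<Longrightarrow> avg J x = x"
  by (rule avg_const[where \<phi> = "\<lambda>x. x", OF _ fxW lin_on_id fxD])

text \<open>An element that maps the finite orbit into itself permutes it.\<close>

lemma avg_perm: assumes J: "cpt J" "x \<in> W" and h: "h \<in> G" "\<And>j. j \<in> J \<Longrightarrow> \<exists>j'\<in>J. \<pi> h (\<pi> j x) = \<pi> j' x"
  shows "\<pi> h (avg J x) = avg J x"
proof -
  have sub: "\<pi> h ` orb J x \<subseteq> orb J x"
  proof
    fix y assume "y \<in> \<pi> h ` orb J x"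
    then obtain j where "j \<in> J" "y = \<pi> h (\<pi> j x)" by (auto simp: orb_def)
    thus "y \<in> orb J x" using h(2) by (auto simp: orb_def)
  qed
  have inj: "inj_on (\<pi> h) (orb J x)" using pi_inj[OF h(1) orb_W[OF J] orb_W[OF J]] by (rule inj_onI)
  have "\<pi> h ` orb J x = orb J x" using endo_inj_surj[OF finite_orb[OF J] sub inj] .
  hence "\<Sum>(orb J x) = sum (\<pi> h) (orb J x)" using sum.reindex[OF inj, of "\<lambda>x. x"] by simp
  also have "\<dots> = \<pi> h (\<Sum>(orb J x))"
    using lin_on_sum[OF pi_lin[OF h(1)] W, of "orb J x" "\<lambda>x. x" "\<lambda>_. 1"] orb_W[OF J] by simp
  finally have "\<pi> h (\<Sum>(orb J x)) = \<Sum>(orb J x)" by simp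
  moreover have "\<Sum>(orb J x) \<in> W" using orb_W[OF J] by (intro subspace_sum W)
  ultimately show ?thesis by (simp add: avg_def pi_scale[OF h(1)])
qed

lemma avg_fx: assumes J: "cpt J" "x \<in> W" shows "avg J x \<in> fx J"
proof (rule fxI[OF avg_W[OF J]])
  fix j assume j: "j \<in> J"
  show "\<pi> j (avg J x) = avg J x"
  proof (rule avg_perm[OF J cptD(1)[OF J(1) j]])
    fix k assume k: "k \<in> J"
    show "\<exists>j'\<in>J. \<pi> j (\<pi> k x) = \<pi> j' x"
      using pi_mult[OF cptD(1)[OF J(1) j] cptD(1)[OF J(1) k] J(2)] cptD(3)[OF J(1) j k]
      by (intro bexI[of _ "j ** k"]) auto
  qed
qed

text \<open>\<open>J\<close> acts on the finite set \<open>\<Phi>\<close> of restrictions of its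
  operators to \<open>Y\<close>, and evaluation at y in \<open>Y\<close> maps \<open>\<Phi>\<close>
  equivariantly onto the orbit of y, so all fibres have the same size. One group element for each
  restriction therefore computes the averages of all vectors of \<open>Y\<close> at once.\<close>

lemma avg_transversal: assumes J: "cpt J" and Y: "finite Y" "Y \<subseteq> W"
  shows "\<exists>S. finite S \<and> S \<noteq> {} \<and> S \<subseteq> J \<and> (\<forall>y\<in>Y. avg J y = inverse (of_nat (card S)) \<odot> (\<Sum>s\<in>S. \<pi> s y))"
proof -
  define F where "F = (\<lambda>j. restrict (\<pi> j) Y)"
  define \<Phi> where "\<Phi> = F ` J"
  have "\<Phi> \<subseteq> PiE Y (orb J)" by (auto simp: \<Phi>_def F_def orb_def)
  hence fin: "finite \<Phi>" using finite_PiE[OF Y(1)] finite_orb[OF J] Y(2) finite_subset by blast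
  define r where "r = (\<lambda>\<phi>. SOME j. j \<in> J \<and> F j = \<phi>)"
  have r: "r \<phi> \<in> J" "F (r \<phi>) = \<phi>" if "\<phi> \<in> \<Phi>" for \<phi>
  proof -
    have "\<exists>j. j \<in> J \<and> F j = \<phi>" using that by (auto simp: \<Phi>_def)
    hence "r \<phi> \<in> J \<and> F (r \<phi>) = \<phi>" unfolding r_def by (rule someI_ex)
    thus "r \<phi> \<in> J" "F (r \<phi>) = \<phi>" by auto
  qed
  have inj: "inj_on r \<Phi>"
  proof (rule inj_onI)
    fix \<phi> \<psi> assume "\<phi> \<in> \<Phi>" "\<psi> \<in> \<Phi>" "r \<phi> = r \<psi>"
    thus "\<phi> = \<psi>" using r(2)[of \<phi>] r(2)[of \<psi>] by metis
  qed
  define act where "act = (\<lambda>k (\<phi>::'v \<Rightarrow> 'v). restrict (\<lambda>y. \<pi> k (\<phi> y)) Y)"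
  have act: "act k (F j) = F (k ** j)" if "k \<in> J" "j \<in> J" for k j
  proof (rule ext)
    fix y
    show "act k (F j) y = F (k ** j) y"
    proof (cases "y \<in> Y")
      case True
      hence "y \<in> W" using Y(2) by blast
      from pi_mult[OF cptD(1)[OF J that(1)] cptD(1)[OF J that(2)] this]
      show ?thesis using True by (simp add: act_def F_def)
    qed (simp add: act_def F_def)
  qed
  have inv: "act (inv3 k) (act k \<phi>) = \<phi>" "act k (act (inv3 k) \<phi>) = \<phi>" if kJ: "k \<in> J" and \<phi>: "\<phi> \<in> \<Phi>" for k \<phi>
  proof -
    obtain j where j: "j \<in> J" "\<phi> = F j" using \<phi> by (auto simp: \<Phi>_def)
    note k = cptD(4)[OF J kJ] cptD(5)[OF J kJ]
    show "act (inv3 k) (act k \<phi>) = \<phi>" "act k (act (inv3 k) \<phi>) = \<phi>"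
      unfolding j(2) act[OF kJ j(1)] act[OF k(1) j(1)]
        act[OF k(1) cptD(3)[OF J kJ j(1)]] act[OF kJ cptD(3)[OF J k(1) j(1)]] GL3_cancel[OF k(2)]
      by (rule refl)+
  qed
  have act\<Phi>: "act k \<phi> \<in> \<Phi>" if k: "k \<in> J" and \<phi>: "\<phi> \<in> \<Phi>" for k \<phi>
  proof -
    obtain j where j: "j \<in> J" "\<phi> = F j" using \<phi> by (auto simp: \<Phi>_def)
    show ?thesis unfolding \<Phi>_def j(2) act[OF k j(1)] using cptD(3)[OF J k j(1)] by blast
  qed
  have eq: "avg J y = inverse (of_nat (card \<Phi>)) \<odot> (\<Sum>\<phi>\<in>\<Phi>. \<phi> y)" if y: "y \<in> Y" for y
  proof -
    have yW: "y \<in> W" using Y y by blast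
    have img: "(\<lambda>\<phi>. \<phi> y) ` \<Phi> = orb J y"
      unfolding \<Phi>_def orb_def image_image by (rule image_cong) (simp_all add: F_def y)
    define n where "n = card {\<phi>\<in>\<Phi>. \<phi> y = y}"
    have fib: "card {\<phi>\<in>\<Phi>. \<phi> y = o'} = n" if o': "o' \<in> orb J y" for o'
    proof -
      obtain k where k: "k \<in> J" "o' = \<pi> k y" using o' by (auto simp: orb_def)
      have \<Phi>W: "\<phi> y \<in> W" if "\<phi> \<in> \<Phi>" for \<phi> using that img orb_W[OF J yW] by blast
      have "bij_betw (act k) {\<phi>\<in>\<Phi>. \<phi> y = y} {\<phi>\<in>\<Phi>. \<phi> y = o'}"
      proof (rule bij_betw_byWitness[where f' = "act (inv3 k)"])
        show "\<forall>\<phi>\<in>{\<phi>\<in>\<Phi>. \<phi> y = y}. act (inv3 k) (act k \<phi>) = \<phi>" using inv(1)[OF k(1)] by simp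
        show "\<forall>\<phi>\<in>{\<phi>\<in>\<Phi>. \<phi> y = o'}. act k (act (inv3 k) \<phi>) = \<phi>" using inv(2)[OF k(1)] by simp
        show "act k ` {\<phi>\<in>\<Phi>. \<phi> y = y} \<subseteq> {\<phi>\<in>\<Phi>. \<phi> y = o'}"
        proof
          fix \<psi> assume "\<psi> \<in> act k ` {\<phi>\<in>\<Phi>. \<phi> y = y}"
          then obtain \<phi> where p: "\<phi> \<in> \<Phi>" "\<phi> y = y" "\<psi> = act k \<phi>" by blast
          have "\<psi> y = o'" unfolding p(3) act_def k(2) using y p(2) by simp
          thus "\<psi> \<in> {\<phi>\<in>\<Phi>. \<phi> y = o'}" using act\<Phi>[OF k(1) p(1)] p(3) by simp
        qed
        show "act (inv3 k) ` {\<phi>\<in>\<Phi>. \<phi> y = o'} \<subseteq> {\<phi>\<in>\<Phi>. \<phi> y = y}"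
        proof
          fix \<psi> assume "\<psi> \<in> act (inv3 k) ` {\<phi>\<in>\<Phi>. \<phi> y = o'}"
          then obtain \<phi> where p: "\<phi> \<in> \<Phi>" "\<phi> y = o'" "\<psi> = act (inv3 k) \<phi>" by blast
          have "\<psi> y = y" unfolding p(3) act_def using y p(2) k(2) pi_inv(1)[OF cptD(1)[OF J k(1)] yW] by simp
          thus "\<psi> \<in> {\<phi>\<in>\<Phi>. \<phi> y = y}" using act\<Phi>[OF cptD(4)[OF J k(1)] p(1)] p(3) by simp
        qed
      qed
      thus ?thesis by (simp add: bij_betw_same_card n_def)
    qed
    have "(\<Sum>\<phi>\<in>\<Phi>. \<phi> y) = (\<Sum>o'\<in>orb J y. \<Sum>\<phi>\<in>{\<phi>\<in>\<Phi>. \<phi> y = o'}. \<phi> y)"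
      using sum.image_gen[OF fin, of "\<lambda>\<phi>. \<phi> y" "\<lambda>\<phi>. \<phi> y"] unfolding img .
    also have "\<dots> = (\<Sum>o'\<in>orb J y. of_nat n \<odot> o')"
    proof (rule sum.cong[OF refl])
      fix o' assume "o' \<in> orb J y"
      have "(\<Sum>\<phi>\<in>{\<phi>\<in>\<Phi>. \<phi> y = o'}. \<phi> y) = (\<Sum>\<phi>\<in>{\<phi>\<in>\<Phi>. \<phi> y = o'}. o')" by (rule sum.cong) auto
      thus "(\<Sum>\<phi>\<in>{\<phi>\<in>\<Phi>. \<phi> y = o'}. \<phi> y) = of_nat n \<odot> o'"
        using fib[OF \<open>o' \<in> orb J y\<close>] by (simp add: sum_constant_scale)
    qed
    also have "\<dots> = of_nat n \<odot> \<Sum>(orb J y)" by (simp add: scale_sum_right)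
    finally have s: "(\<Sum>\<phi>\<in>\<Phi>. \<phi> y) = of_nat n \<odot> \<Sum>(orb J y)" .
    have "card \<Phi> = (\<Sum>o'\<in>orb J y. card {\<phi>\<in>\<Phi>. \<phi> y = o'})"
      using sum.image_gen[OF fin, of "\<lambda>_. 1::nat" "\<lambda>\<phi>. \<phi> y"] unfolding img by simp
    also have "\<dots> = (\<Sum>o'\<in>orb J y. n)" by (rule sum.cong[OF refl fib])
    also have "\<dots> = card (orb J y) * n" by simp
    finally have c: "card \<Phi> = card (orb J y) * n" .
    have "\<Phi> \<noteq> {}" using cptD(2)[OF J] by (auto simp: \<Phi>_def)
    hence "card \<Phi> \<noteq> 0" using fin by simp
    hence "n \<noteq> 0" unfolding c by simp
    have co: "(of_nat (card (orb J y)) :: complex) \<noteq> 0" using card_orb[OF J yW] by simp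
    have "inverse (of_nat (card (orb J y) * n)) \<odot> (of_nat n \<odot> \<Sum>(orb J y)) = inverse (of_nat (card (orb J y))) \<odot> \<Sum>(orb J y)"
      using \<open>n \<noteq> 0\<close> co unfolding scale_scale by (intro arg_cong2[where f = smul] refl) (simp add: field_simps)
    thus ?thesis unfolding s c avg_def by (rule sym)
  qed
  have sum: "(\<Sum>s\<in>r ` \<Phi>. \<pi> s y) = (\<Sum>\<phi>\<in>\<Phi>. \<phi> y)" if "y \<in> Y" for y
  proof -
    have "(\<Sum>s\<in>r ` \<Phi>. \<pi> s y) = (\<Sum>\<phi>\<in>\<Phi>. \<pi> (r \<phi>) y)" by (simp add: sum.reindex[OF inj])
    also have "\<dots> = (\<Sum>\<phi>\<in>\<Phi>. \<phi> y)"
    proof (rule sum.cong[OF refl])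
      fix \<phi> assume "\<phi> \<in> \<Phi>"
      hence "F (r \<phi>) y = \<phi> y" using r(2) by (simp only:)
      moreover have "F (r \<phi>) y = \<pi> (r \<phi>) y" using that by (simp add: F_def)
      ultimately show "\<pi> (r \<phi>) y = \<phi> y" by (rule trans[OF sym, rotated])
    qed
    finally show ?thesis .
  qed
  show ?thesis
  proof (intro exI[of _ "r ` \<Phi>"] conjI ballI)
    show "r ` \<Phi> \<noteq> {}" using cptD(2)[OF J] by (auto simp: \<Phi>_def)
    show "avg J y = inverse (of_nat (card (r ` \<Phi>))) \<odot> (\<Sum>s\<in>r ` \<Phi>. \<pi> s y)" if "y \<in> Y" for y
      unfolding sum[OF that] card_image[OF inj] by (rule eq[OF that])
    show "finite (r ` \<Phi>)" using fin by (rule finite_imageI)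
    show "r ` \<Phi> \<subseteq> J" using r(1) by (rule image_subsetI)
  qed
qed

lemma avg_lin: assumes J: "cpt J" shows "lin_on W (avg J)"
  unfolding lin_on_def
proof (intro conjI ballI allI)
  fix x y assume xy: "x \<in> W" "y \<in> W"
  hence "{x, y, x + y} \<subseteq> W" using W subspace_add by blast
  from avg_transversal[OF J _ this] obtain S where S: "S \<subseteq> J"
    "\<forall>z\<in>{x, y, x + y}. avg J z = inverse (of_nat (card S)) \<odot> (\<Sum>s\<in>S. \<pi> s z)" by auto
  have "(\<Sum>s\<in>S. \<pi> s (x + y)) = (\<Sum>s\<in>S. \<pi> s x + \<pi> s y)"
    using S(1) cptD(1)[OF J] by (intro sum.cong refl pi_add xy) blast
  hence e: "(\<Sum>s\<in>S. \<pi> s (x + y)) = (\<Sum>s\<in>S. \<pi> s x) + (\<Sum>s\<in>S. \<pi> s y)" by (simp add: sum.distrib)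
  have "avg J (x + y) = inverse (of_nat (card S)) \<odot> (\<Sum>s\<in>S. \<pi> s (x + y))" using S(2) by blast
  moreover have "avg J x = inverse (of_nat (card S)) \<odot> (\<Sum>s\<in>S. \<pi> s x)" using S(2) by blast
  moreover have "avg J y = inverse (of_nat (card S)) \<odot> (\<Sum>s\<in>S. \<pi> s y)" using S(2) by blast
  ultimately show "avg J (x + y) = avg J x + avg J y" by (simp only: e scale_right_distrib)
next
  fix c x assume x: "x \<in> W"
  hence "{x, c \<odot> x} \<subseteq> W" using W subspace_scale by blast
  from avg_transversal[OF J _ this] obtain S where S: "S \<subseteq> J"
    "\<forall>z\<in>{x, c \<odot> x}. avg J z = inverse (of_nat (card S)) \<odot> (\<Sum>s\<in>S. \<pi> s z)" by auto
  have "(\<Sum>s\<in>S. \<pi> s (c \<odot> x)) = (\<Sum>s\<in>S. c \<odot> \<pi> s x)"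
    using S(1) cptD(1)[OF J] by (intro sum.cong refl pi_scale x) blast
  hence e: "(\<Sum>s\<in>S. \<pi> s (c \<odot> x)) = c \<odot> (\<Sum>s\<in>S. \<pi> s x)" by (simp only: scale_sum_right)
  have "avg J (c \<odot> x) = inverse (of_nat (card S)) \<odot> (\<Sum>s\<in>S. \<pi> s (c \<odot> x))" using S(2) by blast
  moreover have "avg J x = inverse (of_nat (card S)) \<odot> (\<Sum>s\<in>S. \<pi> s x)" using S(2) by blast
  ultimately show "avg J (c \<odot> x) = c \<odot> avg J x" by (simp only: e scale_scale mult.commute)
qed

lemma avg_0: "cpt J \<Longrightarrow> avg J 0 = 0" using lin_on_0[OF avg_lin W] .
lemma avg_diff: "cpt J \<Longrightarrow> x \<in> W \<Longrightarrow> y \<in> W \<Longrightarrow> avg J (x - y) = avg J x - avg J y"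
  using lin_on_diff[OF avg_lin W] .
lemma avg_add: "cpt J \<Longrightarrow> x \<in> W \<Longrightarrow> y \<in> W \<Longrightarrow> avg J (x + y) = avg J x + avg J y"
  using avg_lin[of J] unfolding lin_on_def by blast
lemma avg_scale: "cpt J \<Longrightarrow> x \<in> W \<Longrightarrow> avg J (c \<odot> x) = c \<odot> avg J x"
  using avg_lin[of J] unfolding lin_on_def by blast
lemma avg_sum: assumes "cpt J" "\<And>i. i \<in> I \<Longrightarrow> f i \<in> W" shows "avg J (\<Sum>i\<in>I. f i) = (\<Sum>i\<in>I. avg J (f i))"
  using lin_on_sum[OF avg_lin[OF assms(1)] W assms(2), of I "\<lambda>i. i" "\<lambda>_. 1"] by simp
lemma pi_sum: assumes "g \<in> G" "\<And>i. i \<in> I \<Longrightarrow> f i \<in> W" shows "\<pi> g (\<Sum>i\<in>I. f i) = (\<Sum>i\<in>I. \<pi> g (f i))"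
  using lin_on_sum[OF pi_lin[OF assms(1)] W assms(2), of I "\<lambda>i. i" "\<lambda>_. 1"] by simp

lemma avg_pi: assumes "cpt J" "j \<in> J" "x \<in> W" shows "avg J (\<pi> j x) = avg J x"
proof (rule avg_eqI)
  note jG = cptD(1)[OF assms(1,2)]
  note i = cptD(4)[OF assms(1,2)]
  fix k assume k: "k \<in> J"
  note kG = cptD(1)[OF assms(1) k]
  show "\<exists>h\<in>J. \<pi> k (\<pi> j x) = \<pi> h x"
    using pi_mult[OF kG jG assms(3)] cptD(3)[OF assms(1) k assms(2)] by (intro bexI[of _ "k ** j"]) simp_all
  have "\<pi> (k ** inv3 j) (\<pi> j x) = \<pi> k (\<pi> (inv3 j) (\<pi> j x))"
    by (rule pi_mult[OF kG cptD(1)[OF assms(1) i] pi_W[OF jG assms(3)]])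
  thus "\<exists>h\<in>J. \<pi> k x = \<pi> h (\<pi> j x)"
    using pi_inv(1)[OF jG assms(3)] cptD(3)[OF assms(1) k i] by (intro bexI[of _ "k ** inv3 j"]) simp_all
qed

lemma avg_sub: assumes "cpt J" "cpt H" "H \<subseteq> J" "x \<in> W" shows "avg J (avg H x) = avg J x"
  by (rule avg_const[OF assms(2,4) avg_lin[OF assms(1)]], rule avg_pi[OF assms(1) _ assms(4)], use assms(3) in blast)

lemma avg_conj: assumes g: "g \<in> G" and J: "cpt J" "cpt H" and x: "x \<in> W"
  and c: "\<And>j. j \<in> J \<Longrightarrow> g ** j ** inv3 g \<in> H" "\<And>h. h \<in> H \<Longrightarrow> inv3 g ** h ** g \<in> J"
  shows "\<pi> g (avg J x) = avg H (\<pi> g x)"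
proof -
  have gx: "\<pi> g x \<in> W" using g x pi_W by blast
  have gG: "g \<in> GL3" using GD(1) g by blast
  have 1: "\<pi> g (\<pi> j x) = \<pi> (g ** j ** inv3 g) (\<pi> g x)" if "j \<in> J" for j
  proof -
    have jG: "j \<in> G" using cptD(1)[OF J(1) that] .
    have "\<pi> (g ** j ** inv3 g ** g) x = \<pi> (g ** j ** inv3 g) (\<pi> g x)"
      by (rule pi_mult) (auto intro: GD g jG x)
    moreover have "g ** j ** inv3 g ** g = g ** j"
      using GL3_inv1(2)[OF gG] by (simp add: matrix_mul_assoc[symmetric])
    moreover have "\<pi> (g ** j) x = \<pi> g (\<pi> j x)" by (rule pi_mult[OF g jG x])
    ultimately show ?thesis by simp
  qed
  have "orb H (\<pi> g x) = \<pi> g ` orb J x"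
  proof
    show "\<pi> g ` orb J x \<subseteq> orb H (\<pi> g x)" using 1 c(1) by (auto simp: orb_def)
    show "orb H (\<pi> g x) \<subseteq> \<pi> g ` orb J x"
    proof
      fix y assume "y \<in> orb H (\<pi> g x)"
      then obtain h where h: "h \<in> H" "y = \<pi> h (\<pi> g x)" by (auto simp: orb_def)
      have "g ** (inv3 g ** h ** g) ** inv3 g = (g ** inv3 g) ** h ** (g ** inv3 g)"
        by (simp add: matrix_mul_assoc)
      hence "g ** (inv3 g ** h ** g) ** inv3 g = h" using GL3_inv1(1)[OF gG] by simp
      hence "y = \<pi> g (\<pi> (inv3 g ** h ** g) x)" using 1[OF c(2)[OF h(1)]] h by simp
      thus "y \<in> \<pi> g ` orb J x" using c(2)[OF h(1)] by (auto simp: orb_def)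
    qed
  qed
  moreover have inj: "inj_on (\<pi> g) (orb J x)" using pi_inj[OF g orb_W[OF J(1) x] orb_W[OF J(1) x]] by (rule inj_onI)
  moreover have "sum (\<pi> g) (orb J x) = \<pi> g (\<Sum>(orb J x))"
    using lin_on_sum[OF pi_lin[OF g] W, of "orb J x" "\<lambda>x. x" "\<lambda>_. 1"] orb_W[OF J(1) x] by simp
  moreover have "\<Sum>(orb J x) \<in> W" using orb_W[OF J(1) x] by (intro subspace_sum W)
  ultimately show ?thesis by (simp add: avg_def card_image sum.reindex pi_scale[OF g])
qed

definition normz :: "'f ^ 3 ^ 3 \<Rightarrow> ('f ^ 3 ^ 3) set \<Rightarrow> bool" where
  "normz g J \<longleftrightarrow> g \<in> G \<and> (\<forall>j\<in>J. g ** j ** inv3 g \<in> J) \<and> (\<forall>j\<in>J. inv3 g ** j ** g \<in> J)"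

lemma normz_avg: "normz g J \<Longrightarrow> cpt J \<Longrightarrow> x \<in> W \<Longrightarrow> \<pi> g (avg J x) = avg J (\<pi> g x)"
  by (rule avg_conj) (auto simp: normz_def)

lemma normz_fx: assumes "normz g J" "J \<subseteq> G" "x \<in> fx J" shows "\<pi> g x \<in> fx J"
proof (rule fxI)
  have g: "g \<in> G" and x: "x \<in> W" using assms fxW by (auto simp: normz_def)
  show "\<pi> g x \<in> W" using g x pi_W by blast
  fix j assume j: "j \<in> J"
  have jG: "j \<in> G" and k: "inv3 g ** j ** g \<in> J" using j assms by (auto simp: normz_def)
  have e: "j ** g = g ** (inv3 g ** j ** g)"
    using GL3_inv1(1)[OF GD(1)[OF g]] by (simp add: matrix_mul_assoc)
  have "\<pi> j (\<pi> g x) = \<pi> (g ** (inv3 g ** j ** g)) x"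
    using pi_mult[OF jG g x] e by simp
  also have "\<dots> = \<pi> g (\<pi> (inv3 g ** j ** g) x)" using k assms(2) g x by (intro pi_mult) auto
  also have "\<dots> = \<pi> g x" using fxD[OF assms(3) k] by simp
  finally show "\<pi> j (\<pi> g x) = \<pi> g x" .
qed

lemma avg_normz_fx: assumes "cpt H" "cpt J" "\<And>h. h \<in> H \<Longrightarrow> normz h J" "x \<in> fx J" shows "avg H x \<in> fx J"
proof -
  have JG: "J \<subseteq> G" using cptD(1)[OF assms(2)] by blast
  have "o' \<in> fx J" if "o' \<in> orb H x" for o'
    using that normz_fx[OF assms(3) JG assms(4)] by (auto simp: orb_def)
  thus ?thesis unfolding avg_def
    by (intro subspace_scale subspace_sum subspace_fx[OF JG])
qed

lemma avg_commute_aux: assumes H: "cpt H" and J: "cpt J" and x: "x \<in> W"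
  and c: "\<And>h. h \<in> H \<Longrightarrow> \<pi> h (avg J x) = avg J (\<pi> h x)"
  shows "avg H (avg J x) = avg J (avg H x)"
proof -
  have "{x, avg J x} \<subseteq> W" using x avg_W[OF J] by blast
  from avg_transversal[OF H _ this] obtain S where S: "S \<subseteq> H"
    "\<forall>y\<in>{x, avg J x}. avg H y = inverse (of_nat (card S)) \<odot> (\<Sum>s\<in>S. \<pi> s y)" by auto
  have sW: "\<pi> s x \<in> W" if "s \<in> S" for s using that S(1) cptD(1)[OF H] x pi_W by blast
  have "(\<Sum>s\<in>S. \<pi> s (avg J x)) = (\<Sum>s\<in>S. avg J (\<pi> s x))"
    using S(1) c by (intro sum.cong refl) blast
  hence e: "(\<Sum>s\<in>S. \<pi> s (avg J x)) = avg J (\<Sum>s\<in>S. \<pi> s x)" using avg_sum[OF J, of S "\<lambda>s. \<pi> s x", OF sW] by simp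
  have "avg H (avg J x) = inverse (of_nat (card S)) \<odot> (\<Sum>s\<in>S. \<pi> s (avg J x))" using S(2) by blast
  also have "\<dots> = avg J (inverse (of_nat (card S)) \<odot> (\<Sum>s\<in>S. \<pi> s x))"
    unfolding e by (rule avg_scale[OF J, symmetric]) (rule subspace_sum[OF W sW])
  also have "inverse (of_nat (card S)) \<odot> (\<Sum>s\<in>S. \<pi> s x) = avg H x" using S(2) by simp
  finally show ?thesis .
qed

lemma avg_commute_normz: assumes H: "cpt H" and J: "cpt J" and n: "\<And>h. h \<in> H \<Longrightarrow> normz h J" and x: "x \<in> W"
  shows "avg H (avg J x) = avg J (avg H x)"
  by (rule avg_commute_aux[OF H J x]) (rule normz_avg[OF n J x])

lemma avg_commute: assumes H: "cpt H" and J: "cpt J" and x: "x \<in> W"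
  and c: "\<And>h j. h \<in> H \<Longrightarrow> j \<in> J \<Longrightarrow> \<pi> h (\<pi> j x) = \<pi> j (\<pi> h x)"
  shows "avg H (avg J x) = avg J (avg H x)"
proof (rule avg_commute_aux[OF H J x])
  fix s assume s: "s \<in> H"
  have sG: "s \<in> G" using s cptD(1)[OF H] by blast
  have "{x, \<pi> s x} \<subseteq> W" using x pi_W[OF sG x] by blast
  from avg_transversal[OF J _ this] obtain R where R: "R \<subseteq> J"
    "\<forall>y\<in>{x, \<pi> s x}. avg J y = inverse (of_nat (card R)) \<odot> (\<Sum>s\<in>R. \<pi> s y)" by auto
  have rW: "\<pi> r x \<in> W" if "r \<in> R" for r using that R(1) cptD(1)[OF J] x pi_W by blast
  have "\<pi> s (\<Sum>r\<in>R. \<pi> r x) = (\<Sum>r\<in>R. \<pi> s (\<pi> r x))" by (rule pi_sum[OF sG rW])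
  also have "\<dots> = (\<Sum>r\<in>R. \<pi> r (\<pi> s x))" using c s R(1) by (intro sum.cong refl) blast
  finally have e: "\<pi> s (\<Sum>r\<in>R. \<pi> r x) = (\<Sum>r\<in>R. \<pi> r (\<pi> s x))" .
  have "avg J x = inverse (of_nat (card R)) \<odot> (\<Sum>r\<in>R. \<pi> r x)" using R(2) by blast
  moreover have "avg J (\<pi> s x) = inverse (of_nat (card R)) \<odot> (\<Sum>r\<in>R. \<pi> r (\<pi> s x))" using R(2) by blast
  ultimately show "\<pi> s (avg J x) = avg J (\<pi> s x)"
    using pi_scale[OF sG subspace_sum[OF W, of R "\<lambda>r. \<pi> r x", OF rW], of "inverse (of_nat (card R))"] e by simp
qed

text \<open>Apply \<open>avg B\<close> to the sum over the orbit of \<open>y\<close>: every orbit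
  point other than \<open>y\<close> contributes 0, so the result is \<open>y\<close> and the orbit
  sum is not 0. All nonvanishing steps of the descents go through this criterion.\<close>

lemma avg_core: assumes J: "cpt J" and B: "cpt B" and y: "y \<in> fx B" "y \<noteq> 0"
  and c: "\<And>j. j \<in> J \<Longrightarrow> \<pi> j y = y \<or> avg B (\<pi> j y) = 0"
  shows "avg J y \<noteq> 0"
proof
  assume 0: "avg J y = 0"
  have yW: "y \<in> W" using fxW y by blast
  have oW: "o' \<in> W" if "o' \<in> orb J y" for o' using orb_W[OF J yW that] .
  have "avg B (\<Sum>o'\<in>orb J y. o') = (\<Sum>o'\<in>orb J y. avg B o')"
    by (rule avg_sum[OF B oW])
  also have "\<dots> = (\<Sum>o'\<in>orb J y. if o' = y then y else 0)"
  proof (rule sum.cong[OF refl])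
    fix o' assume "o' \<in> orb J y"
    then obtain j where "j \<in> J" "o' = \<pi> j y" by (auto simp: orb_def)
    thus "avg B o' = (if o' = y then y else 0)" using c[of j] avg_id[OF B y(1)] by auto
  qed
  also have "\<dots> = y" using finite_orb[OF J yW] orb_self[OF J yW] by simp
  finally have 1: "avg B (\<Sum>(orb J y)) = y" by simp
  have "\<Sum>(orb J y) = of_nat (card (orb J y)) \<odot> avg J y"
    using card_orb[OF J yW] by (simp add: avg_def)
  hence "\<Sum>(orb J y) = 0" using 0 by simp
  thus False using 1 avg_0[OF B] y by simp
qed

text \<open>The average over \<open>B\<close> does not distinguish \<open>\<pi> u y\<close> from
  \<open>\<pi> u (\<pi> c y)\<close>, hence not from \<open>\<pi> u (avg C y)\<close>, which is 0.
  In this way relations between root groups become vanishing statements.\<close>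

lemma avg_kill: assumes B: "cpt B" and C: "cpt C" and u: "u \<in> G" and y: "y \<in> W" "avg C y = 0"
  and c: "\<And>c. c \<in> C \<Longrightarrow> \<exists>b\<in>B. \<pi> b (\<pi> u y) = \<pi> u (\<pi> c y)"
  shows "avg B (\<pi> u y) = 0"
proof -
  have uy: "\<pi> u y \<in> W" using u y pi_W by blast
  have l: "lin_on W (\<lambda>x. avg B (\<pi> u x))"
    using lin_on_comp[OF avg_lin[OF B] pi_lin[OF u]] pi_W[OF u] by blast
  have "avg B (\<pi> u (avg C y)) = avg B (\<pi> u y)"
  proof (rule avg_const[OF C y(1) l])
    fix j assume "j \<in> C"
    then obtain b where "b \<in> B" "\<pi> b (\<pi> u y) = \<pi> u (\<pi> j y)" using c by blast
    thus "avg B (\<pi> u (\<pi> j y)) = avg B (\<pi> u y)" using avg_pi[OF B _ uy, of b] by simp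
  qed
  thus ?thesis using y(2) pi_0[OF u] avg_0[OF B] by simp
qed

text \<open>The groups \<open>U t\<close> grow as \<open>t\<close> decreases, and averages over
  nested groups compose. If \<open>R\<close> and nonvanishing pass from \<open>k\<close> to
  \<open>k - 1\<close>, all averages of \<open>x\<close> below \<open>k\<close> are nonzero, against
  \<open>sc\<close>.\<close>

lemma descent:
  assumes U: "\<And>t. cpt (U t)" "\<And>s t. s \<le> t \<Longrightarrow> U t \<subseteq> U s"
    and sc: "\<And>x. x \<in> W \<Longrightarrow> \<exists>t. avg (U t) x = 0"
    and R: "\<And>k x. R k x \<Longrightarrow> x \<in> W" "\<And>k x. R k x \<Longrightarrow> x \<noteq> 0 \<Longrightarrow> avg (U (k - 1)) x \<noteq> 0 \<and> R (k - 1) (avg (U (k - 1)) x)"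
    and x: "R (k::int) x"
  shows "x = 0"
proof (rule ccontr)
  assume x0: "x \<noteq> 0"
  have *: "avg (U (k - 1 - int j)) x \<noteq> 0 \<and> R (k - 1 - int j) (avg (U (k - 1 - int j)) x)" for j
  proof (induction j)
    case 0 thus ?case using R(2)[OF x x0] by simp
  next
    case (Suc j)
    have "avg (U (k - 1 - int (Suc j))) (avg (U (k - 1 - int j)) x) = avg (U (k - 1 - int (Suc j))) x"
      using U R(1)[OF x] by (intro avg_sub) auto
    thus ?case using R(2) Suc by (force simp: algebra_simps)
  qed
  obtain t where t: "avg (U t) x = 0" using sc R(1)[OF x] by blast
  define j where "j = nat (k - 1 - t)"
  have "avg (U (k - 1 - int j)) (avg (U t) x) = avg (U (k - 1 - int j)) x"
    using U R(1)[OF x] by (intro avg_sub) (auto simp: j_def)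
  thus False using t avg_0 U *[of j] by simp
qed

section \<open>Vectors fixed by congruence subgroups\<close>

definition eK :: "nat \<Rightarrow> 'v \<Rightarrow> 'v" where "eK m = avg (G \<inter> Kc m)"
definition VK :: "nat \<Rightarrow> 'v set" where "VK m = fx (G \<inter> Kc m)"

lemma cpt_GK: "1 \<le> m \<Longrightarrow> cpt (G \<inter> Kc m)"
  unfolding cpt_def using subgrp_Int[OF G subgrp_Kc[of m]] Kc_intm[of _ m] by blast
lemma subspace_VK: "subspace (VK m)" unfolding VK_def by (rule subspace_fx) blast
lemma VK_W: "x \<in> VK m \<Longrightarrow> x \<in> W" using fxW by (simp add: VK_def)
lemma smooth_VK: "x \<in> W \<Longrightarrow> \<exists>m\<ge>1. x \<in> VK m" using smooth[of x] unfolding VK_def fx_def by simp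
lemma normz_GK: "g \<in> G \<Longrightarrow> g \<in> Kmax v \<Longrightarrow> normz g (G \<inter> Kc m)"
  unfolding normz_def by (auto intro: GD Kc_normal Kc_normal')
lemma VK_Kmax: "x \<in> VK m \<Longrightarrow> g \<in> G \<Longrightarrow> g \<in> Kmax v \<Longrightarrow> \<pi> g x \<in> VK m"
  unfolding VK_def by (rule normz_fx[OF normz_GK]) auto
lemma eK_VK: "1 \<le> m \<Longrightarrow> x \<in> W \<Longrightarrow> eK m x \<in> VK m" unfolding eK_def VK_def by (rule avg_fx[OF cpt_GK])
lemma eK_id: "1 \<le> m \<Longrightarrow> x \<in> VK m \<Longrightarrow> eK m x = x" unfolding eK_def VK_def by (rule avg_id[OF cpt_GK])
lemma eK_lin: "1 \<le> m \<Longrightarrow> lin_on W (eK m)" unfolding eK_def by (rule avg_lin[OF cpt_GK])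
lemma eK_pi: "1 \<le> m \<Longrightarrow> k \<in> G \<Longrightarrow> k \<in> Kc m \<Longrightarrow> x \<in> W \<Longrightarrow> eK m (\<pi> k x) = eK m x"
  unfolding eK_def by (rule avg_pi[OF cpt_GK]) auto
lemma eK_Kmax: "1 \<le> m \<Longrightarrow> g \<in> G \<Longrightarrow> g \<in> Kmax v \<Longrightarrow> x \<in> W \<Longrightarrow> \<pi> g (eK m x) = eK m (\<pi> g x)"
  unfolding eK_def by (rule normz_avg[OF normz_GK cpt_GK])

text \<open>Irreducibility tested only on vectors of level \<open>n\<close>: the bounds are proved
  from this form, and \<open>irr_sub\<close> produces it inside spaces of functionals.\<close>

definition irr :: "nat \<Rightarrow> bool" where
  "irr n \<longleftrightarrow> (\<forall>x\<in>VK n. x \<noteq> 0 \<longrightarrow> W \<subseteq> span ((\<lambda>g. \<pi> g x) ` G))"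

end

section \<open>A dimension bound of Burnside type\<close>

context mrep begin

definition A :: "nat \<Rightarrow> 'f ^ 3 ^ 3 \<Rightarrow> 'v \<Rightarrow> 'v" where "A n g x = eK n (\<pi> g x)"

lemma A_VK: "1 \<le> n \<Longrightarrow> g \<in> G \<Longrightarrow> x \<in> W \<Longrightarrow> A n g x \<in> VK n"
  unfolding A_def by (intro eK_VK pi_W)

lemma A_lin: assumes "1 \<le> n" "g \<in> G" shows "lin_on W (A n g)"
  unfolding A_def by (rule lin_on_comp[OF eK_lin[OF assms(1)] pi_lin[OF assms(2)]]) (rule pi_W[OF assms(2)])

text \<open>The translates of \<open>x\<close> span \<open>W\<close>, and \<open>eK n\<close> maps
  \<open>W\<close> onto \<open>VK n\<close>.\<close>

lemma irr_span:
  assumes n: "1 \<le> n" "irr n" and x: "x \<in> VK n" "x \<noteq> 0"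
    and E: "subspace E" "\<And>g. g \<in> G \<Longrightarrow> A n g x \<in> E"
  shows "VK n \<subseteq> E"
proof
  fix y assume y: "y \<in> VK n"
  have xW: "x \<in> W" using x VK_W by blast
  have "y \<in> span ((\<lambda>g. \<pi> g x) ` G)" using n(2) x VK_W[OF y] unfolding irr_def by blast
  moreover have "subspace {y\<in>W. eK n y \<in> E}" by (rule subspace_pullback[OF eK_lin[OF n(1)] W E(1)])
  moreover have "(\<lambda>g. \<pi> g x) ` G \<subseteq> {y\<in>W. eK n y \<in> E}"
  proof
    fix z assume "z \<in> (\<lambda>g. \<pi> g x) ` G"
    then obtain g where g: "g \<in> G" "z = \<pi> g x" by blast
    show "z \<in> {y\<in>W. eK n y \<in> E}" using pi_W[OF g(1) xW] E(2)[OF g(1)] by (simp add: g(2) A_def)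
  qed
  ultimately have "y \<in> {y\<in>W. eK n y \<in> E}" using span_minimal by blast
  thus "y \<in> E" using eK_id[OF n(1) y] by simp
qed

text \<open>Finite dimension gives \<open>z\<close> an eigenvector in \<open>VK n\<close>. Its
  eigenspace in \<open>W\<close> is stable under \<open>G\<close>, since \<open>z\<close> is
  central, and therefore contains everything that the eigenvector generates.\<close>

lemma schur_scalar:
  assumes n: "1 \<le> n" "irr n" "fd (VK n)" and z: "z \<in> G" "\<And>g. g \<in> G \<Longrightarrow> z ** g = g ** z"
  shows "\<exists>c. \<forall>x\<in>VK n. \<pi> z x = c \<odot> x"
proof (cases "VK n \<subseteq> {0}")
  case True
  thus ?thesis using pi_0[OF z(1)] by (intro exI[of _ 0]) auto
next
  case False
  then obtain x0 where x0: "x0 \<in> VK n" "x0 \<noteq> 0" by blast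
  have zV: "\<pi> z x \<in> VK n" if x: "x \<in> VK n" for x
    unfolding VK_def
  proof (rule fxI)
    show "\<pi> z x \<in> W" using pi_W[OF z(1) VK_W[OF x]] .
    fix k assume k: "k \<in> G \<inter> Kc n"
    have "\<pi> k (\<pi> z x) = \<pi> (k ** z) x" using k z(1) VK_W[OF x] by (intro pi_mult[symmetric]) auto
    also have "\<dots> = \<pi> (z ** k) x" using z(2)[of k] k by simp
    also have "\<dots> = \<pi> z (\<pi> k x)" using k z(1) VK_W[OF x] by (intro pi_mult) auto
    finally show "\<pi> k (\<pi> z x) = \<pi> z x" using x k by (simp add: VK_def fx_def)
  qed
  have zl: "lin_on (VK n) (\<pi> z)" using lin_on_subset[OF pi_lin[OF z(1)]] VK_W by blast
  obtain c x where x: "x \<in> VK n" "x \<noteq> 0" "\<pi> z x = c \<odot> x"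
    using eigenvector[OF subspace_VK zl zV n(3) x0] by blast
  define E where "E = {y\<in>W. \<pi> z y = c \<odot> y}"
  have E: "subspace E" unfolding E_def by (rule subspace_eigenspace[OF pi_lin[OF z(1)] W])
  have xW: "x \<in> W" using VK_W x by blast
  have gE: "\<pi> g x \<in> E" if g: "g \<in> G" for g
  proof -
    have "\<pi> z (\<pi> g x) = \<pi> (z ** g) x" by (rule pi_mult[symmetric, OF z(1) g xW])
    also have "\<dots> = \<pi> g (\<pi> z x)" unfolding z(2)[OF g] by (rule pi_mult[OF g z(1) xW])
    also have "\<dots> = c \<odot> \<pi> g x" unfolding x(3) by (rule pi_scale[OF g xW])
    finally show ?thesis using pi_W[OF g xW] by (simp add: E_def)
  qed
  hence "span ((\<lambda>g. \<pi> g x) ` G) \<subseteq> E" by (intro span_minimal E) auto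
  moreover have "W \<subseteq> span ((\<lambda>g. \<pi> g x) ` G)" using n(2) x by (simp add: irr_def)
  ultimately have "\<forall>y\<in>VK n. \<pi> z y = c \<odot> y" using VK_W by (auto simp: E_def)
  thus ?thesis by blast
qed

text \<open>The product rule of the Hecke algebra: the projection between \<open>g\<close> and
  \<open>h\<close> becomes a finite mean over elements \<open>s\<close>, once a finite set of
  vectors is fixed.\<close>

lemma A_A:
  assumes n: "1 \<le> n" and Y: "finite Y" "Y \<subseteq> W" and g: "g \<in> G" and h: "h \<in> G"
  shows "\<exists>S. finite S \<and> S \<subseteq> G \<and> (\<forall>y\<in>Y. A n g (A n h y) = (\<Sum>s\<in>S. inverse (of_nat (card S)) \<odot> A n (g ** s ** h) y))"
proof -
  have Y': "finite (\<pi> h ` Y)" "\<pi> h ` Y \<subseteq> W" using Y pi_W[OF h] by auto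
  from avg_transversal[OF cpt_GK[OF n] Y'] obtain S where S: "finite S" "S \<subseteq> G \<inter> Kc n"
    "\<forall>y\<in>\<pi> h ` Y. avg (G \<inter> Kc n) y = inverse (of_nat (card S)) \<odot> (\<Sum>s\<in>S. \<pi> s y)" by blast
  have "A n g (A n h y) = (\<Sum>s\<in>S. inverse (of_nat (card S)) \<odot> A n (g ** s ** h) y)" if y: "y \<in> Y" for y
  proof -
    have hy: "\<pi> h y \<in> W" using Y' y by blast
    have sy: "\<pi> s (\<pi> h y) \<in> W" if "s \<in> S" for s using that S(2) pi_W[OF _ hy] by blast
    have "A n h y = (\<Sum>s\<in>S. inverse (of_nat (card S)) \<odot> \<pi> s (\<pi> h y))"
      using S(3) y by (simp add: A_def eK_def scale_sum_right)
    hence "A n g (A n h y) = (\<Sum>s\<in>S. inverse (of_nat (card S)) \<odot> A n g (\<pi> s (\<pi> h y)))"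
      using lin_on_sum[OF A_lin[OF n g] W, of S "\<lambda>s. \<pi> s (\<pi> h y)", OF sy] by simp
    also have "\<dots> = (\<Sum>s\<in>S. inverse (of_nat (card S)) \<odot> A n (g ** s ** h) y)"
    proof (rule sum.cong[OF refl])
      fix s assume "s \<in> S"
      hence s: "s \<in> G" using S(2) by blast
      have yW: "y \<in> W" using Y y by blast
      have "\<pi> (g ** s ** h) y = \<pi> (g ** s) (\<pi> h y)" by (rule pi_mult[OF GD(3)[OF g s] h yW])
      also have "\<dots> = \<pi> g (\<pi> s (\<pi> h y))" by (rule pi_mult[OF g s hy])
      finally show "inverse (of_nat (card S)) \<odot> A n g (\<pi> s (\<pi> h y)) = inverse (of_nat (card S)) \<odot> A n (g ** s ** h) y"
        by (simp add: A_def)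
    qed
    finally show ?thesis .
  qed
  thus ?thesis using S by blast
qed

text \<open>The density argument behind Burnside's theorem. Families satisfying the relations form a
  space \<open>R\<close> stable under all \<open>A n h\<close>. In a family of minimal support each
  coordinate is determined by the one at \<open>b0\<close>, compatibly with the operators, hence is
  a scalar multiple of it. The relations then collapse to one functional \<open>\<Xi>\<close> that
  kills \<open>VK n\<close>, although its value at \<open>b0\<close> is not 0.\<close>

lemma burnside_aux:
  assumes n: "1 \<le> n" "irr n" "fd (VK n)"
    and B: "B \<subseteq> VK n" "finite B" "b1 \<in> B"
    and \<xi>: "\<And>b. b \<in> B \<Longrightarrow> fun_on (VK n) (\<xi> b)" "\<And>b b'. b \<in> B \<Longrightarrow> b' \<in> B \<Longrightarrow> \<xi> b b' = (if b = b' then 1 else 0)"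
    and z: "\<And>b. b \<in> B \<Longrightarrow> z b \<in> VK n" "\<And>g. g \<in> G \<Longrightarrow> (\<Sum>b\<in>B. \<xi> b (A n g (z b))) = 0"
  shows "z b1 = 0"
proof (rule ccontr)
  assume z1: "z b1 \<noteq> 0"
  let ?V = "VK n"
  have VW: "?V \<subseteq> W" using VK_W by blast
  note sV = subspace_VK[of n]
  define R where "R = {w. (\<forall>b\<in>B. w b \<in> ?V) \<and> (\<forall>g\<in>G. (\<Sum>b\<in>B. \<xi> b (A n g (w b))) = 0)}"
  define sp where "sp = (\<lambda>w::'v \<Rightarrow> 'v. {b\<in>B. w b \<noteq> 0})"
  have AV: "A n g x \<in> ?V" if "g \<in> G" "x \<in> ?V" for g x using A_VK[OF n(1) that(1)] that(2) VW by blast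
  have Aadd: "A n g (x + y) = A n g x + A n g y" if "g \<in> G" "x \<in> ?V" "y \<in> ?V" for g x y
    using A_lin[OF n(1) that(1)] that VW unfolding lin_on_def by blast
  have Asc: "A n g (c \<odot> x) = c \<odot> A n g x" if "g \<in> G" "x \<in> ?V" for g c x
    using A_lin[OF n(1) that(1)] that VW unfolding lin_on_def by blast
  have xadd: "\<xi> b (x + y) = \<xi> b x + \<xi> b y" if "b \<in> B" "x \<in> ?V" "y \<in> ?V" for b x y
    using \<xi>(1)[OF that(1)] that unfolding fun_on_def by blast
  have xsc: "\<xi> b (c \<odot> x) = c * \<xi> b x" if "b \<in> B" "x \<in> ?V" for b c x
    using \<xi>(1)[OF that(1)] that unfolding fun_on_def by blast
  have Radd: "(\<lambda>b. w b + w' b) \<in> R" if w: "w \<in> R" "w' \<in> R" for w w'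
  proof -
    have "(\<Sum>b\<in>B. \<xi> b (A n g (w b + w' b))) = 0" if g: "g \<in> G" for g
    proof -
      have "(\<Sum>b\<in>B. \<xi> b (A n g (w b + w' b))) = (\<Sum>b\<in>B. \<xi> b (A n g (w b)) + \<xi> b (A n g (w' b)))"
        by (rule sum.cong[OF refl]) (use w g in \<open>simp add: R_def Aadd xadd AV\<close>)
      thus ?thesis using w g by (simp add: R_def sum.distrib)
    qed
    thus ?thesis using w subspace_add[OF sV] by (simp add: R_def)
  qed
  have Rsc: "(\<lambda>b. c \<odot> w b) \<in> R" if w: "w \<in> R" for c w
  proof -
    have "(\<Sum>b\<in>B. \<xi> b (A n g (c \<odot> w b))) = 0" if g: "g \<in> G" for g
    proof -
      have "(\<Sum>b\<in>B. \<xi> b (A n g (c \<odot> w b))) = (\<Sum>b\<in>B. c * \<xi> b (A n g (w b)))"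
        by (rule sum.cong[OF refl]) (use w g in \<open>simp add: R_def Asc xsc AV\<close>)
      thus ?thesis using w g by (simp add: R_def sum_distrib_left[symmetric])
    qed
    thus ?thesis using w subspace_scale[OF sV] by (simp add: R_def)
  qed
  have RA: "(\<lambda>b. A n h (w b)) \<in> R" if w: "w \<in> R" and h: "h \<in> G" for w h
  proof -
    have wV: "w b \<in> ?V" if "b \<in> B" for b using w that by (simp add: R_def)
    have "(\<Sum>b\<in>B. \<xi> b (A n g (A n h (w b)))) = 0" if g: "g \<in> G" for g
    proof -
      have "finite (w ` B)" "w ` B \<subseteq> W" using B(2) wV VW by auto
      from A_A[OF n(1) this g h] obtain S where S: "finite S" "S \<subseteq> G"
        "\<forall>y\<in>w ` B. A n g (A n h y) = (\<Sum>s\<in>S. inverse (of_nat (card S)) \<odot> A n (g ** s ** h) y)" by blast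
      have gs: "g ** s ** h \<in> G" if "s \<in> S" for s using that S(2) GD(3) g h by blast
      have "(\<Sum>b\<in>B. \<xi> b (A n g (A n h (w b)))) = (\<Sum>b\<in>B. \<Sum>s\<in>S. inverse (of_nat (card S)) * \<xi> b (A n (g ** s ** h) (w b)))"
      proof (rule sum.cong[OF refl])
        fix b assume b: "b \<in> B"
        have "A n g (A n h (w b)) = (\<Sum>s\<in>S. inverse (of_nat (card S)) \<odot> A n (g ** s ** h) (w b))" using S(3) b by blast
        thus "\<xi> b (A n g (A n h (w b))) = (\<Sum>s\<in>S. inverse (of_nat (card S)) * \<xi> b (A n (g ** s ** h) (w b)))"
          using fun_on_sum[OF \<xi>(1)[OF b] sV, of S "\<lambda>s. A n (g ** s ** h) (w b)" "\<lambda>_. inverse (of_nat (card S))"]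
            AV[OF gs wV[OF b]] by simp
      qed
      also have "\<dots> = (\<Sum>s\<in>S. inverse (of_nat (card S)) * (\<Sum>b\<in>B. \<xi> b (A n (g ** s ** h) (w b))))"
        by (subst sum.swap) (simp add: sum_distrib_left)
      also have "\<dots> = 0"
      proof (rule sum.neutral, rule ballI)
        fix s assume "s \<in> S"
        hence "(\<Sum>b\<in>B. \<xi> b (A n (g ** s ** h) (w b))) = 0" using w gs by (simp add: R_def)
        thus "inverse (of_nat (card S)) * (\<Sum>b\<in>B. \<xi> b (A n (g ** s ** h) (w b))) = 0" by simp
      qed
      finally show ?thesis .
    qed
    thus ?thesis using AV[OF h wV] by (simp add: R_def)
  qed
  let ?Q = "\<lambda>k. \<exists>w\<in>R. sp w \<noteq> {} \<and> card (sp w) = k"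
  have "z \<in> R" "sp z \<noteq> {}" using z z1 B(3) by (auto simp: R_def sp_def)
  hence "?Q (card (sp z))" by blast
  then obtain k where k: "?Q k" "\<And>m. m < k \<Longrightarrow> \<not> ?Q m" using exists_least_iff[of ?Q] by blast
  then obtain w where w: "w \<in> R" "sp w \<noteq> {}" "card (sp w) = k" by blast
  then obtain b0 where b0: "b0 \<in> B" "w b0 \<noteq> 0" by (auto simp: sp_def)
  define R0 where "R0 = {w'\<in>R. sp w' \<subseteq> sp w}"
  have wR0: "w \<in> R0" using w by (simp add: R0_def)
  have R0V: "w' b \<in> ?V" if "w' \<in> R0" "b \<in> B" for w' b using that by (simp add: R0_def R_def)
  have R0add: "(\<lambda>b. w' b + w'' b) \<in> R0" if "w' \<in> R0" "w'' \<in> R0" for w' w''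
  proof -
    have "sp (\<lambda>b. w' b + w'' b) \<subseteq> sp w' \<union> sp w''" by (auto simp: sp_def)
    thus ?thesis using that Radd[of w' w''] unfolding R0_def by blast
  qed
  have R0sc: "(\<lambda>b. c \<odot> w' b) \<in> R0" if "w' \<in> R0" for c w'
    using that Rsc by (auto simp: R0_def sp_def)
  have A0: "A n h 0 = 0" if "h \<in> G" for h using lin_on_0[OF A_lin[OF n(1) that] W] .
  have R0A: "(\<lambda>b. A n h (w' b)) \<in> R0" if "w' \<in> R0" "h \<in> G" for h w'
    using that RA A0 by (auto simp: R0_def sp_def)
  \<comment> \<open>A nonzero family of \<open>R0\<close> that vanishes at \<open>b0\<close> would
    have strictly smaller support than \<open>w\<close>.\<close>
  have inj0: "w' b = 0" if w': "w' \<in> R0" "w' b0 = 0" and b: "b \<in> B" for w' b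
  proof (rule ccontr)
    assume "w' b \<noteq> 0"
    hence ne: "sp w' \<noteq> {}" using b by (auto simp: sp_def)
    have "sp w' \<subset> sp w" using w' b0 by (auto simp: R0_def sp_def)
    hence "card (sp w') < k" using w(3) B(2) by (auto simp: sp_def intro!: psubset_card_mono)
    thus False using k(2) ne w' by (auto simp: R0_def)
  qed
  have uniq: "w' b = w'' b" if "w' \<in> R0" "w'' \<in> R0" "w' b0 = w'' b0" "b \<in> B" for w' w'' b
  proof -
    have "(\<lambda>b. w' b + (- 1) \<odot> w'' b) \<in> R0" using R0add[OF that(1) R0sc[OF that(2)]] .
    from inj0[OF this _ that(4)] show ?thesis using that(3) by simp
  qed
  define E where "E = (\<lambda>w'. w' b0) ` R0"
  have "subspace E"
  proof (rule subspaceI)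
    show "0 \<in> E" unfolding E_def by (rule image_eqI[OF _ R0sc[OF wR0, of 0]]) simp
    show "x + y \<in> E" if "x \<in> E" "y \<in> E" for x y using that R0add by (auto simp: E_def)
    show "c \<odot> x \<in> E" if "x \<in> E" for c x using that R0sc by (auto simp: E_def)
  qed
  moreover have "A n g (w b0) \<in> E" if "g \<in> G" for g using R0A[OF wR0 that] by (auto simp: E_def)
  ultimately have VE: "?V \<subseteq> E" using irr_span[OF n(1,2) R0V[OF wR0 b0(1)] b0(2)] by blast
  have ex: "\<exists>w'\<in>R0. w' b0 = y" if "y \<in> ?V" for y using that VE by (auto simp: E_def)
  \<comment> \<open>Evaluation at \<open>b0\<close> is onto, and injective up to values off
    \<open>B\<close>; \<open>lift\<close> picks a preimage.\<close>
  define lift where "lift = (\<lambda>y. SOME w'. w' \<in> R0 \<and> w' b0 = y)"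
  have lift: "lift y \<in> R0" "lift y b0 = y" if "y \<in> ?V" for y
  proof -
    have "\<exists>w'. w' \<in> R0 \<and> w' b0 = y" using ex[OF that] by blast
    hence "lift y \<in> R0 \<and> lift y b0 = y" unfolding lift_def by (rule someI_ex)
    thus "lift y \<in> R0" "lift y b0 = y" by auto
  qed
  have scal: "\<exists>c. \<forall>y\<in>?V. lift y b = c \<odot> y" if b: "b \<in> B" for b
  proof -
    define f where "f = (\<lambda>y. lift y b)"
    have fV: "f y \<in> ?V" if "y \<in> ?V" for y using R0V[OF lift(1)[OF that] b] by (simp add: f_def)
    have fl: "lin_on ?V f" unfolding lin_on_def f_def
    proof (intro conjI ballI allI)
      fix x y assume xy: "x \<in> ?V" "y \<in> ?V"
      show "lift (x + y) b = lift x b + lift y b"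
        using uniq[OF lift(1)[OF subspace_add[OF sV xy]] R0add[OF lift(1)[OF xy(1)] lift(1)[OF xy(2)]] _ b]
          lift(2) xy subspace_add[OF sV xy] by simp
    next
      fix c x assume x: "x \<in> ?V"
      show "lift (c \<odot> x) b = c \<odot> lift x b"
        using uniq[OF lift(1)[OF subspace_scale[OF sV x]] R0sc[OF lift(1)[OF x]] _ b]
          lift(2) x subspace_scale[OF sV x] by simp
    qed
    obtain c y0 where y0: "y0 \<in> ?V" "y0 \<noteq> 0" "f y0 = c \<odot> y0"
      using eigenvector[OF sV fl fV n(3) R0V[OF wR0 b0(1)] b0(2)] by blast
    define E' where "E' = {y\<in>?V. f y = c \<odot> y}"
    have "subspace E'" unfolding E'_def by (rule subspace_eigenspace[OF fl sV])
    moreover have "A n g y0 \<in> E'" if g: "g \<in> G" for g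
    proof -
      have "lift (A n g y0) b = A n g (lift y0 b)"
        by (rule uniq[OF lift(1)[OF AV[OF g y0(1)]] R0A[OF lift(1)[OF y0(1)] g] _ b])
          (simp only: lift(2)[OF AV[OF g y0(1)]] lift(2)[OF y0(1)])
      also have "\<dots> = c \<odot> A n g y0" using y0 Asc[OF g] by (simp add: f_def)
      finally show ?thesis using AV[OF g y0(1)] by (simp add: E'_def f_def)
    qed
    ultimately have "?V \<subseteq> E'" using irr_span[OF n(1,2) y0(1,2)] by blast
    thus ?thesis by (auto simp: E'_def f_def)
  qed
  then obtain c where c: "\<And>b y. b \<in> B \<Longrightarrow> y \<in> ?V \<Longrightarrow> lift y b = c b \<odot> y" by metis
  let ?y = "w b0"
  have yV: "?y \<in> ?V" using R0V[OF wR0 b0(1)] .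
  have wc: "w b = c b \<odot> ?y" if "b \<in> B" for b
    using uniq[OF wR0 lift(1)[OF yV] _ that] lift(2)[OF yV] c[OF that yV] by simp
  define \<Xi> where "\<Xi> = (\<lambda>x. \<Sum>b\<in>B. c b * \<xi> b x)"
  have "subspace {x\<in>?V. \<Xi> x = 0}" unfolding \<Xi>_def by (rule subspace_kernel[OF fun_on_lincomb[OF \<xi>(1)] sV])
  moreover have "A n g ?y \<in> {x\<in>?V. \<Xi> x = 0}" if g: "g \<in> G" for g
  proof -
    have "\<Xi> (A n g ?y) = (\<Sum>b\<in>B. \<xi> b (A n g (w b)))"
      unfolding \<Xi>_def
    proof (rule sum.cong[OF refl])
      fix b assume b: "b \<in> B"
      show "c b * \<xi> b (A n g ?y) = \<xi> b (A n g (w b))"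
        unfolding wc[OF b] Asc[OF g yV] xsc[OF b AV[OF g yV]] ..
    qed
    also have "\<dots> = 0" using w(1) g by (simp add: R_def)
    finally show ?thesis using AV[OF g yV] by simp
  qed
  ultimately have "?V \<subseteq> {x\<in>?V. \<Xi> x = 0}" by (rule irr_span[OF n(1,2) yV b0(2)])
  hence "\<Xi> b0 = 0" using B(1) b0(1) by blast
  moreover have "\<Xi> b0 = c b0"
  proof -
    have "\<Xi> b0 = (\<Sum>b\<in>B. if b = b0 then c b0 else 0)"
      unfolding \<Xi>_def by (rule sum.cong[OF refl]) (use \<xi>(2) b0(1) in auto)
    thus ?thesis using B(2) b0(1) by simp
  qed
  ultimately show False using wc[OF b0(1)] b0(2) by simp
qed

text \<open>With fewer than (dim)^2 elements in \<open>\<Omega>\<close>, some nonzero linear form on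
  matrices vanishes on all \<open>A n \<omega>\<close>, hence by \<open>cover\<close> on all
  \<open>A n g\<close>. Read row by row it is a relation excluded by
  \<open>burnside_aux\<close>.\<close>

theorem burnside_count:
  assumes n: "1 \<le> n" "irr n" "fd (VK n)" and \<Omega>: "finite \<Omega>" "\<Omega> \<subseteq> G"
    and cover: "\<And>g. g \<in> G \<Longrightarrow> (\<forall>x\<in>VK n. A n g x = 0) \<or> (\<exists>\<omega>\<in>\<Omega>. \<exists>c. \<forall>x\<in>VK n. A n g x = c \<odot> A n \<omega> x)"
  shows "(dim (VK n))\<^sup>2 \<le> card \<Omega>"
proof (rule ccontr)
  assume neg: "\<not> ?thesis"
  let ?V = "VK n"
  note sV = subspace_VK[of n]
  have VW: "?V \<subseteq> W" using VK_W by blast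
  obtain B where B: "B \<subseteq> ?V" "independent B" "?V \<subseteq> span B" "finite B" "card B = dim ?V"
    using fd_basis[OF n(3)] by metis
  define \<xi> where "\<xi> = (\<lambda>b x. representation B x b)"
  have x1: "fun_on ?V (\<xi> b)" for b
    unfolding fun_on_def \<xi>_def
    by (auto simp: representation_add[OF B(2)] representation_scale[OF B(2)] subsetD[OF B(3)])
  have x2: "\<xi> b b' = (if b = b' then 1 else 0)" if "b' \<in> B" for b b'
    using representation_basis[OF B(2) that] by (simp add: \<xi>_def)
  have "card \<Omega> < card (B \<times> B)" using neg B by (simp add: card_cartesian_product power2_eq_square)
  from homogeneous_system[OF \<Omega>(1) _ this, of "\<lambda>\<omega> p. \<xi> (fst p) (A n \<omega> (snd p))"] B(4)
  obtain c where c: "\<exists>p\<in>B \<times> B. c p \<noteq> 0" "\<forall>\<omega>\<in>\<Omega>. (\<Sum>p\<in>B \<times> B. \<xi> (fst p) (A n \<omega> (snd p)) * c p) = 0" by auto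
  define z where "z = (\<lambda>b. \<Sum>b'\<in>B. c (b, b') \<odot> b')"
  have zV: "z b \<in> ?V" for b unfolding z_def using B(1) by (intro subspace_sum subspace_scale sV) auto
  have zeq: "(\<Sum>b\<in>B. \<xi> b (A n g (z b))) = (\<Sum>p\<in>B \<times> B. \<xi> (fst p) (A n g (snd p)) * c p)" if g: "g \<in> G" for g
  proof -
    have "\<xi> b (A n g (z b)) = (\<Sum>b'\<in>B. \<xi> b (A n g b') * c (b, b'))" for b
    proof -
      have bW: "b' \<in> W" if "b' \<in> B" for b' using that B(1) VW by blast
      have "A n g (z b) = (\<Sum>b'\<in>B. c (b, b') \<odot> A n g b')"
        unfolding z_def by (rule lin_on_sum[OF A_lin[OF n(1) g] W bW])
      also have "\<xi> b \<dots> = (\<Sum>b'\<in>B. c (b, b') * \<xi> b (A n g b'))"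
        by (rule fun_on_sum[OF x1 sV]) (rule A_VK[OF n(1) g bW])
      finally show ?thesis by (simp add: mult.commute)
    qed
    thus ?thesis by (simp add: sum.cartesian_product case_prod_unfold)
  qed
  have Z: "(\<Sum>b\<in>B. \<xi> b (A n g (z b))) = 0" if g: "g \<in> G" for g
    using cover[OF g]
  proof
    assume "\<forall>x\<in>?V. A n g x = 0"
    thus ?thesis using zV fun_on_0[OF x1 sV] by simp
  next
    assume "\<exists>\<omega>\<in>\<Omega>. \<exists>d. \<forall>x\<in>?V. A n g x = d \<odot> A n \<omega> x"
    then obtain \<omega> d where w: "\<omega> \<in> \<Omega>" "\<And>x. x \<in> ?V \<Longrightarrow> A n g x = d \<odot> A n \<omega> x" by blast
    have wG: "\<omega> \<in> G" using w \<Omega> by blast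
    have "(\<Sum>b\<in>B. \<xi> b (A n g (z b))) = (\<Sum>b\<in>B. d * \<xi> b (A n \<omega> (z b)))"
    proof (rule sum.cong[OF refl])
      fix b assume b: "b \<in> B"
      have "A n \<omega> (z b) \<in> ?V" using A_VK[OF n(1) wG] zV VW by blast
      thus "\<xi> b (A n g (z b)) = d * \<xi> b (A n \<omega> (z b))"
        unfolding w(2)[OF zV] using x1[of b] unfolding fun_on_def by blast
    qed
    also have "\<dots> = d * (\<Sum>b\<in>B. \<xi> b (A n \<omega> (z b)))" by (simp add: sum_distrib_left)
    also have "\<dots> = 0" using c(2) w(1) zeq[OF wG] by simp
    finally show ?thesis .
  qed
  obtain b1 b2 where b: "b1 \<in> B" "b2 \<in> B" "c (b1, b2) \<noteq> 0" using c(1) by auto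
  have "z b1 = 0" by (rule burnside_aux[OF n B(1,4) b(1) x1 x2 zV Z]) auto
  moreover have "\<xi> b2 (z b1) = c (b1, b2)"
  proof -
    have "\<xi> b2 (z b1) = (\<Sum>b'\<in>B. c (b1, b') * \<xi> b2 b')"
      unfolding z_def by (rule fun_on_sum[OF x1 sV]) (use B in blast)
    also have "\<dots> = (\<Sum>b'\<in>B. if b' = b2 then c (b1, b2) else 0)"
      by (rule sum.cong[OF refl]) (use x2 in auto)
    finally show ?thesis using b B(4) by simp
  qed
  ultimately show False using b(3) fun_on_0[OF x1 sV] by simp
qed

end

section \<open>Root subgroups and the rank one step\<close>

context dvf begin

abbreviation Tu :: "'f set" where "Tu \<equiv> Tm \<inter> un"

lemma Tm_split: obtains c0 where "c0 \<in> Tm" "c0 \<in> P 1" "Tm = insert c0 Tu" "c0 \<notin> Tu"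
proof -
  obtain c0 where c0: "c0 \<in> Tm" "c0 \<in> P 1" using Tm_ex[of 0] by auto
  have "c = c0" if "c \<in> Tm" "c \<notin> un" for c
    using that c0 Tm_uniq[OF that(1) c0(1)] P_diff[of c 1 c0] Tm_P un_iff by blast
  moreover have "c0 \<notin> Tu" using c0 un_iff by blast
  ultimately show thesis using that c0 by blast
qed

lemma Tu_finite: "finite Tu" using Tm_finite by blast

text \<open>The map induced by \<open>g\<close> on the finite set of unit classes is injective,
  hence a permutation, and \<open>F\<close> depends only on the class.\<close>

lemma Tu_reindex:
  assumes F: "\<And>u u'. u \<in> un \<Longrightarrow> u' \<in> un \<Longrightarrow> u - u' \<in> P 1 \<Longrightarrow> F u = F u'"
    and g: "\<And>u. u \<in> un \<Longrightarrow> g u \<in> un" "\<And>u u'. u \<in> un \<Longrightarrow> u' \<in> un \<Longrightarrow> g u - g u' \<in> P 1 \<Longrightarrow> u - u' \<in> P 1"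
  shows "(\<Sum>c\<in>Tu. F (g c)) = (\<Sum>c\<in>Tu. (F c :: 'b::comm_monoid_add))"
proof -
  have ex: "\<exists>d\<in>Tu. g c - d \<in> P 1" if c: "c \<in> Tu" for c
  proof -
    have gc: "g c \<in> un" using g(1) c by blast
    obtain d where d: "d \<in> Tm" "g c - d \<in> P 1" using Tm_ex un_P gc by blast
    have "- (g c - d) \<in> P 1" using d(2) by (simp only: P_minus)
    hence "g c + - (g c - d) \<in> un" by (rule un_add[OF gc])
    thus ?thesis using d by (intro bexI[of _ d]) auto
  qed
  then obtain s where s: "\<And>c. c \<in> Tu \<Longrightarrow> s c \<in> Tu" "\<And>c. c \<in> Tu \<Longrightarrow> g c - s c \<in> P 1" by metis
  have inj: "inj_on s Tu"
  proof (rule inj_onI)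
    fix c d assume cd: "c \<in> Tu" "d \<in> Tu" "s c = s d"
    have "(g c - s c) - (g d - s d) \<in> P 1" by (rule P_diff[OF s(2)[OF cd(1)] s(2)[OF cd(2)]])
    hence "g c - g d \<in> P 1" using cd(3) by simp
    hence "c - d \<in> P 1" using g(2) cd by blast
    thus "c = d" using Tm_uniq cd by blast
  qed
  have "s ` Tu = Tu" by (rule endo_inj_surj[OF Tu_finite _ inj]) (use s(1) in blast)
  hence "(\<Sum>c\<in>Tu. F c) = (\<Sum>c\<in>Tu. F (s c))" using sum.reindex[OF inj, of F] by simp
  also have "\<dots> = (\<Sum>c\<in>Tu. F (g c))"
    by (rule sum.cong[OF refl], rule F[symmetric]) (use g(1) s in auto)
  finally show ?thesis by simp
qed

text \<open>A 2 by 2 block placed in a 3 by 3 matrix and described by its entries, so that every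
  identity in SL_2 transfers by comparing four entries. The last clause bounds the matrix by its
  entries, which makes root groups bounded.\<close>

definition sl2emb :: "('f \<Rightarrow> 'f \<Rightarrow> 'f \<Rightarrow> 'f \<Rightarrow> 'f ^ 3 ^ 3) \<Rightarrow> bool" where
  "sl2emb \<phi> \<longleftrightarrow> (\<forall>a b c d a' b' c' d'. \<phi> a b c d ** \<phi> a' b' c' d' = \<phi> (a*a' + b*c') (a*b' + b*d') (c*a' + d*c') (c*b' + d*d'))
    \<and> \<phi> 1 0 0 1 = mat 1 \<and> (\<forall>a b c d. a*d - b*c = 1 \<longrightarrow> \<phi> a b c d \<in> GL3)
    \<and> (\<forall>a b c d k. k \<le> 0 \<longrightarrow> a \<in> P k \<longrightarrow> b \<in> P k \<longrightarrow> c \<in> P k \<longrightarrow> d \<in> P k \<longrightarrow> \<phi> a b c d \<in> intm k)"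

definition f12 :: "'f \<Rightarrow> 'f \<Rightarrow> 'f \<Rightarrow> 'f \<Rightarrow> 'f ^ 3 ^ 3" where "f12 a b c d = mat3 a b 0 c d 0 0 0 1"
definition f13 :: "'f \<Rightarrow> 'f \<Rightarrow> 'f \<Rightarrow> 'f \<Rightarrow> 'f ^ 3 ^ 3" where "f13 a b c d = mat3 a 0 b 0 1 0 c 0 d"
definition f23 :: "'f \<Rightarrow> 'f \<Rightarrow> 'f \<Rightarrow> 'f \<Rightarrow> 'f ^ 3 ^ 3" where "f23 a b c d = mat3 1 0 0 0 a b 0 c d"

lemma sl2emb_f: "sl2emb f12" "sl2emb f13" "sl2emb f23"
  unfolding sl2emb_def f12_def f13_def f23_def
  by (auto simp: mat3_mult mat3_1 GL3_def mat3_det intm_mat3 algebra_simps)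

text \<open>\<open>Xp\<close>, \<open>Xm\<close> and \<open>Hh\<close> are the depth filtrations of
  the positive root group, the negative root group and the coroot torus.\<close>

definition Xp :: "('f \<Rightarrow> 'f \<Rightarrow> 'f \<Rightarrow> 'f \<Rightarrow> 'f ^ 3 ^ 3) \<Rightarrow> int \<Rightarrow> ('f ^ 3 ^ 3) set" where "Xp \<phi> f = (\<lambda>r. \<phi> 1 r 0 1) ` P f"
definition Xm :: "('f \<Rightarrow> 'f \<Rightarrow> 'f \<Rightarrow> 'f \<Rightarrow> 'f ^ 3 ^ 3) \<Rightarrow> int \<Rightarrow> ('f ^ 3 ^ 3) set" where "Xm \<phi> f = (\<lambda>r. \<phi> 1 0 r 1) ` P f"
definition Hh :: "('f \<Rightarrow> 'f \<Rightarrow> 'f \<Rightarrow> 'f \<Rightarrow> 'f ^ 3 ^ 3) \<Rightarrow> int \<Rightarrow> ('f ^ 3 ^ 3) set" where "Hh \<phi> n = (\<lambda>u. \<phi> u 0 0 (1/u)) ` O1 n"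

context
  fixes \<phi> assumes \<phi>: "sl2emb \<phi>"
begin

lemma phi_mult: "\<phi> a b c d ** \<phi> a' b' c' d' = \<phi> (a*a' + b*c') (a*b' + b*d') (c*a' + d*c') (c*b' + d*d')"
  using \<phi> unfolding sl2emb_def by blast
lemma phi_1: "\<phi> 1 0 0 1 = mat 1" using \<phi> unfolding sl2emb_def by blast
lemma phi_GL3: "a*d - b*c = 1 \<Longrightarrow> \<phi> a b c d \<in> GL3" using \<phi> unfolding sl2emb_def by blast
lemma phi_intm: "k \<le> 0 \<Longrightarrow> a \<in> P k \<Longrightarrow> b \<in> P k \<Longrightarrow> c \<in> P k \<Longrightarrow> d \<in> P k \<Longrightarrow> \<phi> a b c d \<in> intm k"
  using \<phi> unfolding sl2emb_def by blast
lemma phi_inv: assumes "a*d - b*c = 1" shows "inv3 (\<phi> a b c d) = \<phi> d (-b) (-c) a"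
proof (rule inv3_unique)
  have "\<phi> a b c d ** \<phi> d (-b) (-c) a = \<phi> (a*d - b*c) 0 0 (a*d - b*c)"
    unfolding phi_mult by (simp add: algebra_simps)
  thus "\<phi> a b c d ** \<phi> d (-b) (-c) a = mat 1" using assms phi_1 by simp
qed

lemma subgrp_Xp: "subgrp (Xp \<phi> f)" and subgrp_Xm: "subgrp (Xm \<phi> f)"
proof -
  show "subgrp (Xp \<phi> f)" unfolding subgrp_def Xp_def
  proof (intro conjI ballI)
    show "(\<lambda>r. \<phi> 1 r 0 1) ` P f \<subseteq> GL3" using phi_GL3[of 1 1 _ 0] by auto
    show "mat 1 \<in> (\<lambda>r. \<phi> 1 r 0 1) ` P f" by (rule image_eqI[where x = 0]) (simp_all add: phi_1)
    show "g ** h \<in> (\<lambda>r. \<phi> 1 r 0 1) ` P f" if "g \<in> (\<lambda>r. \<phi> 1 r 0 1) ` P f" "h \<in> (\<lambda>r. \<phi> 1 r 0 1) ` P f" for g h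
      using that by (auto simp: phi_mult intro!: imageI P_add)
    show "inv3 g \<in> (\<lambda>r. \<phi> 1 r 0 1) ` P f" if "g \<in> (\<lambda>r. \<phi> 1 r 0 1) ` P f" for g
      using that by (auto simp: phi_inv intro!: imageI)
  qed
  show "subgrp (Xm \<phi> f)" unfolding subgrp_def Xm_def
  proof (intro conjI ballI)
    show "(\<lambda>r. \<phi> 1 0 r 1) ` P f \<subseteq> GL3" using phi_GL3[of 1 1 0] by auto
    show "mat 1 \<in> (\<lambda>r. \<phi> 1 0 r 1) ` P f" by (rule image_eqI[where x = 0]) (simp_all add: phi_1)
    show "g ** h \<in> (\<lambda>r. \<phi> 1 0 r 1) ` P f" if "g \<in> (\<lambda>r. \<phi> 1 0 r 1) ` P f" "h \<in> (\<lambda>r. \<phi> 1 0 r 1) ` P f" for g h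
      using that by (auto simp: phi_mult intro!: imageI P_add)
    show "inv3 g \<in> (\<lambda>r. \<phi> 1 0 r 1) ` P f" if "g \<in> (\<lambda>r. \<phi> 1 0 r 1) ` P f" for g
      using that by (auto simp: phi_inv intro!: imageI)
  qed
qed

lemma subgrp_Hh: assumes "1 \<le> n" shows "subgrp (Hh \<phi> n)"
  unfolding subgrp_def Hh_def
proof (intro conjI ballI)
  have nz: "u \<noteq> 0" if "u \<in> O1 n" for u using O1_un[OF that assms] un_nz by blast
  show "(\<lambda>u. \<phi> u 0 0 (1/u)) ` O1 n \<subseteq> GL3" using nz by (auto intro!: phi_GL3)
  show "mat 1 \<in> (\<lambda>u. \<phi> u 0 0 (1/u)) ` O1 n" by (rule image_eqI[where x = 1]) (simp_all add: phi_1)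
  show "g ** h \<in> (\<lambda>u. \<phi> u 0 0 (1/u)) ` O1 n" if gh: "g \<in> (\<lambda>u. \<phi> u 0 0 (1/u)) ` O1 n" "h \<in> (\<lambda>u. \<phi> u 0 0 (1/u)) ` O1 n" for g h
  proof -
    obtain u w where u: "u \<in> O1 n" "g = \<phi> u 0 0 (1/u)" "w \<in> O1 n" "h = \<phi> w 0 0 (1/w)" using gh by blast
    have "g ** h = \<phi> (u * w) 0 0 (1 / (u * w))" unfolding u(2,4) phi_mult by simp
    thus ?thesis using O1_mult[OF u(1,3) assms] by blast
  qed
  show "inv3 g \<in> (\<lambda>u. \<phi> u 0 0 (1/u)) ` O1 n" if g: "g \<in> (\<lambda>u. \<phi> u 0 0 (1/u)) ` O1 n" for g
  proof -
    obtain u where u: "u \<in> O1 n" "g = \<phi> u 0 0 (1/u)" using g by blast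
    have "inv3 g = \<phi> (inverse u) 0 0 (1 / inverse u)" unfolding u(2) using nz[OF u(1)]
      by (subst phi_inv) (auto simp: field_simps)
    thus ?thesis using O1_inverse[OF u(1) assms] by blast
  qed
qed

lemma Xp_intm: "Xp \<phi> f \<subseteq> intm (min f 0)" and Xm_intm: "Xm \<phi> f \<subseteq> intm (min f 0)"
  unfolding Xp_def Xm_def using P_mono by (auto intro!: phi_intm)
lemma Hh_intm: "1 \<le> n \<Longrightarrow> Hh \<phi> n \<subseteq> intm 0"
proof
  fix g assume n: "1 \<le> n" and "g \<in> Hh \<phi> n"
  then obtain u where u: "u \<in> O1 n" "g = \<phi> u 0 0 (1/u)" unfolding Hh_def by blast
  have "u \<in> un" using O1_un[OF u(1) n] .
  thus "g \<in> intm 0" unfolding u(2) using un_P un_divide[OF un_1] by (intro phi_intm) auto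
qed

end

lemma Xp_mono: "a \<le> b \<Longrightarrow> Xp \<phi> b \<subseteq> Xp \<phi> a" and Xm_mono: "a \<le> b \<Longrightarrow> Xm \<phi> b \<subseteq> Xm \<phi> a"
  using P_mono unfolding Xp_def Xm_def by blast+
lemma HhI: "u \<in> O1 n \<Longrightarrow> w = 1/u \<Longrightarrow> \<phi> u 0 0 w \<in> Hh \<phi> n" unfolding Hh_def by blast

end

context mrep begin

text \<open>When \<open>J\<close> moves \<open>x\<close> through a parameter in \<open>P f\<close>
  modulo \<open>P (f + 1)\<close> and acts on the parameter by translations, the mean over the q
  classes is already fixed by \<open>J\<close>. The abstract \<open>E\<close> lets this serve both
  root groups and quotients of consecutive torus groups.\<close>

lemma avg_Tm:
  assumes J: "cpt J" and x: "x \<in> W"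
    and E: "\<And>r. r \<in> P f \<Longrightarrow> \<exists>j\<in>J. E r = \<pi> j x" "\<And>r s. r \<in> P f \<Longrightarrow> s \<in> P f \<Longrightarrow> r - s \<in> P (f + 1) \<Longrightarrow> E r = E s"
      "\<And>j. j \<in> J \<Longrightarrow> \<exists>d\<in>P f. \<forall>r\<in>P f. \<pi> j (E r) = E (r + d)"
  shows "avg J x = inverse (of_nat q) \<odot> (\<Sum>c\<in>Tm. E (pw f * c))"
proof -
  let ?s = "\<Sum>c\<in>Tm. E (pw f * c)"
  have pf: "pw f * c \<in> P f" if "c \<in> Tm" for c using Tm_P[OF that] by (simp add: pw_mult_P)
  have EW: "E r \<in> W" if r: "r \<in> P f" for r using E(1)[OF r] pi_W[OF cptD(1)[OF J] x] by auto
  have EW': "E (pw f * c) \<in> W" if "c \<in> Tm" for c using EW[OF pf[OF that]] .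
  have sW: "?s \<in> W" by (rule subspace_sum[OF W EW'])
  have "?s \<in> fx J"
  proof (rule fxI[OF sW])
    fix j assume j: "j \<in> J"
    obtain d where d: "d \<in> P f" "\<And>r. r \<in> P f \<Longrightarrow> \<pi> j (E r) = E (r + d)" using E(3)[OF j] by blast
    have "\<exists>c'\<in>Tm. pw f * c + d - pw f * c' \<in> P (f + 1)" if c: "c \<in> Tm" for c
    proof -
      have "d / pw f \<in> P 0" using d(1) by (simp add: pw_divide_P)
      hence "c + d / pw f \<in> P 0" using Tm_P[OF c] P_add by blast
      then obtain c' where c': "c' \<in> Tm" "c + d / pw f - c' \<in> P 1" using Tm_ex by blast
      have "pw f * (c + d / pw f - c') \<in> P (f + 1)" using c'(2) by (simp add: pw_mult_P)
      moreover have "pw f * (c + d / pw f - c') = pw f * c + d - pw f * c'" by (simp add: field_simps)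
      ultimately show ?thesis using c' by auto
    qed
    then obtain s where s: "\<And>c. c \<in> Tm \<Longrightarrow> s c \<in> Tm" "\<And>c. c \<in> Tm \<Longrightarrow> pw f * c + d - pw f * s c \<in> P (f + 1)" by metis
    have inj: "inj_on s Tm"
    proof (rule inj_onI)
      fix a b assume ab: "a \<in> Tm" "b \<in> Tm" "s a = s b"
      have "(pw f * a + d - pw f * s a) - (pw f * b + d - pw f * s b) \<in> P (f + 1)"
        by (rule P_diff[OF s(2)[OF ab(1)] s(2)[OF ab(2)]])
      hence "pw f * (a - b) \<in> P (f + 1)" using ab(3) by (simp add: right_diff_distrib)
      hence "a - b \<in> P 1" by (simp add: pw_mult_P)
      thus "a = b" using Tm_uniq ab by blast
    qed
    have surj: "s ` Tm = Tm" by (rule endo_inj_surj[OF Tm_finite _ inj]) (use s(1) in blast)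
    have "\<pi> j ?s = (\<Sum>c\<in>Tm. \<pi> j (E (pw f * c)))" by (rule pi_sum[OF cptD(1)[OF J j] EW'])
    also have "\<dots> = (\<Sum>c\<in>Tm. E (pw f * s c))"
    proof (rule sum.cong[OF refl])
      fix c assume c: "c \<in> Tm"
      show "\<pi> j (E (pw f * c)) = E (pw f * s c)"
        unfolding d(2)[OF pf[OF c]] by (rule E(2)[OF P_add[OF pf[OF c] d(1)] pf[OF s(1)[OF c]] s(2)[OF c]])
    qed
    also have "\<dots> = ?s" using sum.reindex[OF inj, of "\<lambda>c. E (pw f * c)"] surj by simp
    finally show "\<pi> j ?s = ?s" .
  qed
  hence "?s = avg J ?s" using avg_id[OF J] by simp
  also have "\<dots> = (\<Sum>c\<in>Tm. avg J (E (pw f * c)))" by (rule avg_sum[OF J EW'])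
  also have "\<dots> = (\<Sum>c\<in>Tm. avg J x)"
  proof (rule sum.cong[OF refl])
    fix c assume "c \<in> Tm"
    then obtain j where "j \<in> J" "E (pw f * c) = \<pi> j x" using E(1)[OF pf] by blast
    thus "avg J (E (pw f * c)) = avg J x" using avg_pi[OF J _ x] by simp
  qed
  also have "\<dots> = of_nat q \<odot> avg J x" by (simp add: sum_constant_scale Tm_card)
  finally have "inverse (of_nat q) \<odot> ?s = (inverse (of_nat q) * of_nat q) \<odot> avg J x" by simp
  moreover have "inverse (of_nat q) * of_nat q = (1::complex)" using q_ge2 by simp
  ultimately show ?thesis by simp
qed

context
  fixes \<phi> assumes \<phi>: "sl2emb \<phi>" and \<phi>G: "\<And>a b c d. a*d - b*c = 1 \<Longrightarrow> \<phi> a b c d \<in> G"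
begin

lemmas pm = phi_mult[OF \<phi>]

lemma cpt_Xp: "cpt (Xp \<phi> f)" and cpt_Xm: "cpt (Xm \<phi> f)"
  unfolding cpt_def using subgrp_Xp[OF \<phi>] subgrp_Xm[OF \<phi>] Xp_intm[OF \<phi>, of f] Xm_intm[OF \<phi>, of f] \<phi>G
  by (auto simp: Xp_def Xm_def)
lemma cpt_Hh: "1 \<le> n \<Longrightarrow> cpt (Hh \<phi> n)"
  unfolding cpt_def using subgrp_Hh[OF \<phi>, of n] Hh_intm[OF \<phi>, of n] \<phi>G O1_un[of _ n] un_nz
  by (auto simp: Hh_def)

abbreviation "ep r \<equiv> \<phi> 1 r 0 1"
abbreviation "em r \<equiv> \<phi> 1 0 r 1"
abbreviation "hh u \<equiv> \<phi> u 0 0 (1/u)"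

lemma epG: "ep r \<in> G" and emG: "em r \<in> G" by (simp_all add: \<phi>G)
lemma hhG: "u \<noteq> 0 \<Longrightarrow> hh u \<in> G" by (simp add: \<phi>G)

lemma hh_normz: assumes "u \<in> un" shows "normz (hh u) (Xp \<phi> f)" "normz (hh u) (Xm \<phi> f)" "normz (hh u) (Hh \<phi> n)"
proof -
  have nz: "u \<noteq> 0" using un_nz assms by blast
  have i: "inv3 (hh u) = \<phi> (1/u) 0 0 u" using nz by (simp add: phi_inv[OF \<phi>])
  have s: "u * u \<in> un" "1 / (u * u) \<in> un" using assms un_mult un_divide un_1 by blast+
  have 1: "hh u ** ep r ** inv3 (hh u) = ep (u * u * r)" "inv3 (hh u) ** ep r ** hh u = ep (r * (1 / (u * u)))"
    "hh u ** em r ** inv3 (hh u) = em (r * (1 / (u * u)))" "inv3 (hh u) ** em r ** hh u = em (u * u * r)"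
    "hh u ** hh w ** inv3 (hh u) = hh w" "inv3 (hh u) ** hh w ** hh u = hh w" for r w
    unfolding i pm using nz by (simp_all add: field_simps)
  show "normz (hh u) (Xp \<phi> f)" unfolding normz_def Xp_def using hhG[OF nz] P_mult_un[OF s(1)] P_mult_un[OF s(2)]
    by (auto simp: 1 intro!: imageI)
  show "normz (hh u) (Xm \<phi> f)" unfolding normz_def Xm_def using hhG[OF nz] P_mult_un[OF s(1)] P_mult_un[OF s(2)]
    by (auto simp: 1 intro!: imageI)
  show "normz (hh u) (Hh \<phi> n)" unfolding normz_def Hh_def using hhG[OF nz]
    by (auto simp: 1 intro!: imageI)
qed

lemma avg_root_Tm:
  assumes J: "cpt (e ` P f)" and e: "\<And>r. e r \<in> G" "\<And>r s. e r ** e s = e (r + s)" and x: "x \<in> fx (e ` P (f + 1))"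
  shows "avg (e ` P f) x = inverse (of_nat q) \<odot> (\<Sum>c\<in>Tm. \<pi> (e (pw f * c)) x)"
proof (rule avg_Tm[OF J fxW[OF x]])
  have add: "\<pi> (e r) (\<pi> (e s) x) = \<pi> (e (s + r)) x" for r s
    using pi_mult[OF e(1,1) fxW[OF x], of r s] by (simp add: e(2) add.commute)
  show "\<exists>j\<in>e ` P f. \<pi> (e r) x = \<pi> j x" if "r \<in> P f" for r using that by blast
  show "\<pi> (e r) x = \<pi> (e s) x" if "r - s \<in> P (f + 1)" for r s
    using add[of s "r - s"] fxD[OF x, of "e (r - s)"] that by simp
  show "\<exists>d\<in>P f. \<forall>r\<in>P f. \<pi> j (\<pi> (e r) x) = \<pi> (e (r + d)) x" if "j \<in> e ` P f" for j
    using that add by auto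
qed

lemma avg_Xp_Tm: assumes "x \<in> fx (Xp \<phi> (f + 1))" shows "avg (Xp \<phi> f) x = inverse (of_nat q) \<odot> (\<Sum>c\<in>Tm. \<pi> (ep (pw f * c)) x)"
  using avg_root_Tm[OF cpt_Xp[unfolded Xp_def] epG _ assms[unfolded Xp_def]] by (simp add: pm Xp_def add.commute)
lemma avg_Xm_Tm: assumes "x \<in> fx (Xm \<phi> (f + 1))" shows "avg (Xm \<phi> f) x = inverse (of_nat q) \<odot> (\<Sum>c\<in>Tm. \<pi> (em (pw f * c)) x)"
  using avg_root_Tm[OF cpt_Xm[unfolded Xm_def] emG _ assms[unfolded Xm_def]] by (simp add: pm Xm_def)

text \<open>If the average \<open>p\<close> over the opposite root group of the reflected vector is killed, the Bruhat
  decomposition of \<open>SL\<^sub>2\<close> over the residue field forces first torus invariance of \<open>x\<close> and then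
  proportionality of \<open>x\<close> to its reflection.\<close>
lemma rank_one:
  assumes x: "x \<in> fx (Xp \<phi> f)" "x \<in> fx (Xm \<phi> (1 - f))" "x \<in> fx (Hh \<phi> 1)"
    and z: "avg (Xp \<phi> (f - 1)) x = 0"
  shows "x = 0"
proof -
  have xW: "x \<in> W" using fxW[OF x(1)] .
  define b where "b = pw (f - 1)"
  have b: "b \<noteq> 0" "v b = f - 1" by (simp_all add: b_def)
  have bP: "b * r \<in> P k \<longleftrightarrow> r \<in> P (k - (f - 1))" for r k by (simp add: b_def pw_mult_P)
  \<comment> \<open>The reflection is normalized so that, for a unit \<open>c\<close>,
    \<open>ep (b * c)\<close> lies in the big cell with lower factors in
    \<open>Xm \<phi> (1 - f)\<close>, where they fix \<open>x\<close>.\<close>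
  define w where "w = \<phi> 0 b (-1/b) 0"
  have wG: "w \<in> G" unfolding w_def by (rule \<phi>G) (use b in simp)
  define x' where "x' = \<pi> w x"
  let ?B = "avg (Xm \<phi> (1 - f))" and ?F = "\<lambda>c. \<pi> (em (1 / (b * c))) (\<pi> (hh c) x')"
  have x'W: "x' \<in> W" using pi_W[OF wG xW] by (simp add: x'_def)
  have qq: "(of_nat q :: complex) \<noteq> 0" "(of_nat q :: complex) \<noteq> 1" using q_ge2 by auto
  obtain c0 where c0: "c0 \<in> Tm" "c0 \<in> P 1" "Tm = insert c0 Tu" "c0 \<notin> Tu" by (rule Tm_split)
  have fTm: "sum F Tm = F c0 + sum F Tu" for F :: "'f \<Rightarrow> 'v"
    using c0(4) Tu_finite by (subst c0(3)) simp
  have move: "\<pi> (g ** w) x = \<pi> g x'" if "g \<in> G" for g using pi_mult[OF that wG xW] by (simp add: x'_def)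
  have fixA: "\<pi> (ep r) x = x" if "r \<in> P f" for r using fxD[OF x(1)] that by (simp add: Xp_def)
  have fixB: "\<pi> (em r) x = x" if "r \<in> P (1 - f)" for r using fxD[OF x(2)] that by (simp add: Xm_def)
  have x'_moves: "\<pi> g x' = x'" if "g \<in> G" "k \<in> G" "g ** w = w ** k" "\<pi> k x = x" for g k
    using move[OF that(1)] pi_mult[OF wG that(2) xW] that(3,4) by (simp add: x'_def)
  have x'A: "\<pi> (ep r) x' = x'" if r: "r \<in> P (f - 1)" for r
  proof (rule x'_moves[OF epG emG])
    show "ep r ** w = w ** em (- r / (b * b))" unfolding w_def pm using b by (simp add: field_simps)
    have "r / b \<in> P 0" using r by (simp add: b_def pw_divide_P)
    hence "(r / b) / b \<in> P (1 - f)" unfolding b_def pw_divide_P by simp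
    hence "- ((r / b) / b) \<in> P (1 - f)" by (simp only: P_minus)
    moreover have "- ((r / b) / b) = - r / (b * b)" by simp
    ultimately show "\<pi> (em (- r / (b * b))) x = x" using fixB by simp
  qed
  have x'B: "\<pi> (em r) x' = x'" if r: "r \<in> P (2 - f)" for r
  proof (rule x'_moves[OF emG epG])
    show "em r ** w = w ** ep (- (b * (b * r)))" unfolding w_def pm using b by (simp add: field_simps)
    have "b * (b * r) \<in> P f" using r by (simp add: bP)
    hence "- (b * (b * r)) \<in> P f" by (simp only: P_minus)
    thus "\<pi> (ep (- (b * (b * r)))) x = x" by (rule fixA)
  qed
  have x'H: "\<pi> (hh u) x' = x'" if u: "u \<noteq> 0" "\<pi> (hh (1/u)) x = x" for u
  proof (rule x'_moves[OF hhG hhG])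
    show "hh u ** w = w ** hh (1/u)" unfolding w_def pm using b u by (simp add: field_simps)
  qed (use u in auto)
  have x'H1: "x' \<in> fx (Hh \<phi> 1)"
  proof (rule fxI[OF x'W])
    fix j assume "j \<in> Hh \<phi> 1"
    then obtain u where u: "u \<in> O1 1" "j = hh u" by (auto simp: Hh_def)
    have "inverse u \<in> O1 1" using O1_inverse u by simp
    hence "hh (1/u) \<in> Hh \<phi> 1" by (intro HhI) (simp_all add: inverse_eq_divide)
    thus "\<pi> j x' = x'" unfolding u(2) using x'H fxD[OF x(3)] O1_un[OF u(1)] un_nz by simp
  qed
  have hmod: "\<pi> (hh u) y = \<pi> (hh u') y" if y: "y \<in> fx (Hh \<phi> 1)" and u: "u \<in> un" "u' \<in> un" "u - u' \<in> P 1" for u u' y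
  proof -
    have "u / u' - 1 = (u - u') / u'" using un_nz[OF u(2)] by (simp add: field_simps)
    hence "u / u' \<in> O1 1" using u by (simp add: O1_def P_divide_un)
    hence "hh (u / u') \<in> Hh \<phi> 1" by (rule HhI) simp
    moreover have "hh u = hh u' ** hh (u / u')" unfolding pm using un_nz[OF u(1)] un_nz[OF u(2)] by (simp add: field_simps)
    ultimately show ?thesis
      using pi_mult[OF hhG hhG fxW[OF y], of u' "u / u'"] un_nz[OF u(1)] un_nz[OF u(2)] fxD[OF y] by simp
  qed
  define p where "p = ?B x'"
  have pW: "p \<in> W" unfolding p_def by (rule avg_W[OF cpt_Xm x'W])
  have pH1: "p \<in> fx (Hh \<phi> 1)" unfolding p_def
  proof (rule fxI[OF avg_W[OF cpt_Xm x'W]])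
    fix j assume j: "j \<in> Hh \<phi> 1"
    then obtain u where u: "u \<in> O1 1" "j = hh u" by (auto simp: Hh_def)
    have "\<pi> j (?B x') = ?B (\<pi> j x')"
      unfolding u(2) by (rule normz_avg[OF hh_normz(2) cpt_Xm x'W]) (use O1_un[OF u(1)] in simp)
    thus "\<pi> j (?B x') = ?B x'" using fxD[OF x'H1 j] by simp
  qed
  \<comment> \<open>The big cell: \<open>ep (b * c)\<close> is the product of
    \<open>em (1 / (b * c))\<close>, \<open>hh c\<close>, \<open>w\<close> and
    \<open>em (1 / (b * c))\<close>, and the last factor fixes \<open>x\<close>.\<close>
  have bru: "\<pi> (ep (b * c)) x = ?F c" if c: "c \<in> un" for c
  proof -
    have cn: "c \<noteq> 0" using un_nz c by blast
    have rP: "1 / (b * c) \<in> P (1 - f)" using b cn c by (simp add: P_def v_divide v_mult un_def)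
    have "ep (b * c) = em (1 / (b * c)) ** (hh c ** (w ** em (1 / (b * c))))"
      unfolding w_def pm using b cn by (simp add: field_simps)
    hence "\<pi> (ep (b * c)) x = \<pi> (em (1 / (b * c))) (\<pi> (hh c) (\<pi> w (\<pi> (em (1 / (b * c))) x)))"
      using pi_mult[OF emG GD(3)[OF hhG[OF cn] GD(3)[OF wG emG]] xW]
        pi_mult[OF hhG[OF cn] GD(3)[OF wG emG] xW] pi_mult[OF wG emG xW] by simp
    thus ?thesis using fixB[OF rP] by (simp add: x'_def)
  qed
  have x1: "x \<in> fx (Xp \<phi> (f - 1 + 1))" using x by simp
  have "inverse (of_nat q) \<odot> (\<Sum>c\<in>Tm. \<pi> (ep (b * c)) x) = 0" using avg_Xp_Tm[OF x1] z by (simp add: b_def)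
  hence "(\<Sum>c\<in>Tm. \<pi> (ep (b * c)) x) = 0" using qq by simp
  moreover have "\<pi> (ep (b * c0)) x = x" by (rule fixA) (use c0(2) in \<open>simp add: bP\<close>)
  \<comment> \<open>In the mean over q classes, the class of 0 contributes \<open>x\<close> itself
    and the unit classes contribute the big cell.\<close>
  ultimately have s0: "x + (\<Sum>c\<in>Tu. \<pi> (ep (b * c)) x) = 0" unfolding fTm by simp
  have "(\<Sum>c\<in>Tu. \<pi> (ep (b * c)) x) = (\<Sum>c\<in>Tu. ?F c)"
    by (rule sum.cong[OF refl]) (use bru in blast)
  hence s1: "x + (\<Sum>c\<in>Tu. ?F c) = 0" using s0 by simp
  have hW: "\<pi> (hh c) x' \<in> W" if "c \<in> Tu" for c using that by (intro pi_W hhG x'W) (auto simp: un_def)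
  have ehW: "?F c \<in> W" if "c \<in> Tu" for c by (rule pi_W[OF emG hW[OF that]])
  have rP: "em (1 / (b * c)) \<in> Xm \<phi> (1 - f)" if "c \<in> un" for c
    unfolding Xm_def using b that by (auto simp: P_def v_divide v_mult un_def)
  have "?B (x + (\<Sum>c\<in>Tu. ?F c)) = x + (\<Sum>c\<in>Tu. \<pi> (hh c) p)"
  proof -
    have "?B (x + (\<Sum>c\<in>Tu. ?F c))
      = ?B x + (\<Sum>c\<in>Tu. ?B (?F c))"
      using avg_sum[OF cpt_Xm, of Tu "\<lambda>c. ?F c", OF ehW, of "1 - f"]
        avg_add[OF cpt_Xm xW, of "\<Sum>c\<in>Tu. ?F c" "1 - f"]
        subspace_sum[OF W, of Tu "\<lambda>c. ?F c", OF ehW] by simp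
    also have "?B x = x" by (rule avg_id[OF cpt_Xm x(2)])
    also have "(\<Sum>c\<in>Tu. ?B (?F c)) = (\<Sum>c\<in>Tu. \<pi> (hh c) p)"
    proof (rule sum.cong[OF refl])
      fix c assume c: "c \<in> Tu"
      have "?B (?F c) = ?B (\<pi> (hh c) x')"
        by (rule avg_pi[OF cpt_Xm rP hW[OF c]]) (use c in blast)
      also have "\<dots> = \<pi> (hh c) p" unfolding p_def
        by (rule normz_avg[OF hh_normz(2) cpt_Xm x'W, symmetric]) (use c in blast)
      finally show "?B (?F c) = \<pi> (hh c) p" .
    qed
    finally show ?thesis .
  qed
  hence s2: "x + (\<Sum>c\<in>Tu. \<pi> (hh c) p) = 0" unfolding s1 avg_0[OF cpt_Xm] by simp
  \<comment> \<open>The relation just found writes \<open>x\<close> as minus a sum of torus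
    translates of \<open>p\<close> over all unit classes, a sum that every unit merely
    permutes.\<close>
  have xH: "\<pi> (hh u) x = x" if u: "u \<in> un" for u
  proof -
    have uG: "hh u \<in> G" using u un_nz hhG by blast
    have cG: "hh c \<in> G" if "c \<in> Tu" for c using that un_nz hhG by blast
    have "\<pi> (hh u) (\<Sum>c\<in>Tu. \<pi> (hh c) p) = (\<Sum>c\<in>Tu. \<pi> (hh u) (\<pi> (hh c) p))"
      by (rule pi_sum[OF uG]) (rule pi_W[OF cG pW])
    also have "\<dots> = (\<Sum>c\<in>Tu. \<pi> (hh (u * c)) p)"
    proof (rule sum.cong[OF refl])
      fix c assume c: "c \<in> Tu"
      have "hh u ** hh c = hh (u * c)" unfolding pm by simp
      thus "\<pi> (hh u) (\<pi> (hh c) p) = \<pi> (hh (u * c)) p" using pi_mult[OF uG cG[OF c] pW] by simp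
    qed
    also have "\<dots> = (\<Sum>c\<in>Tu. \<pi> (hh c) p)"
    proof (rule Tu_reindex[where F = "\<lambda>c. \<pi> (hh c) p" and g = "\<lambda>c. u * c"])
      show "\<pi> (hh c) p = \<pi> (hh d) p" if "c \<in> un" "d \<in> un" "c - d \<in> P 1" for c d by (rule hmod[OF pH1 that])
      show "u * c \<in> un" if "c \<in> un" for c using un_mult[OF u that] .
      show "c - d \<in> P 1" if "u * c - u * d \<in> P 1" for c d
        using that P_mult_un(2)[OF u, of "c - d"] by (simp add: right_diff_distrib)
    qed
    finally have e: "\<pi> (hh u) (\<Sum>c\<in>Tu. \<pi> (hh c) p) = (\<Sum>c\<in>Tu. \<pi> (hh c) p)" .
    have xe: "x = (- 1) \<odot> (\<Sum>c\<in>Tu. \<pi> (hh c) p)" using s2 by (simp add: eq_neg_iff_add_eq_0)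
    show ?thesis by (subst (1 2) xe) (simp only: pi_scale[OF uG subspace_sum[OF W pi_W[OF cG pW]]] e)
  qed
  have x'Hu: "\<pi> (hh u) x' = x'" if "u \<in> un" for u
    using x'H[OF un_nz[OF that]] xH[OF un_divide[OF un_1 that]] by blast
  have "(\<Sum>c\<in>Tu. ?F c) = (\<Sum>c\<in>Tu. \<pi> (em ((1 / b) * (1 / c))) x')"
    by (rule sum.cong[OF refl]) (use x'Hu in simp)
  also have "\<dots> = (\<Sum>c\<in>Tu. \<pi> (em ((1 / b) * c)) x')"
  proof (rule Tu_reindex[where F = "\<lambda>c. \<pi> (em ((1 / b) * c)) x'" and g = "\<lambda>c. 1 / c"])
    show "\<pi> (em (1 / b * c)) x' = \<pi> (em (1 / b * d)) x'" if "c \<in> un" "d \<in> un" "c - d \<in> P 1" for c d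
    proof -
      have "em (1 / b * c) = em (1 / b * d) ** em (1 / b * (c - d))" unfolding pm by (simp add: right_diff_distrib diff_divide_distrib)
      moreover have "(c - d) / b \<in> P (2 - f)" using that(3) by (simp add: b_def pw_divide_P)
      ultimately show ?thesis using pi_mult[OF emG emG x'W] x'B by simp
    qed
    show "1 / c \<in> un" if "c \<in> un" for c using un_divide[OF un_1 that] .
    show "c - d \<in> P 1" if "c \<in> un" "d \<in> un" "1 / c - 1 / d \<in> P 1" for c d
    proof -
      have "1 / c - 1 / d = (d - c) / (c * d)" using un_nz that by (simp add: field_simps)
      hence "d - c \<in> P 1" using that P_divide_un[OF un_mult[OF that(1,2)]] by simp
      hence "- (d - c) \<in> P 1" by (simp only: P_minus)
      thus ?thesis by simp
    qed
  qed
  finally have s3: "x + (\<Sum>c\<in>Tu. \<pi> (em ((1 / b) * c)) x') = 0" using s1 by simp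
  have x'B': "x' \<in> fx (Xm \<phi> (1 - f + 1))"
    by (rule fxI[OF x'W]) (use x'B in \<open>auto simp: Xm_def\<close>)
  have pb: "pw (1 - f) = 1 / b" using pw_minus[of "f - 1"] by (simp add: b_def inverse_eq_divide)
  have "p = inverse (of_nat q) \<odot> (\<Sum>c\<in>Tm. \<pi> (em ((1 / b) * c)) x')"
    unfolding p_def avg_Xm_Tm[OF x'B'] pb ..
  hence "of_nat q \<odot> p = (\<Sum>c\<in>Tm. \<pi> (em ((1 / b) * c)) x')" using qq by simp
  moreover have "\<pi> (em ((1 / b) * c0)) x' = x'" by (rule x'B) (use c0(2) pw_divide_P[of c0 "f - 1"] in \<open>simp add: b_def\<close>)
  ultimately have s4: "of_nat q \<odot> p = x' + (\<Sum>c\<in>Tu. \<pi> (em ((1 / b) * c)) x')" unfolding fTm by simp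
  \<comment> \<open>The same sum over unit classes occurs in \<open>s3\<close> and in the average
    \<open>p\<close> of \<open>x'\<close>; it is eliminated.\<close>
  have s5: "x = x' - of_nat q \<odot> p" using s3 s4 by (simp add: eq_neg_iff_add_eq_0)
  have "?B x = ?B x' - ?B (of_nat q \<odot> p)"
    unfolding s5 by (rule avg_diff[OF cpt_Xm x'W subspace_scale[OF W pW]])
  also have "?B (of_nat q \<odot> p) = of_nat q \<odot> p"
    by (rule avg_id[OF cpt_Xm subspace_scale[OF subspace_fx_cpt[OF cpt_Xm]]]) (simp add: p_def avg_fx[OF cpt_Xm x'W])
  finally have "x = p - of_nat q \<odot> p" using avg_id[OF cpt_Xm x(2)] by (simp add: p_def)
  hence s6: "x = (1 - of_nat q) \<odot> p" by (simp add: scale_left_diff_distrib)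
  have "x' = x + of_nat q \<odot> p" using s5 by simp
  also have "\<dots> = p" by (subst s6) (simp add: scale_left_distrib[symmetric])
  finally have s7: "x = (1 - of_nat q) \<odot> x'" using s6 by simp
  \<comment> \<open>As a multiple of \<open>x'\<close>, the vector \<open>x\<close> inherits
    invariance under the larger group, and its average, which is 0, equals \<open>x\<close>.\<close>
  have "x \<in> fx (Xp \<phi> (f - 1))"
  proof (rule fxI[OF xW])
    fix j assume "j \<in> Xp \<phi> (f - 1)"
    then obtain r where r: "r \<in> P (f - 1)" "j = ep r" by (auto simp: Xp_def)
    show "\<pi> j x = x" by (subst (1 2) s7) (simp only: r(2) pi_scale[OF epG x'W] x'A[OF r(1)])
  qed
  thus ?thesis using avg_id[OF cpt_Xp] z by simp
qed

end
end

section \<open>Vanishing in rank one at every depth\<close>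

context mrep begin

lemma avg_fx_normz: assumes J: "cpt J" and x: "x \<in> fx H" and n: "\<And>h. h \<in> H \<Longrightarrow> normz h J"
  shows "avg J x \<in> fx H"
proof (rule fxI[OF avg_W[OF J fxW[OF x]]])
  fix h assume h: "h \<in> H"
  show "\<pi> h (avg J x) = avg J x" using normz_avg[OF n[OF h] J fxW[OF x]] fxD[OF x h] by simp
qed

lemma pi_eq2: assumes "g ** h = g' ** h'" "g \<in> G" "h \<in> G" "g' \<in> G" "h' \<in> G" "x \<in> W"
  shows "\<pi> g (\<pi> h x) = \<pi> g' (\<pi> h' x)"
  using pi_mult[OF assms(2,3,6)] pi_mult[OF assms(4,5,6)] assms(1) by simp

lemma pi_eq3: assumes "g ** h = g' ** h' ** k'" "g \<in> G" "h \<in> G" "g' \<in> G" "h' \<in> G" "k' \<in> G" "x \<in> W"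
  shows "\<pi> g (\<pi> h x) = \<pi> g' (\<pi> h' (\<pi> k' x))"
  using pi_mult[OF assms(2,3,7)] pi_mult[OF GD(3)[OF assms(4,5)] assms(6,7)] pi_mult[OF assms(4,5) pi_W[OF assms(6,7)]] assms(1) by simp

context
  fixes \<phi> assumes \<phi>: "sl2emb \<phi>" and \<phi>G: "\<And>a b c d. a*d - b*c = 1 \<Longrightarrow> \<phi> a b c d \<in> G"
begin

lemma cptX: "cpt (Xp \<phi> f)" "cpt (Xm \<phi> f)" "1 \<le> n \<Longrightarrow> cpt (Hh \<phi> n)"
  by (rule cpt_Xp[OF \<phi>], rule \<phi>G, assumption) (rule cpt_Xm[OF \<phi>], rule \<phi>G, assumption, rule cpt_Hh[OF \<phi>], rule \<phi>G)
lemma memG: "ep \<phi> r \<in> G" "em \<phi> r \<in> G" "u \<noteq> 0 \<Longrightarrow> hh \<phi> u \<in> G"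
  by (rule \<phi>G, simp)+
lemma nrm: assumes "u \<in> un" shows "normz (hh \<phi> u) (Xp \<phi> f)" "normz (hh \<phi> u) (Xm \<phi> f)" "normz (hh \<phi> u) (Hh \<phi> n)"
  by (rule hh_normz[OF \<phi> _ assms], rule \<phi>G, assumption)+
lemmas pmm = phi_mult[OF \<phi>]

lemma em_ep: assumes x: "x \<in> W" and d: "1 + r * w \<noteq> 0" and f: "\<pi> (em \<phi> (r / (1 + r * w))) x = x"
  shows "\<pi> (em \<phi> r) (\<pi> (ep \<phi> w) x) = \<pi> (ep \<phi> (w / (1 + r * w))) (\<pi> (hh \<phi> (1 / (1 + r * w))) x)"
proof -
  let ?d = "1 + r * w"
  have "em \<phi> r ** ep \<phi> w = ep \<phi> (w / ?d) ** hh \<phi> (1 / ?d) ** em \<phi> (r / ?d)"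
  proof -
    have "1 / ?d + w * r / ?d = 1" using d by (simp add: add_divide_distrib[symmetric] mult.commute)
    thus ?thesis unfolding pmm using d by (simp add: mult.commute add.commute)
  qed
  from pi_eq3[OF this memG(2) memG(1) memG(1) memG(3) memG(2) x] d f show ?thesis by simp
qed

lemma ep_shift: assumes x: "x \<in> fx (Xp \<phi> k)" and "w' - w \<in> P k" shows "\<pi> (ep \<phi> w') x = \<pi> (ep \<phi> w) x"
proof -
  have "ep \<phi> w' = ep \<phi> w ** ep \<phi> (w' - w)" unfolding pmm by simp
  hence "\<pi> (ep \<phi> w') x = \<pi> (ep \<phi> w) (\<pi> (ep \<phi> (w' - w)) x)"
    using pi_mult[OF memG(1) memG(1) fxW[OF x]] by simp
  also have "\<pi> (ep \<phi> (w' - w)) x = x" by (rule fxD[OF x]) (use assms(2) in \<open>auto simp: Xp_def\<close>)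
  finally show ?thesis .
qed

lemma fx_hh: assumes "x \<in> fx J" "normz (hh \<phi> u) J" "J \<subseteq> G" shows "\<pi> (hh \<phi> u) x \<in> fx J"
  by (rule normz_fx[OF assms(2,3,1)])

lemma XG: "Xp \<phi> f \<subseteq> G" "Xm \<phi> f \<subseteq> G" using cptD(1)[OF cptX(1)] cptD(1)[OF cptX(2)] by blast+

lemma Hh_normz_X: assumes "1 \<le> n" "h \<in> Hh \<phi> n" shows "normz h (Xp \<phi> f)" "normz h (Xm \<phi> f)" "normz h (Hh \<phi> m)"
  using assms nrm O1_un[of _ n] by (auto simp: Hh_def)

lemma avg_Xp_fix_Xm:
  assumes x: "x \<in> fx (Hh \<phi> n)" "x \<in> fx (Xm \<phi> s)" and n: "1 \<le> n" "n \<le> s + t"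
  shows "avg (Xp \<phi> t) x \<in> fx (Xm \<phi> s)"
proof (rule fxI[OF avg_W[OF cptX(1) fxW[OF x(1)]]])
  fix j assume "j \<in> Xm \<phi> s"
  then obtain r where r: "r \<in> P s" "j = em \<phi> r" by (auto simp: Xm_def)
  show "\<pi> j (avg (Xp \<phi> t) x) = avg (Xp \<phi> t) x"
  proof (rule avg_perm[OF cptX(1) fxW[OF x(1)]])
    show "j \<in> G" using r memG by simp
    fix e assume "e \<in> Xp \<phi> t"
    then obtain w where w: "w \<in> P t" "e = ep \<phi> w" by (auto simp: Xp_def)
    have "r * w \<in> P n" by (rule P_mult'[OF r(1) w(1)]) (use n in simp)
    hence dO: "1 + r * w \<in> O1 n" by (rule O1_I)
    have du: "1 + r * w \<in> un" by (rule O1_un[OF dO n(1)])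
    have "\<pi> (em \<phi> r) (\<pi> (ep \<phi> w) x) = \<pi> (ep \<phi> (w / (1 + r * w))) (\<pi> (hh \<phi> (1 / (1 + r * w))) x)"
    proof (rule em_ep[OF fxW[OF x(1)] un_nz[OF du]])
      show "\<pi> (em \<phi> (r / (1 + r * w))) x = x"
        by (rule fxD[OF x(2)]) (use r(1) P_divide_un[OF du] in \<open>auto simp: Xm_def\<close>)
    qed
    also have "\<pi> (hh \<phi> (1 / (1 + r * w))) x = x"
      by (rule fxD[OF x(1)], rule HhI[OF O1_divide[OF O1_1 dO n(1)]]) simp
    finally show "\<exists>j'\<in>Xp \<phi> t. \<pi> j (\<pi> e x) = \<pi> j' x"
      unfolding r(2) w(2) using w(1) P_divide_un[OF du] by (intro bexI) (auto simp: Xp_def)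
  qed
qed

text \<open>An element of \<open>Xp \<phi> (k - 1)\<close> outside \<open>Xp \<phi> k\<close> has a
  parameter of exact valuation k - 1, and for these \<open>B\<close> kills the translate;
  \<open>avg_core\<close> applies.\<close>

lemma root_step:
  assumes B: "cpt B" and y: "y \<in> fx (Xp \<phi> k)" "y \<in> fx B" "y \<noteq> 0"
    and kil: "\<And>w. w \<in> P (k - 1) \<Longrightarrow> w \<noteq> 0 \<Longrightarrow> v w = k - 1 \<Longrightarrow> avg B (\<pi> (ep \<phi> w) y) = 0"
  shows "avg (Xp \<phi> (k - 1)) y \<noteq> 0"
proof (rule avg_core[OF cptX(1) B y(2,3)])
  fix j assume "j \<in> Xp \<phi> (k - 1)"
  then obtain w where w: "w \<in> P (k - 1)" "j = ep \<phi> w" by (auto simp: Xp_def)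
  show "\<pi> j y = y \<or> avg B (\<pi> j y) = 0"
  proof (cases "w \<in> P k")
    case True
    thus ?thesis using fxD[OF y(1)] w(2) by (auto simp: Xp_def)
  next
    case False
    thus ?thesis using v_exact[of w "k - 1"] kil w by auto
  qed
qed

text \<open>The vanishing of the torus average says that only torus characters nontrivial on
  \<open>1 + P (n - 1)\<close> occur in \<open>y\<close>. Moving \<open>Xm \<phi> (n - k)\<close>
  past \<open>ep \<phi> w\<close> with \<open>v w = k - 1\<close> produces all of
  \<open>Hh \<phi> (n - 1)\<close> up to absorbed factors, so the lower average kills the
  translate.\<close>

lemma ss_step:
  assumes n: "2 \<le> n" and y: "y \<in> fx (Hh \<phi> n)" "y \<in> fx (Xp \<phi> k)" "y \<in> fx (Xm \<phi> (n - k))" "y \<noteq> 0" "avg (Hh \<phi> (n - 1)) y = 0"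
  shows "avg (Xp \<phi> (k - 1)) y \<noteq> 0"
proof (rule root_step[OF cptX(2) y(2,3,4)])
  have yW: "y \<in> W" using fxW y by blast
  fix w assume w: "w \<in> P (k - 1)" "w \<noteq> 0" "v w = k - 1"
  show "avg (Xm \<phi> (n - k)) (\<pi> (ep \<phi> w) y) = 0"
  proof (rule avg_kill[OF cptX(2) cptX(3) memG(1) yW y(5)])
    show "1 \<le> n - 1" using n by simp
    fix c assume "c \<in> Hh \<phi> (n - 1)"
    then obtain u where u: "u \<in> O1 (n - 1)" "c = hh \<phi> u" by (auto simp: Hh_def)
    have uu: "u \<in> un" using O1_un[OF u(1)] n by simp
    define r where "r = (1 / u - 1) / w"
    have "1 / u \<in> O1 (n - 1)" using O1_divide[OF O1_1 u(1)] n by simp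
    hence "1 / u - 1 \<in> P (n - 1)" by (simp add: O1_def)
    hence r: "r \<in> P (n - k)" unfolding r_def by (rule P_divide) (use w in simp_all)
    have d: "1 + r * w = 1 / u" using w by (simp add: r_def)
    have d0: "1 + r * w \<noteq> 0" using d un_nz[OF uu] by simp
    have "\<pi> (em \<phi> r) (\<pi> (ep \<phi> w) y) = \<pi> (ep \<phi> (w / (1 + r * w))) (\<pi> (hh \<phi> (1 / (1 + r * w))) y)"
    proof (rule em_ep[OF yW d0])
      have "1 / u \<in> un" using un_divide[OF un_1 uu] .
      thus "\<pi> (em \<phi> (r / (1 + r * w))) y = y"
        unfolding d using r P_divide_un[of "1 / u" r] by (intro fxD[OF y(3)]) (auto simp: Xm_def)
    qed
    also have "\<dots> = \<pi> (ep \<phi> w) (\<pi> (hh \<phi> u) y)"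
    proof -
      have "u - 1 \<in> P (n - 1)" using u by (simp add: O1_def)
      hence "w * (u - 1) \<in> P k" by (rule P_mult'[OF w(1)]) (use n in simp)
      moreover have "w / (1 + r * w) - w = w * (u - 1)" unfolding d by (simp add: algebra_simps)
      ultimately have "w / (1 + r * w) - w \<in> P k" by simp
      moreover have "1 / (1 + r * w) = u" unfolding d by simp
      ultimately show ?thesis using ep_shift[OF fx_hh[OF y(2) nrm(1)[OF uu] XG(1)]] by simp
    qed
    finally show "\<exists>b\<in>Xm \<phi> (n - k). \<pi> b (\<pi> (ep \<phi> w) y) = \<pi> (ep \<phi> w) (\<pi> c y)"
      using r u(2) by (auto simp: Xm_def)
  qed
qed

text \<open>Descent along \<open>k\<close> for vectors invariant to depth \<open>k\<close> above and
  \<open>n - k\<close> below the diagonal. \<open>Q\<close> is a further condition inherited by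
  averages: trivial at depth one, the vanishing of a torus average at greater depth.\<close>

lemma vanish_core:
  assumes sc: "\<And>x. x \<in> W \<Longrightarrow> \<exists>t. avg (Xp \<phi> t) x = 0" and n: "1 \<le> n" and st: "s + t \<le> n"
    and Q: "\<And>k y. y \<in> fx (Xp \<phi> k) \<Longrightarrow> y \<in> fx (Xm \<phi> (n - k)) \<Longrightarrow> y \<in> fx (Hh \<phi> n) \<Longrightarrow> Q y \<Longrightarrow> y \<noteq> 0 \<Longrightarrow> avg (Xp \<phi> (k - 1)) y \<noteq> 0"
      "\<And>k y. y \<in> W \<Longrightarrow> Q y \<Longrightarrow> Q (avg (Xp \<phi> k) y)"
    and x: "x \<in> fx (Hh \<phi> n)" "x \<in> fx (Xm \<phi> s)" "Q x"
  shows "avg (Xp \<phi> t) x = 0"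
proof -
  let ?R = "\<lambda>k y. y \<in> fx (Xp \<phi> k) \<and> y \<in> fx (Xm \<phi> (n - k)) \<and> y \<in> fx (Hh \<phi> n) \<and> Q y"
  have av: "?R k (avg (Xp \<phi> k) y)"
    if y: "y \<in> fx (Hh \<phi> n)" "y \<in> fx (Xm \<phi> (n - k))" "Q y" for k y
    using avg_fx[OF cptX(1) fxW[OF y(1)]] avg_Xp_fix_Xm[OF y(1,2) n] avg_fx_normz[OF cptX(1) y(1) Hh_normz_X(1)[OF n]] Q(2)[OF fxW[OF y(1)] y(3)] by auto
  have "avg (Xp \<phi> (n - s)) x = 0"
  proof (rule descent[where U = "Xp \<phi>" and k = "n - s" and R = ?R, OF cptX(1) Xp_mono sc])
    show "y \<in> W" if "?R k y" for k y using that fxW by blast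
    fix k y assume y: "?R k y" "y \<noteq> 0"
    have "y \<in> fx (Xm \<phi> (n - (k - 1)))" by (rule fx_anti[OF _ Xm_mono]) (use y in auto)
    thus "avg (Xp \<phi> (k - 1)) y \<noteq> 0 \<and> ?R (k - 1) (avg (Xp \<phi> (k - 1)) y)" using av[of y "k - 1"] Q(1)[of y k] y by blast
  next
    have "x \<in> fx (Xm \<phi> (n - (n - s)))" using x(2) by simp
    thus "?R (n - s) (avg (Xp \<phi> (n - s)) x)"
      by (rule av[OF x(1) _ x(3)])
  qed
  moreover have "avg (Xp \<phi> t) (avg (Xp \<phi> (n - s)) x) = avg (Xp \<phi> t) x"
    by (rule avg_sub[OF cptX(1) cptX(1) Xp_mono fxW[OF x(1)]]) (use st in simp)
  ultimately show ?thesis using avg_0[OF cptX(1)] by metis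
qed

text \<open>Splitting off the average over the next larger torus group leaves a part to which
  \<open>ss_step\<close> applies and a part of smaller depth. At depth n the descent kills the
  averages with t up to n - s, so the base case n = 1 dictates the bound on s + t.\<close>

lemma GL2_vanish:
  assumes sc: "\<And>x. x \<in> W \<Longrightarrow> \<exists>t. avg (Xp \<phi> t) x = 0"
    and x: "x \<in> fx (Hh \<phi> (int n))" "x \<in> fx (Xm \<phi> s)" and n: "1 \<le> n" and st: "s + t \<le> 1"
  shows "avg (Xp \<phi> t) x = 0"
  using n x
proof (induction n arbitrary: x rule: nat_induct_at_least)
  case base
  note x = base
  show ?case
  proof (rule vanish_core[OF sc, where n = 1 and s = s and Q = "\<lambda>_. True"])
    show "avg (Xp \<phi> (k - 1)) y \<noteq> 0" if "y \<in> fx (Xp \<phi> k)" "y \<in> fx (Xm \<phi> (1 - k))" "y \<in> fx (Hh \<phi> 1)" "y \<noteq> 0" for k y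
      using rank_one[OF \<phi> \<phi>G that(1-3)] that(4) by blast
  qed (use x st in simp_all)
next
  case (Suc m)
  define n where "n = int (Suc m)"
  have n2: "2 \<le> n" using Suc.hyps by (simp add: n_def)
  have nm: "n - 1 = int m" by (simp add: n_def)
  have x: "x \<in> fx (Hh \<phi> n)" "x \<in> fx (Xm \<phi> s)" using Suc.prems by (simp_all add: n_def)
  have c: "cpt (Hh \<phi> (n - 1))" by (rule cptX(3)) (use n2 in simp)
  have xW: "x \<in> W" using fxW x by blast
  define x1 where "x1 = avg (Hh \<phi> (n - 1)) x"
  have n1: "1 \<le> n" "1 \<le> n - 1" using n2 by auto
  have x1: "x1 \<in> fx (Hh \<phi> (n - 1))" "x1 \<in> W" "x1 \<in> fx (Hh \<phi> n)" "x1 \<in> fx (Xm \<phi> s)"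
    unfolding x1_def using avg_fx[OF c xW] avg_W[OF c xW]
      avg_fx_normz[OF c x(1), OF Hh_normz_X(3)[OF n1(1)]] avg_normz_fx[OF c cptX(2) Hh_normz_X(2)[OF n1(2)] x(2)] by auto
  have v1: "avg (Xp \<phi> t) x1 = 0" by (rule Suc.IH[OF x1(1)[unfolded nm] x1(4)])
  define y where "y = x - x1"
  have sub: "x - x1 \<in> fx J" if "cpt J" "x \<in> fx J" "x1 \<in> fx J" for J
    using subspace_diff[OF subspace_fx_cpt[OF that(1)] that(2,3)] .
  have y: "y \<in> W" "y \<in> fx (Hh \<phi> n)" "y \<in> fx (Xm \<phi> s)" "avg (Hh \<phi> (n - 1)) y = 0"
    unfolding y_def using W_diff[OF xW x1(2)] sub[OF cptX(3)[OF n1(1)] x(1) x1(3)] sub[OF cptX(2) x(2) x1(4)]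
      avg_diff[OF c xW x1(2)] avg_id[OF c x1(1)] by (auto simp: x1_def)
  have "avg (Xp \<phi> t) y = 0"
  proof (rule vanish_core[OF sc n1(1), where s = s and Q = "\<lambda>y. avg (Hh \<phi> (n - 1)) y = 0"])
    show "avg (Xp \<phi> (k - 1)) y \<noteq> 0" if "y \<in> fx (Xp \<phi> k)" "y \<in> fx (Xm \<phi> (n - k))" "y \<in> fx (Hh \<phi> n)" "avg (Hh \<phi> (n - 1)) y = 0" "y \<noteq> 0" for k y
      by (rule ss_step[OF n2 that(3,1,2,5,4)])
    show "avg (Hh \<phi> (n - 1)) (avg (Xp \<phi> k) y) = 0" if "y \<in> W" "avg (Hh \<phi> (n - 1)) y = 0" for k y
      using avg_commute_normz[OF c cptX(1) Hh_normz_X(1)[OF n1(2)] that(1)] that(2) avg_0[OF cptX(1)] by simp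
  qed (use st n2 y in simp_all)
  moreover have "x = y + x1" by (simp add: y_def)
  ultimately show ?case using avg_add[OF cptX(1) y(1) x1(2)] v1 by simp
qed

end
end

section \<open>Unimodular groups with prescribed depths\<close>

context dvf begin

lemma O1_addP: "x \<in> O1 m \<Longrightarrow> y \<in> P m \<Longrightarrow> x + y \<in> O1 m" "x \<in> O1 m \<Longrightarrow> y \<in> P m \<Longrightarrow> x - y \<in> O1 m"
    "x \<in> O1 m \<Longrightarrow> y \<in> P m \<Longrightarrow> y + x \<in> O1 m"
proof -
  assume a: "x \<in> O1 m" "y \<in> P m"
  have e: "x + y - 1 = (x - 1) + y" "x - y - 1 = (x - 1) - y" "y + x - 1 = (x - 1) + y" by auto
  thus "x + y \<in> O1 m" "x - y \<in> O1 m" "y + x \<in> O1 m" using a P_add[of "x - 1" m y] P_diff[of "x - 1" m y] by (simp_all only: O1_def mem_Collect_eq e)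
qed

lemma O1_P0: "x \<in> O1 m \<Longrightarrow> 1 \<le> m \<Longrightarrow> x \<in> P 0" using O1_un un_P by blast

text \<open>Depths are prescribed entry by entry. The condition \<open>det g = 1\<close> ties the
  third diagonal entry to the others, which \<open>fx_JJ_torus\<close> exploits.\<close>

definition JJ :: "int \<Rightarrow> int \<Rightarrow> int \<Rightarrow> int \<Rightarrow> int \<Rightarrow> int \<Rightarrow> int \<Rightarrow> ('f ^ 3 ^ 3) set" where
  "JJ m k12 k13 k21 k23 k31 k32 = {g. g$1$1 \<in> O1 m \<and> g$2$2 \<in> O1 m \<and> g$3$3 \<in> O1 m \<and>
     g$1$2 \<in> P k12 \<and> g$1$3 \<in> P k13 \<and> g$2$1 \<in> P k21 \<and> g$2$3 \<in> P k23 \<and> g$3$1 \<in> P k31 \<and> g$3$2 \<in> P k32 \<and> det g = 1}"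

lemma JJ_mat3: "mat3 a b c d e f g h i \<in> JJ m k12 k13 k21 k23 k31 k32 \<longleftrightarrow> a \<in> O1 m \<and> e \<in> O1 m \<and> i \<in> O1 m \<and>
   b \<in> P k12 \<and> c \<in> P k13 \<and> d \<in> P k21 \<and> f \<in> P k23 \<and> g \<in> P k31 \<and> h \<in> P k32 \<and> a*e*i + b*f*g + c*d*h - a*f*h - b*d*i - c*e*g = 1"
  by (simp add: JJ_def mat3_det)

lemma JJ_E: assumes "x \<in> JJ m k12 k13 k21 k23 k31 k32"
  obtains a b c d e f g h i where "x = mat3 a b c d e f g h i" "a \<in> O1 m" "e \<in> O1 m" "i \<in> O1 m" "b \<in> P k12" "c \<in> P k13"
    "d \<in> P k21" "f \<in> P k23" "g \<in> P k31" "h \<in> P k32" "a*e*i + b*f*g + c*d*h - a*f*h - b*d*i - c*e*g = 1"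
proof -
  obtain a b c d e f g h i where e: "x = mat3 a b c d e f g h i" by (rule mat3_cases)
  from assms show ?thesis unfolding e JJ_mat3 by (elim conjE) (rule that[OF e])
qed

lemma P_scale: "x \<in> P k \<Longrightarrow> a \<noteq> 0 \<Longrightarrow> b \<noteq> 0 \<Longrightarrow> l \<le> k + v b - v a \<Longrightarrow> x * b / a \<in> P l"
  by (cases "x = 0") (auto simp: P_def v_mult v_divide)

lemma diag_JJ:
  assumes nz: "a \<noteq> 0" "b \<noteq> 0" "c \<noteq> 0" and x: "x \<in> JJ m k12 k13 k21 k23 k31 k32"
    and k: "l12 \<le> k12 + v b - v a" "l13 \<le> k13 + v c - v a" "l21 \<le> k21 + v a - v b"
      "l23 \<le> k23 + v c - v b" "l31 \<le> k31 + v a - v c" "l32 \<le> k32 + v b - v c"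
  shows "inv3 (mat3 a 0 0 0 b 0 0 0 c) ** x ** mat3 a 0 0 0 b 0 0 0 c \<in> JJ m l12 l13 l21 l23 l31 l32"
proof (cases rule: JJ_E[OF x])
  case X: (1 x1 x2 x3 x4 x5 x6 x7 x8 x9)
  have "mat3 a 0 0 0 b 0 0 0 c \<in> GL3" using nz by (simp add: GL3_def mat3_det)
  from det_conj(1)[OF this] have "det (inv3 (mat3 a 0 0 0 b 0 0 0 c) ** x ** mat3 a 0 0 0 b 0 0 0 c) = 1" using x by (simp add: JJ_def)
  thus ?thesis unfolding JJ_def X(1) using X(2-) nz k by (simp add: diag_conj P_scale)
qed

text \<open>Concavity of the depth function along roots whose sum is a root or 0; it gives closure
  under products and inverses.\<close>

definition okJ :: "int \<Rightarrow> int \<Rightarrow> int \<Rightarrow> int \<Rightarrow> int \<Rightarrow> int \<Rightarrow> int \<Rightarrow> bool" where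
  "okJ m k12 k13 k21 k23 k31 k32 \<longleftrightarrow> 1 \<le> m \<and> m \<le> k12 + k21 \<and> m \<le> k13 + k31 \<and> m \<le> k23 + k32 \<and>
     k13 \<le> k12 + k23 \<and> k12 \<le> k13 + k32 \<and> k23 \<le> k21 + k13 \<and> k21 \<le> k23 + k31 \<and> k32 \<le> k31 + k12 \<and> k31 \<le> k32 + k21"

lemma subgrp_JJ: assumes ok: "okJ m k12 k13 k21 k23 k31 k32" shows "subgrp (JJ m k12 k13 k21 k23 k31 k32)"
proof -
  let ?J = "JJ m k12 k13 k21 k23 k31 k32"
  note k = ok[unfolded okJ_def]
  have m: "1 \<le> m" using k by blast
  show ?thesis unfolding subgrp_def
  proof (intro conjI ballI)
    show "?J \<subseteq> GL3" by (auto simp: JJ_def GL3_def)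
    show "mat 1 \<in> ?J" unfolding mat3_1 by (simp add: JJ_mat3)
    fix x assume x: "x \<in> ?J"
    from x obtain a b c d e f g h i where X: "x = mat3 a b c d e f g h i" "a \<in> O1 m" "e \<in> O1 m" "i \<in> O1 m" "b \<in> P k12" "c \<in> P k13"
      "d \<in> P k21" "f \<in> P k23" "g \<in> P k31" "h \<in> P k32" "a*e*i + b*f*g + c*d*h - a*f*h - b*d*i - c*e*g = 1" by (rule JJ_E)
    note X0 = X(2-4)[THEN O1_P0[OF _ m]]
    have "mat3 (e*i - f*h) (c*h - b*i) (b*f - c*e) (f*g - d*i) (a*i - c*g) (c*d - a*f) (d*h - e*g) (b*g - a*h) (a*e - b*d) \<in> ?J"
    proof -
      have "e*i - f*h \<in> O1 m" "a*i - c*g \<in> O1 m" "a*e - b*d \<in> O1 m"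
        by (rule O1_addP(2)[OF O1_mult[OF _ _ m] P_mult'], (rule X)+, use k in linarith)+
      moreover have "c*h - b*i \<in> P k12" "b*f - c*e \<in> P k13" "f*g - d*i \<in> P k21" "c*d - a*f \<in> P k23" "d*h - e*g \<in> P k31" "b*g - a*h \<in> P k32"
        using X X0 k by - (rule P_diff; erule (1) P_mult', linarith)+
      moreover have "det (mat3 (e*i - f*h) (c*h - b*i) (b*f - c*e) (f*g - d*i) (a*i - c*g) (c*d - a*f) (d*h - e*g) (b*g - a*h) (a*e - b*d)) = 1"
      proof -
        have "inv3 x = mat3 (e*i - f*h) (c*h - b*i) (b*f - c*e) (f*g - d*i) (a*i - c*g) (c*d - a*f) (d*h - e*g) (b*g - a*h) (a*e - b*d)"
          unfolding X(1) inv3_mat3 using X(11) by (simp add: mat3_det)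
        moreover have "det (x ** inv3 x) = 1" using inv3(1)[of x] X(11) by (simp add: X(1) mat3_det)
        moreover have "det x = 1" using X(11) by (simp add: X(1) mat3_det)
        ultimately show ?thesis by (simp add: det_mul)
      qed
      ultimately show ?thesis by (simp add: JJ_mat3 mat3_det)
    qed
    moreover have "inv3 x = mat3 (e*i - f*h) (c*h - b*i) (b*f - c*e) (f*g - d*i) (a*i - c*g) (c*d - a*f) (d*h - e*g) (b*g - a*h) (a*e - b*d)"
      unfolding X(1) inv3_mat3 using X(11) by (simp add: mat3_det)
    ultimately show "inv3 x \<in> ?J" by simp
    fix y assume y: "y \<in> ?J"
    from y obtain a' b' c' d' e' f' g' h' i' where Y: "y = mat3 a' b' c' d' e' f' g' h' i'" "a' \<in> O1 m" "e' \<in> O1 m" "i' \<in> O1 m" "b' \<in> P k12" "c' \<in> P k13"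
      "d' \<in> P k21" "f' \<in> P k23" "g' \<in> P k31" "h' \<in> P k32" "a'*e'*i' + b'*f'*g' + c'*d'*h' - a'*f'*h' - b'*d'*i' - c'*e'*g' = 1" by (rule JJ_E)
    note Y0 = Y(2-4)[THEN O1_P0[OF _ m]]
    have "det (x ** y) = 1" using x y by (simp add: det_mul JJ_def)
    moreover have "a*a' + b*d' + c*g' \<in> O1 m" "d*b' + e*e' + f*h' \<in> O1 m" "g*c' + h*f' + i*i' \<in> O1 m"
    proof -
      have "b*d' \<in> P m" "c*g' \<in> P m" "d*b' \<in> P m" "f*h' \<in> P m" "g*c' \<in> P m" "h*f' \<in> P m"
        using X Y k by - (erule (1) P_mult', linarith)+
      moreover have "a*a' \<in> O1 m" "e*e' \<in> O1 m" "i*i' \<in> O1 m" using O1_mult[OF _ _ m] X Y by blast+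
      ultimately show "a*a' + b*d' + c*g' \<in> O1 m" "d*b' + e*e' + f*h' \<in> O1 m" "g*c' + h*f' + i*i' \<in> O1 m"
        by (blast intro: O1_addP P_add)+
    qed
    moreover have "a*b' + b*e' + c*h' \<in> P k12" "a*c' + b*f' + c*i' \<in> P k13" "d*a' + e*d' + f*g' \<in> P k21"
        "d*c' + e*f' + f*i' \<in> P k23" "g*a' + h*d' + i*g' \<in> P k31" "g*b' + h*e' + i*h' \<in> P k32"
      using X X0 Y Y0 k by - (intro P_add; erule (1) P_mult', linarith)+
    ultimately show "x ** y \<in> ?J" unfolding X(1) Y(1) mat3_mult by (simp add: JJ_mat3 mat3_det)
  qed
qed

lemma JJ_intm: "\<exists>c. JJ m k12 k13 k21 k23 k31 k32 \<subseteq> intm c" if m: "1 \<le> m"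
proof (intro exI subsetI)
  fix x assume "x \<in> JJ m k12 k13 k21 k23 k31 k32"
  then obtain a b c d e f g h i where X: "x = mat3 a b c d e f g h i" "a \<in> O1 m" "e \<in> O1 m" "i \<in> O1 m" "b \<in> P k12" "c \<in> P k13"
      "d \<in> P k21" "f \<in> P k23" "g \<in> P k31" "h \<in> P k32" by (rule JJ_E)
  note X0 = X(2-4)[THEN O1_P0[OF _ m]]
  show "x \<in> intm (min 0 (min k12 (min k13 (min k21 (min k23 (min k31 k32))))))"
    unfolding X(1) intm_mat3 using X X0 by (intro conjI) (erule P_mono, linarith)+
qed

text \<open>The factor complementary to \<open>U2\<close> in the Iwahori factorization of
  \<open>JJ\<close>.\<close>

definition JL :: "int \<Rightarrow> int \<Rightarrow> int \<Rightarrow> int \<Rightarrow> int \<Rightarrow> ('f ^ 3 ^ 3) set" where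
  "JL m k12 k21 k31 k32 = {g \<in> JJ m k12 0 k21 0 k31 k32. g$1$3 = 0 \<and> g$2$3 = 0}"

lemma JL_JJ: "JL m k12 k21 k31 k32 \<subseteq> JJ m k12 k13 k21 k23 k31 k32" by (auto simp: JL_def JJ_def)

text \<open>The unipotent radical of type (2,1). Its two coordinates have separate depths because
  the descents enlarge one root group at a time.\<close>

definition U2 :: "int \<Rightarrow> int \<Rightarrow> ('f ^ 3 ^ 3) set" where
  "U2 p l = {mat3 1 0 a 0 1 b 0 0 1 | a b. a \<in> P p \<and> b \<in> P l}"

lemma U2_I: "a \<in> P p \<Longrightarrow> b \<in> P l \<Longrightarrow> mat3 1 0 a 0 1 b 0 0 1 \<in> U2 p l" by (auto simp: U2_def)
lemma U2_mono: "p' \<le> p \<Longrightarrow> l' \<le> l \<Longrightarrow> U2 p l \<subseteq> U2 p' l'" unfolding U2_def using P_mono by blast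
lemma inv3_U2: "inv3 (mat3 1 0 a 0 1 b 0 0 1) = mat3 1 0 (-a) 0 1 (-b) 0 0 1"
  by (rule inv3_unique) (simp add: mat3_mult mat3_1)

lemma subgrp_U2: "subgrp (U2 p l)"
  unfolding subgrp_def
proof (intro conjI ballI)
  show "U2 p l \<subseteq> GL3" by (auto simp: U2_def GL3_def mat3_det)
  show "mat 1 \<in> U2 p l" unfolding mat3_1 by (rule U2_I) simp_all
  fix g assume "g \<in> U2 p l"
  then obtain a b where g: "g = mat3 1 0 a 0 1 b 0 0 1" "a \<in> P p" "b \<in> P l" by (auto simp: U2_def)
  show "inv3 g \<in> U2 p l" unfolding g(1) inv3_U2 by (rule U2_I) (use g in simp_all)
  fix h assume "h \<in> U2 p l"
  then obtain a' b' where h: "h = mat3 1 0 a' 0 1 b' 0 0 1" "a' \<in> P p" "b' \<in> P l" by (auto simp: U2_def)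
  show "g ** h \<in> U2 p l" unfolding g(1) h(1) mat3_mult
    using U2_I[OF P_add[OF g(2) h(2)] P_add[OF g(3) h(3)]] by (simp add: add.commute)
qed

lemma U2_intm: "U2 p l \<subseteq> intm (min 0 (min p l))"
proof
  fix g assume "g \<in> U2 p l"
  then obtain a b where g: "g = mat3 1 0 a 0 1 b 0 0 1" "a \<in> P p" "b \<in> P l" by (auto simp: U2_def)
  show "g \<in> intm (min 0 (min p l))" unfolding g(1) intm_mat3
    using P_mono[OF g(2)] P_mono[OF g(3)] by simp
qed

lemma U2_Xp: "Xp f13 p \<subseteq> U2 p l" "Xp f23 l \<subseteq> U2 p l"
  by (auto simp: Xp_def f13_def f23_def intro!: U2_I)

lemma U2_E: assumes "x \<in> U2 p l" obtains a b where "x = mat3 1 0 a 0 1 b 0 0 1" "a \<in> P p" "b \<in> P l"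
  using assms unfolding U2_def by blast

end

context mrep begin

lemma fx_conj: assumes x: "x \<in> fx J" "J \<subseteq> G" and g: "g \<in> G" and H: "H \<subseteq> G" "\<And>h. h \<in> H \<Longrightarrow> inv3 g ** h ** g \<in> J"
  shows "\<pi> g x \<in> fx H"
proof (rule fxI[OF pi_W[OF g fxW[OF x(1)]]])
  fix h assume h: "h \<in> H"
  hence hG: "h \<in> G" using H by blast
  have cG: "inv3 g ** h ** g \<in> G" using H(2)[OF h] x(2) by blast
  have "\<pi> h (\<pi> g x) = \<pi> g (\<pi> (inv3 g ** h ** g) x)"
  proof (rule pi_eq2[OF _ hG g g cG fxW[OF x(1)]])
    show "h ** g = g ** (inv3 g ** h ** g)"
      using GL3_inv1(1)[OF GD(1)[OF g]] by (simp add: matrix_mul_assoc)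
  qed
  thus "\<pi> h (\<pi> g x) = \<pi> g x" using fxD[OF x(1) H(2)[OF h]] by simp
qed

lemma fx_diff: "cpt J \<Longrightarrow> x \<in> fx J \<Longrightarrow> y \<in> fx J \<Longrightarrow> x - y \<in> fx J"
  using subspace_diff[OF subspace_fx_cpt] .

lemma fx_split: assumes "x \<in> W" "\<And>j. j \<in> H \<Longrightarrow> \<exists>a b. a \<in> G \<and> b \<in> G \<and> j = a ** b \<and> \<pi> a x = x \<and> \<pi> b x = x"
  shows "x \<in> fx H"
proof (rule fxI[OF assms(1)])
  fix j assume "j \<in> H"
  then obtain a b where ab: "a \<in> G" "b \<in> G" "j = a ** b" "\<pi> a x = x" "\<pi> b x = x" using assms(2) by blast
  show "\<pi> j x = x" unfolding ab(3) using pi_mult[OF ab(1,2) assms(1)] ab by simp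
qed

end

locale gl3 = mrep v q smul G W \<pi>
  for v :: "'f::field \<Rightarrow> int" and q and smul :: "complex \<Rightarrow> 'v::ab_group_add \<Rightarrow> 'v" (infixr "\<odot>" 75)
    and G and W :: "'v set" and \<pi> +
  assumes GG: "G = GL3"
begin

lemma cpt_JJ: "okJ m k12 k13 k21 k23 k31 k32 \<Longrightarrow> cpt (JJ m k12 k13 k21 k23 k31 k32)"
  unfolding cpt_def using subgrp_JJ[of m k12 k13 k21 k23 k31 k32] JJ_intm[of m k12 k13 k21 k23 k31 k32]
  unfolding GG subgrp_def okJ_def by blast

lemma cpt_U2: "cpt (U2 p l)"
  unfolding cpt_def using subgrp_U2[of p l] U2_intm[of p l] unfolding GG subgrp_def by blast

lemma JJ_G: "JJ m k12 k13 k21 k23 k31 k32 \<subseteq> G" by (auto simp: GG GL3_def JJ_def)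
lemma JL_G: "JL m k12 k21 k31 k32 \<subseteq> G" using JJ_G unfolding JL_def by blast
lemma U2_G: "U2 p l \<subseteq> G" using cpt_U2 by (auto simp: cpt_def)
lemma mG: "det g \<noteq> 0 \<Longrightarrow> g \<in> G" by (simp add: GG GL3_def)

lemma fx_diag:
  assumes y: "y \<in> fx (JJ m k12 k13 k21 k23 k31 k32)" and nz: "a \<noteq> 0" "b \<noteq> 0" "c \<noteq> 0"
    and k: "k12 \<le> l12 + v b - v a" "k13 \<le> l13 + v c - v a" "k21 \<le> l21 + v a - v b"
      "k23 \<le> l23 + v c - v b" "k31 \<le> l31 + v a - v c" "k32 \<le> l32 + v b - v c"
  shows "\<pi> (mat3 a 0 0 0 b 0 0 0 c) y \<in> fx (JJ m l12 l13 l21 l23 l31 l32)"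
  by (rule fx_conj[OF y JJ_G _ JJ_G diag_JJ[OF nz _ k]]) (simp_all add: mG mat3_det nz)

text \<open>Iwahori factorization: for \<open>g\<close> in the larger group and \<open>u\<close> in the unipotent radical,
  \<open>g u = u' m\<close> where \<open>u'\<close> is read off from the third column of \<open>g u\<close>.\<close>

lemma avg_U2_fx:
  assumes y: "y \<in> fx (JL m k12 k21 k31 k32)" and m: "1 \<le> m"
    and K: "k12 \<le> K12" "k21 \<le> K21" "k31 \<le> K31" "k32 \<le> K32" "p \<le> K12 + l" "l \<le> K21 + p"
      "m \<le> p + K31" "m \<le> l + K32" "k12 \<le> p + K32" "k21 \<le> l + K31"
  shows "avg (U2 p l) y \<in> fx (JJ m K12 p K21 l K31 K32)"
proof (rule fxI[OF avg_W[OF cpt_U2 fxW[OF y]]])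
  fix x assume x: "x \<in> JJ m K12 p K21 l K31 K32"
  have xG: "x \<in> G" using JJ_G x by blast
  obtain a b c d e f g h i where X: "x = mat3 a b c d e f g h i" "a \<in> O1 m" "e \<in> O1 m" "i \<in> O1 m" "b \<in> P K12" "c \<in> P p"
      "d \<in> P K21" "f \<in> P l" "g \<in> P K31" "h \<in> P K32" "a*e*i + b*f*g + c*d*h - a*f*h - b*d*i - c*e*g = 1" by (rule JJ_E[OF x])
  note X0 = X(2-4)[THEN O1_P0[OF _ m]]
  show "\<pi> x (avg (U2 p l) y) = avg (U2 p l) y"
  proof (rule avg_perm[OF cpt_U2 fxW[OF y] xG])
    fix u assume u: "u \<in> U2 p l"
    then obtain s t where st: "u = mat3 1 0 s 0 1 t 0 0 1" "s \<in> P p" "t \<in> P l" by (rule U2_E)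
    define r where "r = g * s + h*t + i"
    have r: "r \<in> O1 m" unfolding r_def
      by (rule O1_addP(3)[OF X(4) P_add[OF P_mult'[OF X(9) st(2)] P_mult'[OF X(10) st(3)]]]) (use K in linarith)+
    have ru: "r \<in> un" by (rule O1_un[OF r m])
    have r0: "r \<noteq> 0" by (rule un_nz[OF ru])
    define s' t' where "s' = (a * s + b*t + c) / r" and "t' = (d * s + e*t + f) / r"
    have s': "s' \<in> P p" unfolding s'_def P_divide_un[OF ru]
      by (intro P_add P_mult'[OF X0(1) st(2)] P_mult'[OF X(5) st(3)] X(6)) (use K in linarith)+
    have t': "t' \<in> P l" unfolding t'_def P_divide_un[OF ru]
      by (intro P_add P_mult'[OF X(7) st(2)] P_mult'[OF X0(2) st(3)] X(8)) (use K in linarith)+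
    define n where "n = mat3 (a - s'*g) (b - s'*h) 0 (d - t'*g) (e - t'*h) 0 g h r"
    have eq: "x ** u = mat3 1 0 s' 0 1 t' 0 0 1 ** n"
      unfolding X(1) st(1) n_def mat3_mult mat3_eq using r0 by (simp add: s'_def t'_def r_def)
    have u': "mat3 1 0 s' 0 1 t' 0 0 1 \<in> U2 p l" using U2_I s' t' .
    have "det x * det u = det (mat3 1 0 s' 0 1 t' 0 0 1) * det n" using eq by (metis det_mul)
    moreover have "det x = 1" using x by (simp add: JJ_def)
    ultimately have dn: "det n = 1" by (simp add: st(1) mat3_det[of 1])
    have "n \<in> JL m k12 k21 k31 k32"
    proof -
      have "a - s'*g \<in> O1 m" by (rule O1_addP(2)[OF X(2) P_mult'[OF s' X(9)]]) (use K in linarith)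
      moreover have "e - t'*h \<in> O1 m" by (rule O1_addP(2)[OF X(3) P_mult'[OF t' X(10)]]) (use K in linarith)
      moreover have "b - s'*h \<in> P k12" by (rule P_diff[OF P_mono[OF X(5)] P_mult'[OF s' X(10)]]) (use K in linarith)+
      moreover have "d - t'*g \<in> P k21" by (rule P_diff[OF P_mono[OF X(7)] P_mult'[OF t' X(9)]]) (use K in linarith)+
      moreover have "g \<in> P k31" by (rule P_mono[OF X(9)]) (use K in linarith)
      moreover have "h \<in> P k32" by (rule P_mono[OF X(10)]) (use K in linarith)
      ultimately show ?thesis using dn r unfolding JL_def JJ_def by (simp add: n_def)
    qed
    hence n: "n \<in> G" "\<pi> n y = y" using JL_G fxD[OF y] by blast+
    have "\<pi> x (\<pi> u y) = \<pi> (mat3 1 0 s' 0 1 t' 0 0 1) (\<pi> n y)"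
      by (rule pi_eq2[OF eq xG _ _ n(1) fxW[OF y]]) (use u u' U2_G in blast)+
    thus "\<exists>u'\<in>U2 p l. \<pi> x (\<pi> u y) = \<pi> u' y" using u' n(2) by auto
  qed
qed

lemma JJ_JL_fx: "y \<in> fx (JJ m k12 k13 k21 k23 k31 k32) \<Longrightarrow> y \<in> fx (JL m k12 k21 k31 k32)"
  by (erule fx_anti, rule JL_JJ)

text \<open>The radical is abelian, so the coordinate that fixes \<open>y\<close> can be moved next
  to \<open>y\<close> and absorbed.\<close>

lemma avg_U2_X: assumes "y \<in> W"
  shows "y \<in> fx (Xp f23 l) \<Longrightarrow> avg (U2 p l) y = avg (Xp f13 p) y"
    "y \<in> fx (Xp f13 p) \<Longrightarrow> avg (U2 p l) y = avg (Xp f23 l) y"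
proof -
  have u: "\<pi> (mat3 1 0 a 0 1 b 0 0 1) y = \<pi> (mat3 1 0 a 0 1 0 0 0 1) (\<pi> (mat3 1 0 0 0 1 b 0 0 1) y)"
    "\<pi> (mat3 1 0 a 0 1 b 0 0 1) y = \<pi> (mat3 1 0 0 0 1 b 0 0 1) (\<pi> (mat3 1 0 a 0 1 0 0 0 1) y)" for a b
    by (subst pi_mult[OF mG mG assms, symmetric]; simp add: mat3_det mat3_mult)+
  have X: "\<exists>a b. h = mat3 1 0 a 0 1 b 0 0 1 \<and> mat3 1 0 a 0 1 0 0 0 1 \<in> Xp f13 p \<and> mat3 1 0 0 0 1 b 0 0 1 \<in> Xp f23 l" if "h \<in> U2 p l" for h
    using that by (rule U2_E) (auto simp: Xp_def f13_def f23_def)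
  show "avg (U2 p l) y = avg (Xp f13 p) y" if y: "y \<in> fx (Xp f23 l)"
  proof (rule avg_eqI)
    show "\<exists>j\<in>Xp f13 p. \<pi> h y = \<pi> j y" if "h \<in> U2 p l" for h
      using X[OF that] fxD[OF y] u(1) by metis
  qed (use U2_Xp(1) in blast)
  show "avg (U2 p l) y = avg (Xp f23 l) y" if y: "y \<in> fx (Xp f13 p)"
  proof (rule avg_eqI)
    show "\<exists>j\<in>Xp f23 l. \<pi> h y = \<pi> j y" if "h \<in> U2 p l" for h
      using X[OF that] fxD[OF y] u(2) by metis
  qed (use U2_Xp(2) in blast)
qed

lemma fx_JJ_ext:
  assumes "y \<in> fx J" "J \<subseteq> G" "y \<in> fx X" "X \<subseteq> G" "\<And>x. x \<in> H \<Longrightarrow> \<exists>e\<in>X. \<exists>z\<in>J. x = e ** z"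
  shows "y \<in> fx H"
proof (rule fx_split[OF fxW[OF assms(1)]])
  fix x assume "x \<in> H"
  then obtain e z where "e \<in> X" "z \<in> J" "x = e ** z" using assms(5) by blast
  thus "\<exists>a b. a \<in> G \<and> b \<in> G \<and> x = a ** b \<and> \<pi> a y = y \<and> \<pi> b y = y" using assms(1-4) fxD by blast
qed

text \<open>A row operation with the (2,2) entry as pivot clears the (1,2) entry, and an entry 0
  satisfies any depth; so the larger group is generated by \<open>Xp f12 i\<close> and the old
  one.\<close>

lemma fx_JJ_12:
  assumes y: "y \<in> fx (JJ m k12 k13 k21 k23 k31 k32)" "y \<in> fx (Xp f12 i)"
    and k: "1 \<le> m" "m \<le> i + k21" "k13 \<le> i + k23"
  shows "y \<in> fx (JJ m i k13 k21 k23 k31 k32)"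
proof (rule fx_JJ_ext[OF y(1) JJ_G y(2)])
  fix x assume x: "x \<in> JJ m i k13 k21 k23 k31 k32"
  obtain a b c d e f g h j where X: "x = mat3 a b c d e f g h j" "a \<in> O1 m" "e \<in> O1 m" "j \<in> O1 m" "b \<in> P i" "c \<in> P k13"
      "d \<in> P k21" "f \<in> P k23" "g \<in> P k31" "h \<in> P k32" "a*e*j + b*f*g + c*d*h - a*f*h - b*d*j - c*e*g = 1" by (rule JJ_E[OF x])
  have eu: "e \<in> un" using O1_un[OF X(3) k(1)] .
  define t where "t = b / e"
  have t: "t \<in> P i" using X(5) P_divide_un[OF eu] by (simp add: t_def)
  define z where "z = mat3 (a - t*d) 0 (c - t*f) d e f g h j"
  have eq: "x = mat3 1 t 0 0 1 0 0 0 1 ** z" unfolding X(1) z_def mat3_mult mat3_eq using un_nz[OF eu] by (simp add: t_def)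
  have "det x = det (mat3 1 t 0 0 1 0 0 0 1) * det z" unfolding eq det_mul ..
  hence "det z = 1" using x by (simp add: JJ_def mat3_det[of 1])
  moreover have "a - t*d \<in> O1 m" by (rule O1_addP(2)[OF X(2) P_mult'[OF t X(7)]]) (use k in linarith)
  moreover have "c - t*f \<in> P k13" by (rule P_diff[OF X(6) P_mult'[OF t X(8)]]) (use k in linarith)
  ultimately have z: "z \<in> JJ m k12 k13 k21 k23 k31 k32" using X by (simp add: JJ_def z_def)
  have "mat3 1 t 0 0 1 0 0 0 1 \<in> Xp f12 i" using t by (auto simp: Xp_def f12_def)
  thus "\<exists>e\<in>Xp f12 i. \<exists>z\<in>JJ m k12 k13 k21 k23 k31 k32. x = e ** z" using eq z by blast
qed (auto simp: Xp_def f12_def mG mat3_det)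

lemma fx_JJ_21:
  assumes y: "y \<in> fx (JJ m k12 k13 k21 k23 k31 k32)" "y \<in> fx (Xm f12 i)"
    and k: "1 \<le> m" "m \<le> i + k12" "k23 \<le> i + k13"
  shows "y \<in> fx (JJ m k12 k13 i k23 k31 k32)"
proof (rule fx_JJ_ext[OF y(1) JJ_G y(2)])
  fix x assume x: "x \<in> JJ m k12 k13 i k23 k31 k32"
  obtain a b c d e f g h j where X: "x = mat3 a b c d e f g h j" "a \<in> O1 m" "e \<in> O1 m" "j \<in> O1 m" "b \<in> P k12" "c \<in> P k13"
      "d \<in> P i" "f \<in> P k23" "g \<in> P k31" "h \<in> P k32" "a*e*j + b*f*g + c*d*h - a*f*h - b*d*j - c*e*g = 1" by (rule JJ_E[OF x])
  have au: "a \<in> un" using O1_un[OF X(2) k(1)] .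
  define t where "t = d / a"
  have t: "t \<in> P i" using X(7) P_divide_un[OF au] by (simp add: t_def)
  define z where "z = mat3 a b c 0 (e - t*b) (f - t*c) g h j"
  have eq: "x = mat3 1 0 0 t 1 0 0 0 1 ** z" unfolding X(1) z_def mat3_mult mat3_eq using un_nz[OF au] by (simp add: t_def)
  have "det x = det (mat3 1 0 0 t 1 0 0 0 1) * det z" unfolding eq det_mul ..
  hence "det z = 1" using x by (simp add: JJ_def mat3_det[of 1])
  moreover have "e - t*b \<in> O1 m" by (rule O1_addP(2)[OF X(3) P_mult'[OF t X(5)]]) (use k in linarith)
  moreover have "f - t*c \<in> P k23" by (rule P_diff[OF X(8) P_mult'[OF t X(6)]]) (use k in linarith)
  ultimately have z: "z \<in> JJ m k12 k13 k21 k23 k31 k32" using X by (simp add: JJ_def z_def)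
  have "mat3 1 0 0 t 1 0 0 0 1 \<in> Xm f12 i" using t by (auto simp: Xm_def f12_def)
  thus "\<exists>e\<in>Xm f12 i. \<exists>z\<in>JJ m k12 k13 k21 k23 k31 k32. x = e ** z" using eq z by blast
qed (auto simp: Xm_def f12_def mG mat3_det)

text \<open>Dividing by a diagonal matrix makes the first two diagonal entries 1. The determinant
  then puts the third into \<open>1 + P n\<close>, because all other terms of its expansion lie in
  \<open>P n\<close> by the depth conditions.\<close>

lemma fx_JJ_torus:
  assumes y: "y \<in> fx (JJ n k12 k13 k21 k23 k31 k32)" "y \<in> fx (Hh f12 m)" "y \<in> fx (Hh f13 m)"
    and ok: "okJ n k12 k13 k21 k23 k31 k32" and m: "1 \<le> m"
  shows "y \<in> fx (JJ m k12 k13 k21 k23 k31 k32)"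
proof (rule fx_split[OF fxW[OF y(1)]])
  note k = ok[unfolded okJ_def]
  fix x assume x: "x \<in> JJ m k12 k13 k21 k23 k31 k32"
  obtain a b c d e f g h j where X: "x = mat3 a b c d e f g h j" "a \<in> O1 m" "e \<in> O1 m" "j \<in> O1 m" "b \<in> P k12" "c \<in> P k13"
      "d \<in> P k21" "f \<in> P k23" "g \<in> P k31" "h \<in> P k32" "a*e*j + b*f*g + c*d*h - a*f*h - b*d*j - c*e*g = 1" by (rule JJ_E[OF x])
  have au: "a \<in> un" and eu: "e \<in> un" and ju: "j \<in> un" using O1_un X m by blast+
  note nz = un_nz[OF au] un_nz[OF eu]
  have aeO: "a*e \<in> O1 m" "1/e \<in> O1 m" using O1_mult[OF X(2,3) m] O1_divide[OF O1_1 X(3) m] by auto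
  define z where "z = mat3 1 (b/a) (c/a) (d/e) 1 (f/e) (g*(a*e)) (h*(a*e)) (j*(a*e))"
  have ae: "a*e \<in> un" using un_mult[OF au eu] .
  have eq: "x = (mat3 (1/e) 0 0 0 e 0 0 0 1 ** mat3 (a*e) 0 0 0 1 0 0 0 (1/(a*e))) ** z"
    unfolding X(1) z_def mat3_mult mat3_eq using nz by simp
  have "det x = det (mat3 (1/e) 0 0 0 e 0 0 0 1) * det (mat3 (a*e) 0 0 0 1 0 0 0 (1/(a*e))) * det z" unfolding eq det_mul ..
  hence dz: "det z = 1" using x nz by (simp add: JJ_def mat3_det[of _ 0 0 0])
  have E: "b/a \<in> P k12" "c/a \<in> P k13" "d/e \<in> P k21" "f/e \<in> P k23" "g*(a*e) \<in> P k31" "h*(a*e) \<in> P k32"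
    using X P_divide_un[OF au] P_divide_un[OF eu] P_mult_un(1)[OF ae] by simp_all
  have jP: "j*(a*e) \<in> P 0" using un_P[OF un_mult[OF ju ae]] .
  have "j*(a*e) = 1 - (b/a)*(f/e)*(g*(a*e)) - (c/a)*(d/e)*(h*(a*e)) + (f/e)*(h*(a*e)) + (b/a)*(d/e)*(j*(a*e)) + (c/a)*(g*(a*e))"
    using dz unfolding z_def mat3_det by (simp add: algebra_simps)
  also have "\<dots> \<in> O1 n"
  proof -
    have 1: "(b/a)*(f/e) \<in> P k13" "(c/a)*(d/e) \<in> P k23" "(b/a)*(d/e) \<in> P n"
      using P_mult'[OF E(1,4)] P_mult'[OF E(2,3)] P_mult'[OF E(1,3)] k by (simp_all add: add.commute)
    have "(b/a)*(f/e)*(g*(a*e)) \<in> P n" "(c/a)*(d/e)*(h*(a*e)) \<in> P n" "(f/e)*(h*(a*e)) \<in> P n"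
      "(b/a)*(d/e)*(j*(a*e)) \<in> P n" "(c/a)*(g*(a*e)) \<in> P n"
      using P_mult'[OF 1(1) E(5), of n] P_mult'[OF 1(2) E(6), of n] P_mult'[OF E(4,6), of n] P_mult'[OF 1(3) jP, of n] P_mult'[OF E(2,5), of n] k by simp_all
    thus ?thesis by (intro O1_addP(1,2)) simp_all
  qed
  finally have "z \<in> JJ n k12 k13 k21 k23 k31 k32" using E dz by (simp add: JJ_def z_def)
  hence z: "z \<in> G" "\<pi> z y = y" using JJ_G fxD[OF y(1)] by blast+
  have h12: "mat3 (1/e) 0 0 0 e 0 0 0 1 \<in> Hh f12 m" using aeO nz by (auto simp: Hh_def f12_def intro!: image_eqI[of _ _ "1/e"])
  have h13: "mat3 (a*e) 0 0 0 1 0 0 0 (1/(a*e)) \<in> Hh f13 m" using aeO nz by (auto simp: Hh_def f13_def intro!: image_eqI[of _ _ "a*e"])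
  have hG: "mat3 (1/e) 0 0 0 e 0 0 0 1 \<in> G" "mat3 (a*e) 0 0 0 1 0 0 0 (1/(a*e)) \<in> G" using nz by (simp_all add: mG mat3_det)
  have "\<pi> (mat3 (1/e) 0 0 0 e 0 0 0 1 ** mat3 (a*e) 0 0 0 1 0 0 0 (1/(a*e))) y = y"
    using pi_mult[OF hG fxW[OF y(1)]] fxD[OF y(2) h12] fxD[OF y(3) h13] by simp
  thus "\<exists>a b. a \<in> G \<and> b \<in> G \<and> x = a ** b \<and> \<pi> a y = y \<and> \<pi> b y = y"
    using eq z GD(3)[OF hG] by blast
qed

end

section \<open>Descent for cuspidal representations\<close>

context dvf begin

text \<open>The maximal compact subgroup of the Levi factor; it normalizes every depth group that
  treats the first two coordinates alike.\<close>

definition LR :: "('f ^ 3 ^ 3) set" where "LR = LG \<inter> Kmax v"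

lemma LR_I: "a \<in> P 0 \<Longrightarrow> b \<in> P 0 \<Longrightarrow> c \<in> P 0 \<Longrightarrow> d \<in> P 0 \<Longrightarrow> a*d - b*c \<in> un \<Longrightarrow> e \<in> un \<Longrightarrow> mat3 a b 0 c d 0 0 0 e \<in> LR"
  using un_mult[of "a*d - b*c" e] un_P[of e] un_nz[of e] un_nz[of "a*d - b*c"]
  unfolding LR_def Int_iff LG_mat3 Kmax_iff intm_mat3 by (simp add: mat3_det left_diff_distrib)

lemma LR_E: assumes "g \<in> LR"
  obtains a b c d e where "g = mat3 a b 0 c d 0 0 0 e" "a \<in> P 0" "b \<in> P 0" "c \<in> P 0" "d \<in> P 0" "a*d - b*c \<in> un" "e \<in> un"
proof -
  have gL: "g \<in> LG" using assms by (simp add: LR_def)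
  obtain a b c d e where g: "g = mat3 a b 0 c d 0 0 0 e" "a*d - b*c \<noteq> 0" "e \<noteq> 0" by (rule LG_E[OF gL])
  have k: "a \<in> P 0" "b \<in> P 0" "c \<in> P 0" "d \<in> P 0" "e \<in> P 0" "(a*d - b*c)*e \<in> un"
    using assms unfolding LR_def Int_iff Kmax_iff g(1) intm_mat3 by (simp_all add: mat3_det left_diff_distrib)
  have "a*d - b*c \<in> P 0" using P_diff[OF P_mult[OF k(1,4)] P_mult[OF k(2,3)]] by simp
  hence "a*d - b*c \<in> un" "e \<in> un" using k(5,6) g(2,3) by (auto simp: un_def P_def v_mult)
  thus ?thesis using that g(1) k by blast
qed

lemma subgrp_LR: "subgrp LR" unfolding LR_def by (rule subgrp_Int[OF subgrp_patterns(2) subgrp_Kmax])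
lemma LR_inv: "g \<in> LR \<Longrightarrow> inv3 g \<in> LR" by (rule subgrp_D(4)[OF subgrp_LR])
lemma LR_Kmax: "g \<in> LR \<Longrightarrow> g \<in> Kmax v" by (simp add: LR_def)

lemma LR_conj_JJ:
  assumes g: "g \<in> LR" and x: "x \<in> JJ n n k n k s s" and n: "1 \<le> n"
  shows "g ** x ** inv3 g \<in> JJ n n k n k s s"
proof (cases rule: JJ_E[OF x])
  case X: (1 x1 x2 x3 x4 x5 x6 x7 x8 x9)
  obtain a b c d e where G: "g = mat3 a b 0 c d 0 0 0 e" "a \<in> P 0" "b \<in> P 0" "c \<in> P 0" "d \<in> P 0" "a*d - b*c \<in> un" "e \<in> un"
    by (rule LR_E[OF g])
  obtain A B C D E where H: "inv3 g = mat3 A B 0 C D 0 0 0 E" "A \<in> P 0" "B \<in> P 0" "C \<in> P 0" "D \<in> P 0" "A*D - B*C \<in> un" "E \<in> un"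
    by (rule LR_E[OF LR_inv[OF g]])
  have gG: "g \<in> GL3" using LR_Kmax[OF g] by (rule Kmax_GL3)
  have "g ** inv3 g = mat 1" by (rule GL3_inv1(1)[OF gG])
  hence rel: "a*A + b*C = 1" "a*B + b*D = 0" "c*A + d*C = 0" "c*B + d*D = 1" "e*E = 1"
    unfolding H(1) unfolding G(1) mat3_mult mat3_1 mat3_eq by simp_all
  \<comment> \<open>Subtracting 1 on the diagonal isolates the identity matrix, whose conjugate is
    controlled by the relations \<open>rel\<close>.\<close>
  define y1 y5 where "y1 = x1 - 1" and "y5 = x5 - 1"
  have y: "y1 \<in> P n" "y5 \<in> P n" "x1 = y1 + 1" "x5 = y5 + 1" using X(2,3) by (simp_all add: y1_def y5_def O1_def)
  have m1: "u * z * w \<in> P j" if "z \<in> P j" "u \<in> P 0" "w \<in> P 0" for u z w j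
    using P_mult[OF P_mult[OF that(2,1)] that(3)] by simp
  have det: "det (g ** x ** inv3 g) = 1" using det_conj(2)[OF gG] x by (simp add: JJ_def)
  have e11: "(a*x1 + b*x4)*A + (a*x2 + b*x5)*C - 1 = a*y1*A + b*x4*A + a*x2*C + b*y5*C"
    unfolding y(3,4) using rel(1) by algebra
  have e22: "(c*x1 + d*x4)*B + (c*x2 + d*x5)*D - 1 = c*y1*B + d*x4*B + c*x2*D + d*y5*D"
    unfolding y(3,4) using rel(4) by algebra
  have e12: "(a*x1 + b*x4)*B + (a*x2 + b*x5)*D = a*y1*B + b*x4*B + a*x2*D + b*y5*D"
    unfolding y(3,4) using rel(2) by algebra
  have e21: "(c*x1 + d*x4)*A + (c*x2 + d*x5)*C = c*y1*A + d*x4*A + c*x2*C + d*y5*C"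
    unfolding y(3,4) using rel(3) by algebra
  have eP: "e \<in> P 0" "E \<in> P 0" using un_P G(7) H(7) by blast+
  have m: "g ** x ** inv3 g = mat3 ((a*x1 + b*x4)*A + (a*x2 + b*x5)*C) ((a*x1 + b*x4)*B + (a*x2 + b*x5)*D) ((a*x3+b*x6)*E)
     ((c*x1 + d*x4)*A + (c*x2 + d*x5)*C) ((c*x1 + d*x4)*B + (c*x2 + d*x5)*D) ((c*x3+d*x6)*E)
     (e*x7*A+e*x8*C) (e*x7*B+e*x8*D) (e*x9*E)" unfolding H(1) unfolding G(1) X(1) mat3_mult mat3_eq by simp
  have x9: "e*x9*E = x9" using rel(5) by (simp add: mult.commute mult.left_commute)
  have "(a*x3+b*x6)*E \<in> P k" "(c*x3+d*x6)*E \<in> P k" unfolding distrib_right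
    by (intro P_add m1 X eP G)+
  moreover have "e*x7*A+e*x8*C \<in> P s" "e*x7*B+e*x8*D \<in> P s" by (intro P_add m1 X eP H)+
  moreover have "(a*x1 + b*x4)*A + (a*x2 + b*x5)*C \<in> O1 n" "(c*x1 + d*x4)*B + (c*x2 + d*x5)*D \<in> O1 n"
    unfolding O1_def mem_Collect_eq e11 e22 by (intro P_add m1 X y G H)+
  moreover have "(a*x1 + b*x4)*B + (a*x2 + b*x5)*D \<in> P n" "(c*x1 + d*x4)*A + (c*x2 + d*x5)*C \<in> P n"
    unfolding e12 e21 by (intro P_add m1 X y G H)+
  ultimately show ?thesis using X(4) det unfolding JJ_def by (simp add: m x9)
qed

lemma LR_conj_U2: assumes g: "g \<in> LR" and x: "x \<in> U2 k k" shows "g ** x ** inv3 g \<in> U2 k k"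
proof -
  obtain a b c d e where G: "g = mat3 a b 0 c d 0 0 0 e" "a \<in> P 0" "b \<in> P 0" "c \<in> P 0" "d \<in> P 0" "a*d - b*c \<in> un" "e \<in> un"
    by (rule LR_E[OF g])
  obtain s t where st: "x = mat3 1 0 s 0 1 t 0 0 1" "s \<in> P k" "t \<in> P k" by (rule U2_E[OF x])
  define s' t' where "s' = (a * s + b*t)/e" and "t' = (c * s + d*t)/e"
  have P: "s' \<in> P k" "t' \<in> P k" unfolding s'_def t'_def P_divide_un[OF G(7)]
    using P_mult[OF G(2) st(2)] P_mult[OF G(3) st(3)] P_mult[OF G(4) st(2)] P_mult[OF G(5) st(3)] by (simp_all add: P_add)
  have "g ** x = mat3 1 0 s' 0 1 t' 0 0 1 ** g" unfolding G(1) st(1) mat3_mult mat3_eq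
    using un_nz[OF G(7)] by (simp add: s'_def t'_def)
  hence "g ** x ** inv3 g = mat3 1 0 s' 0 1 t' 0 0 1" using GL3_inv1(1)[OF Kmax_GL3[OF LR_Kmax[OF g]]]
    by (simp add: matrix_mul_assoc[symmetric])
  thus ?thesis using U2_I[OF P] by simp
qed

definition Ub :: "int \<Rightarrow> ('f ^ 3 ^ 3) set" where
  "Ub s = {mat3 1 0 0 0 1 0 a b 1 | a b. a \<in> P s \<and> b \<in> P s}"

lemma Ub_I: "a \<in> P s \<Longrightarrow> b \<in> P s \<Longrightarrow> mat3 1 0 0 0 1 0 a b 1 \<in> Ub s" by (auto simp: Ub_def)
lemma Ub_E: assumes "x \<in> Ub s" obtains a b where "x = mat3 1 0 0 0 1 0 a b 1" "a \<in> P s" "b \<in> P s"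
  using assms unfolding Ub_def by blast

lemma LR_conj_Ub: assumes g: "g \<in> LR" and x: "x \<in> Ub k" shows "inv3 g ** x ** g \<in> Ub k"
proof -
  obtain a b c d e where G: "g = mat3 a b 0 c d 0 0 0 e" "a \<in> P 0" "b \<in> P 0" "c \<in> P 0" "d \<in> P 0" "a*d - b*c \<in> un" "e \<in> un"
    by (rule LR_E[OF g])
  obtain s t where st: "x = mat3 1 0 0 0 1 0 s t 1" "s \<in> P k" "t \<in> P k" by (rule Ub_E[OF x])
  define s' t' where "s' = (s * a + t * c)/e" and "t' = (s * b + t * d)/e"
  have P: "s' \<in> P k" "t' \<in> P k" unfolding s'_def t'_def P_divide_un[OF G(7)]
    using P_mult[OF st(2) G(2)] P_mult[OF st(2) G(3)] P_mult[OF st(3) G(4)] P_mult[OF st(3) G(5)] by (simp_all add: P_add)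
  have "x ** g = g ** mat3 1 0 0 0 1 0 s' t' 1" unfolding G(1) st(1) mat3_mult mat3_eq
    using un_nz[OF G(7)] by (simp add: s'_def t'_def)
  hence "inv3 g ** x ** g = mat3 1 0 0 0 1 0 s' t' 1" using GL3_cancel(1)[OF Kmax_GL3[OF LR_Kmax[OF g]]]
    by (simp add: matrix_mul_assoc[symmetric])
  thus ?thesis using Ub_I[OF P] by simp
qed

lemma inv3_Ub: "inv3 (mat3 1 0 0 0 1 0 a b 1) = mat3 1 0 0 0 1 0 (-a) (-b) 1"
  by (rule inv3_unique) (simp add: mat3_mult mat3_1)

lemma subgrp_Ub: "subgrp (Ub s)"
  unfolding subgrp_def
proof (intro conjI ballI)
  show "Ub s \<subseteq> GL3" by (auto simp: Ub_def GL3_def mat3_det)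
  show "mat 1 \<in> Ub s" unfolding mat3_1 by (rule Ub_I) simp_all
  fix g assume "g \<in> Ub s"
  then obtain a b where g: "g = mat3 1 0 0 0 1 0 a b 1" "a \<in> P s" "b \<in> P s" by (rule Ub_E)
  show "inv3 g \<in> Ub s" unfolding g(1) inv3_Ub by (rule Ub_I) (use g in simp_all)
  fix h assume "h \<in> Ub s"
  then obtain a' b' where h: "h = mat3 1 0 0 0 1 0 a' b' 1" "a' \<in> P s" "b' \<in> P s" by (rule Ub_E)
  show "g ** h \<in> Ub s" unfolding g(1) h(1) mat3_mult
    using Ub_I[OF P_add[OF g(2) h(2)] P_add[OF g(3) h(3)]] by simp
qed

lemma Ub_intm: "Ub s \<subseteq> intm (min 0 s)"
proof
  fix g assume "g \<in> Ub s"
  then obtain a b where g: "g = mat3 1 0 0 0 1 0 a b 1" "a \<in> P s" "b \<in> P s" by (rule Ub_E)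
  show "g \<in> intm (min 0 s)" unfolding g(1) intm_mat3
    using P_mono[OF g(2)] P_mono[OF g(3)] by simp
qed

lemma Ub_JJ: "1 \<le> m \<Longrightarrow> Ub s \<subseteq> JJ m k12 k13 k21 k23 s s" by (auto simp: JJ_mat3 elim!: Ub_E)

text \<open>What is left of \<open>Ub (n - k)\<close> after it is moved past a (1,3) root element of
  exact valuation k - 1: a (1,3) torus element and a (1,2) root element. The maximum with 1 matters
  for n = 1, where \<open>u\<close> must still be congruent to 1.\<close>

definition Cg :: "int \<Rightarrow> ('f ^ 3 ^ 3) set" where
  "Cg n = {mat3 u z 0 0 1 0 0 0 (1/u) | u z. u \<in> O1 (max 1 (n - 1)) \<and> z \<in> P (n - 1)}"

lemma Cg_I: "u \<in> O1 (max 1 (n - 1)) \<Longrightarrow> z \<in> P (n - 1) \<Longrightarrow> w = 1/u \<Longrightarrow> mat3 u z 0 0 1 0 0 0 w \<in> Cg n" by (auto simp: Cg_def)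
lemma Cg_E: assumes "x \<in> Cg n" obtains u z where "x = mat3 u z 0 0 1 0 0 0 (1/u)" "u \<in> O1 (max 1 (n - 1))" "z \<in> P (n - 1)" "u \<in> un"
proof -
  obtain u z where "x = mat3 u z 0 0 1 0 0 0 (1/u)" "u \<in> O1 (max 1 (n - 1))" "z \<in> P (n - 1)" using assms unfolding Cg_def by blast
  thus ?thesis using that O1_un[of u "max 1 (n - 1)"] by simp
qed

lemma Cg_LR: "1 \<le> n \<Longrightarrow> Cg n \<subseteq> LR"
proof
  fix x assume n: "1 \<le> n" and xC: "x \<in> Cg n"
  obtain u z where x: "x = mat3 u z 0 0 1 0 0 0 (1/u)" "u \<in> O1 (max 1 (n - 1))" "z \<in> P (n - 1)" "u \<in> un" by (rule Cg_E[OF xC])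
  show "x \<in> LR" unfolding x(1) by (rule LR_I) (use x n un_P[OF x(4)] P_mono[OF x(3)] un_divide[OF un_1 x(4)] in simp_all)
qed

lemma subgrp_Cg: assumes n: "1 \<le> n" shows "subgrp (Cg n)"
  unfolding subgrp_def
proof (intro conjI ballI)
  let ?m = "max 1 (n - 1)"
  show "Cg n \<subseteq> GL3" using Cg_LR[OF n] LR_Kmax Kmax_GL3 by blast
  show "mat 1 \<in> Cg n" unfolding mat3_1 by (rule Cg_I) simp_all
  fix g assume "g \<in> Cg n"
  then obtain u z where g: "g = mat3 u z 0 0 1 0 0 0 (1/u)" "u \<in> O1 ?m" "z \<in> P (n - 1)" "u \<in> un" by (rule Cg_E)
  have "inv3 g = mat3 (1/u) (-(z/u)) 0 0 1 0 0 0 u" unfolding g(1)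
    by (rule inv3_unique) (use un_nz[OF g(4)] in \<open>simp add: mat3_mult mat3_1\<close>)
  moreover have "mat3 (1/u) (-(z/u)) 0 0 1 0 0 0 u \<in> Cg n"
    by (rule Cg_I) (use O1_divide[OF O1_1 g(2)] P_divide_un[OF g(4)] g(3) in simp_all)
  ultimately show "inv3 g \<in> Cg n" by simp
  fix h assume "h \<in> Cg n"
  then obtain u' z' where h: "h = mat3 u' z' 0 0 1 0 0 0 (1/u')" "u' \<in> O1 ?m" "z' \<in> P (n - 1)" "u' \<in> un" by (rule Cg_E)
  have "mat3 (u*u') (u*z' + z) 0 0 1 0 0 0 (1/u*(1/u')) \<in> Cg n"
    by (rule Cg_I) (use O1_mult[OF g(2) h(2)] P_add[OF _ g(3)] P_mult_un(2)[OF g(4)] h(3) in simp_all)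
  thus "g ** h \<in> Cg n" unfolding g(1) h(1) mat3_mult by simp
qed

end

context gl3 begin

lemma LR_G: "g \<in> LR \<Longrightarrow> g \<in> G" using LR_Kmax Kmax_GL3 GG by blast
lemma cpt_Ub: "cpt (Ub s)"
  unfolding cpt_def using subgrp_Ub[of s] Ub_intm[of s] unfolding GG subgrp_def by blast
lemma cpt_Cg: assumes "1 \<le> n" shows "cpt (Cg n)"
proof -
  have "Cg n \<subseteq> intm 0" using Cg_LR[OF assms] LR_Kmax Kmax_iff by blast
  thus ?thesis unfolding cpt_def using subgrp_Cg[OF assms] unfolding GG subgrp_def by blast
qed

lemma LR_normz: assumes g: "g \<in> LR"
  shows "normz g (U2 k k)" "normz g (Ub s)" "1 \<le> n \<Longrightarrow> normz g (JJ n n k n k s s)"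
  unfolding normz_def using LR_G[OF g] LR_conj_U2[OF g] LR_conj_U2[OF LR_inv[OF g]] LR_conj_Ub[OF g] LR_conj_Ub[OF LR_inv[OF g]]
    LR_conj_JJ[OF g] LR_conj_JJ[OF LR_inv[OF g]] inv3_inv3[of g] GG by auto

text \<open>An element of \<open>U2 (k - 1) (k - 1)\<close> outside \<open>U2 k k\<close> is
  conjugate under \<open>LR\<close> to a (1,3) root element of exact valuation k - 1. Moving
  \<open>Ub (n - k)\<close> past that element yields all of \<open>Cg n\<close>, which kills the
  translates of \<open>y\<close>, so \<open>avg_core\<close> applies.\<close>

lemma cuspA_step:
  assumes n: "1 \<le> n" and y: "y \<in> fx (JJ n n k n k (n - k) (n - k))" "y \<noteq> 0"
    and kil: "\<And>g. g \<in> LR \<Longrightarrow> avg (Cg n) (\<pi> g y) = 0"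
  shows "avg (U2 (k - 1) (k - 1)) y \<noteq> 0"
proof (rule avg_core[OF cpt_U2 cpt_Ub, of y "n - k"])
  note yW = fxW[OF y(1)]
  show "y \<in> fx (Ub (n - k))" by (rule fx_anti[OF y(1) Ub_JJ[OF n]])
  show "y \<noteq> 0" by fact
  fix j assume j: "j \<in> U2 (k - 1) (k - 1)"
  obtain a b where ab: "j = mat3 1 0 a 0 1 b 0 0 1" "a \<in> P (k - 1)" "b \<in> P (k - 1)" by (rule U2_E[OF j])
  have main: "avg (Ub (n - k)) (\<pi> j y) = 0" if g: "g \<in> LR" and w: "w \<noteq> 0" "v w = k - 1" and e: "j ** g = g ** mat3 1 0 w 0 1 0 0 0 1" for g w
  proof -
    let ?E = "\<lambda>w. mat3 1 0 w 0 1 0 0 0 1"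
    have EG: "?E w \<in> G" for w by (rule mG) (simp add: mat3_det)
    have gG: "g \<in> G" "inv3 g \<in> G" using LR_G[OF g] GD(4) by auto
    define z where "z = \<pi> (inv3 g) y"
    have z: "z \<in> fx (JJ n n k n k (n - k) (n - k))" unfolding z_def
      by (rule normz_fx[OF LR_normz(3)[OF LR_inv[OF g] n] JJ_G y(1)])
    have zW: "z \<in> W" using fxW[OF z] .
    have gz: "\<pi> g z = y" unfolding z_def by (rule pi_inv(2)[OF gG(1) yW])
    have "\<pi> j y = \<pi> g (\<pi> (?E w) z)"
      using pi_eq2[OF e _ gG(1) gG(1) EG zW] subsetD[OF U2_G j] gz by simp
    hence "avg (Ub (n - k)) (\<pi> j y) = \<pi> g (avg (Ub (n - k)) (\<pi> (?E w) z))"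
      using normz_avg[OF LR_normz(2)[OF g] cpt_Ub pi_W[OF EG zW]] by simp
    also have "avg (Ub (n - k)) (\<pi> (?E w) z) = 0"
    proof (rule avg_kill[OF cpt_Ub cpt_Cg[OF n] EG zW])
      show "avg (Cg n) z = 0" unfolding z_def by (rule kil[OF LR_inv[OF g]])
      fix c assume c: "c \<in> Cg n"
      obtain u t where u: "c = mat3 u t 0 0 1 0 0 0 (1/u)" "u \<in> O1 (max 1 (n - 1))" "t \<in> P (n - 1)" "u \<in> un" by (rule Cg_E[OF c])
      note u0 = un_nz[OF u(4)]
      \<comment> \<open>Solved from the requirement that commuting with \<open>?E w\<close> leave
        exactly \<open>c\<close>, up to factors that fix the vector they meet.\<close>
      define r1 r2 where "r1 = (1/u - 1)/w" and "r2 = - (t/u)/w"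
      have "1/u - 1 \<in> P (max 1 (n - 1))" using O1_divide[OF O1_1 u(2)] by (simp add: O1_def)
      hence r1: "r1 \<in> P (n - k)" unfolding r1_def by (rule P_divide) (use w in auto)
      have "- (t/u) \<in> P (n - 1)" using u P_divide_un[OF u(4)] by simp
      hence r2: "r2 \<in> P (n - k)" unfolding r2_def by (rule P_divide) (use w in auto)
      let ?B = "\<lambda>r1 r2. mat3 1 0 0 0 1 0 r1 r2 1"
      have BU: "?B r1 r2 \<in> Ub (n - k)" using Ub_I r1 r2 .
      have BU': "?B (r1*u) (r2*u) \<in> Ub (n - k)" using Ub_I[of "r1*u" "n - k" "r2*u"] r1 r2 P_mult_un(1)[OF u(4)] by simp
      have BG: "?B r s \<in> G" for r s by (rule mG) (simp add: mat3_det)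
      have cG: "c \<in> G" using Cg_LR[OF n] c LR_G by blast
      have eq: "?B r1 r2 ** ?E w = ?E w ** (?E (w*u - w) ** (c ** ?B (r1*u) (r2*u)))"
        unfolding u(1) mat3_mult mat3_eq using w u0 by (simp add: r1_def r2_def field_simps)
      have Bz: "\<pi> (?B (r1*u) (r2*u)) z = z" by (rule fxD[OF z]) (use BU' Ub_JJ[OF n] in blast)
      have cz: "\<pi> c z \<in> fx (JJ n n k n k (n - k) (n - k))"
        by (rule normz_fx[OF LR_normz(3)[OF _ n] JJ_G z]) (use Cg_LR[OF n] c in blast)
      have "u - 1 \<in> P 1" using P_mono[of "u - 1" "max 1 (n - 1)" 1] u(2) by (simp add: O1_def)
      hence "w * (u - 1) \<in> P k" using P_mult'[of w "k - 1" "u - 1" 1 k] w by (simp add: P_def)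
      hence "w*u - w \<in> P k" by (simp add: right_diff_distrib)
      hence "?E (w*u - w) \<in> JJ n n k n k (n - k) (n - k)" by (simp add: JJ_mat3)
      hence Ez: "\<pi> (?E (w*u - w)) (\<pi> c z) = \<pi> c z" by (rule fxD[OF cz])
      have "\<pi> (?B r1 r2) (\<pi> (?E w) z) = \<pi> (?E w) (\<pi> (?E (w*u - w) ** (c ** ?B (r1*u) (r2*u))) z)"
        by (rule pi_eq2[OF eq BG EG EG GD(3)[OF EG GD(3)[OF cG BG]] zW])
      also have "\<pi> (?E (w*u - w) ** (c ** ?B (r1*u) (r2*u))) z = \<pi> c z"
        using pi_mult[OF EG GD(3)[OF cG BG] zW] pi_mult[OF cG BG zW] Bz Ez by simp
      finally show "\<exists>b\<in>Ub (n - k). \<pi> b (\<pi> (?E w) z) = \<pi> (?E w) (\<pi> c z)" using BU by blast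
    qed
    finally show ?thesis using pi_0[OF gG(1)] by simp
  qed
  show "\<pi> j y = y \<or> avg (Ub (n - k)) (\<pi> j y) = 0"
  proof (cases "a \<in> P k \<and> b \<in> P k")
    case True
    hence "j \<in> JJ n n k n k (n - k) (n - k)" by (simp add: ab(1) JJ_mat3)
    thus ?thesis using fxD[OF y(1)] by blast
  next
    case F: False
    show ?thesis
    proof (cases "a \<in> P k")
      case False
      hence a: "a \<noteq> 0" "v a = k - 1" using v_exact[of a "k - 1"] ab(2) by auto
      have "b/a \<in> P 0" by (rule P_divide[OF ab(3)]) (use a in simp_all)
      \<comment> \<open>This element of \<open>LR\<close> carries the column (a, 0) to (a, b); it is
        integral because \<open>a\<close> has the smaller valuation.\<close>
      hence "mat3 1 0 0 (b/a) 1 0 0 0 1 \<in> LR" by (intro LR_I) simp_all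
      moreover have "j ** mat3 1 0 0 (b/a) 1 0 0 0 1 = mat3 1 0 0 (b/a) 1 0 0 0 1 ** mat3 1 0 a 0 1 0 0 0 1"
        unfolding ab(1) mat3_mult mat3_eq using a by simp
      ultimately show ?thesis using main[OF _ a] by blast
    next
      case True
      hence b: "b \<noteq> 0" "v b = k - 1" using v_exact[of b "k - 1"] ab(3) F by auto
      have "a/b \<in> P 0" by (rule P_divide[OF ab(2)]) (use b in simp_all)
      hence "mat3 (a/b) 1 0 1 0 0 0 0 1 \<in> LR" by (intro LR_I) simp_all
      moreover have "j ** mat3 (a/b) 1 0 1 0 0 0 0 1 = mat3 (a/b) 1 0 1 0 0 0 0 1 ** mat3 1 0 b 0 1 0 0 0 1"
        unfolding ab(1) mat3_mult mat3_eq using b by simp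
      ultimately show ?thesis using main[OF _ b] by blast
    qed
  qed
qed

end

text \<open>Cuspidality along the radical of type (2,1), with a depth that may vary with the
  vector.\<close>

locale cuspidal_gl3 = gl3 v q smul G W \<pi>
  for v :: "'f::field \<Rightarrow> int" and q and smul :: "complex \<Rightarrow> 'v::ab_group_add \<Rightarrow> 'v" (infixr "\<odot>" 75)
    and G and W :: "'v set" and \<pi> +
  assumes sc: "x \<in> W \<Longrightarrow> \<exists>t. avg (U2 t t) x = 0"
begin

lemma descU:
  assumes "\<And>k x. R k x \<Longrightarrow> x \<in> W" "\<And>k x. R k x \<Longrightarrow> x \<noteq> 0 \<Longrightarrow> avg (U2 (k - 1) (k - 1)) x \<noteq> 0 \<and> R (k - 1) (avg (U2 (k - 1) (k - 1)) x)"
    "R (k::int) x"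
  shows "x = 0"
  by (rule descent[where U = "\<lambda>t. U2 t t" and R = R, OF cpt_U2 U2_mono sc assms])

text \<open>Otherwise \<open>cuspA_step\<close> applies at every stage, since \<open>LR\<close>
  normalizes the groups \<open>U2 k k\<close> and the averages of \<open>y\<close> are still killed
  by \<open>Cg n\<close> after any translation; the descent then gives \<open>y = 0\<close>.\<close>

lemma cuspA:
  assumes n: "1 \<le> n" and y: "y \<in> fx (JJ n n k n k (n - k) (n - k))" "y \<noteq> 0"
  shows "\<exists>g\<in>LR. avg (Cg n) (\<pi> g y) \<noteq> 0"
proof (rule ccontr)
  assume c: "\<not> ?thesis"
  let ?R = "\<lambda>k y. y \<in> fx (JJ n n k n k (n - k) (n - k)) \<and> (\<forall>g\<in>LR. avg (Cg n) (\<pi> g y) = 0)"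
  have "y = 0"
  proof (rule descU[where k = k and R = ?R])
    fix k y assume "?R k y"
    hence y: "y \<in> fx (JJ n n k n k (n - k) (n - k))" and kil: "\<And>g. g \<in> LR \<Longrightarrow> avg (Cg n) (\<pi> g y) = 0" by auto
    show "y \<in> W" by (rule fxW[OF y])
    assume y0: "y \<noteq> 0"
    have "avg (U2 (k - 1) (k - 1)) y \<noteq> 0" by (rule cuspA_step[OF n y y0 kil])
    moreover have "avg (U2 (k - 1) (k - 1)) y \<in> fx (JJ n n (k - 1) n (k - 1) (n - (k - 1)) (n - (k - 1)))"
      by (rule avg_U2_fx[OF JJ_JL_fx[OF y] n]) (use n in simp_all)
    moreover have "avg (Cg n) (\<pi> g (avg (U2 (k - 1) (k - 1)) y)) = 0" if g: "g \<in> LR" for g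
    proof -
      have gy: "\<pi> g y \<in> W" using pi_W[OF LR_G[OF g] fxW[OF y]] .
      have "\<pi> g (avg (U2 (k - 1) (k - 1)) y) = avg (U2 (k - 1) (k - 1)) (\<pi> g y)"
        by (rule normz_avg[OF LR_normz(1)[OF g] cpt_U2 fxW[OF y]])
      moreover have "avg (Cg n) (avg (U2 (k - 1) (k - 1)) (\<pi> g y)) = avg (U2 (k - 1) (k - 1)) (avg (Cg n) (\<pi> g y))"
        by (rule avg_commute_normz[OF cpt_Cg[OF n] cpt_U2 _ gy], rule LR_normz(1)) (use Cg_LR[OF n] in blast)
      ultimately show ?thesis using kil[OF g] avg_0[OF cpt_U2] by simp
    qed
    ultimately show "avg (U2 (k - 1) (k - 1)) y \<noteq> 0 \<and> ?R (k - 1) (avg (U2 (k - 1) (k - 1)) y)" by blast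
  qed (use c y in blast)
  thus False using y(2) by blast
qed

end

section \<open>Normalizers of depth groups and commutators of root groups\<close>

context gl3 begin

lemma normzI: assumes "g ** g' = mat 1" "\<And>j. j \<in> J \<Longrightarrow> g ** j ** g' \<in> J" "\<And>j. j \<in> J \<Longrightarrow> g' ** j ** g \<in> J"
  shows "normz g J"
proof -
  have "det g * det g' = 1" using assms(1) by (metis det_mul det_I)
  hence "g \<in> G" by (intro mG) auto
  thus ?thesis using assms(2,3) inv3_unique[OF assms(1)] by (simp add: normz_def)
qed

lemma normz_comm: assumes g: "g \<in> G" and c: "\<And>j. j \<in> J \<Longrightarrow> g ** j = j ** g" shows "normz g J"
proof -
  have "g ** j ** inv3 g = j" "inv3 g ** j ** g = j" if j: "j \<in> J" for j
  proof -
    show "g ** j ** inv3 g = j" unfolding c[OF j] using GL3_inv1(1)[OF GD(1)[OF g]] by (simp add: matrix_mul_assoc[symmetric])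
    show "inv3 g ** j ** g = j" using GL3_cancel(1)[OF GD(1)[OF g]] by (simp add: matrix_mul_assoc[symmetric] c[OF j, symmetric])
  qed
  thus ?thesis using g by (simp add: normz_def)
qed

lemma diag_normz: assumes u: "a \<in> un" "b \<in> un" "c \<in> un"
  shows "normz (mat3 a 0 0 0 b 0 0 0 c) (U2 p l)" "normz (mat3 a 0 0 0 b 0 0 0 c) (JJ m k12 k13 k21 k23 k31 k32)"
proof -
  note nz = un_nz[OF u(1)] un_nz[OF u(2)] un_nz[OF u(3)]
  have uv: "v a = 0" "v b = 0" "v c = 0" using u by (simp_all add: un_def)
  let ?g = "mat3 a 0 0 0 b 0 0 0 c"
  have gG: "?g \<in> GL3" using nz by (simp add: GL3_def mat3_det)
  have "inv3 ?g ** j ** ?g \<in> U2 p l" "?g ** j ** inv3 ?g \<in> U2 p l" if "j \<in> U2 p l" for j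
    by (rule U2_E[OF that], simp add: diag_conj[OF nz] U2_I P_scale nz uv P_divide_un[OF u(3)] P_mult_un u)+
  thus "normz ?g (U2 p l)" using gG[folded GG] unfolding normz_def by blast
  have "?g ** j ** inv3 ?g \<in> JJ m k12 k13 k21 k23 k31 k32" if j: "j \<in> JJ m k12 k13 k21 k23 k31 k32" for j
  proof -
    have "inv3 (inv3 ?g) ** j ** inv3 ?g \<in> JJ m k12 k13 k21 k23 k31 k32"
      unfolding inv3_diag[OF nz] by (rule diag_JJ[OF _ _ _ j]) (use nz uv in \<open>simp_all add: v_divide\<close>)
    thus ?thesis by (simp only: inv3_inv3[OF gG])
  qed
  moreover have "inv3 ?g ** j ** ?g \<in> JJ m k12 k13 k21 k23 k31 k32" if j: "j \<in> JJ m k12 k13 k21 k23 k31 k32" for j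
    by (rule diag_JJ[OF nz j]) (simp_all add: uv)
  ultimately show "normz ?g (JJ m k12 k13 k21 k23 k31 k32)" using gG[folded GG] unfolding normz_def by blast
qed

lemma Hh_nrm: assumes "1 \<le> n" "\<phi> = f12 \<or> \<phi> = f13 \<or> \<phi> = f23" "h \<in> Hh \<phi> n"
  shows "normz h (U2 p l)" "normz h (JJ m k12 k13 k21 k23 k31 k32)"
proof -
  obtain u where u: "u \<in> O1 n" "h = \<phi> u 0 0 (1/u)" using assms(3) by (auto simp: Hh_def)
  have "u \<in> un" "1/u \<in> un" "1 \<in> un" using O1_un[OF u(1) assms(1)] un_divide[OF un_1] by auto
  thus "normz h (U2 p l)" "normz h (JJ m k12 k13 k21 k23 k31 k32)"
    using assms(2) unfolding u(2) f12_def f13_def f23_def by (metis diag_normz)+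
qed

lemma e12_conj: assumes w: "w \<in> P j" and x: "x \<in> JJ m k12 k13 k21 k23 k31 k32"
    and k: "1 \<le> m" "m \<le> j + k21" "k12 \<le> j + m" "k12 \<le> 2*j + k21" "k13 \<le> j + k23" "k32 \<le> j + k31"
  shows "mat3 1 w 0 0 1 0 0 0 1 ** x ** mat3 1 (-w) 0 0 1 0 0 0 1 \<in> JJ m k12 k13 k21 k23 k31 k32"
proof (cases rule: JJ_E[OF x])
  case X: (1 x1 x2 x3 x4 x5 x6 x7 x8 x9)
  have det: "det (mat3 1 w 0 0 1 0 0 0 1 ** x ** mat3 1 (-w) 0 0 1 0 0 0 1) = 1"
    using x by (simp add: det_mul JJ_def mat3_det)
  have m: "mat3 1 w 0 0 1 0 0 0 1 ** x ** mat3 1 (-w) 0 0 1 0 0 0 1 =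
    mat3 (x1 + w*x4) (x2 + w*(x5 - x1) - w*w*x4) (x3 + w*x6) x4 (x5 - x4*w) x6 x7 (x8 - x7*w) x9"
    unfolding X(1) mat3_mult mat3_eq by (simp add: algebra_simps)
  have "x4*w \<in> P m" "w*x4 \<in> P m" by (rule P_mult'[OF X(7) w] P_mult'[OF w X(7)], use k in linarith)+
  hence "x5 - x4*w \<in> O1 m" "x1 + w*x4 \<in> O1 m" using O1_addP X(2,3) by blast+
  moreover have "x2 + w*(x5 - x1) - w*w*x4 \<in> P k12"
  proof -
    have "x5 - x1 \<in> P m" using P_diff[of "x5 - 1" m "x1 - 1"] X(2,3) by (simp add: O1_def)
    hence "w*(x5 - x1) \<in> P k12" by (rule P_mult'[OF w]) (use k in linarith)
    moreover have "w*w*x4 \<in> P k12" by (rule P_mult'[OF P_mult[OF w w] X(7)]) (use k in linarith)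
    ultimately show ?thesis using P_add P_diff X(5) by blast
  qed
  moreover have "x3 + w*x6 \<in> P k13" by (rule P_add[OF X(6) P_mult'[OF w X(8)]]) (use k in linarith)
  moreover have "x8 - x7*w \<in> P k32" by (rule P_diff[OF X(10) P_mult'[OF X(9) w]]) (use k in linarith)
  ultimately show ?thesis using X(2-) det unfolding JJ_def by (simp add: m)
qed

lemma transpose_JJ: "x \<in> JJ m k12 k13 k21 k23 k31 k32 \<Longrightarrow> transpose x \<in> JJ m k21 k31 k12 k32 k13 k23"
  by (simp add: JJ_def det_transpose) (simp add: transpose_def)

lemma e21_conj: assumes w: "w \<in> P j" and x: "x \<in> JJ m k12 k13 k21 k23 k31 k32"
    and k: "1 \<le> m" "m \<le> j + k12" "k21 \<le> j + m" "k21 \<le> 2*j + k12" "k31 \<le> j + k32" "k23 \<le> j + k13"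
  shows "mat3 1 0 0 w 1 0 0 0 1 ** x ** mat3 1 0 0 (-w) 1 0 0 0 1 \<in> JJ m k12 k13 k21 k23 k31 k32"
proof -
  have "- w \<in> P j" using w by simp
  from transpose_JJ[OF e12_conj[OF this transpose_JJ[OF x] k]] show ?thesis
    by (simp add: matrix_transpose_mul mat3_transpose matrix_mul_assoc)
qed

lemma Xp_normzI:
  assumes \<phi>: "sl2emb \<phi>" and g: "g \<in> Xp \<phi> j" and c: "\<And>w x. w \<in> P j \<Longrightarrow> x \<in> J \<Longrightarrow> \<phi> 1 w 0 1 ** x ** \<phi> 1 (- w) 0 1 \<in> J"
  shows "normz g J"
proof -
  obtain w where w: "w \<in> P j" "- w \<in> P j" "g = \<phi> 1 w 0 1" using g by (auto simp: Xp_def)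
  show ?thesis unfolding w(3)
    by (rule normzI[OF _ c[OF w(1)] c[OF w(2), unfolded minus_minus]]) (simp_all add: phi_mult[OF \<phi>] phi_1[OF \<phi>])
qed

lemma Xm_normzI:
  assumes \<phi>: "sl2emb \<phi>" and g: "g \<in> Xm \<phi> j" and c: "\<And>w x. w \<in> P j \<Longrightarrow> x \<in> J \<Longrightarrow> \<phi> 1 0 w 1 ** x ** \<phi> 1 0 (- w) 1 \<in> J"
  shows "normz g J"
proof -
  obtain w where w: "w \<in> P j" "- w \<in> P j" "g = \<phi> 1 0 w 1" using g by (auto simp: Xm_def)
  show ?thesis unfolding w(3)
    by (rule normzI[OF _ c[OF w(1)] c[OF w(2), unfolded minus_minus]]) (simp_all add: phi_mult[OF \<phi>] phi_1[OF \<phi>])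
qed

lemma e21_nrm: assumes "g \<in> Xm f12 j" "1 \<le> m" "m \<le> j + k12" "k21 \<le> j + m" "k21 \<le> 2*j + k12" "k23 \<le> j + k13" "k31 \<le> j + k32"
  shows "normz g (JJ m k12 k13 k21 k23 k31 k32)"
  by (rule Xm_normzI[OF sl2emb_f(1) assms(1)]) (unfold f12_def, rule e21_conj[OF _ _ assms(2-5,7,6)])

lemma e12_nrm: assumes "g \<in> Xp f12 j" "1 \<le> m" "m \<le> j + k21" "k12 \<le> j + m" "k12 \<le> 2*j + k21" "k13 \<le> j + k23" "k32 \<le> j + k31"
  shows "normz g (JJ m k12 k13 k21 k23 k31 k32)"
  by (rule Xp_normzI[OF sl2emb_f(1) assms(1)]) (unfold f12_def, rule e12_conj[OF _ _ assms(2-)])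

lemma e21_nrm_U2: assumes "g \<in> Xm f12 j" "l \<le> j + p" shows "normz g (U2 p l)"
proof (rule Xm_normzI[OF sl2emb_f(1) assms(1)])
  fix w x assume w: "w \<in> P j" and x: "x \<in> U2 p l"
  obtain s t where st: "x = mat3 1 0 s 0 1 t 0 0 1" "s \<in> P p" "t \<in> P l" by (rule U2_E[OF x])
  have "f12 1 0 w 1 ** x ** f12 1 0 (- w) 1 = mat3 1 0 s 0 1 (t + w * s) 0 0 1"
    unfolding st(1) f12_def mat3_mult mat3_eq by (simp add: algebra_simps)
  thus "f12 1 0 w 1 ** x ** f12 1 0 (- w) 1 \<in> U2 p l" using U2_I[OF st(2) P_add[OF st(3) P_mult'[OF w st(2) assms(2)]]] by simp
qed

lemma e12_nrm_U2: assumes "g \<in> Xp f12 j" "p \<le> j + l" shows "normz g (U2 p l)"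
proof (rule Xp_normzI[OF sl2emb_f(1) assms(1)])
  fix w x assume w: "w \<in> P j" and x: "x \<in> U2 p l"
  obtain s t where st: "x = mat3 1 0 s 0 1 t 0 0 1" "s \<in> P p" "t \<in> P l" by (rule U2_E[OF x])
  have "f12 1 w 0 1 ** x ** f12 1 (- w) 0 1 = mat3 1 0 (s + w * t) 0 1 t 0 0 1"
    unfolding st(1) f12_def mat3_mult mat3_eq by (simp add: algebra_simps)
  thus "f12 1 w 0 1 ** x ** f12 1 (- w) 0 1 \<in> U2 p l" using U2_I[OF P_add[OF st(2) P_mult'[OF w st(3) assms(2)]] st(3)] by simp
qed

lemma phG: "sl2emb \<phi> \<Longrightarrow> a*d - b*c = 1 \<Longrightarrow> \<phi> a b c d \<in> G" using phi_GL3 GG by blast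
lemma cX: "sl2emb \<phi> \<Longrightarrow> cpt (Xp \<phi> f)" by (rule cpt_Xp, assumption, rule phG)
lemma cY: "sl2emb \<phi> \<Longrightarrow> cpt (Xm \<phi> f)" by (rule cpt_Xm, assumption, rule phG)
lemma cH: "sl2emb \<phi> \<Longrightarrow> 1 \<le> n \<Longrightarrow> cpt (Hh \<phi> n)" by (rule cpt_Hh, assumption, rule phG)

lemma XJ: assumes "1 \<le> m"
  shows "Xp f12 k12 \<subseteq> JJ m k12 k13 k21 k23 k31 k32" "Xp f13 k13 \<subseteq> JJ m k12 k13 k21 k23 k31 k32"
    "Xp f23 k23 \<subseteq> JJ m k12 k13 k21 k23 k31 k32" "Xm f12 k21 \<subseteq> JJ m k12 k13 k21 k23 k31 k32"
    "Xm f13 k31 \<subseteq> JJ m k12 k13 k21 k23 k31 k32" "Xm f23 k32 \<subseteq> JJ m k12 k13 k21 k23 k31 k32"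
    "Hh f12 m \<subseteq> JJ m k12 k13 k21 k23 k31 k32" "Hh f13 m \<subseteq> JJ m k12 k13 k21 k23 k31 k32"
    "Hh f23 m \<subseteq> JJ m k12 k13 k21 k23 k31 k32"
  using O1_divide[OF O1_1 _ assms] O1_un[OF _ assms] un_nz
  by (auto simp: Xp_def Xm_def Hh_def f12_def f13_def f23_def JJ_mat3)

lemma fxXJ: assumes "y \<in> fx (JJ m k12 k13 k21 k23 k31 k32)" "1 \<le> m"
  shows "y \<in> fx (Xp f12 k12)" "y \<in> fx (Xp f13 k13)" "y \<in> fx (Xp f23 k23)" "y \<in> fx (Xm f12 k21)" "y \<in> fx (Xm f13 k31)"
   "y \<in> fx (Xm f23 k32)" "y \<in> fx (Hh f12 m)" "y \<in> fx (Hh f13 m)" "y \<in> fx (Hh f23 m)"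
  by (rule fx_anti[OF assms(1) XJ(1)[OF assms(2)]] fx_anti[OF assms(1) XJ(2)[OF assms(2)]] fx_anti[OF assms(1) XJ(3)[OF assms(2)]]
    fx_anti[OF assms(1) XJ(4)[OF assms(2)]] fx_anti[OF assms(1) XJ(5)[OF assms(2)]] fx_anti[OF assms(1) XJ(6)[OF assms(2)]]
    fx_anti[OF assms(1) XJ(7)[OF assms(2)]] fx_anti[OF assms(1) XJ(8)[OF assms(2)]] fx_anti[OF assms(1) XJ(9)[OF assms(2)]])+

text \<open>The radical is enlarged first along the (1,3) root and then along the (2,3) root,
  because each nonvanishing criterion concerns a single root. \<open>aa\<close>, \<open>ac\<close>
  are the lower depths kept after the first stage, \<open>ba\<close>, \<open>bc\<close> those after
  the second.\<close>

lemma two_step: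
  assumes y: "y \<in> fx (JJ m k12 k k21 k k31 k32)" and m: "1 \<le> m" "0 \<le> k12" "1 \<le> k21"
    and a: "k31 \<le> aa" "k32 \<le> ac" "m \<le> k - 1 + aa" "m \<le> k + ac" "k12 \<le> k - 1 + ac" "k21 \<le> k + aa"
    and b: "aa \<le> ba" "ac \<le> bc" "m \<le> k - 1 + ba" "m \<le> k - 1 + bc" "k12 \<le> k - 1 + bc" "k21 \<le> k - 1 + ba"
  shows "avg (Xp f13 (k - 1)) y \<in> fx (JJ m k12 (k - 1) k21 k aa ac)"
    "avg (U2 (k - 1) k) y = avg (Xp f13 (k - 1)) y"
    "avg (U2 (k - 1) (k - 1)) y = avg (Xp f23 (k - 1)) (avg (Xp f13 (k - 1)) y)"
    "avg (U2 (k - 1) (k - 1)) y \<in> fx (JJ m k12 (k - 1) k21 (k - 1) ba bc)"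
proof -
  note yW = fxW[OF y]
  show e1: "avg (U2 (k - 1) k) y = avg (Xp f13 (k - 1)) y" by (rule avg_U2_X(1)[OF yW fxXJ(3)[OF y m(1)]])
  show y1: "avg (Xp f13 (k - 1)) y \<in> fx (JJ m k12 (k - 1) k21 k aa ac)"
    unfolding e1[symmetric] by (rule avg_U2_fx[OF JJ_JL_fx[OF y] m(1)]) (use m a in linarith)+
  have e2: "avg (U2 (k - 1) (k - 1)) (avg (U2 (k - 1) k) y) = avg (U2 (k - 1) (k - 1)) y"
    by (rule avg_sub[OF cpt_U2 cpt_U2 U2_mono yW]) simp_all
  have e3: "avg (U2 (k - 1) (k - 1)) (avg (Xp f13 (k - 1)) y) = avg (Xp f23 (k - 1)) (avg (Xp f13 (k - 1)) y)"
    by (rule avg_U2_X(2)[OF fxW[OF y1] fxXJ(2)[OF y1 m(1)]])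
  show "avg (U2 (k - 1) (k - 1)) y = avg (Xp f23 (k - 1)) (avg (Xp f13 (k - 1)) y)" using e1 e2 e3 by simp
  have "avg (U2 (k - 1) (k - 1)) (avg (Xp f13 (k - 1)) y) \<in> fx (JJ m k12 (k - 1) k21 (k - 1) ba bc)"
    by (rule avg_U2_fx[OF JJ_JL_fx[OF y1] m(1)]) (use m b in linarith)+
  thus "avg (U2 (k - 1) (k - 1)) y \<in> fx (JJ m k12 (k - 1) k21 (k - 1) ba bc)" using e1 e2 by simp
qed

lemma avg_normz_0: assumes "cpt H" "cpt J" "\<And>h. h \<in> H \<Longrightarrow> normz h J" "x \<in> W" "avg H x = 0" shows "avg H (avg J x) = 0"
  using avg_commute_normz[OF assms(1-4)] assms(5) avg_0[OF assms(2)] by simp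

text \<open>Every element of \<open>C\<close> arises when the negative \<open>\<psi>\<close> group
  is moved past a positive \<open>\<phi>\<close> element of valuation k - 1. As \<open>C\<close>
  kills \<open>y\<close>, the \<open>\<psi>\<close> average kills the translate, and
  \<open>root_step\<close> applies.\<close>

lemma kill_comm:
  assumes \<phi>: "sl2emb \<phi>" and \<psi>: "sl2emb \<psi>" and C: "cpt C" "avg C y = 0"
    and y: "y \<in> fx (Xp \<phi> k)" "y \<in> fx (Xm \<psi> s)" "y \<noteq> 0"
    and c: "\<And>w c. w \<noteq> 0 \<Longrightarrow> v w = k - 1 \<Longrightarrow> c \<in> C \<Longrightarrow> \<exists>r\<in>P s. \<psi> 1 0 r 1 ** \<phi> 1 w 0 1 = \<phi> 1 w 0 1 ** (c ** \<psi> 1 0 r 1)"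
  shows "avg (Xp \<phi> (k - 1)) y \<noteq> 0"
proof (rule root_step[OF \<phi> phG[OF \<phi>] cY[OF \<psi>] y])
  note yW = fxW[OF y(1)]
  fix w assume w: "w \<noteq> 0" "v w = k - 1"
  have jG: "\<phi> 1 w 0 1 \<in> G" by (rule phG[OF \<phi>]) simp
  show "avg (Xm \<psi> s) (\<pi> (\<phi> 1 w 0 1) y) = 0"
  proof (rule avg_kill[OF cY[OF \<psi>] C(1) jG yW C(2)])
    fix c' assume c': "c' \<in> C"
    from c[OF w c'] obtain r where r: "r \<in> P s" "\<psi> 1 0 r 1 ** \<phi> 1 w 0 1 = \<phi> 1 w 0 1 ** (c' ** \<psi> 1 0 r 1)" by blast
    hence b: "\<psi> 1 0 r 1 \<in> Xm \<psi> s" by (auto simp: Xm_def)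
    have bG: "\<psi> 1 0 r 1 \<in> G" by (rule phG[OF \<psi>]) simp
    have cG: "c' \<in> G" using cptD(1)[OF C(1) c'] .
    have "\<pi> (\<psi> 1 0 r 1) (\<pi> (\<phi> 1 w 0 1) y) = \<pi> (\<phi> 1 w 0 1) (\<pi> (c' ** \<psi> 1 0 r 1) y)" by (rule pi_eq2[OF r(2) bG jG jG GD(3)[OF cG bG] yW])
    also have "\<pi> (c' ** \<psi> 1 0 r 1) y = \<pi> c' y" using pi_mult[OF cG bG yW] fxD[OF y(2) b] by simp
    finally show "\<exists>b\<in>Xm \<psi> s. \<pi> b (\<pi> (\<phi> 1 w 0 1) y) = \<pi> (\<phi> 1 w 0 1) (\<pi> c' y)" using b by blast
  qed
qed

text \<open>The commutator of the (3,2) and (1,3) root groups lies in the (1,2) root group.\<close>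

lemma kill_13:
  assumes y: "y \<in> fx (Xp f13 k)" "y \<in> fx (Xm f23 s)" "avg (Xp f12 (s + k - 1)) y = 0" "y \<noteq> 0"
  shows "avg (Xp f13 (k - 1)) y \<noteq> 0"
proof (rule kill_comm[OF sl2emb_f(2,3) cX[OF sl2emb_f(1)] y(3,1,2,4)])
  fix w c assume w: "w \<noteq> 0" "v w = k - 1" and "c \<in> Xp f12 (s + k - 1)"
  then obtain z where z: "z \<in> P (s + k - 1)" "c = f12 1 z 0 1" by (auto simp: Xp_def)
  have "(- z) / w \<in> P s" by (rule P_divide[of _ "s + k - 1"]) (use z w in simp_all)
  thus "\<exists>r\<in>P s. f23 1 0 r 1 ** f13 1 w 0 1 = f13 1 w 0 1 ** (c ** f23 1 0 r 1)"
    by (rule bexI[rotated]) (use w in \<open>simp add: z(2) f12_def f13_def f23_def mat3_mult mat3_eq\<close>)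
qed

text \<open>The commutator of the (3,1) and (2,3) root groups lies in the (2,1) root group.\<close>

lemma kill_23:
  assumes y: "y \<in> fx (Xp f23 k)" "y \<in> fx (Xm f13 s)" "avg (Xm f12 (s + k - 1)) y = 0" "y \<noteq> 0"
  shows "avg (Xp f23 (k - 1)) y \<noteq> 0"
proof (rule kill_comm[OF sl2emb_f(3,2) cY[OF sl2emb_f(1)] y(3,1,2,4)])
  fix w c assume w: "w \<noteq> 0" "v w = k - 1" and "c \<in> Xm f12 (s + k - 1)"
  then obtain z where z: "z \<in> P (s + k - 1)" "c = f12 1 0 z 1" by (auto simp: Xm_def)
  have "(- z) / w \<in> P s" by (rule P_divide[of _ "s + k - 1"]) (use z w in simp_all)
  thus "\<exists>r\<in>P s. f13 1 0 r 1 ** f23 1 w 0 1 = f23 1 w 0 1 ** (c ** f13 1 0 r 1)"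
    by (rule bexI[rotated]) (use w in \<open>simp add: z(2) f12_def f13_def f23_def mat3_mult mat3_eq\<close>)
qed

end

section \<open>Descents for three shapes of invariance\<close>

context cuspidal_gl3 begin

text \<open>Depth one: the group is a conjugate of the pro-unipotent part of an Iwahori subgroup of
  SL_3, so \<open>rank_one\<close> serves both stages of \<open>two_step\<close>.\<close>

lemma IW: assumes y: "y \<in> fx (JJ 1 0 k 1 k (1 - k) (1 - k))" shows "y = 0"
proof -
  let ?R = "\<lambda>k y. y \<in> fx (JJ 1 0 k 1 k (1 - k) (1 - k))"
  have "?R k y" using y by blast
  thus ?thesis
  proof (rule descU[where R = ?R, rotated 2])
    fix k y assume "?R k y"
    hence y: "y \<in> fx (JJ 1 0 k 1 k (1 - k) (1 - k))" by auto
    show yW: "y \<in> W" by (rule fxW[OF y])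
    assume y0: "y \<noteq> 0"
    have t: "avg (Xp f13 (k - 1)) y \<in> fx (JJ 1 0 (k - 1) 1 k (2 - k) (1 - k))"
      "avg (U2 (k - 1) (k - 1)) y = avg (Xp f23 (k - 1)) (avg (Xp f13 (k - 1)) y)"
      "avg (U2 (k - 1) (k - 1)) y \<in> fx (JJ 1 0 (k - 1) 1 (k - 1) (2 - k) (2 - k))"
      by (rule two_step[OF y, where aa = "2 - k" and ac = "1 - k" and ba = "2 - k" and bc = "2 - k"]; simp)+
    have y1: "avg (Xp f13 (k - 1)) y \<noteq> 0"
      using rank_one[OF sl2emb_f(2) phG[OF sl2emb_f(2)] fxXJ(2)[OF y] fxXJ(5)[OF y] fxXJ(8)[OF y]] y0 by auto
    have "avg (Xp f23 (k - 1)) (avg (Xp f13 (k - 1)) y) \<noteq> 0"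
      using rank_one[OF sl2emb_f(3) phG[OF sl2emb_f(3)] fxXJ(3)[OF t(1)] fxXJ(6)[OF t(1)] fxXJ(9)[OF t(1)]] y1 by auto
    thus "avg (U2 (k - 1) (k - 1)) y \<noteq> 0 \<and> ?R (k - 1) (avg (U2 (k - 1) (k - 1)) y)" using t(2,3) by simp
  qed
qed

text \<open>Greater depth: the two vanishing torus averages permit \<open>ss_step\<close> at both
  stages of \<open>two_step\<close>.\<close>

lemma C1: assumes n: "2 \<le> n" and y: "y \<in> fx (JJ n (n - 1) k n k (n - k) (n - k))" "avg (Hh f13 (n - 1)) y = 0" "avg (Hh f23 (n - 1)) y = 0"
  shows "y = 0"
proof -
  let ?R = "\<lambda>k y. y \<in> fx (JJ n (n - 1) k n k (n - k) (n - k)) \<and> avg (Hh f13 (n - 1)) y = 0 \<and> avg (Hh f23 (n - 1)) y = 0"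
  have n1: "1 \<le> n" "1 \<le> n - 1" using n by auto
  have "?R k y" using y by blast
  thus ?thesis
  proof (rule descU[where R = ?R, rotated 2])
    fix k y assume "?R k y"
    hence y: "y \<in> fx (JJ n (n - 1) k n k (n - k) (n - k))" "avg (Hh f13 (n - 1)) y = 0" "avg (Hh f23 (n - 1)) y = 0" by auto
    show yW: "y \<in> W" by (rule fxW[OF y(1)])
    assume y0: "y \<noteq> 0"
    have t: "avg (Xp f13 (k - 1)) y \<in> fx (JJ n (n - 1) (k - 1) n k (n - (k - 1)) (n - k))"
      "avg (U2 (k - 1) k) y = avg (Xp f13 (k - 1)) y"
      "avg (U2 (k - 1) (k - 1)) y = avg (Xp f23 (k - 1)) (avg (Xp f13 (k - 1)) y)"
      "avg (U2 (k - 1) (k - 1)) y \<in> fx (JJ n (n - 1) (k - 1) n (k - 1) (n - (k - 1)) (n - (k - 1)))"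
      by (rule two_step[OF y(1), where aa = "n - (k - 1)" and ac = "n - k" and ba = "n - (k - 1)" and bc = "n - (k - 1)"]; use n in simp)+
    have y1: "avg (Xp f13 (k - 1)) y \<noteq> 0"
      by (rule ss_step[OF sl2emb_f(2) phG[OF sl2emb_f(2)] n fxXJ(8)[OF y(1) n1(1)] fxXJ(2)[OF y(1) n1(1)] fxXJ(5)[OF y(1) n1(1)] y0 y(2)])
    \<comment> \<open>The tori normalize the radical, so the vanishing of their averages is
      inherited.\<close>
    have kil: "avg (Hh f13 (n - 1)) (avg (U2 p l) y) = 0" "avg (Hh f23 (n - 1)) (avg (U2 p l) y) = 0" for p l
    proof -
      show "avg (Hh f13 (n - 1)) (avg (U2 p l) y) = 0"
        by (rule avg_normz_0[OF cH[OF sl2emb_f(2) n1(2)] cpt_U2 Hh_nrm(1)[OF n1(2), where \<phi> = f13] yW y(2)]) simp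
      show "avg (Hh f23 (n - 1)) (avg (U2 p l) y) = 0"
        by (rule avg_normz_0[OF cH[OF sl2emb_f(3) n1(2)] cpt_U2 Hh_nrm(1)[OF n1(2), where \<phi> = f23] yW y(3)]) simp
    qed
    have "avg (Xp f23 (k - 1)) (avg (Xp f13 (k - 1)) y) \<noteq> 0"
      by (rule ss_step[OF sl2emb_f(3) phG[OF sl2emb_f(3)] n fxXJ(9)[OF t(1) n1(1)] fxXJ(3)[OF t(1) n1(1)] fxXJ(6)[OF t(1) n1(1)] y1 kil(2)[of "k - 1" k, unfolded t(2)]])
    thus "avg (U2 (k - 1) (k - 1)) y \<noteq> 0 \<and> ?R (k - 1) (avg (U2 (k - 1) (k - 1)) y)" using t(3,4) kil[of "k - 1" "k - 1"] by simp
  qed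
qed

text \<open>Here \<open>y\<close> is invariant under the torus at depth n - 1, which leaves
  \<open>ss_step\<close> without input. The two stages use the (1,2) and (2,1) root groups instead,
  through \<open>kill_13\<close> and \<open>kill_23\<close>.\<close>

lemma C3r: assumes n: "2 \<le> n" and y: "y \<in> fx (JJ (n - 1) (n - 1) k n k (n - k) (n - 1 - k))"
    "avg (Xp f12 (n - 2)) y = 0" "avg (Xm f12 (n - 1)) y = 0"
  shows "y = 0"
proof -
  let ?R = "\<lambda>k y. y \<in> fx (JJ (n - 1) (n - 1) k n k (n - k) (n - 1 - k)) \<and> avg (Xp f12 (n - 2)) y = 0 \<and> avg (Xm f12 (n - 1)) y = 0"
  have n1: "1 \<le> n" "1 \<le> n - 1" using n by auto
  have "?R k y" using y by blast
  thus ?thesis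
  proof (rule descU[where R = ?R, rotated 2])
    fix k y assume "?R k y"
    hence y: "y \<in> fx (JJ (n - 1) (n - 1) k n k (n - k) (n - 1 - k))" "avg (Xp f12 (n - 2)) y = 0" "avg (Xm f12 (n - 1)) y = 0" by auto
    show yW: "y \<in> W" by (rule fxW[OF y(1)])
    assume y0: "y \<noteq> 0"
    have t: "avg (Xp f13 (k - 1)) y \<in> fx (JJ (n - 1) (n - 1) (k - 1) n k (n - k) (n - k))"
      "avg (U2 (k - 1) k) y = avg (Xp f13 (k - 1)) y"
      "avg (U2 (k - 1) (k - 1)) y = avg (Xp f23 (k - 1)) (avg (Xp f13 (k - 1)) y)"
      "avg (U2 (k - 1) (k - 1)) y \<in> fx (JJ (n - 1) (n - 1) (k - 1) n (k - 1) (n - (k - 1)) (n - 1 - (k - 1)))"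
      by (rule two_step[OF y(1), where aa = "n - k" and ac = "n - k" and ba = "n - (k - 1)" and bc = "n - 1 - (k - 1)"]; use n in simp)+
    \<comment> \<open>The depths match: (n - 1 - k) + k - 1 = n - 2 for the (1,2) root here, and (n
      - k) + k - 1 = n - 1 for the (2,1) root below.\<close>
    have y1: "avg (Xp f13 (k - 1)) y \<noteq> 0"
      by (rule kill_13[OF fxXJ(2)[OF y(1) n1(2)] fxXJ(6)[OF y(1) n1(2)] _ y0]) (use y(2) in \<open>simp add: algebra_simps\<close>)
    have kil: "avg (Xp f12 (n - 2)) (avg (U2 (k - 1) (k - 1)) y) = 0"
      by (rule avg_normz_0[OF cX[OF sl2emb_f(1)] cpt_U2 e12_nrm_U2 yW y(2)]) (use n in auto)
    have kil': "avg (Xm f12 (n - 1)) (avg (U2 (k - 1) l) y) = 0" if "l \<le> k" for l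
      by (rule avg_normz_0[OF cY[OF sl2emb_f(1)] cpt_U2 e21_nrm_U2 yW y(3)]) (use n that in auto)
    have "avg (Xp f23 (k - 1)) (avg (Xp f13 (k - 1)) y) \<noteq> 0"
      by (rule kill_23[OF fxXJ(3)[OF t(1) n1(2)] fxXJ(5)[OF t(1) n1(2)] _ y1]) (use kil'[of k] t(2) in simp)
    thus "avg (U2 (k - 1) (k - 1)) y \<noteq> 0 \<and> ?R (k - 1) (avg (U2 (k - 1) (k - 1)) y)" using t(3,4) kil kil'[of "k - 1"] by simp
  qed
qed

end

context mrep begin

text \<open>The quotient of \<open>1 + P (n - 1)\<close> by \<open>1 + P n\<close> is additive
  because 2 (n - 1) >= n. The free unit \<open>c\<close> only rescales the digit;
  \<open>C2_step\<close> applies this with a different \<open>c\<close> for each term.\<close>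

lemma avg_Hh_Tm:
  assumes \<phi>: "sl2emb \<phi>" and \<phi>G: "\<And>a b c d. a*d - b*c = 1 \<Longrightarrow> \<phi> a b c d \<in> G"
    and y: "y \<in> fx (Hh \<phi> n)" and n: "2 \<le> n" and c: "c \<in> un"
  shows "avg (Hh \<phi> (n - 1)) y = inverse (of_nat q) \<odot> (\<Sum>d\<in>Tm. \<pi> (\<phi> (1 + pw (n - 1) * d * c) 0 0 (1/(1 + pw (n - 1) * d * c))) y)"
proof (rule avg_Tm[where E = "\<lambda>r. \<pi> (\<phi> (1 + r * c) 0 0 (1/(1 + r * c))) y"])
  note yW = fxW[OF y]
  have n1: "1 \<le> n" "1 \<le> n - 1" using n by auto
  show "cpt (Hh \<phi> (n - 1))" by (rule cpt_Hh[OF \<phi> _ n1(2)], rule \<phi>G)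
  show "y \<in> W" by fact
  have O: "1 + r * c \<in> O1 (n - 1)" if "r \<in> P (n - 1)" for r using that P_mult_un(1)[OF c] by (intro O1_I) simp
  have hG: "\<phi> u 0 0 (1/u) \<in> G" if "u \<in> un" for u using un_nz[OF that] by (intro \<phi>G) simp
  have hm: "\<pi> (\<phi> u 0 0 (1/u)) y = \<pi> (\<phi> w 0 0 (1/w)) y" if u: "u \<in> un" "w \<in> un" "u - w \<in> P n" for u w
  proof -
    have "u / w - 1 = (u - w) / w" using un_nz[OF u(2)] by (simp add: field_simps)
    hence "u / w \<in> O1 n" using u by (simp add: O1_def P_divide_un)
    hence h: "\<phi> (u/w) 0 0 (1/(u/w)) \<in> Hh \<phi> n" by (rule HhI) simp
    have "\<phi> u 0 0 (1/u) = \<phi> w 0 0 (1/w) ** \<phi> (u/w) 0 0 (1/(u/w))" unfolding phi_mult[OF \<phi>] using un_nz[OF u(1)] un_nz[OF u(2)] by simp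
    thus ?thesis using pi_mult[OF hG[OF u(2)] hG[OF un_divide[OF u(1,2)]] yW] fxD[OF y h] by simp
  qed
  show "\<exists>j\<in>Hh \<phi> (n - 1). \<pi> (\<phi> (1 + r * c) 0 0 (1/(1 + r * c))) y = \<pi> j y" if "r \<in> P (n - 1)" for r
    using HhI[OF O[OF that] refl] by blast
  show "\<pi> (\<phi> (1 + r * c) 0 0 (1/(1 + r * c))) y = \<pi> (\<phi> (1 + s * c) 0 0 (1/(1 + s * c))) y"
    if "r \<in> P (n - 1)" "s \<in> P (n - 1)" "r - s \<in> P (n - 1 + 1)" for r s
  proof (rule hm[OF O1_un[OF O[OF that(1)] n1(2)] O1_un[OF O[OF that(2)] n1(2)]])
    have "(r - s) * c \<in> P n" using that(3) P_mult_un(1)[OF c] by simp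
    thus "1 + r * c - (1 + s * c) \<in> P n" by (simp add: left_diff_distrib)
  qed
  fix j assume "j \<in> Hh \<phi> (n - 1)"
  then obtain u where u: "u \<in> O1 (n - 1)" "j = \<phi> u 0 0 (1/u)" by (auto simp: Hh_def)
  have uu: "u \<in> un" using O1_un[OF u(1) n1(2)] .
  define d where "d = (u - 1)/c"
  have c0: "c \<noteq> 0" using un_nz[OF c] .
  have d: "d \<in> P (n - 1)" unfolding d_def P_divide_un[OF c] using u(1) by (simp add: O1_def)
  have ud: "u = 1 + d * c" using c0 by (simp add: d_def)
  have "\<pi> j (\<pi> (\<phi> (1 + r * c) 0 0 (1/(1 + r * c))) y) = \<pi> (\<phi> (1 + (r + d) * c) 0 0 (1/(1 + (r + d) * c))) y" if r: "r \<in> P (n - 1)" for r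
  proof -
    have ru: "1 + r * c \<in> un" using O1_un[OF O[OF r] n1(2)] .
    have "\<pi> j (\<pi> (\<phi> (1 + r * c) 0 0 (1/(1 + r * c))) y) = \<pi> (j ** \<phi> (1 + r * c) 0 0 (1/(1 + r * c))) y"
      by (rule pi_mult[symmetric, OF _ hG[OF ru] yW]) (simp add: u(2) hG[OF uu])
    also have "j ** \<phi> (1 + r * c) 0 0 (1/(1 + r * c)) = \<phi> (u * (1 + r * c)) 0 0 (1/(u * (1 + r * c)))"
      unfolding u(2) phi_mult[OF \<phi>] by simp
    also have "\<pi> \<dots> y = \<pi> (\<phi> (1 + (r + d) * c) 0 0 (1/(1 + (r + d) * c))) y"
    proof (rule hm[OF un_mult[OF uu ru] O1_un[OF O[OF P_add[OF r d]] n1(2)]])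
      have "u * (1 + r * c) - (1 + (r + d) * c) = (d * r) * (c * c)" unfolding ud by algebra
      moreover have "d * r \<in> P n" by (rule P_mult'[OF d r]) (use n in simp)
      ultimately show "u * (1 + r * c) - (1 + (r + d) * c) \<in> P n" using P_mult_un(1)[OF un_mult[OF c c]] by simp
    qed
    finally show ?thesis .
  qed
  thus "\<exists>d\<in>P (n - 1). \<forall>r\<in>P (n - 1). \<pi> j (\<pi> (\<phi> (1 + r * c) 0 0 (1/(1 + r * c))) y) = \<pi> (\<phi> (1 + (r + d) * c) 0 0 (1/(1 + (r + d) * c))) y"
    using d by blast
qed

end

section \<open>Lowering the (1,2) depth\<close>

context gl3 begin

text \<open>If all these averages vanished, moving the (2,1) element back across the q terms would
  give \<open>S w = 0\<close>, where the term of digit \<open>c\<close> carries the torus element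
  \<open>1 + b * c * w\<close>. Summing over the digits of \<open>w\<close> turns each term with
  unit \<open>c\<close> into a full torus average, which is 0, while the class of 0 contributes q
  copies of \<open>y\<close>.\<close>

lemma C2_step:
  assumes n: "2 \<le> n" and i: "1 \<le> i" "i \<le> n - 1" and y: "y \<in> fx (JJ n i 0 n 0 n n)" "y \<noteq> 0" "avg (Hh f12 (n - 1)) y = 0"
  shows "\<exists>w\<in>P (n - i). avg (Xp f12 (i - 1)) (\<pi> (f12 1 0 w 1) y) \<noteq> 0"
proof (rule ccontr)
  assume "\<not> ?thesis"
  hence z: "avg (Xp f12 (i - 1)) (\<pi> (f12 1 0 w 1) y) = 0" if "w \<in> P (n - i)" for w using that by blast
  note yW = fxW[OF y(1)]
  have n1: "1 \<le> n" "1 \<le> n - 1" using n by auto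
  note pm = phi_mult[OF sl2emb_f(1)]
  have G12: "a*d - b*c = 1 \<Longrightarrow> f12 a b c d \<in> G" for a b c d by (rule phG[OF sl2emb_f(1)])
  define b where "b = pw (i - 1)"
  let ?h = "\<lambda>u. f12 u 0 0 (1/u)"
  have qq: "of_nat q \<noteq> (0::complex)" using q_ge2 by simp
  define S where "S = (\<lambda>w. \<Sum>c\<in>Tm. \<pi> (?h (1 + b * c * w)) (\<pi> (f12 1 (b * c) 0 1) y))"
  have S: "S w = 0" if w: "w \<in> P (n - i)" for w
  proof -
    have eG: "f12 1 0 w 1 \<in> G" for w by (rule G12) simp
    have pG: "f12 1 w 0 1 \<in> G" for w by (rule G12) simp
    have "\<pi> (f12 1 0 w 1) y \<in> fx (JJ n i 0 n 0 n n)"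
      by (rule normz_fx[OF e21_nrm[where j = "n - i"] JJ_G y(1)]) (use w n i in \<open>auto simp: Xm_def\<close>)
    hence ex: "\<pi> (f12 1 0 w 1) y \<in> fx (Xp f12 (i - 1 + 1))" using fxXJ(1)[OF _ n1(1)] by simp
    have "inverse (of_nat q) \<odot> (\<Sum>c\<in>Tm. \<pi> (f12 1 (b * c) 0 1) (\<pi> (f12 1 0 w 1) y)) = 0"
      using avg_Xp_Tm[OF sl2emb_f(1) G12 ex] z[OF w] by (simp add: b_def)
    hence 0: "(\<Sum>c\<in>Tm. \<pi> (f12 1 (b * c) 0 1) (\<pi> (f12 1 0 w 1) y)) = 0" using qq by simp
    have "0 = \<pi> (f12 1 0 (-w) 1) (\<Sum>c\<in>Tm. \<pi> (f12 1 (b * c) 0 1) (\<pi> (f12 1 0 w 1) y))" unfolding 0 using pi_0[OF eG] by simp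
    also have "\<dots> = (\<Sum>c\<in>Tm. \<pi> (f12 1 0 (-w) 1) (\<pi> (f12 1 (b * c) 0 1) (\<pi> (f12 1 0 w 1) y)))"
      by (rule pi_sum[OF eG pi_W[OF pG pi_W[OF eG yW]]])
    also have "\<dots> = S w" unfolding S_def
    proof (rule sum.cong[OF refl])
      fix c assume c: "c \<in> Tm"
      define x where "x = b * c"
      have x: "x \<in> P (i - 1)" using Tm_P[OF c] by (simp add: x_def b_def pw_mult_P)
      have xw: "x * w \<in> P (n - 1)" by (rule P_mult'[OF x w]) simp
      define u where "u = 1 + x * w"
      have uO: "u \<in> O1 (n - 1)" unfolding u_def by (rule O1_I[OF xw])
      have uu: "u \<in> un" by (rule O1_un[OF uO n1(2)])
      note u0 = un_nz[OF uu]
      have hG: "?h u \<in> G" by (rule G12) (use u0 in simp)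
      \<comment> \<open>The error in commuting the (2,1) element past the (1,2) element once the
        torus element \<open>?h u\<close> is split off; it lies in the group that fixes
        \<open>y\<close>.\<close>
      define m where "m = f12 (1 + x*x*w*w*u) (x * (1/u - 1) + x*x*x*w*w) (- (x*w*w*u)) (1 - x*x*w*w)"
      have "(1 - x*w) * u = 1 - x*x*w*w" by (simp add: u_def algebra_simps)
      hence e1: "f12 1 0 (-w) 1 ** (f12 1 x 0 1 ** f12 1 0 w 1) = ?h u ** (f12 1 x 0 1 ** m)"
        unfolding m_def f12_def mat3_mult mat3_eq using u0 by (simp add: field_simps) (simp add: u_def algebra_simps)
      have mJ: "m \<in> JJ n i 0 n 0 n n"
      proof -
        have ww: "w * w \<in> P (2*(n - i))" by (rule P_mult'[OF w w]) simp
        have xxww: "(x*w)*(x*w) \<in> P n" by (rule P_mult'[OF xw xw]) (use n in simp)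
        have "1 + (x*w)*(x*w)*u \<in> O1 n" by (rule O1_I) (use xxww P_mult_un(1)[OF uu] in blast)
        hence 1: "1 + x*x*w*w*u \<in> O1 n" by (simp add: mult_ac)
        have "1 + (- ((x*w)*(x*w))) \<in> O1 n" by (rule O1_I) (use xxww in simp)
        hence 2: "1 - x*x*w*w \<in> O1 n" by (simp add: mult_ac)
        have "1/u - 1 \<in> P (n - 1)" using O1_divide[OF O1_1 uO n1(2)] by (simp add: O1_def)
        hence a: "x * (1/u - 1) \<in> P i" by (rule P_mult'[OF x]) (use n in simp)
        have "x * ((x*w)*(x*w)) \<in> P i" by (rule P_mult'[OF x xxww]) (use n in simp)
        hence 3: "x * (1/u - 1) + x*x*x*w*w \<in> P i" using P_add[OF a] by (simp add: mult_ac)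
        have "x * (w*w) \<in> P n" by (rule P_mult'[OF x ww]) (use i in simp)
        hence 4: "- (x*w*w*u) \<in> P n" using P_mult_un(1)[OF uu, of "x*(w*w)" n] by (simp add: mult_ac)
        have "det (f12 1 0 (-w) 1 ** (f12 1 x 0 1 ** f12 1 0 w 1)) = det (?h u ** (f12 1 x 0 1 ** m))" unfolding e1 ..
        hence "det m = 1" unfolding det_mul using u0 by (simp add: f12_def mat3_det[of _ _ 0])
        thus ?thesis using 1 2 3 4 unfolding JJ_def m_def f12_def by simp
      qed
      have mG: "m \<in> G" using mJ JJ_G by blast
      have "\<pi> (f12 1 0 (-w) 1) (\<pi> (f12 1 x 0 1) (\<pi> (f12 1 0 w 1) y)) = \<pi> (f12 1 0 (-w) 1) (\<pi> (f12 1 x 0 1 ** f12 1 0 w 1) y)"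
        using pi_mult[OF pG eG yW] by simp
      also have "\<dots> = \<pi> (?h u) (\<pi> (f12 1 x 0 1 ** m) y)"
        by (rule pi_eq2[OF e1 eG GD(3)[OF pG eG] hG GD(3)[OF pG mG] yW])
      also have "\<pi> (f12 1 x 0 1 ** m) y = \<pi> (f12 1 x 0 1) y" using pi_mult[OF pG mG yW] fxD[OF y(1) mJ] by simp
      finally show "\<pi> (f12 1 0 (-w) 1) (\<pi> (f12 1 (b*c) 0 1) (\<pi> (f12 1 0 w 1) y)) = \<pi> (?h (1 + b*c*w)) (\<pi> (f12 1 (b*c) 0 1) y)"
        unfolding x_def u_def .
    qed
    finally show ?thesis by simp
  qed
  define T where "T = (\<lambda>c. \<Sum>d\<in>Tm. \<pi> (?h (1 + b * c * (pw (n - i) * d))) (\<pi> (f12 1 (b * c) 0 1) y))"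
  have "(\<Sum>d\<in>Tm. S (pw (n - i) * d)) = 0"
    by (rule sum.neutral, rule ballI, rule S) (use Tm_P in \<open>simp add: pw_mult_P\<close>)
  hence TS: "(\<Sum>c\<in>Tm. T c) = 0" unfolding S_def T_def by (subst (asm) sum.swap)
  have bpw: "b * c * (pw (n - i) * d) = pw (n - 1) * d * c" for c d
    using pw_add[of "i - 1" "n - i"] by (simp add: b_def mult_ac)
  have Tu0: "T c = 0" if c: "c \<in> Tu" for c
  proof -
    have cu: "c \<in> un" using c by blast
    let ?e = "f12 1 (b * c) 0 1"
    have eG: "?e \<in> G" by (rule G12) simp
    have bc: "b * c \<in> P (i - 1)" using un_P[OF cu] by (simp add: b_def pw_mult_P)
    have "T c = (\<Sum>d\<in>Tm. \<pi> ?e (\<pi> (?h (1 + pw (n - 1) * d * c)) y))" unfolding T_def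
    proof (rule sum.cong[OF refl])
      fix d assume d: "d \<in> Tm"
      define u where "u = 1 + pw (n - 1) * d * c"
      have "pw (n - 1) * d * c \<in> P (n - 1)" using Tm_P[OF d] P_mult_un(1)[OF cu] by (simp add: pw_mult_P)
      hence uO: "u \<in> O1 (n - 1)" unfolding u_def by (rule O1_I)
      have uu: "u \<in> un" by (rule O1_un[OF uO n1(2)])
      note u0 = un_nz[OF uu]
      have hG: "?h u \<in> G" by (rule G12) (use u0 in simp)
      let ?m = "f12 1 (b * c * (1 - 1/(u*u))) 0 1"
      have "1/(u*u) \<in> O1 (n - 1)" using O1_divide[OF O1_1 O1_mult[OF uO uO n1(2)] n1(2)] .
      hence "- (1/(u*u) - 1) \<in> P (n - 1)" by (simp only: P_minus) (simp add: O1_def)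
      hence "b * c * (1 - 1/(u*u)) \<in> P i" by (intro P_mult'[OF bc, of _ "n - 1"]) (use n in auto)
      hence mf: "\<pi> ?m y = y" by (intro fxD[OF fxXJ(1)[OF y(1) n1(1)]]) (auto simp: Xp_def)
      have mG: "?m \<in> G" by (rule G12) simp
      have e: "?h u ** ?e = (?e ** ?h u) ** ?m" unfolding f12_def mat3_mult mat3_eq using u0
        by (simp add: field_simps)
      have "\<pi> (?h u) (\<pi> ?e y) = \<pi> (?e ** ?h u) (\<pi> ?m y)" by (rule pi_eq2[OF e hG eG GD(3)[OF eG hG] mG yW])
      also have "\<dots> = \<pi> ?e (\<pi> (?h u) y)" unfolding mf by (rule pi_mult[OF eG hG yW])
      finally show "\<pi> (?h (1 + b * c * (pw (n - i) * d))) (\<pi> ?e y) = \<pi> ?e (\<pi> (?h (1 + pw (n - 1) * d * c)) y)"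
        unfolding u_def bpw .
    qed
    also have "\<dots> = \<pi> ?e (\<Sum>d\<in>Tm. \<pi> (?h (1 + pw (n - 1) * d * c)) y)"
    proof (rule pi_sum[OF eG, symmetric])
      fix d assume d: "d \<in> Tm"
      have "1 + pw (n - 1) * d * c \<in> un" using Tm_P[OF d] P_mult_un(1)[OF cu] n1(2) by (intro un_1p[of _ "n - 1"]) (simp_all add: pw_mult_P)
      thus "\<pi> (?h (1 + pw (n - 1) * d * c)) y \<in> W" by (intro pi_W[OF G12 yW]) (simp add: un_nz)
    qed
    also have "(\<Sum>d\<in>Tm. \<pi> (?h (1 + pw (n - 1) * d * c)) y) = 0"
      using avg_Hh_Tm[OF sl2emb_f(1) G12 fxXJ(7)[OF y(1) n1(1)] n cu] y(3) qq by simp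
    finally show ?thesis using pi_0[OF eG] by simp
  qed
  obtain c0 where c0: "c0 \<in> Tm" "c0 \<in> P 1" "Tm = insert c0 Tu" "c0 \<notin> Tu" by (rule Tm_split)
  have T0: "T c0 = of_nat q \<odot> y"
  proof -
    have "b * c0 \<in> P i" using c0(2) by (simp add: b_def pw_mult_P)
    hence e: "\<pi> (f12 1 (b * c0) 0 1) y = y" by (intro fxD[OF fxXJ(1)[OF y(1) n1(1)]]) (auto simp: Xp_def)
    have "T c0 = (\<Sum>d\<in>Tm. y)" unfolding T_def e
    proof (rule sum.cong[OF refl])
      fix d assume d: "d \<in> Tm"
      have "pw (n - 1) * d \<in> P (n - 1)" using Tm_P[OF d] by (simp add: pw_mult_P)
      hence "pw (n - 1) * d * c0 \<in> P n" by (rule P_mult'[OF _ c0(2)]) simp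
      hence "1 + b * c0 * (pw (n - i) * d) \<in> O1 n" unfolding bpw by (rule O1_I)
      thus "\<pi> (?h (1 + b * c0 * (pw (n - i) * d))) y = y" by (intro fxD[OF fxXJ(7)[OF y(1) n1(1)]] HhI[OF _ refl])
    qed
    thus ?thesis by (simp add: sum_constant_scale Tm_card)
  qed
  have "(\<Sum>c\<in>Tm. T c) = T c0 + (\<Sum>c\<in>Tu. T c)" by (subst c0(3)) (use c0(4) Tu_finite in simp)
  also have "(\<Sum>c\<in>Tu. T c) = 0" using Tu0 by (intro sum.neutral) blast
  finally have "of_nat q \<odot> y = 0" using TS T0 by simp
  thus False using qq y(2) by simp
qed

end

context cuspidal_gl3 begin

lemma avg_kill_same: assumes H: "cpt H" and g: "g \<in> G" and x: "x \<in> W" "avg H x = 0"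
  and c: "\<And>h. h \<in> H \<Longrightarrow> \<pi> h (\<pi> g x) = \<pi> g (\<pi> h x)"
  shows "avg H (\<pi> g x) = 0"
  by (rule avg_kill[OF H H g x]) (use c in blast)

text \<open>A monomial matrix that permutes the coordinates cyclically carries this to
  \<open>C1\<close> with k = n: the (1,2) and (2,3) tori become the (2,3) and (1,3) tori.\<close>

lemma C2_zero: assumes n: "2 \<le> n" and y: "y \<in> fx (JJ n 0 0 n 0 n n)" "avg (Hh f12 (n - 1)) y = 0" "avg (Hh f23 (n - 1)) y = 0"
  shows "y = 0"
proof -
  have n1: "1 \<le> n" "1 \<le> n - 1" using n by auto
  define g where "g = mat3 0 0 1 (pw n) 0 0 0 1 0"
  have gi: "g ** mat3 0 (1 / pw n) 0 0 0 1 1 0 0 = mat 1" unfolding g_def mat3_mult mat3_1 by simp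
  have ig: "inv3 g = mat3 0 (1 / pw n) 0 0 0 1 1 0 0" by (rule inv3_unique[OF gi])
  have gG: "g \<in> G" by (rule mG) (simp add: g_def mat3_det)
  note yW = fxW[OF y(1)]
  have f1: "\<pi> g y \<in> fx (JJ n (n - 1) n n n (n - n) (n - n))"
  proof (rule fx_conj[OF y(1) JJ_G gG JJ_G])
    fix x assume x: "x \<in> JJ n (n - 1) n n n (n - n) (n - n)"
    obtain x1 x2 x3 x4 x5 x6 x7 x8 x9 where X: "x = mat3 x1 x2 x3 x4 x5 x6 x7 x8 x9" "x1 \<in> O1 n" "x5 \<in> O1 n" "x9 \<in> O1 n"
      "x2 \<in> P (n - 1)" "x3 \<in> P n" "x4 \<in> P n" "x6 \<in> P n" "x7 \<in> P (n - n)" "x8 \<in> P (n - n)" by (rule JJ_E[OF x])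
    have det: "det (inv3 g ** x ** g) = 1" using det_conj(1)[OF GD(1)[OF gG]] x by (simp add: JJ_def)
    have "inv3 g ** x ** g = mat3 x5 (x6 / pw n) (x4 / pw n) (x8 * pw n) x9 x7 (x2 * pw n) x3 x1"
      unfolding ig unfolding g_def X(1) mat3_mult mat3_eq by simp
    thus "inv3 g ** x ** g \<in> JJ n 0 0 n 0 n n" using det X(2-) P_mono[OF X(5), of 0] n
      unfolding JJ_def by (simp add: pw_divide_P pw_mult_P)
  qed
  have f2: "avg (Hh f13 (n - 1)) (\<pi> g y) = 0" "avg (Hh f23 (n - 1)) (\<pi> g y) = 0"
  proof -
    have h: "g ** f23 u 0 0 (1/u) ** inv3 g = f13 (1/u) 0 0 u" "g ** f12 u 0 0 (1/u) ** inv3 g = f23 u 0 0 (1/u)"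
      "inv3 g ** f13 u 0 0 (1/u) ** g = f23 (1/u) 0 0 u" "inv3 g ** f23 u 0 0 (1/u) ** g = f12 u 0 0 (1/u)" for u
      unfolding ig unfolding g_def f12_def f13_def f23_def mat3_mult mat3_eq by simp_all
    have i: "f13 (1/u) 0 0 u \<in> Hh f13 (n - 1)" "f23 (1/u) 0 0 u \<in> Hh f23 (n - 1)" if "u \<in> O1 (n - 1)" for u
      by (rule HhI[OF O1_divide[OF O1_1 that n1(2)]]; simp)+
    have "\<pi> g (avg (Hh f23 (n - 1)) y) = avg (Hh f13 (n - 1)) (\<pi> g y)"
    proof (rule avg_conj[OF gG cH[OF sl2emb_f(3) n1(2)] cH[OF sl2emb_f(2) n1(2)] yW])
      fix j assume "j \<in> Hh f23 (n - 1)"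
      then obtain u where "u \<in> O1 (n - 1)" "j = f23 u 0 0 (1/u)" unfolding Hh_def by blast
      thus "g ** j ** inv3 g \<in> Hh f13 (n - 1)" using h(1) i(1) by simp
    next
      fix j assume "j \<in> Hh f13 (n - 1)"
      then obtain u where "u \<in> O1 (n - 1)" "j = f13 u 0 0 (1/u)" unfolding Hh_def by blast
      thus "inv3 g ** j ** g \<in> Hh f23 (n - 1)" using h(3) i(2) by simp
    qed
    moreover have "\<pi> g (avg (Hh f12 (n - 1)) y) = avg (Hh f23 (n - 1)) (\<pi> g y)"
      by (rule avg_conj[OF gG cH[OF sl2emb_f(1) n1(2)] cH[OF sl2emb_f(3) n1(2)] yW])
         (use h in \<open>auto simp: Hh_def\<close>)
    ultimately show "avg (Hh f13 (n - 1)) (\<pi> g y) = 0" "avg (Hh f23 (n - 1)) (\<pi> g y) = 0" using y pi_0[OF gG] by simp_all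
  qed
  have "\<pi> g y = 0" by (rule C1[OF n f1 f2])
  thus ?thesis using pi_nz[OF gG yW] by blast
qed

text \<open>A nonzero vector of (1,2) depth i + 1 gives, by \<open>C2_step\<close>, a translate
  whose average over the next larger (1,2) root group is nonzero. That average satisfies the
  hypotheses at depth i.\<close>

lemma C2_desc: assumes n: "2 \<le> n" and y: "y \<in> fx (JJ n (int i) 0 n 0 n n)" "avg (Hh f12 (n - 1)) y = 0" "avg (Hh f23 (n - 1)) y = 0"
    and i: "int i \<le> n - 1"
  shows "y = 0"
  using y i
proof (induction i arbitrary: y)
  case 0
  thus ?case using C2_zero[OF n] by simp
next
  case (Suc i)
  define k where "k = int (Suc i)"
  have k: "1 \<le> k" "k \<le> n - 1" "int i = k - 1" using Suc.prems(4) by (simp_all add: k_def)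
  note y = Suc.prems(1-3)[folded k_def]
  have n1: "1 \<le> n" "1 \<le> n - 1" using n by auto
  note yW = fxW[OF y(1)]
  show ?case
  proof (rule ccontr)
    assume "y \<noteq> 0"
    from C2_step[OF n k(1,2) y(1) this y(2)] obtain w where w: "w \<in> P (n - k)" "avg (Xp f12 (k - 1)) (\<pi> (f12 1 0 w 1) y) \<noteq> 0" by blast
    let ?e = "f12 1 0 w 1"
    have eG: "?e \<in> G" by (rule phG[OF sl2emb_f(1)]) simp
    define y1 where "y1 = \<pi> ?e y"
    have y1: "y1 \<in> fx (JJ n k 0 n 0 n n)" unfolding y1_def
      by (rule normz_fx[OF e21_nrm[where j = "n - k"] JJ_G y(1)]) (use w n k in \<open>auto simp: Xm_def\<close>)
    \<comment> \<open>The torus commutes with \<open>?e\<close> up to a (2,1) root element in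
      \<open>P n\<close>, which fixes \<open>y\<close>; so the translate is killed by the same torus
      averages.\<close>
    have kom: "\<pi> h (\<pi> ?e y) = \<pi> ?e (\<pi> h y)" if h: "h \<in> Hh f12 (n - 1) \<or> h \<in> Hh f23 (n - 1)" for h
    proof -
      obtain u where u: "u \<in> O1 (n - 1)" "h = mat3 u 0 0 0 (1/u) 0 0 0 1 \<or> h = mat3 1 0 0 0 u 0 0 0 (1/u)"
        using h by (auto simp: Hh_def f12_def f23_def)
      have uu: "u \<in> un" by (rule O1_un[OF u(1) n1(2)])
      note u0 = un_nz[OF uu]
      have hG: "h \<in> G" by (rule mG) (use u(2) u0 in \<open>auto simp: mat3_det\<close>)
      have "\<exists>t\<in>P n. h ** ?e = (?e ** h) ** f12 1 0 t 1"
        using u(2)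
      proof
        assume h: "h = mat3 u 0 0 0 (1/u) 0 0 0 1"
        have uO: "1/u \<in> O1 (n - 1)" using O1_divide[OF O1_1 u(1) n1(2)] .
        have "1/u - u \<in> P (n - 1)" using P_diff[of "1/u - 1" "n - 1" "u - 1"] uO u(1) by (simp add: O1_def)
        hence "w * (1/u - u) \<in> P n" by (rule P_mult'[OF w(1)]) (use k in simp)
        hence "w * (1/u - u) * u \<in> P n" using P_mult_un(1)[OF uu] by simp
        moreover have "h ** ?e = (?e ** h) ** f12 1 0 (w * (1/u - u) * u) 1"
          unfolding h f12_def mat3_mult mat3_eq using u0 by (simp add: algebra_simps)
        ultimately show ?thesis by blast
      next
        assume h: "h = mat3 1 0 0 0 u 0 0 0 (1/u)"
        have "u - 1 \<in> P (n - 1)" using u(1) by (simp add: O1_def)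
        hence "w * (u - 1) \<in> P n" by (rule P_mult'[OF w(1)]) (use k in simp)
        hence "w * (u - 1) / u \<in> P n" using P_divide_un[OF uu] by simp
        moreover have "h ** ?e = (?e ** h) ** f12 1 0 (w * (u - 1) / u) 1"
          unfolding h f12_def mat3_mult mat3_eq using u0 by (simp add: field_simps)
        ultimately show ?thesis by blast
      qed
      then obtain t where t: "t \<in> P n" "h ** ?e = (?e ** h) ** f12 1 0 t 1" by blast
      have tG: "f12 1 0 t 1 \<in> G" by (rule phG[OF sl2emb_f(1)]) simp
      have ty: "\<pi> (f12 1 0 t 1) y = y" by (rule fxD[OF fxXJ(4)[OF y(1) n1(1)]]) (use t in \<open>auto simp: Xm_def\<close>)
      have "\<pi> h (\<pi> ?e y) = \<pi> (?e ** h) (\<pi> (f12 1 0 t 1) y)" by (rule pi_eq2[OF t(2) hG eG GD(3)[OF eG hG] tG yW])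
      also have "\<dots> = \<pi> ?e (\<pi> h y)" unfolding ty by (rule pi_mult[OF eG hG yW])
      finally show ?thesis .
    qed
    have kil: "avg (Hh f12 (n - 1)) y1 = 0" "avg (Hh f23 (n - 1)) y1 = 0" unfolding y1_def
      by (rule avg_kill_same[OF cH[OF sl2emb_f(1) n1(2)] eG yW y(2)]; use kom in blast)
         (rule avg_kill_same[OF cH[OF sl2emb_f(3) n1(2)] eG yW y(3)]; use kom in blast)
    define y2 where "y2 = avg (Xp f12 (k - 1)) y1"
    have nrX: "normz h (JJ n k 0 n 0 n n)" if "h \<in> Xp f12 (k - 1)" for h
      by (rule e12_nrm[OF that]) (use n k in auto)
    have "y2 \<in> fx (JJ n k 0 n 0 n n)" unfolding y2_def
      by (rule avg_normz_fx[OF cX[OF sl2emb_f(1)] cpt_JJ nrX y1]) (use n k in \<open>auto simp: okJ_def\<close>)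
    moreover have "y2 \<in> fx (Xp f12 (k - 1))" unfolding y2_def by (rule avg_fx[OF cX[OF sl2emb_f(1)] fxW[OF y1]])
    ultimately have y2: "y2 \<in> fx (JJ n (k - 1) 0 n 0 n n)" by (rule fx_JJ_12) (use n k in auto)
    have hX: "normz h (Xp f12 f)" if h: "h \<in> Hh f12 (n - 1) \<or> h \<in> Hh f23 (n - 1)" for h f
      using h
    proof
      assume "h \<in> Hh f12 (n - 1)"
      thus ?thesis using Hh_normz_X(1)[OF sl2emb_f(1) phG[OF sl2emb_f(1)] n1(2)] by blast
    next
      assume "h \<in> Hh f23 (n - 1)"
      then obtain u where u: "u \<in> O1 (n - 1)" "h = mat3 1 0 0 0 u 0 0 0 (1/u)" by (auto simp: Hh_def f23_def)
      have uu: "u \<in> un" by (rule O1_un[OF u(1) n1(2)])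
      have i: "h ** mat3 1 0 0 0 (1/u) 0 0 0 u = mat 1" unfolding u(2) mat3_mult mat3_1 using un_nz[OF uu] by simp
      show ?thesis
      proof (rule normzI[OF i])
        fix j assume "j \<in> Xp f12 f"
        then obtain r where r: "r \<in> P f" "j = mat3 1 r 0 0 1 0 0 0 1" by (auto simp: Xp_def f12_def)
        have "h ** j ** mat3 1 0 0 0 (1/u) 0 0 0 u = f12 1 (r/u) 0 1" "mat3 1 0 0 0 (1/u) 0 0 0 u ** j ** h = f12 1 (r*u) 0 1"
          unfolding u(2) r(2) f12_def mat3_mult mat3_eq using un_nz[OF uu] by simp_all
        thus "h ** j ** mat3 1 0 0 0 (1/u) 0 0 0 u \<in> Xp f12 f" "mat3 1 0 0 0 (1/u) 0 0 0 u ** j ** h \<in> Xp f12 f"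
          using r P_divide_un[OF uu] P_mult_un(1)[OF uu] by (auto simp: Xp_def)
      qed
    qed
    have "avg (Hh f12 (n - 1)) y2 = 0" "avg (Hh f23 (n - 1)) y2 = 0" unfolding y2_def
      by (rule avg_normz_0[OF cH[OF sl2emb_f(1) n1(2)] cX[OF sl2emb_f(1)] hX fxW[OF y1] kil(1)]; simp)
         (rule avg_normz_0[OF cH[OF sl2emb_f(3) n1(2)] cX[OF sl2emb_f(1)] hX fxW[OF y1] kil(2)]; simp)
    from Suc.IH[OF y2[folded k(3)] this] k have "y2 = 0" by simp
    thus False using w(2) by (simp add: y2_def y1_def)
  qed
qed

text \<open>A central element of the Levi factor rescales the radical, which reduces
  \<open>k\<close> to 0, and commutes with the tori.\<close>

lemma C2: assumes n: "2 \<le> n" and y: "y \<in> fx (JJ n (n - 1) k n k (n - k) (n - k))" "avg (Hh f12 (n - 1)) y = 0" "avg (Hh f23 (n - 1)) y = 0"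
  shows "y = 0"
proof -
  have n1: "1 \<le> n" "1 \<le> n - 1" using n by auto
  define g where "g = mat3 (pw (-k)) 0 0 0 (pw (-k)) 0 0 0 1"
  have gG: "g \<in> G" by (rule mG) (simp add: g_def mat3_det)
  note yW = fxW[OF y(1)]
  have "\<pi> g y \<in> fx (JJ n (n - 1) 0 n 0 n n)" unfolding g_def by (rule fx_diag[OF y(1)]) simp_all
  hence 1: "\<pi> g y \<in> fx (JJ n (int (nat (n - 1))) 0 n 0 n n)" using n by simp
  have 2: "avg (Hh f12 (n - 1)) (\<pi> g y) = 0" "avg (Hh f23 (n - 1)) (\<pi> g y) = 0"
  proof -
    have c: "\<pi> h (\<pi> g y) = \<pi> g (\<pi> h y)" if "h \<in> Hh f12 (n - 1) \<or> h \<in> Hh f23 (n - 1)" for h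
    proof (rule pi_eq2[OF _ _ gG gG _ yW])
      show hG: "h \<in> G" "h \<in> G" using that cptD(1)[OF cH[OF sl2emb_f(1) n1(2)]] cptD(1)[OF cH[OF sl2emb_f(3) n1(2)]] by blast+
      show "h ** g = g ** h" using that unfolding g_def Hh_def f12_def f23_def by (auto simp: mat3_mult mat3_eq)
    qed
    show "avg (Hh f12 (n - 1)) (\<pi> g y) = 0" "avg (Hh f23 (n - 1)) (\<pi> g y) = 0"
      by (rule avg_kill_same[OF cH[OF sl2emb_f(1) n1(2)] gG yW y(2)]; use c in blast)
         (rule avg_kill_same[OF cH[OF sl2emb_f(3) n1(2)] gG yW y(3)]; use c in blast)
  qed
  have "\<pi> g y = 0" by (rule C2_desc[OF n 1 2]) (use n in simp)
  thus ?thesis using pi_nz[OF gG yW] by blast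
qed

text \<open>A relation between coroots: the (2,3) torus element of \<open>u\<close> is the (1,2)
  torus element of \<open>1/u\<close> times the (1,3) torus element of \<open>u\<close>, and the
  latter fixes \<open>y\<close>.\<close>

lemma avg_f23_f12: assumes n: "1 \<le> n" and y: "y \<in> fx (Hh f13 n)" shows "avg (Hh f23 n) y = avg (Hh f12 n) y"
proof -
  note yW = fxW[OF y]
  have e: "\<pi> (f23 u 0 0 (1/u)) y = \<pi> (f12 (1/u) 0 0 u) y" if u: "u \<in> O1 n" for u
  proof -
    have u0: "u \<noteq> 0" using O1_un[OF u n] un_nz by blast
    have G: "f13 u 0 0 (1/u) \<in> G" "f12 (1/u) 0 0 u \<in> G" by (rule phG[OF sl2emb_f(2)] phG[OF sl2emb_f(1)], use u0 in simp)+
    have "f23 u 0 0 (1/u) = f12 (1/u) 0 0 u ** f13 u 0 0 (1/u)" unfolding f12_def f13_def f23_def mat3_mult mat3_eq using u0 by simp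
    moreover have "\<pi> (f13 u 0 0 (1/u)) y = y" by (rule fxD[OF y HhI[OF u]]) simp
    ultimately show ?thesis using pi_mult[OF G(2,1) yW] by simp
  qed
  show ?thesis
  proof (rule avg_eqI)
    show "\<exists>j\<in>Hh f12 n. \<pi> h y = \<pi> j y" if "h \<in> Hh f23 n" for h
      using that e HhI[OF O1_divide[OF O1_1 _ n], of _ _ f12] unfolding Hh_def[of f23] by fastforce
    fix j assume "j \<in> Hh f12 n"
    then obtain u where u: "u \<in> O1 n" "j = f12 u 0 0 (1/u)" by (auto simp: Hh_def)
    have u': "1/u \<in> O1 n" using O1_divide[OF O1_1 u(1) n] .
    have "\<pi> j y = \<pi> (f23 (1/u) 0 0 (1/(1/u))) y" unfolding e[OF u'] u(2) by simp
    thus "\<exists>h\<in>Hh f23 n. \<pi> j y = \<pi> h y" using HhI[OF u' refl, of f23] by blast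
  qed
qed

text \<open>The two root elements commute up to \<open>m\<close>, which fixes \<open>y\<close>: the
  product \<open>a * b\<close> lies in \<open>P (2 * n - 3)\<close>, and 2 n - 3 >= n - 1.\<close>

lemma avg_comm_XY: assumes n: "2 \<le> n" and y: "y \<in> fx (JJ (n - 1) (n - 1) k n k s s)"
  shows "avg (Xm f12 (n - 1)) (avg (Xp f12 (n - 2)) y) = avg (Xp f12 (n - 2)) (avg (Xm f12 (n - 1)) y)"
proof (rule avg_commute[OF cY[OF sl2emb_f(1)] cX[OF sl2emb_f(1)] fxW[OF y]])
  note yW = fxW[OF y]
  fix h j assume h: "h \<in> Xm f12 (n - 1)" and j: "j \<in> Xp f12 (n - 2)"
  obtain a where a: "a \<in> P (n - 2)" "j = f12 1 a 0 1" using j by (auto simp: Xp_def)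
  obtain b where b: "b \<in> P (n - 1)" "h = f12 1 0 b 1" using h by (auto simp: Xm_def)
  have hG: "h \<in> G" and jG: "j \<in> G" using cptD(1)[OF cX[OF sl2emb_f(1)] j] cptD(1)[OF cY[OF sl2emb_f(1)] h] by auto
  define m where "m = f12 (1 - a*b) (- (a*(a*b))) (b*(a*b)) (1 + (a*b + (a*b)*(a*b)))"
  have eq: "h ** j = j ** (h ** m)" unfolding a(2) b(2) m_def f12_def mat3_mult mat3_eq by (simp add: algebra_simps)
  have "det (h ** j) = det (j ** (h ** m))" unfolding eq ..
  hence det: "det m = 1" unfolding det_mul a(2) b(2) by (simp add: f12_def mat3_det[of 1])
  have ab: "a*b \<in> P (n - 1)" by (rule P_mult'[OF a(1) b(1)]) (use n in simp)
  have ab2: "a*b \<in> P (2*n - 3)" by (rule P_mult'[OF a(1) b(1)]) simp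
  have "a*(a*b) \<in> P (n - 1)" by (rule P_mult'[OF a(1) ab2]) (use n in simp)
  moreover have "b*(a*b) \<in> P n" by (rule P_mult'[OF b(1) ab2]) (use n in simp)
  moreover have "(a*b)*(a*b) \<in> P (n - 1)" by (rule P_mult'[OF ab ab]) (use n in simp)
  moreover have "1 + - (a*b) \<in> O1 (n - 1)" by (rule O1_I) (use ab in simp)
  ultimately have mJ: "m \<in> JJ (n - 1) (n - 1) k n k s s"
    using det O1_I[OF P_add[OF ab, of "(a*b)*(a*b)"]] unfolding JJ_def m_def f12_def by simp
  have mG': "m \<in> G" using mJ JJ_G by blast
  have "\<pi> h (\<pi> j y) = \<pi> j (\<pi> (h ** m) y)" by (rule pi_eq2[OF eq hG jG jG GD(3)[OF hG mG'] yW])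
  thus "\<pi> h (\<pi> j y) = \<pi> j (\<pi> h y)" using pi_mult[OF hG mG' yW] fxD[OF y mJ] by simp
qed

text \<open>Induction on the level. By \<open>cuspA\<close> a counterexample may be taken with (1,2)
  depth n - 1. It is split into pieces that are 0 by \<open>C2\<close> or \<open>C3r\<close>, or
  that have level n - 1. One of the latter must first be conjugated, which replaces t by t + 1;
  hence the bound on s + t falls from 1 by one with each level.\<close>

theorem GL3_vanish:
  assumes "1 \<le> N" "x \<in> fx (JL (int N) (int N) (int N) s s)" "s + t \<le> 2 - int N"
  shows "avg (U2 t t) x = 0"
proof -
  define L where "L = (\<lambda>t. avg (U2 t t))"
  have Ldiff: "L t (x - y) = L t x - L t y" if "x \<in> W" "y \<in> W" for t x y unfolding L_def by (rule avg_diff[OF cpt_U2 that])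
  \<comment> \<open>\<open>cuspA\<close> is applied to \<open>L t x\<close>, but the average over
    \<open>Cg n\<close> is carried out on the smaller average \<open>x0\<close> at depth
    \<open>n - s\<close>, so that depth \<open>s\<close> survives in the last row.\<close>
  have reduce: "\<exists>z. L t z \<noteq> 0 \<and> z \<in> fx (JJ n (n - 1) (n - s) n (n - s) s s) \<and> z \<in> fx (Hh f13 (max 1 (n - 1)))"
    if n: "1 \<le> n" and x: "x \<in> fx (JL n n n s s)" and st: "s + t \<le> n" and nz: "L t x \<noteq> 0" for n x t
  proof -
    define k where "k = n - s"
    have s: "n - k = s" by (simp add: k_def)
    note xW = fxW[OF x]
    have y: "L t x \<in> fx (JJ n n t n t (n - t) (n - t))" unfolding L_def
      by (rule avg_U2_fx[OF x n]) (use st n in simp_all)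
    obtain g where g: "g \<in> LR" "avg (Cg n) (\<pi> g (L t x)) \<noteq> 0" using cuspA[OF n y nz] by blast
    note gG = LR_G[OF g(1)]
    define x0 where "x0 = L k x"
    have x0: "x0 \<in> fx (JJ n n k n k (n - k) (n - k))" unfolding x0_def L_def
      by (rule avg_U2_fx[OF x n]) (use n in \<open>simp_all add: k_def\<close>)
    have Lx0: "L t x0 = L t x" unfolding x0_def L_def
      by (rule avg_sub[OF cpt_U2 cpt_U2 U2_mono xW]) (use st in \<open>simp_all add: k_def\<close>)
    define z where "z = avg (Cg n) (\<pi> g x0)"
    have gx: "\<pi> g x0 \<in> fx (JJ n n k n k (n - k) (n - k))" by (rule normz_fx[OF LR_normz(3)[OF g(1) n] JJ_G x0])
    have CL: "h \<in> LR" if "h \<in> Cg n" for h using Cg_LR[OF n] that by blast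
    have z1: "z \<in> fx (JJ n n k n k (n - k) (n - k))" unfolding z_def
      by (rule avg_normz_fx[OF cpt_Cg[OF n] cpt_JJ _ gx], simp add: okJ_def n) (use n in \<open>simp_all add: LR_normz(3)[OF CL]\<close>)
    have zC: "z \<in> fx (Cg n)" unfolding z_def by (rule avg_fx[OF cpt_Cg[OF n] fxW[OF gx]])
    have "z \<in> fx (Xp f12 (n - 1))" by (rule fx_anti[OF zC]) (auto simp: Xp_def f12_def intro!: Cg_I)
    hence z2: "z \<in> fx (JJ n (n - 1) k n k (n - k) (n - k))" by (intro fx_JJ_12[OF z1]) (use n in simp_all)
    have z3: "z \<in> fx (Hh f13 (max 1 (n - 1)))" by (rule fx_anti[OF zC]) (auto simp: Hh_def f13_def intro!: Cg_I)
    have "L t z = avg (Cg n) (L t (\<pi> g x0))" unfolding z_def L_def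
      by (rule avg_commute_normz[symmetric, OF cpt_Cg[OF n] cpt_U2 LR_normz(1)[OF CL] fxW[OF gx]])
    also have "L t (\<pi> g x0) = \<pi> g (L t x0)" unfolding L_def
      by (rule normz_avg[symmetric, OF LR_normz(1)[OF g(1)] cpt_U2 fxW[OF x0]])
    finally have "L t z \<noteq> 0" using g(2) Lx0 by simp
    thus ?thesis using z2[unfolded s, unfolded k_def] z3 by blast
  qed
  show ?thesis using assms
  proof (induction N arbitrary: x t rule: nat_induct_at_least)
    case base
    show ?case
    proof (rule ccontr)
      assume "avg (U2 t t) x \<noteq> 0"
      hence nz: "L t x \<noteq> 0" by (simp add: L_def)
      have b: "x \<in> fx (JL 1 1 1 s s)" "s + t \<le> 1" using base.prems by simp_all
      obtain z where "L t z \<noteq> 0" "z \<in> fx (JJ 1 (1 - 1) (1 - s) 1 (1 - s) s s)" using reduce[OF order_refl b nz] by blast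
      hence z: "L t z \<noteq> 0" "z \<in> fx (JJ 1 0 (1 - s) 1 (1 - s) s s)" by simp_all
      have z': "z \<in> fx (JJ 1 0 (1 - s) 1 (1 - s) (1 - (1 - s)) (1 - (1 - s)))" using z(2) by simp
      have "z = 0" by (rule IW[OF z'])
      thus False using z(1) avg_0[OF cpt_U2] by (simp add: L_def)
    qed
  next
    case (Suc N)
    define n where "n = int (Suc N)"
    have n: "2 \<le> n" "int N = n - 1" using Suc.hyps by (simp_all add: n_def)
    have n1: "1 \<le> n" "1 \<le> n - 1" using n by auto
    have IH: "L t x = 0" if "x \<in> fx (JL (n - 1) (n - 1) (n - 1) s s)" "s + t \<le> 2 - (n - 1)" for x t
      using Suc.IH[of x t] that n(2) by (simp add: L_def)
    have st: "s + t \<le> 2 - n" and x: "x \<in> fx (JL n n n s s)" using Suc.prems by (simp_all add: n_def)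
    show ?case
    proof (rule ccontr)
      assume "avg (U2 t t) x \<noteq> 0"
      hence nz: "L t x \<noteq> 0" by (simp add: L_def)
      have "s + t \<le> n" using st n by simp
      from reduce[OF n1(1) x this nz] obtain z where z: "L t z \<noteq> 0" "z \<in> fx (JJ n (n - 1) (n - s) n (n - s) s s)"
        "z \<in> fx (Hh f13 (max 1 (n - 1)))" by blast
      have "max 1 (n - 1) = n - 1" using n by simp
      hence z3': "z \<in> fx (Hh f13 (n - 1))" using z(3) by simp
      define k where "k = n - s"
      have s: "n - k = s" by (simp add: k_def)
      have L0: "L t 0 = 0" by (simp add: L_def avg_0[OF cpt_U2])
      note zk = z(2)[folded k_def]
      note zW = fxW[OF zk]
      have ok1: "okJ n (n - 1) k n k s s" using n by (simp add: okJ_def k_def)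
      have ok2: "okJ (n - 1) (n - 1) k n k s s" using n by (simp add: okJ_def k_def)
      note cH12 = cH[OF sl2emb_f(1) n1(2)]
      \<comment> \<open>The difference \<open>z - z1\<close> is killed by the (1,2) torus average,
        hence by the (2,3) one too, and vanishes by \<open>C2\<close>.\<close>
      define z1 where "z1 = avg (Hh f12 (n - 1)) z"
      have z1: "z1 \<in> fx (JJ n (n - 1) k n k s s)" unfolding z1_def
        by (rule avg_normz_fx[OF cH12 cpt_JJ[OF ok1] Hh_nrm(2)[OF n1(2), where \<phi> = f12] zk]) simp_all
      have z1H: "z1 \<in> fx (Hh f12 (n - 1))" unfolding z1_def by (rule avg_fx[OF cH12 zW])
      have z1H13: "z1 \<in> fx (Hh f13 (n - 1))" unfolding z1_def
      proof (rule avg_normz_fx[OF cH12 cH[OF sl2emb_f(2) n1(2)] _ z3'])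
        fix h assume "h \<in> Hh f12 (n - 1)"
        then obtain u where u: "u \<in> O1 (n - 1)" "h = mat3 u 0 0 0 (1/u) 0 0 0 1" by (auto simp: Hh_def f12_def)
        have u0: "u \<noteq> 0" using O1_un[OF u(1) n1(2)] un_nz by blast
        show "normz h (Hh f13 (n - 1))" unfolding u(2)
          by (rule normz_comm[OF mG]) (use u0 in \<open>auto simp: mat3_det Hh_def f13_def mat3_mult mat3_eq\<close>)
      qed
      have z1W: "z1 \<in> W" using fxW[OF z1] .
      have "L t z1 \<noteq> 0"
      proof
        assume e: "L t z1 = 0"
        have w: "z - z1 \<in> fx (JJ n (n - 1) k n k (n - k) (n - k))" unfolding s by (rule fx_diff[OF cpt_JJ[OF ok1] zk z1])
        have w2: "avg (Hh f12 (n - 1)) (z - z1) = 0"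
          using avg_diff[OF cH12 zW z1W] avg_id[OF cH12 z1H] by (simp add: z1_def)
        have "z - z1 \<in> fx (Hh f13 (n - 1))" by (rule fx_diff[OF cH[OF sl2emb_f(2) n1(2)] z3' z1H13])
        hence "avg (Hh f23 (n - 1)) (z - z1) = 0" using avg_f23_f12[OF n1(2)] w2 by simp
        hence "z - z1 = 0" by (rule C2[OF n(1) w w2])
        thus False using z(1) e by simp
      qed
      have z1T: "z1 \<in> fx (JJ (n - 1) (n - 1) k n k s s)" by (rule fx_JJ_torus[OF z1 z1H z1H13 ok1 n1(2)])
      note cM = cY[OF sl2emb_f(1), of "n - 1"]
      note cP = cX[OF sl2emb_f(1), of "n - 2"]
      \<comment> \<open>The part invariant under the (2,1) root group at depth n - 1 has level n - 1
        and falls to the induction hypothesis.\<close>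
      define z3 where "z3 = avg (Xm f12 (n - 1)) z1"
      have z3: "z3 \<in> fx (JJ (n - 1) (n - 1) k n k s s)" unfolding z3_def
        by (rule avg_normz_fx[OF cM cpt_JJ[OF ok2] e21_nrm z1T]) (use n in \<open>auto simp: k_def\<close>)
      have z3M: "z3 \<in> fx (Xm f12 (n - 1))" unfolding z3_def by (rule avg_fx[OF cM z1W])
      have z3J: "z3 \<in> fx (JJ (n - 1) (n - 1) k (n - 1) k s s)" by (rule fx_JJ_21[OF z3 z3M n1(2)]) (use n in simp_all)
      have "L t z3 = 0" by (rule IH[OF JJ_JL_fx[OF z3J]]) (use st in simp)
      define z4 where "z4 = z1 - z3"
      have z4: "z4 \<in> fx (JJ (n - 1) (n - 1) k n k s s)" unfolding z4_def by (rule fx_diff[OF cpt_JJ[OF ok2] z1T z3])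
      have Lz4: "L t z4 \<noteq> 0" unfolding z4_def using Ldiff[OF z1W fxW[OF z3]] \<open>L t z1 \<noteq> 0\<close> \<open>L t z3 = 0\<close> by simp
      have k4: "avg (Xm f12 (n - 1)) z4 = 0"
        unfolding z4_def using avg_diff[OF cM z1W fxW[OF z3]] avg_id[OF cM z3M] by (simp add: z3_def)
      \<comment> \<open>The part invariant under the (1,2) root group at depth n - 2: conjugation by
        diag(uf, 1, 1) turns the depths n - 2 and n into n - 1 and n - 1, at the price of t + 1 in
        place of t.\<close>
      define z5 where "z5 = avg (Xp f12 (n - 2)) z4"
      have z5: "z5 \<in> fx (JJ (n - 1) (n - 1) k n k s s)" unfolding z5_def
        by (rule avg_normz_fx[OF cP cpt_JJ[OF ok2] e12_nrm z4]) (use n in \<open>auto simp: k_def\<close>)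
      have z5P: "z5 \<in> fx (Xp f12 (n - 2))" unfolding z5_def by (rule avg_fx[OF cP fxW[OF z4]])
      have z5J: "z5 \<in> fx (JJ (n - 1) (n - 2) k n k s s)" by (rule fx_JJ_12[OF z5 z5P n1(2)]) (use n in simp_all)
      have Lz5: "L t z5 = 0"
      proof -
        define g where "g = mat3 (pw 1) 0 0 0 1 0 0 0 1"
        have gG: "g \<in> G" by (rule mG) (simp add: g_def mat3_det)
        have "\<pi> g z5 \<in> fx (JJ (n - 1) (n - 1) (k + 1) (n - 1) k s s)" unfolding g_def by (rule fx_diag[OF z5J]) simp_all
        hence "\<pi> g z5 \<in> fx (JL (n - 1) (n - 1) (n - 1) s s)" by (rule JJ_JL_fx)
        from IH[OF this, of "t + 1"] st have v: "avg (U2 (t + 1) (t + 1)) (\<pi> g z5) = 0" by (simp add: L_def)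
        have gW: "\<pi> g z5 \<in> W" by (rule pi_W[OF gG fxW[OF z5]])
        have "avg (U2 (t + 1) t) (avg (U2 (t + 1) (t + 1)) (\<pi> g z5)) = avg (U2 (t + 1) t) (\<pi> g z5)"
          by (rule avg_sub[OF cpt_U2 cpt_U2 U2_mono gW]) simp_all
        hence "avg (U2 (t + 1) t) (\<pi> g z5) = 0" using v avg_0[OF cpt_U2] by simp
        moreover have "\<pi> g (avg (U2 t t) z5) = avg (U2 (t + 1) t) (\<pi> g z5)"
        proof (rule avg_conj[OF gG cpt_U2 cpt_U2 fxW[OF z5]])
          fix j assume "j \<in> U2 t t"
          then obtain a b where ab: "j = mat3 1 0 a 0 1 b 0 0 1" "a \<in> P t" "b \<in> P t" by (rule U2_E)
          thus "g ** j ** inv3 g \<in> U2 (t + 1) t" unfolding g_def by (simp add: diag_conj U2_I pw_mult_P)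
        next
          fix j assume "j \<in> U2 (t + 1) t"
          then obtain a b where ab: "j = mat3 1 0 a 0 1 b 0 0 1" "a \<in> P (t + 1)" "b \<in> P t" by (rule U2_E)
          thus "inv3 g ** j ** g \<in> U2 t t" unfolding g_def by (simp add: diag_conj U2_I pw_divide_P)
        qed
        ultimately have "\<pi> g (L t z5) = 0" by (simp add: L_def)
        thus ?thesis using pi_nz[OF gG avg_W[OF cpt_U2 fxW[OF z5]]] unfolding L_def by blast
      qed
      define z6 where "z6 = z4 - z5"
      have z6: "z6 \<in> fx (JJ (n - 1) (n - 1) k n k s s)" unfolding z6_def by (rule fx_diff[OF cpt_JJ[OF ok2] z4 z5])
      have Lz6: "L t z6 \<noteq> 0" unfolding z6_def using Ldiff[OF fxW[OF z4] fxW[OF z5]] Lz4 Lz5 by simp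
      have k6: "avg (Xp f12 (n - 2)) z6 = 0"
        unfolding z6_def using avg_diff[OF cP fxW[OF z4] fxW[OF z5]] avg_id[OF cP z5P] by (simp add: z5_def)
      have "avg (Xm f12 (n - 1)) z5 = 0" unfolding z5_def avg_comm_XY[OF n(1) z4] k4 by (rule avg_0[OF cP])
      hence k6': "avg (Xm f12 (n - 1)) z6 = 0"
        unfolding z6_def using avg_diff[OF cM fxW[OF z4] fxW[OF z5]] k4 by simp
      \<comment> \<open>With this depth the average acquires the lower depths n - l = s + 1 and n -
        1 - l = s required by \<open>C3r\<close>.\<close>
      define l where "l = n - 1 - s"
      define z7 where "z7 = L l z6"
      have "L t z7 = L t z6" unfolding z7_def L_def
        by (rule avg_sub[OF cpt_U2 cpt_U2 U2_mono fxW[OF z6]]) (use st n in \<open>simp_all add: l_def\<close>)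
      have z7: "z7 \<in> fx (JJ (n - 1) (n - 1) l n l (n - l) (n - 1 - l))" unfolding z7_def L_def
        by (rule avg_U2_fx[OF JJ_JL_fx[OF z6] n1(2)]) (use n in \<open>simp_all add: l_def\<close>)
      have k7: "avg (Xp f12 (n - 2)) z7 = 0" unfolding z7_def L_def
        by (rule avg_normz_0[OF cP cpt_U2 e12_nrm_U2 fxW[OF z6] k6]) (use n in auto)
      have k7': "avg (Xm f12 (n - 1)) z7 = 0" unfolding z7_def L_def
        by (rule avg_normz_0[OF cM cpt_U2 e21_nrm_U2 fxW[OF z6] k6']) (use n in auto)
      have "z7 = 0" by (rule C3r[OF n(1) z7 k7 k7'])
      hence "L t z7 = 0" by (simp only: L0)
      thus False unfolding \<open>L t z7 = L t z6\<close> using Lz6 by contradiction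
    qed
  qed
qed

end

section \<open>Functionals invariant under a unipotent radical\<close>

abbreviation scF :: "complex \<Rightarrow> ('v \<Rightarrow> complex) \<Rightarrow> 'v \<Rightarrow> complex" where "scF \<equiv> \<lambda>c f x. c * f x"

lemma cvs_fun: "cvs scF"
  by unfold_locales (auto simp: algebra_simps fun_eq_iff)

text \<open>A parabolic subgroup \<open>Q\<close> with Levi factor \<open>M\<close>, radical and
  opposite radical filtered by \<open>U\<close> and \<open>Ub\<close>, and an element
  \<open>a\<close> central in \<open>M\<close> that contracts the radical and expands the opposite
  one. The instances are the type (2,1) in GL_3 and the Borel subgroup of its Levi factor.\<close>

locale parab = mrep v q smul G W \<pi>
  for v :: "'f::field \<Rightarrow> int" and q and smul :: "complex \<Rightarrow> 'v::ab_group_add \<Rightarrow> 'v" (infixr "\<odot>" 75)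
    and G and W :: "'v set" and \<pi> +
  fixes M Q :: "('f ^ 3 ^ 3) set" and U :: "int \<Rightarrow> ('f ^ 3 ^ 3) set" and Ub :: "nat \<Rightarrow> ('f ^ 3 ^ 3) set" and a :: "'f ^ 3 ^ 3"
  assumes M: "subgrp M" and MG: "M \<subseteq> G"
    and U_cpt: "cpt (U t)" and U_mono: "s \<le> t \<Longrightarrow> U t \<subseteq> U s" and UK: "1 \<le> m \<Longrightarrow> U (int m) \<subseteq> Kc m"
    and MU: "h \<in> M \<Longrightarrow> u \<in> U t \<Longrightarrow> \<exists>s. inv3 h ** u ** h \<in> U s"
    and Q: "subgrp Q" and QG: "Q \<subseteq> G"
    and aM: "a \<in> M" and a_comm: "h \<in> M \<Longrightarrow> a ** h = h ** a"
    and aU: "u \<in> U t \<Longrightarrow> a ** u ** inv3 a \<in> U (t + 1)" and aU': "u \<in> U (t + 1) \<Longrightarrow> inv3 a ** u ** a \<in> U t"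
    and aQ: "b \<in> Q \<Longrightarrow> b \<in> Kc m \<Longrightarrow> a ** b ** inv3 a \<in> Kc m"
    and fac: "1 \<le> m \<Longrightarrow> g \<in> G \<Longrightarrow> g \<in> Kc m \<Longrightarrow> \<exists>b\<in>Q \<inter> Kc m. \<exists>w\<in>Ub m. g = b ** w"
    and UbG: "Ub m \<subseteq> G \<inter> Kc m" and UbS: "Ub (Suc m) \<subseteq> Ub m" and aUb: "w \<in> Ub m \<Longrightarrow> inv3 a ** w ** a \<in> Ub (Suc m)"
    and QU: "1 \<le> m \<Longrightarrow> b \<in> Q \<Longrightarrow> b \<in> Kc m \<Longrightarrow> \<exists>u\<in>U (int m). \<exists>h\<in>M \<inter> Kc m. b = u ** h"
begin

lemmas MD = subgrp_D[OF M]
lemma aG: "a \<in> G" using aM MG by blast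
lemma MGd: "h \<in> M \<Longrightarrow> h \<in> G" using MG by blast

definition aj :: "nat \<Rightarrow> 'v \<Rightarrow> 'v" where "aj j = (\<pi> a ^^ j)"

lemma aj_0 [simp]: "aj 0 x = x" by (simp add: aj_def)
lemma aj_Suc: "aj (Suc j) x = \<pi> a (aj j x)" by (simp add: aj_def)
lemma aj_W: "x \<in> W \<Longrightarrow> aj j x \<in> W" by (induction j) (simp_all add: aj_Suc pi_W[OF aG])
lemma aj_lin: "lin_on W (aj j)"
proof (induction j)
  case 0 thus ?case by (simp add: lin_on_def)
next
  case (Suc j)
  have e: "aj (Suc j) = (\<lambda>x. \<pi> a (aj j x))" by (simp add: fun_eq_iff aj_Suc)
  show ?case unfolding e by (rule lin_on_comp[OF pi_lin[OF aG] Suc aj_W])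
qed
lemma aj_nz: "x \<in> W \<Longrightarrow> x \<noteq> 0 \<Longrightarrow> aj j x \<noteq> 0" by (induction j) (simp_all add: aj_Suc pi_nz[OF aG] aj_W)

lemma aj_M: "h \<in> M \<Longrightarrow> x \<in> W \<Longrightarrow> \<pi> h (aj j x) = aj j (\<pi> h x)"
proof (induction j)
  case (Suc j)
  have "\<pi> h (\<pi> a (aj j x)) = \<pi> a (\<pi> h (aj j x))"
    by (rule pi_eq2[OF a_comm[OF Suc.prems(1), symmetric] MGd[OF Suc.prems(1)] aG aG MGd[OF Suc.prems(1)] aj_W[OF Suc.prems(2)]])
  thus ?case using Suc by (simp add: aj_Suc)
qed simp

lemma pi_a_conj: assumes "g \<in> G" "x \<in> W" shows "\<pi> a (\<pi> g x) = \<pi> (a ** g ** inv3 a) (\<pi> a x)"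
proof (rule pi_eq2[OF _ aG assms(1) _ aG assms(2)])
  show "a ** g = a ** g ** inv3 a ** a" using GL3_inv1(2)[OF GD(1)[OF aG]] by (simp add: matrix_mul_assoc[symmetric])
  show "a ** g ** inv3 a \<in> G" by (rule GD(3)[OF GD(3)[OF aG assms(1)] GD(4)[OF aG]])
qed

lemma aj_U: "u \<in> U t \<Longrightarrow> x \<in> W \<Longrightarrow> \<exists>u'\<in>U (t + int j). aj j (\<pi> u x) = \<pi> u' (aj j x)"
proof (induction j)
  case (Suc j)
  then obtain u' where u': "u' \<in> U (t + int j)" "aj j (\<pi> u x) = \<pi> u' (aj j x)" by blast
  have "\<pi> a (\<pi> u' (aj j x)) = \<pi> (a ** u' ** inv3 a) (\<pi> a (aj j x))"
    by (rule pi_a_conj[OF cptD(1)[OF U_cpt u'(1)] aj_W[OF Suc.prems(2)]])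
  moreover have "a ** u' ** inv3 a \<in> U (t + int (Suc j))" using aU[OF u'(1)] by (simp add: ac_simps)
  ultimately show ?case using u'(2) by (auto simp: aj_Suc)
qed auto

lemma aj_avg: "x \<in> W \<Longrightarrow> aj j (avg (U t) x) = avg (U (t + int j)) (aj j x)"
proof (induction j)
  case (Suc j)
  have "\<pi> a (avg (U (t + int j)) (aj j x)) = avg (U (t + int j + 1)) (\<pi> a (aj j x))"
    by (rule avg_conj[OF aG U_cpt U_cpt aj_W[OF Suc.prems] aU aU'])
  thus ?case using Suc by (simp add: aj_Suc ac_simps)
qed simp

lemma Ub_mono: "m \<le> k \<Longrightarrow> Ub k \<subseteq> Ub m"
  by (induction k rule: dec_induct) (use UbS in auto)

lemma UbGd: "Ub m \<subseteq> G" using UbG by blast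

lemma fx_Ub_a: assumes "x \<in> fx (Ub (Suc m))" shows "\<pi> a x \<in> fx (Ub m)"
  by (rule fx_conj[OF assms UbGd aG UbGd aUb])

lemma aj_Ub: "x \<in> fx (Ub (m + j)) \<Longrightarrow> aj j x \<in> fx (Ub m)"
proof (induction j arbitrary: m)
  case (Suc j)
  have "aj j x \<in> fx (Ub (Suc m))" by (rule Suc.IH) (use Suc.prems in simp)
  thus ?case using fx_Ub_a by (simp add: aj_Suc)
qed simp

text \<open>Some \<open>Ub k\<close> fixes \<open>x\<close> by smoothness, and each application of
  \<open>a\<close> enlarges that group by one step.\<close>

lemma aj_Ub_ev: assumes "x \<in> W" shows "\<exists>j0. \<forall>j\<ge>j0. aj j x \<in> fx (Ub m)"
proof -
  obtain k where k: "1 \<le> k" "x \<in> VK k" using smooth_VK[OF assms] by blast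
  have xk: "x \<in> fx (Ub k)" using fx_anti[OF k(2)[unfolded VK_def] UbG] .
  have "aj j x \<in> fx (Ub m)" if "k \<le> j" for j
    by (rule aj_Ub[OF fx_anti[OF xk Ub_mono]]) (use that in simp)
  thus ?thesis by blast
qed

lemma cpt_Q: assumes "1 \<le> m" shows "cpt (Q \<inter> Kc m)"
proof -
  have "subgrp (Q \<inter> Kc m)" using subgrp_Int[OF Q subgrp_Kc[OF assms]] .
  moreover have "Q \<inter> Kc m \<subseteq> intm 0" using Kc_intm by blast
  ultimately show ?thesis unfolding cpt_def using QG by blast
qed

lemma eK_Q: assumes m: "1 \<le> m" and y: "y \<in> fx (Ub m)" shows "eK m y = avg (Q \<inter> Kc m) y"
  unfolding eK_def
proof (rule avg_eqI)
  note yW = fxW[OF y]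
  fix g assume g: "g \<in> G \<inter> Kc m"
  obtain b w where bw: "b \<in> Q \<inter> Kc m" "w \<in> Ub m" "g = b ** w" using fac[OF m] g by blast
  have "b \<in> G" "w \<in> G" using bw QG UbGd by blast+
  hence "\<pi> g y = \<pi> b y" unfolding bw(3) using pi_mult[OF _ _ yW] fxD[OF y bw(2)] by simp
  thus "\<exists>j\<in>Q \<inter> Kc m. \<pi> g y = \<pi> j y" using bw(1) by blast
qed (use QG in blast)

lemma eK_a: assumes m: "1 \<le> m" and y: "y \<in> fx (Ub m)" shows "eK m (\<pi> a (eK m y)) = eK m (\<pi> a y)"
  unfolding eK_Q[OF m y]
proof (rule avg_const[OF cpt_Q[OF m] fxW[OF y]])
  show "lin_on W (\<lambda>x. eK m (\<pi> a x))" by (rule lin_on_comp[OF eK_lin[OF m] pi_lin[OF aG] pi_W[OF aG]])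
  fix b assume b: "b \<in> Q \<inter> Kc m"
  hence bG: "b \<in> G" using QG by blast
  have "\<pi> a (\<pi> b y) = \<pi> (a ** b ** inv3 a) (\<pi> a y)" by (rule pi_a_conj[OF bG fxW[OF y]])
  moreover have "a ** b ** inv3 a \<in> G" "a ** b ** inv3 a \<in> Kc m" using GD(3)[OF GD(3)[OF aG bG] GD(4)[OF aG]] aQ[of b m] b by auto
  ultimately show "eK m (\<pi> a (\<pi> b y)) = eK m (\<pi> a y)" using eK_pi[OF m] pi_W[OF aG fxW[OF y]] by simp
qed

lemma eK_avg_U: assumes m: "1 \<le> m" and y: "y \<in> fx (Ub m)" "y \<in> fx (M \<inter> Kc m)" shows "eK m y = avg (U (int m)) y"
  unfolding eK_Q[OF m y(1)]
proof (rule avg_eqI)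
  note yW = fxW[OF y(1)]
  fix g assume g: "g \<in> Q \<inter> Kc m"
  obtain u h where uh: "u \<in> U (int m)" "h \<in> M \<inter> Kc m" "g = u ** h" using QU[OF m] g by blast
  have "\<pi> g y = \<pi> u y" unfolding uh(3) using pi_mult[OF cptD(1)[OF U_cpt uh(1)] MGd yW] uh(2) fxD[OF y(2) uh(2)] by simp
  thus "\<exists>j\<in>U (int m). \<pi> g y = \<pi> j y" using uh(1) by blast
next
  note yW = fxW[OF y(1)]
  fix u assume u: "u \<in> U (int m)"
  obtain b w where bw: "b \<in> Q \<inter> Kc m" "w \<in> Ub m" "u = b ** w" using fac[OF m cptD(1)[OF U_cpt u]] UK[OF m] u by blast
  have "b \<in> G" "w \<in> G" using bw QG UbGd by blast+
  hence "\<pi> u y = \<pi> b y" unfolding bw(3) using pi_mult[OF _ _ yW] fxD[OF y(1) bw(2)] by simp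
  thus "\<exists>b\<in>Q \<inter> Kc m. \<pi> u y = \<pi> b y" using bw(1) by blast
qed

lemma VK_Ub: "x \<in> VK m \<Longrightarrow> x \<in> fx (Ub m)" unfolding VK_def by (rule fx_anti[OF _ UbG])
lemma VK_M: "x \<in> VK m \<Longrightarrow> x \<in> fx (M \<inter> Kc m)" unfolding VK_def by (erule fx_anti) (use MG in blast)

lemma aj_Ub_up: assumes "aj j x \<in> fx (Ub m)" shows "aj (j + k) x \<in> fx (Ub m)"
proof (induction k)
  case (Suc k)
  thus ?case using fx_Ub_a[OF fx_anti[OF _ UbS]] by (simp add: aj_Suc)
qed (use assms in simp)

text \<open>On \<open>VK m\<close> the operator T = e a satisfies T^j x = e a^j x. The averages of
  \<open>x0\<close> never vanish, so T is not nilpotent there and has an eigenfunctional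
  \<open>f\<close> with eigenvalue \<open>l\<close> not 0. The values l^(-j) f(e a^j x) are constant
  for large j, and radical invariance holds because a^j carries any given piece of the radical into
  the level subgroup.\<close>

lemma asymptotic_functional:
  assumes m: "1 \<le> m" "fd (VK m)" and x0: "x0 \<in> VK m" "\<And>t. avg (U t) x0 \<noteq> 0"
  shows "\<exists>l L. l \<noteq> 0 \<and> fun_on W L \<and> (\<forall>x. x \<notin> W \<longrightarrow> L x = 0) \<and> (\<exists>x\<in>W. L x \<noteq> 0) \<and>
    (\<forall>x\<in>W. L (\<pi> a x) = l * L x) \<and> (\<forall>t. \<forall>u\<in>U t. \<forall>x\<in>W. L (\<pi> u x) = L x) \<and> (\<forall>h\<in>M \<inter> Kc m. \<forall>x\<in>W. L (\<pi> h x) = L x)"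
proof -
  define T where "T = (\<lambda>x. eK m (\<pi> a x))"
  have TV: "T x \<in> VK m" if "x \<in> VK m" for x unfolding T_def using that by (intro eK_VK[OF m(1)] pi_W[OF aG] VK_W)
  have Tl: "lin_on W T" unfolding T_def by (rule lin_on_comp[OF eK_lin[OF m(1)] pi_lin[OF aG] pi_W[OF aG]])
  have TlV: "lin_on (VK m) T" by (rule lin_on_subset[OF Tl]) (use VK_W in blast)
  have Tj: "eK m (aj (Suc j) x) = T (eK m (aj j x))" if "aj j x \<in> fx (Ub m)" for x j
    unfolding T_def aj_Suc using eK_a[OF m(1) that] by simp
  have Tjx: "(T ^^ j) x = eK m (aj j x)" if x: "x \<in> VK m" for x j
  proof (induction j)
    case 0 thus ?case using eK_id[OF m(1) x] by simp
  next
    case (Suc j)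
    have "aj j x \<in> fx (Ub m)" using aj_Ub_up[of 0 x m j] VK_Ub[OF x] by simp
    thus ?case using Tj Suc by simp
  qed
  have x0W: "x0 \<in> W" using VK_W x0 by blast
  have "(T ^^ j) x0 \<noteq> 0" for j
  proof -
    have 1: "aj j x0 \<in> fx (Ub m)" using aj_Ub_up[of 0 x0 m j] VK_Ub[OF x0(1)] by simp
    have 2: "aj j x0 \<in> fx (M \<inter> Kc m)"
    proof (rule fxI[OF aj_W[OF x0W]])
      fix h assume h: "h \<in> M \<inter> Kc m"
      hence "\<pi> h x0 = x0" using fxD[OF VK_M[OF x0(1)]] by blast
      thus "\<pi> h (aj j x0) = aj j x0" using aj_M[of h x0 j] h x0W by simp
    qed
    \<comment> \<open>Pulled back through a^j, the average over the radical at depth m becomes one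
      over a larger piece, nonzero by hypothesis.\<close>
    have "eK m (aj j x0) = aj j (avg (U (int m - int j)) x0)" using eK_avg_U[OF m(1) 1 2] aj_avg[OF x0W, of j "int m - int j"] by simp
    thus ?thesis using aj_nz[OF avg_W[OF U_cpt x0W] x0(2)] Tjx[OF x0(1)] by simp
  qed
  from eigenvector_nonzero[OF subspace_VK TlV TV m(2) x0(1) this] obtain l y where ly: "l \<noteq> 0" "y \<in> VK m" "y \<noteq> 0" "T y = l \<odot> y" by blast
  from eigenfunctional[OF subspace_VK TlV TV m(2) ly(2-4)] obtain f where
    f: "fun_on UNIV f" "\<exists>x\<in>VK m. f x \<noteq> 0" "\<forall>x\<in>VK m. f (T x) = l * f x" by blast
  define F where "F = (\<lambda>x j. inverse (l ^ j) * f (eK m (aj j x)))"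
  have F_Suc: "F x (Suc j) = F x j" if x: "x \<in> W" "aj j x \<in> fx (Ub m)" for x j
  proof -
    have "eK m (aj j x) \<in> VK m" by (rule eK_VK[OF m(1) aj_W[OF x(1)]])
    hence "f (eK m (aj (Suc j) x)) = l * f (eK m (aj j x))" using f(3) Tj[OF x(2)] by simp
    thus ?thesis using ly(1) by (simp add: F_def)
  qed
  have F_up: "F x (j + k) = F x j" if x: "x \<in> W" "aj j x \<in> fx (Ub m)" for x j k
  proof (induction k)
    case (Suc k)
    thus ?case using F_Suc[OF x(1) aj_Ub_up[OF x(2), of k]] by simp
  qed simp
  \<comment> \<open>Any admissible \<open>j\<close> gives the same value, by \<open>F_up\<close>.
    The value 0 outside \<open>W\<close> makes a functional on \<open>W\<close> a single function on
    the type.\<close>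
  define L where "L = (\<lambda>x. if x \<in> W then F x (SOME j. aj j x \<in> fx (Ub m)) else 0)"
  have L: "L x = F x j" if x: "x \<in> W" "aj j x \<in> fx (Ub m)" for x j
  proof -
    define i where "i = (SOME j. aj j x \<in> fx (Ub m))"
    have i: "aj i x \<in> fx (Ub m)" unfolding i_def by (rule someI[of "\<lambda>j. aj j x \<in> fx (Ub m)", OF x(2)])
    have "F x i = F x (i + j)" using F_up[OF x(1) i] by simp
    also have "\<dots> = F x j" using F_up[OF x, of i] by (simp add: add.commute)
    finally show ?thesis using x(1) by (simp add: L_def i_def)
  qed
  have fe: "f (eK m (aj j (x + y))) = f (eK m (aj j x)) + f (eK m (aj j y))" "f (eK m (aj j (c \<odot> x))) = c * f (eK m (aj j x))"
    if "x \<in> W" "y \<in> W" for x y c j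
  proof -
    have l: "lin_on W (\<lambda>x. eK m (aj j x))" by (rule lin_on_comp[OF eK_lin[OF m(1)] aj_lin aj_W])
    have "eK m (aj j (x + y)) = eK m (aj j x) + eK m (aj j y)" using l that unfolding lin_on_def by blast
    thus "f (eK m (aj j (x + y))) = f (eK m (aj j x)) + f (eK m (aj j y))" using f(1) by (simp add: fun_on_def)
    have "eK m (aj j (c \<odot> x)) = c \<odot> eK m (aj j x)" using l that unfolding lin_on_def by blast
    thus "f (eK m (aj j (c \<odot> x))) = c * f (eK m (aj j x))" using f(1) by (simp add: fun_on_def)
  qed
  have Ladd: "L (x + y) = L x + L y" if xy: "x \<in> W" "y \<in> W" for x y
  proof -
    obtain jx where jx: "\<forall>j\<ge>jx. aj j x \<in> fx (Ub m)" using aj_Ub_ev[OF xy(1)] by blast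
    obtain jy where jy: "\<forall>j\<ge>jy. aj j y \<in> fx (Ub m)" using aj_Ub_ev[OF xy(2)] by blast
    define j where "j = max jx jy"
    have a: "aj j x \<in> fx (Ub m)" "aj j y \<in> fx (Ub m)" using jx jy by (auto simp: j_def)
    have "aj j (x + y) = aj j x + aj j y" using aj_lin[of j] xy unfolding lin_on_def by blast
    hence "aj j (x + y) \<in> fx (Ub m)" using subspace_add[OF subspace_fx[OF UbGd] a] by simp
    thus ?thesis using L[OF xy(1) a(1)] L[OF xy(2) a(2)] L[OF subspace_add[OF W xy]] fe(1)[OF xy, of j] by (simp add: F_def algebra_simps)
  qed
  have Lsc: "L (c \<odot> x) = c * L x" if x: "x \<in> W" for c x
  proof -
    obtain j where j: "aj j x \<in> fx (Ub m)" using aj_Ub_ev[OF x] by blast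
    have "aj j (c \<odot> x) = c \<odot> aj j x" using aj_lin[of j] x unfolding lin_on_def by blast
    hence "aj j (c \<odot> x) \<in> fx (Ub m)" using subspace_scale[OF subspace_fx[OF UbGd] j] by simp
    thus ?thesis using L[OF x j] L[OF subspace_scale[OF W x]] fe(2)[OF x x, of j c] by (simp add: F_def)
  qed
  have Linv: "L (\<pi> g x) = L x" if g: "g \<in> G" and x: "x \<in> W"
    and c: "\<exists>j0. \<forall>j\<ge>j0. \<exists>g'\<in>G \<inter> Kc m. aj j (\<pi> g x) = \<pi> g' (aj j x)" for g x
  proof -
    obtain j0 where j0: "\<And>j. j \<ge> j0 \<Longrightarrow> \<exists>g'\<in>G \<inter> Kc m. aj j (\<pi> g x) = \<pi> g' (aj j x)" using c by blast
    obtain jx where jx: "\<forall>j\<ge>jx. aj j x \<in> fx (Ub m)" using aj_Ub_ev[OF x] by blast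
    obtain jy where jy: "\<forall>j\<ge>jy. aj j (\<pi> g x) \<in> fx (Ub m)" using aj_Ub_ev[OF pi_W[OF g x]] by blast
    define j where "j = max j0 (max jx jy)"
    have a: "aj j x \<in> fx (Ub m)" "aj j (\<pi> g x) \<in> fx (Ub m)" "j0 \<le> j" using jx jy by (auto simp: j_def)
    obtain g' where g': "g' \<in> G" "g' \<in> Kc m" "aj j (\<pi> g x) = \<pi> g' (aj j x)" using j0[OF a(3)] by blast
    have "eK m (aj j (\<pi> g x)) = eK m (aj j x)" unfolding g'(3) by (rule eK_pi[OF m(1) g'(1,2) aj_W[OF x]])
    thus ?thesis using L[OF x a(1)] L[OF pi_W[OF g x] a(2)] by (simp add: F_def)
  qed
  have LU: "L (\<pi> u x) = L x" if u: "u \<in> U t" and x: "x \<in> W" for u t x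
  proof (rule Linv[OF cptD(1)[OF U_cpt u] x], intro exI[of _ "nat (int m - t)"] allI impI)
    fix j assume j: "nat (int m - t) \<le> j"
    obtain u' where u': "u' \<in> U (t + int j)" "aj j (\<pi> u x) = \<pi> u' (aj j x)" using aj_U[OF u x] by blast
    have "int m \<le> t + int j" using j by linarith
    hence "u' \<in> U (int m)" using u'(1) U_mono by blast
    hence "u' \<in> G \<inter> Kc m" using UK[OF m(1)] cptD(1)[OF U_cpt] by blast
    thus "\<exists>g'\<in>G \<inter> Kc m. aj j (\<pi> u x) = \<pi> g' (aj j x)" using u'(2) by blast
  qed
  have LM: "L (\<pi> h x) = L x" if h: "h \<in> M \<inter> Kc m" and x: "x \<in> W" for h x
  proof (rule Linv[OF _ x], use h MG in blast, intro exI[of _ 0] allI impI)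
    fix j
    have "aj j (\<pi> h x) = \<pi> h (aj j x)" using aj_M[of h x j] h x by simp
    thus "\<exists>g'\<in>G \<inter> Kc m. aj j (\<pi> h x) = \<pi> g' (aj j x)" using h MG by blast
  qed
  have La: "L (\<pi> a x) = l * L x" if x: "x \<in> W" for x
  proof -
    obtain jx where jx: "\<forall>j\<ge>jx. aj j x \<in> fx (Ub m)" using aj_Ub_ev[OF x] by blast
    have sw: "aj j (\<pi> a x) = aj (Suc j) x" for j by (simp add: aj_def funpow_swap1)
    have "aj jx (\<pi> a x) \<in> fx (Ub m)" unfolding sw using jx by simp
    hence "L (\<pi> a x) = F (\<pi> a x) jx" by (rule L[OF pi_W[OF aG x]])
    also have "\<dots> = l * F x (Suc jx)" using ly(1) by (simp add: F_def sw)
    also have "F x (Suc jx) = L x" by (rule L[OF x, symmetric]) (use jx in simp)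
    finally show ?thesis .
  qed
  obtain x1 where x1: "x1 \<in> VK m" "f x1 \<noteq> 0" using f(2) by blast
  have "L x1 = f x1" using L[OF VK_W[OF x1(1)], of 0] VK_Ub[OF x1(1)] eK_id[OF m(1) x1(1)] by (simp add: F_def)
  hence Lnz: "\<exists>x\<in>W. L x \<noteq> 0" using x1 VK_W[OF x1(1)] by (intro bexI[of _ x1]) simp_all
  have "fun_on W L" unfolding fun_on_def using Ladd Lsc by blast
  moreover have "\<forall>x. x \<notin> W \<longrightarrow> L x = 0" by (simp add: L_def)
  ultimately show ?thesis using ly(1) Lnz La LU LM by blast
qed

end

section \<open>Subrepresentations generated by a vector of given level\<close>

context mrep begin

lemma sub_mrep: assumes Z: "subspace Z" "Z \<subseteq> W" "\<forall>g\<in>G. \<forall>x\<in>Z. \<pi> g x \<in> Z"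
  shows "mrep v q smul G Z \<pi>" "mrep.VK v G Z \<pi> m = VK m \<inter> Z"
proof -
  show m: "mrep v q smul G Z \<pi>"
  proof (unfold_locales)
    show "subgrp G" by (rule G)
    show "subspace Z" by fact
    show "lin_on Z (\<pi> g)" if "g \<in> G" for g using lin_on_subset[OF pi_lin[OF that] Z(2)] .
    show "\<pi> g x \<in> Z" if "g \<in> G" "x \<in> Z" for g x using Z(3) that by blast
    show "\<pi> (mat 1) x = x" if "x \<in> Z" for x using pi_1 Z(2) that by blast
    show "\<pi> (g ** h) x = \<pi> g (\<pi> h x)" if "g \<in> G" "h \<in> G" "x \<in> Z" for g h x using pi_mult[OF that(1,2)] Z(2) that(3) by blast
    show "\<exists>m\<ge>1. \<forall>k\<in>G \<inter> Kc m. \<pi> k x = x" if "x \<in> Z" for x using smooth Z(2) that by blast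
  qed
  show "mrep.VK v G Z \<pi> m = VK m \<inter> Z"
    unfolding VK_def fx_def mrep.VK_def[OF m] mrep.fx_def[OF m] using Z(2) by blast
qed

text \<open>Take a nonzero level-n vector whose generated subspace meets \<open>VK n\<close> in
  least dimension: any nonzero level-n vector inside then generates the same subspace. Without such
  vectors \<open>irr n\<close> is vacuous and \<open>W\<close> serves.\<close>

lemma irr_sub: assumes n: "1 \<le> n" and f: "fd (VK n)" and W1: "x1 \<in> W" "x1 \<noteq> 0"
  shows "\<exists>Z\<subseteq>W. (\<exists>x\<in>Z. x \<noteq> 0) \<and> subspace Z \<and> (\<forall>g\<in>G. \<forall>x\<in>Z. \<pi> g x \<in> Z) \<and> mrep.irr v smul G Z \<pi> n"
proof (cases "VK n \<subseteq> {0}")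
  case True
  have "irr n" unfolding irr_def using True by blast
  thus ?thesis using W W1 pi_W by (intro exI[of _ W]) auto
next
  case False
  define Sp where "Sp = (\<lambda>x. span ((\<lambda>g. \<pi> g x) ` G))"
  have Spd: "Sp y = span ((\<lambda>g. \<pi> g y) ` G)" for y by (simp add: Sp_def)
  have SpW: "Sp x \<subseteq> W" if "x \<in> W" for x unfolding Sp_def
    by (rule span_minimal[OF _ W]) (use pi_W that in blast)
  have Sps: "subspace (Sp x)" for x by (simp add: Sp_def)
  have Sp_self: "x \<in> Sp x" if "x \<in> W" for x unfolding Sp_def
    by (rule span_base) (use pi_1[OF that] GD(2) in \<open>auto intro!: image_eqI[of _ _ "mat 1"]\<close>)
  have Sp_G: "\<pi> g y \<in> Sp x" if "g \<in> G" "x \<in> W" "y \<in> Sp x" for g x y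
    using span_orbit_stable[OF that(2,1)] that(3) by (simp add: Sp_def)
  define d where "d = (\<lambda>x. dim (VK n \<inter> Sp x))"
  obtain x where x: "x \<in> VK n" "x \<noteq> 0" "\<And>y. y \<in> VK n \<Longrightarrow> y \<noteq> 0 \<Longrightarrow> d x \<le> d y"
  proof -
    let ?Q = "\<lambda>k. \<exists>x\<in>VK n. x \<noteq> 0 \<and> d x = k"
    have "\<exists>k. ?Q k" using False by blast
    then obtain k where k: "?Q k" "\<And>m. m < k \<Longrightarrow> \<not> ?Q m" using exists_least_iff[of ?Q] by blast
    obtain x where "x \<in> VK n" "x \<noteq> 0" "d x = k" using k(1) by blast
    moreover have "d x \<le> d y" if "y \<in> VK n" "y \<noteq> 0" for y proof (rule ccontr)
      assume "\<not> d x \<le> d y"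
      hence "d y < k" using \<open>d x = k\<close> by simp
      thus False using k(2) that by blast
    qed
    ultimately show ?thesis using that by blast
  qed
  note xW = VK_W[OF x(1)]
  let ?Z = "Sp x"
  have SG: "\<forall>g\<in>G. \<forall>y\<in>Sp x. \<pi> g y \<in> Sp x" using Sp_G[OF _ xW] by blast
  note sm = sub_mrep[OF Sps SpW[OF xW] SG]
  have "mrep.irr v smul G ?Z \<pi> n" unfolding mrep.irr_def[OF sm(1)] sm(2)
  proof (intro ballI impI)
    fix y assume y: "y \<in> VK n \<inter> ?Z" "y \<noteq> 0"
    have yW: "y \<in> W" using y VK_W by blast
    have sub: "Sp y \<subseteq> Sp x" unfolding Spd[of y] by (rule span_minimal[OF _ Sps]) (use Sp_G[OF _ xW] y in blast)
    have fx': "fd (VK n \<inter> Sp x)" by (rule fd_subset[OF f]) blast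
    have "VK n \<inter> Sp y = VK n \<inter> Sp x"
    proof (rule ccontr)
      assume ne: "VK n \<inter> Sp y \<noteq> VK n \<inter> Sp x"
      obtain B where B: "B \<subseteq> VK n \<inter> Sp x" "independent B" "VK n \<inter> Sp x \<subseteq> span B" "finite B" "card B = dim (VK n \<inter> Sp x)"
        by (rule fd_basis[OF fx'])
      have fy: "fd (VK n \<inter> Sp y)" by (rule fd_subset[OF f]) blast
      obtain C where C: "C \<subseteq> VK n \<inter> Sp y" "independent C" "VK n \<inter> Sp y \<subseteq> span C" "finite C" "card C = dim (VK n \<inter> Sp y)"
        by (rule fd_basis[OF fy])
      have sI: "subspace (VK n \<inter> Sp y)" by (rule subspace_inter[OF subspace_VK Sps])
      have "span C \<subseteq> VK n \<inter> Sp y" by (rule span_minimal[OF C(1) sI])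
      then obtain b where b: "b \<in> VK n \<inter> Sp x" "b \<notin> span C" using ne sub by blast
      have "independent (insert b C)" using independent_insertI[OF b(2) C(2)] .
      moreover have "insert b C \<subseteq> span B" using b(1) C(1) sub B(3) by blast
      ultimately have "card (insert b C) \<le> card B" using independent_span_bound[OF B(4)] by blast
      moreover have "b \<notin> C" using b(2) span_base by blast
      ultimately have "d y < d x" using B(5) C(4,5) by (simp add: d_def)
      thus False using x(3)[of y] y by simp
    qed
    hence "x \<in> Sp y" using x(1) Sp_self[OF xW] by blast
    hence "Sp x \<subseteq> Sp y" unfolding Spd[of x] by (intro span_minimal Sps) (use Sp_G[OF _ yW] in blast)
    thus "?Z \<subseteq> span ((\<lambda>g. \<pi> g y) ` G)" by (simp add: Sp_def)
  qed
  thus ?thesis using SpW[OF xW] x(2) Sp_self[OF xW] Sps Sp_G[OF _ xW] by blast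
qed

end

section \<open>The Levi factor acting on invariant functionals\<close>

context parab begin

text \<open>The contragredient action, with the convention that functionals are 0 outside
  \<open>W\<close>.\<close>

definition rho :: "'f ^ 3 ^ 3 \<Rightarrow> ('v \<Rightarrow> complex) \<Rightarrow> 'v \<Rightarrow> complex" where
  "rho g N x = (if x \<in> W then N (\<pi> (inv3 g) x) else 0)"

text \<open>A piece of the dual of the Jacquet module, smooth for \<open>M\<close>. Fixing the
  eigenvalue \<open>l\<close> of the central element \<open>a\<close> allows values to be
  transported along powers of \<open>a\<close>.\<close>

definition FZ :: "complex \<Rightarrow> ('v \<Rightarrow> complex) set" where
  "FZ l = {N. fun_on W N \<and> (\<forall>x. x \<notin> W \<longrightarrow> N x = 0) \<and> (\<forall>x\<in>W. N (\<pi> a x) = l * N x) \<and> (\<forall>t. \<forall>u\<in>U t. \<forall>x\<in>W. N (\<pi> u x) = N x) \<and>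
    (\<exists>m\<ge>1. \<forall>h\<in>M \<inter> Kc m. \<forall>x\<in>W. N (\<pi> h x) = N x)}"

lemma FZ_D: assumes "N \<in> FZ l" shows "fun_on W N" "x \<notin> W \<Longrightarrow> N x = 0" "x \<in> W \<Longrightarrow> N (\<pi> a x) = l * N x"
   "u \<in> U t \<Longrightarrow> x \<in> W \<Longrightarrow> N (\<pi> u x) = N x" "\<exists>m\<ge>1. \<forall>h\<in>M \<inter> Kc m. \<forall>x\<in>W. N (\<pi> h x) = N x"
  using assms unfolding FZ_def by blast+

lemma FZ_I: assumes "fun_on W N" "\<And>x. x \<notin> W \<Longrightarrow> N x = 0" "\<And>x. x \<in> W \<Longrightarrow> N (\<pi> a x) = l * N x"
   "\<And>u t x. u \<in> U t \<Longrightarrow> x \<in> W \<Longrightarrow> N (\<pi> u x) = N x" "1 \<le> m" "\<And>h x. h \<in> M \<Longrightarrow> h \<in> Kc m \<Longrightarrow> x \<in> W \<Longrightarrow> N (\<pi> h x) = N x"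
  shows "N \<in> FZ l"
  using assms unfolding FZ_def by blast

lemma fun_on_D: "fun_on W N \<Longrightarrow> x \<in> W \<Longrightarrow> y \<in> W \<Longrightarrow> N (x + y) = N x + N y"
  "fun_on W N \<Longrightarrow> x \<in> W \<Longrightarrow> N (c \<odot> x) = c * N x" unfolding fun_on_def by blast+

lemma FZ_rho: assumes N: "N \<in> FZ l" and g: "g \<in> M" shows "rho g N \<in> FZ l"
proof -
  note ND = FZ_D[OF N]
  have gi: "inv3 g \<in> M" using MD(4)[OF g] .
  note giG = MGd[OF gi]
  note gG = MGd[OF g]
  obtain m where m: "1 \<le> m" "\<forall>h\<in>M \<inter> Kc m. \<forall>x\<in>W. N (\<pi> h x) = N x" using ND(5) by blast
  obtain m' where m': "1 \<le> m'" "\<And>k. k \<in> Kc m' \<Longrightarrow> inv3 g ** k ** g \<in> Kc m" by (rule Kc_conj[OF GD(1)[OF gG]]) blast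
  have mv: "\<pi> (inv3 g) (\<pi> h x) = \<pi> (inv3 g ** h ** g) (\<pi> (inv3 g) x)" if h: "h \<in> G" and x: "x \<in> W" for h x
  proof (rule pi_eq2[OF _ giG h _ giG x])
    show "inv3 g ** h = inv3 g ** h ** g ** inv3 g" using GL3_inv1(1)[OF GD(1)[OF gG]] by (simp add: matrix_mul_assoc[symmetric])
    show "inv3 g ** h ** g \<in> G" by (rule GD(3)[OF GD(3)[OF giG h] gG])
  qed
  show ?thesis
  proof (rule FZ_I[OF _ _ _ _ m'(1)])
    show "fun_on W (rho g N)" unfolding fun_on_def rho_def
      using subspace_add[OF W] subspace_scale[OF W] pi_add[OF giG] pi_scale[OF giG] pi_W[OF giG] fun_on_D[OF ND(1)] by simp
    show "rho g N x = 0" if "x \<notin> W" for x using that by (simp add: rho_def)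
    show "rho g N (\<pi> a x) = l * rho g N x" if x: "x \<in> W" for x
    proof -
      have "\<pi> (inv3 g) (\<pi> a x) = \<pi> a (\<pi> (inv3 g) x)"
        by (rule pi_eq2[OF a_comm[OF gi, symmetric] giG aG aG giG x])
      thus ?thesis using x pi_W[OF aG x] ND(3)[OF pi_W[OF giG x]] by (simp add: rho_def)
    qed
    show "rho g N (\<pi> u x) = rho g N x" if u: "u \<in> U t" and x: "x \<in> W" for u t x
    proof -
      obtain s where s: "inv3 g ** u ** g \<in> U s" using MU[OF g u] by blast
      note uG = cptD(1)[OF U_cpt u]
      show ?thesis using x pi_W[OF uG x] mv[OF uG x] ND(4)[OF s pi_W[OF giG x]] by (simp add: rho_def)
    qed
    show "rho g N (\<pi> h x) = rho g N x" if h: "h \<in> M" "h \<in> Kc m'" and x: "x \<in> W" for h x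
    proof -
      note hG = MGd[OF h(1)]
      have "inv3 g ** h ** g \<in> M \<inter> Kc m" using MD(3)[OF MD(3)[OF gi h(1)] g] m'(2)[OF h(2)] by blast
      thus ?thesis using x pi_W[OF hG x] mv[OF hG x] m(2) pi_W[OF giG x] by (simp add: rho_def)
    qed
  qed
qed

lemma mrep_FZ: "mrep v q scF M (FZ l) rho"
proof -
  interpret F: cvs scF by (rule cvs_fun)
  show ?thesis
  proof (unfold_locales)
    show "subgrp M" by (rule M)
    show "F.subspace (FZ l)"
    proof (rule F.subspaceI)
      show "0 \<in> FZ l" by (rule FZ_I[of _ _ 1]) (auto simp: fun_on_def)
      fix N N' assume N: "N \<in> FZ l" and N': "N' \<in> FZ l"
      obtain m where m: "1 \<le> m" "\<forall>h\<in>M \<inter> Kc m. \<forall>x\<in>W. N (\<pi> h x) = N x" using FZ_D(5)[OF N] by blast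
      obtain m' where m': "1 \<le> m'" "\<forall>h\<in>M \<inter> Kc m'. \<forall>x\<in>W. N' (\<pi> h x) = N' x" using FZ_D(5)[OF N'] by blast
      show "N + N' \<in> FZ l"
      proof (rule FZ_I[of _ _ "max m m'"])
        show "fun_on W (N + N')" using FZ_D(1)[OF N] FZ_D(1)[OF N'] by (simp add: fun_on_def algebra_simps)
        show "1 \<le> max m m'" using m by simp
        show "(N + N') (\<pi> h x) = (N + N') x" if h: "h \<in> M" "h \<in> Kc (max m m')" and x: "x \<in> W" for h x
        proof -
          have "h \<in> Kc m" "h \<in> Kc m'" using Kc_mono[OF h(2)] by auto
          thus ?thesis using m(2) m'(2) h(1) x by simp
        qed
      qed (use FZ_D(2-4)[OF N] FZ_D(2-4)[OF N'] in \<open>auto simp: distrib_left\<close>)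
    next
      fix c N assume N: "N \<in> FZ l"
      obtain m where m: "1 \<le> m" "\<forall>h\<in>M \<inter> Kc m. \<forall>x\<in>W. N (\<pi> h x) = N x" using FZ_D(5)[OF N] by blast
      show "(\<lambda>x. c * N x) \<in> FZ l"
        by (rule FZ_I[of _ _ m]) (use FZ_D(1-4)[OF N] m in \<open>auto simp: fun_on_def algebra_simps\<close>)
    qed
    fix g assume g: "g \<in> M"
    show "F.lin_on (FZ l) (rho g)" unfolding F.lin_on_def by (auto simp: rho_def fun_eq_iff)
    show "rho g N \<in> FZ l" if "N \<in> FZ l" for N by (rule FZ_rho[OF that g])
    show "rho (g ** h) N = rho g (rho h N)" if h: "h \<in> M" and N: "N \<in> FZ l" for h N
    proof (rule ext)
      fix x
      have "inv3 (g ** h) = inv3 h ** inv3 g" by (rule inv3_mult[OF MD(1)[OF g] MD(1)[OF h]])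
      thus "rho (g ** h) N x = rho g (rho h N) x"
        using pi_mult[OF MGd[OF MD(4)[OF h]] MGd[OF MD(4)[OF g]], of x] pi_W[OF MGd[OF MD(4)[OF g]], of x] by (simp add: rho_def)
    qed
  next
    fix N assume N: "N \<in> FZ l"
    show "rho (mat 1) N = N" by (rule ext) (use FZ_D(2)[OF N] pi_1 in \<open>simp add: rho_def\<close>)
    obtain m where m: "1 \<le> m" "\<forall>h\<in>M \<inter> Kc m. \<forall>x\<in>W. N (\<pi> h x) = N x" using FZ_D(5)[OF N] by blast
    have "rho k N = N" if k: "k \<in> M \<inter> Kc m" for k
    proof (rule ext)
      fix x
      have "inv3 k \<in> M \<inter> Kc m" using k MD(4) subgrp_D(4)[OF subgrp_Kc[OF m(1)]] by blast
      thus "rho k N x = N x" using m(2) FZ_D(2)[OF N] by (simp add: rho_def)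
    qed
    thus "\<exists>m\<ge>1. \<forall>k\<in>M \<inter> Kc m. rho k N = N" using m(1) by blast
  qed
qed

text \<open>\<open>N x\<close> is recovered from the value of \<open>N\<close> at a^j x. For large j
  that vector is fixed by the opposite radical, so its level-m projection is an average over
  \<open>Q \<inter> Kc m\<close>, under which \<open>N\<close> is invariant.\<close>

lemma FZ_determined:
  assumes l: "l \<noteq> 0" and m: "1 \<le> m" and N: "N \<in> FZ l" "\<And>h x. h \<in> M \<inter> Kc m \<Longrightarrow> x \<in> W \<Longrightarrow> N (\<pi> h x) = N x"
    and z: "\<And>x. x \<in> VK m \<Longrightarrow> N x = 0"
  shows "N = 0"
proof (rule ext)
  fix x
  show "N x = 0 x"
  proof (cases "x \<in> W")
    case True
    obtain j where j: "aj j x \<in> fx (Ub m)" using aj_Ub_ev[OF True] by blast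
    have e: "N (aj j x) = l ^ j * N x" for j by (induction j) (simp_all add: aj_Suc FZ_D(3)[OF N(1) aj_W[OF True]])
    note yW = aj_W[OF True, of j]
    have "N (eK m (aj j x)) = N (aj j x)" unfolding eK_Q[OF m j]
    proof (rule avg_const_fun[OF cpt_Q[OF m] yW FZ_D(1)[OF N(1)]])
      fix b assume b: "b \<in> Q \<inter> Kc m"
      then obtain u h where uh: "u \<in> U (int m)" "h \<in> M \<inter> Kc m" "b = u ** h" using QU[OF m] by blast
      have hG: "h \<in> G" using uh(2) MG by blast
      have "N (\<pi> b (aj j x)) = N (\<pi> u (\<pi> h (aj j x)))" unfolding uh(3) using pi_mult[OF cptD(1)[OF U_cpt uh(1)] hG yW] by simp
      also have "\<dots> = N (aj j x)" using FZ_D(4)[OF N(1) uh(1) pi_W[OF hG yW]] N(2)[OF uh(2) yW] by simp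
      finally show "N (\<pi> b (aj j x)) = N (aj j x)" .
    qed
    thus ?thesis using z[OF eK_VK[OF m yW]] e[of j] l by simp
  next
    case False
    thus ?thesis using FZ_D(2)[OF N(1)] by simp
  qed
qed

text \<open>The functionals x to b(\<open>\<pi> r x\<close>), with r in \<open>R\<close> and b in a
  basis of the level-n part of \<open>Z\<close>, separate \<open>VK n\<close>. If all vanish at x,
  averaging extends this to all of \<open>Z\<close>, the decomposition of \<open>G\<close> extends
  it from \<open>R\<close> to all translates of x, and irreducibility then forces x = 0.\<close>

theorem jacquet_bound:
  assumes n: "1 \<le> n" "irr n" and fdV: "\<And>m. 1 \<le> m \<Longrightarrow> fd (VK m)"
    and x0: "x0 \<in> W" "\<And>t. avg (U t) x0 \<noteq> 0"
    and R: "finite R" "R \<subseteq> G \<inter> Kmax v"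
    and dec: "\<And>g. g \<in> G \<Longrightarrow> \<exists>h u t r k. h \<in> M \<and> u \<in> U t \<and> r \<in> R \<and> k \<in> Kc n \<and> g = h ** (u ** (r ** k))"
  shows "\<exists>Z. mrep v q scF M Z rho \<and> mrep.irr v scF M Z rho n \<and> (\<forall>m\<ge>1. cvs.fd scF (mrep.VK v M Z rho m)) \<and>
    dim (VK n) \<le> card R * vector_space.dim scF (mrep.VK v M Z rho n)"
proof -
  obtain m where m: "1 \<le> m" "x0 \<in> VK m" using smooth_VK[OF x0(1)] by blast
  from asymptotic_functional[OF m(1) fdV[OF m(1)] m(2) x0(2)] obtain l L where L: "l \<noteq> 0" "fun_on W L" "\<forall>x. x \<notin> W \<longrightarrow> L x = 0"
    "\<exists>x\<in>W. L x \<noteq> 0" "\<forall>x\<in>W. L (\<pi> a x) = l * L x" "\<forall>t. \<forall>u\<in>U t. \<forall>x\<in>W. L (\<pi> u x) = L x" "\<forall>h\<in>M \<inter> Kc m. \<forall>x\<in>W. L (\<pi> h x) = L x" by blast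
  have LF: "L \<in> FZ l" unfolding FZ_def using L m(1) by blast
  have L0: "L \<noteq> 0" using L(4) by auto
  interpret F: mrep v q scF M "FZ l" rho by (rule mrep_FZ)
  have FVK: "N (\<pi> h x) = N x" if N: "N \<in> F.VK k" and h: "h \<in> M \<inter> Kc k" and x: "x \<in> W" and k: "1 \<le> k" for N h x k
  proof -
    have hi: "inv3 h \<in> M \<inter> Kc k" using h MD(4) subgrp_D(4)[OF subgrp_Kc[OF k]] by blast
    have "rho (inv3 h) N = N" using N hi unfolding F.VK_def by (rule F.fxD)
    moreover have "rho (inv3 h) N x = N (\<pi> h x)" using x inv3_inv3[OF MD(1)] h by (simp add: rho_def)
    ultimately show ?thesis by simp
  qed
  \<comment> \<open>By \<open>FZ_determined\<close>, evaluation at a finite basis of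
    \<open>VK k\<close> separates the level-k functionals.\<close>
  have Ffd: "F.fd (F.VK k)" if k: "1 \<le> k" for k
  proof -
    obtain B where B: "finite B" "VK k \<subseteq> span B" "B \<subseteq> VK k" using fd_basis[OF fdV[OF k]] by metis
    show ?thesis
    proof (rule F.dim_le_functionals(1)[OF B(1) F.subspace_VK, where \<phi> = "\<lambda>b N. N b"])
      show "F.fun_on (F.VK k) (\<lambda>N. N b)" for b by (simp add: F.fun_on_def)
      fix N assume N: "N \<in> F.VK k" and z: "\<And>b. b \<in> B \<Longrightarrow> N b = 0"
      have NF: "N \<in> FZ l" using F.VK_W[OF N] .
      show "N = 0"
      proof (rule FZ_determined[OF L(1) k NF])
        show "N (\<pi> h x) = N x" if "h \<in> M \<inter> Kc k" "x \<in> W" for h x by (rule FVK[OF N that k])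
        fix x assume x: "x \<in> VK k"
        obtain u where u: "\<And>y. y \<in> VK k \<Longrightarrow> y = (\<Sum>b\<in>B. u y b \<odot> b)" using fd_span[OF B(1,2)] by blast
        have "N (\<Sum>b\<in>B. u x b \<odot> b) = (\<Sum>b\<in>B. u x b * N b)"
          by (rule fun_on_sum[OF FZ_D(1)[OF NF] W]) (use B(3) VK_W in blast)
        also have "\<dots> = 0" using z by simp
        finally show "N x = 0" using u[OF x] by simp
      qed
    qed
  qed
  from F.irr_sub[OF n(1) Ffd[OF n(1)] LF L0] obtain Z where Z: "Z \<subseteq> FZ l" "\<exists>N\<in>Z. N \<noteq> 0" "F.subspace Z"
    "\<forall>g\<in>M. \<forall>N\<in>Z. rho g N \<in> Z" "mrep.irr v scF M Z rho n" by blast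
  have ZG: "\<And>g N. g \<in> M \<Longrightarrow> N \<in> Z \<Longrightarrow> rho g N \<in> Z" using Z(4) by blast
  note sm = F.sub_mrep[OF Z(3,1,4)]
  interpret Z: mrep v q scF M Z rho by (rule sm(1))
  have Zfd: "F.fd (Z.VK k)" if "1 \<le> k" for k unfolding sm(2) using F.fd_subset[OF Ffd[OF that]] by blast
  obtain B where B: "B \<subseteq> Z.VK n" "Z.VK n \<subseteq> F.span B" "finite B" "card B = F.dim (Z.VK n)"
    using F.fd_basis[OF Zfd[OF n(1)]] by metis
  have RG: "r \<in> G" if "r \<in> R" for r using R that by blast
  have "dim (VK n) \<le> card (R \<times> B)"
  proof (rule dim_le_functionals(2)[OF _ subspace_VK, where \<phi> = "\<lambda>(r, b) x. b (\<pi> r x)"])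
    show "finite (R \<times> B)" using R B by simp
    fix i assume i: "i \<in> R \<times> B"
    then obtain r b where rb: "i = (r, b)" "r \<in> R" "b \<in> B" by blast
    have bF: "fun_on W b" using FZ_D(1) Z(1) Z.VK_W B(1) rb(3) by blast
    show "fun_on (VK n) ((\<lambda>(r, b) x. b (\<pi> r x)) i)" unfolding rb(1) fun_on_def prod.case
      using pi_add[OF RG[OF rb(2)] VK_W VK_W] pi_scale[OF RG[OF rb(2)] VK_W] fun_on_D[OF bF] pi_W[OF RG[OF rb(2)] VK_W] by simp
  next
    fix x assume x: "x \<in> VK n" and z: "\<And>i. i \<in> R \<times> B \<Longrightarrow> (\<lambda>(r, b) x. b (\<pi> r x)) i x = 0"
    note xW = VK_W[OF x]
    have z1: "N (\<pi> r x) = 0" if r: "r \<in> R" and N: "N \<in> Z.VK n" for r N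
    proof -
      obtain u where u: "\<And>y. y \<in> Z.VK n \<Longrightarrow> y = (\<Sum>b\<in>B. scF (u y b) b)" using F.fd_span[OF B(3,2)] by blast
      have "N (\<pi> r x) = (\<Sum>b\<in>B. scF (u N b) b) (\<pi> r x)" using u[OF N] by simp
      also have "\<dots> = (\<Sum>b\<in>B. u N b * b (\<pi> r x))" by (induction B rule: infinite_finite_induct) simp_all
      also have "\<dots> = 0" using z[of "(r, b)" for b] r by (intro sum.neutral) auto
      finally show ?thesis .
    qed
    have z2: "N (\<pi> r x) = 0" if r: "r \<in> R" and N: "N \<in> Z" for r N
    proof -
      have y: "\<pi> r x \<in> VK n" by (rule VK_Kmax[OF x]) (use r R in blast)+
      have "(\<lambda>N. N (\<pi> r x)) (Z.avg (M \<inter> Kc n) N) = N (\<pi> r x)"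
      proof (rule Z.avg_const_fun[OF Z.cpt_GK[OF n(1)] N])
        show "F.fun_on Z (\<lambda>N. N (\<pi> r x))" by (simp add: F.fun_on_def)
        fix h assume h: "h \<in> M \<inter> Kc n"
        have "inv3 h \<in> M \<inter> Kc n" using h MD(4) subgrp_D(4)[OF subgrp_Kc[OF n(1)]] by blast
        hence "\<pi> (inv3 h) (\<pi> r x) = \<pi> r x" using fxD[OF VK_M[OF y]] by blast
        thus "rho h N (\<pi> r x) = N (\<pi> r x)" using VK_W[OF y] by (simp add: rho_def)
      qed
      moreover have "Z.avg (M \<inter> Kc n) N \<in> Z.VK n" using Z.eK_VK[OF n(1) N] by (simp add: Z.eK_def)
      from z1[OF r this] have "Z.avg (M \<inter> Kc n) N (\<pi> r x) = 0" .
      ultimately show ?thesis by simp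
    qed
    obtain N0 where N0: "N0 \<in> Z" "N0 \<noteq> 0" using Z(2) by blast
    have N0F: "N0 \<in> FZ l" using N0 Z(1) by blast
    have z3: "N0 (\<pi> g x) = 0" if g: "g \<in> G" for g
    proof -
      obtain h u t r k where d: "h \<in> M" "u \<in> U t" "r \<in> R" "k \<in> Kc n" "g = h ** (u ** (r ** k))" using dec[OF g] by blast
      note hG = MGd[OF d(1)] and uG = cptD(1)[OF U_cpt d(2)] and rG = RG[OF d(3)]
      have "inv3 r ** (inv3 u ** (inv3 h ** g)) = k" unfolding d(5) using hG uG rG by (simp add: GL3_cancel GD(1))
      hence kG: "k \<in> G" using GD(3)[OF GD(4)[OF rG] GD(3)[OF GD(4)[OF uG] GD(3)[OF GD(4)[OF hG] g]]] by simp
      have "\<pi> g x = \<pi> h (\<pi> u (\<pi> r (\<pi> k x)))" unfolding d(5)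
        using pi_mult[OF hG GD(3)[OF uG GD(3)[OF rG kG]] xW] pi_mult[OF uG GD(3)[OF rG kG] xW] pi_mult[OF rG kG xW] by simp
      also have "\<pi> k x = x" using x d(4) kG unfolding VK_def fx_def by simp
      finally have e: "\<pi> g x = \<pi> h (\<pi> u (\<pi> r x))" .
      have rW: "\<pi> r x \<in> W" by (rule pi_W[OF rG xW])
      have hi: "inv3 h \<in> M" using MD(4)[OF d(1)] .
      have "N0 (\<pi> h (\<pi> u (\<pi> r x))) = rho (inv3 h) N0 (\<pi> u (\<pi> r x))"
        using pi_W[OF uG rW] inv3_inv3[OF MD(1)[OF d(1)]] by (simp add: rho_def)
      also have "\<dots> = rho (inv3 h) N0 (\<pi> r x)" by (rule FZ_D(4)[OF FZ_rho[OF N0F hi] d(2) rW])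
      also have "\<dots> = 0" using z2[OF d(3) ZG[OF hi N0(1)]] by simp
      finally show ?thesis using e by simp
    qed
    show "x = 0"
    proof (rule ccontr)
      assume "x \<noteq> 0"
      hence sp: "W \<subseteq> span ((\<lambda>g. \<pi> g x) ` G)" using n(2) x unfolding irr_def by blast
      have "subspace {w \<in> W. N0 w = 0}" by (rule subspace_kernel[OF FZ_D(1)[OF N0F] W])
      moreover have "(\<lambda>g. \<pi> g x) ` G \<subseteq> {w \<in> W. N0 w = 0}" using z3 pi_W[OF _ xW] by blast
      ultimately have "span ((\<lambda>g. \<pi> g x) ` G) \<subseteq> {w \<in> W. N0 w = 0}" by (rule span_minimal[rotated])
      hence "N0 w = 0" for w using sp FZ_D(2)[OF N0F] by (cases "w \<in> W") auto
      thus False using N0(2) by (simp add: fun_eq_iff)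
    qed
  qed
  hence "dim (VK n) \<le> card R * F.dim (Z.VK n)" using B(4) by (simp add: card_cartesian_product)
  thus ?thesis using sm(1) Z(5) Zfd by blast
qed

end

section \<open>Counting double cosets\<close>

text \<open>Take a maximal family of disjoint sets: counting in \<open>Y\<close> bounds its size,
  and by maximality every other set meets a member.\<close>

lemma disjoint_family:
  assumes Y: "finite Y" and O: "\<And>p. p \<in> X \<Longrightarrow> O' p \<subseteq> Y" "\<And>p. p \<in> X \<Longrightarrow> card (O' p) = s" and s: "1 \<le> s"
  shows "\<exists>\<Omega>\<subseteq>X. finite \<Omega> \<and> card \<Omega> * s \<le> card Y \<and> (\<forall>p\<in>X. \<exists>w\<in>\<Omega>. O' p \<inter> O' w \<noteq> {})"
proof -
  let ?F = "{\<Omega>. finite \<Omega> \<and> \<Omega> \<subseteq> X \<and> disjoint_family_on O' \<Omega>}"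
  have c: "card \<Omega> * s \<le> card Y" if \<Omega>: "\<Omega> \<in> ?F" for \<Omega>
  proof -
    have "card \<Omega> * s = (\<Sum>p\<in>\<Omega>. card (O' p))" using \<Omega> O(2) by (simp add: subset_iff)
    also have "\<dots> = card (\<Union>p\<in>\<Omega>. O' p)"
      by (rule card_UN_disjoint[symmetric]) (use \<Omega> finite_subset[OF O(1) Y] in \<open>auto simp: disjoint_family_on_def\<close>)
    also have "\<dots> \<le> card Y" by (rule card_mono[OF Y]) (use O(1) \<Omega> in blast)
    finally show ?thesis .
  qed
  have "card \<Omega> < Suc (card Y)" if "\<Omega> \<in> ?F" for \<Omega>
    using le_trans[OF mult_le_mono2[OF s, of "card \<Omega>"] c[OF that]] by simp
  hence b: "\<forall>\<Omega>. \<Omega> \<in> ?F \<longrightarrow> card \<Omega> < Suc (card Y)" by blast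
  have "{} \<in> ?F" by (simp add: disjoint_family_on_def)
  from ex_has_greatest_nat[of "\<lambda>\<Omega>. \<Omega> \<in> ?F", OF this b]
  obtain \<Omega> where \<Omega>: "\<Omega> \<in> ?F" "\<And>Z. Z \<in> ?F \<Longrightarrow> card Z \<le> card \<Omega>" by blast
  have "\<exists>w\<in>\<Omega>. O' p \<inter> O' w \<noteq> {}" if p: "p \<in> X" for p
  proof (rule ccontr)
    assume n: "\<not> (\<exists>w\<in>\<Omega>. O' p \<inter> O' w \<noteq> {})"
    hence "p \<notin> \<Omega>" using O(2)[OF p] s by fastforce
    moreover have "insert p \<Omega> \<in> ?F" using \<Omega>(1) p n by (auto simp: disjoint_family_on_def)
    ultimately show False using \<Omega>(2)[of "insert p \<Omega>"] \<Omega>(1) by simp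
  qed
  thus ?thesis using \<Omega>(1) c[OF \<Omega>(1)] by blast
qed

section \<open>Operators up to a scalar and their orbits\<close>

context mrep begin

text \<open>The factor is nonzero so that the relation is symmetric.\<close>

definition sim :: "nat \<Rightarrow> 'f ^ 3 ^ 3 \<Rightarrow> 'f ^ 3 ^ 3 \<Rightarrow> bool" where
  "sim n g h \<longleftrightarrow> (\<exists>c. c \<noteq> 0 \<and> (\<forall>x\<in>VK n. A n g x = c \<odot> A n h x))"

lemma sim_sym: assumes "sim n g h" shows "sim n h g"
proof -
  obtain c where c: "c \<noteq> 0" "\<forall>x\<in>VK n. A n g x = c \<odot> A n h x" using assms unfolding sim_def by blast
  show ?thesis unfolding sim_def by (rule exI[of _ "1/c"]) (use c in simp)
qed

lemma sim_trans: assumes "sim n g h" "sim n h k" shows "sim n g k"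
proof -
  obtain c d where c: "c \<noteq> 0" "\<forall>x\<in>VK n. A n g x = c \<odot> A n h x" "d \<noteq> 0" "\<forall>x\<in>VK n. A n h x = d \<odot> A n k x"
    using assms unfolding sim_def by blast
  show ?thesis unfolding sim_def by (rule exI[of _ "c * d"]) (use c in simp)
qed

text \<open>\<open>k2\<close> acts on a vector fixed by the level subgroup, and \<open>k1\<close>,
  which normalizes that subgroup, may be applied after the projection; hence both matter only modulo
  the n-th power of the uniformizer.\<close>

lemma sim_cong:
  assumes n: "1 \<le> n" and a: "a \<in> G" and k: "k1 \<in> G \<inter> Kmax v" "k1' \<in> G \<inter> Kmax v" "k2 \<in> G \<inter> Kmax v" "k2' \<in> G \<inter> Kmax v"
    and c: "k1' - k1 \<in> intm (int n)" "k2' - k2 \<in> intm (int n)"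
  shows "sim n (k1 ** (a ** k2)) (k1' ** (a ** k2'))"
proof -
  have kG: "k1 \<in> G" "k1' \<in> G" "k2 \<in> G" "k2' \<in> G" using k by auto
  have mv: "\<pi> l y = \<pi> k y" if kl: "k \<in> G \<inter> Kmax v" "l \<in> G \<inter> Kmax v" "l - k \<in> intm (int n)" and y: "y \<in> VK n" for k l y
  proof -
    have "inv3 k ** l \<in> Kc n" by (rule Kc_congI) (use kl in auto)
    moreover have i: "inv3 k ** l \<in> G" by (rule GD(3)[OF GD(4)]) (use kl in auto)
    ultimately have f: "\<pi> (inv3 k ** l) y = y" using y unfolding VK_def by (intro fxD[of y "G \<inter> Kc n"]) auto
    have "l = k ** (inv3 k ** l)" using GL3_cancel(2)[OF GD(1), of k l] kl by simp
    thus ?thesis using pi_mult[of k "inv3 k ** l" y] kl i VK_W[OF y] f by simp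
  qed
  have "A n (k1 ** (a ** k2)) x = A n (k1' ** (a ** k2')) x" if x: "x \<in> VK n" for x
  proof -
    note xW = VK_W[OF x]
    have E: "A n (k ** (a ** l)) x = \<pi> k (eK n (\<pi> a (\<pi> l x)))" if "k \<in> G" "l \<in> G" "k \<in> Kmax v" for k l
      unfolding A_def using pi_mult[OF that(1) GD(3)[OF a that(2)] xW] pi_mult[OF a that(2) xW]
        eK_Kmax[OF n that(1,3) pi_W[OF a pi_W[OF that(2) xW]]] by simp
    have "\<pi> k1' (eK n (\<pi> a (\<pi> k2 x))) = \<pi> k1 (eK n (\<pi> a (\<pi> k2 x)))"
      by (rule mv[OF k(1,2) c(1) eK_VK[OF n pi_W[OF a pi_W[OF kG(3) xW]]]])
    thus ?thesis using E[OF kG(1,3)] E[OF kG(2,4)] k mv[OF k(3,4) c(2) x] by auto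
  qed
  thus ?thesis unfolding sim_def by (intro exI[of _ 1]) simp
qed

lemma sim_central: assumes n: "1 \<le> n" "irr n" "fd (VK n)" and z: "z \<in> G" "\<forall>g\<in>G. z ** g = g ** z" and g: "g \<in> G"
  shows "sim n (z ** g) g"
proof -
  obtain c where c: "\<forall>x\<in>VK n. \<pi> z x = c \<odot> x" using schur_scalar[OF n z(1)] z(2) by blast
  have A: "A n (z ** g) x = c \<odot> A n g x" if x: "x \<in> VK n" for x
  proof -
    note xW = VK_W[OF x]
    have "\<pi> (z ** g) x = \<pi> g (\<pi> z x)" using z(2) g pi_mult[OF g z(1) xW] by simp
    also have "\<dots> = c \<odot> \<pi> g x" using c x pi_scale[OF g xW] by simp
    finally show ?thesis unfolding A_def using eK_lin[OF n(1)] pi_W[OF g xW] by (simp add: lin_on_def)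
  qed
  show ?thesis
  proof (cases "VK n \<subseteq> {0}")
    case True
    have "A n h 0 = 0" if "h \<in> G" for h using lin_on_0[OF A_lin[OF n(1) that] W] .
    hence "\<forall>x\<in>VK n. A n (z ** g) x = 1 \<odot> A n g x" using True g GD(3)[OF z(1) g] by (auto dest!: subsetD)
    thus ?thesis unfolding sim_def by (intro exI[of _ 1]) simp
  next
    case False
    then obtain x where x: "x \<in> VK n" "x \<noteq> 0" by blast
    have "c \<noteq> 0" using pi_nz[OF z(1) VK_W[OF x(1)] x(2)] c x(1) by auto
    thus ?thesis unfolding sim_def using A by blast
  qed
qed

definition reps :: "nat \<Rightarrow> ('f ^ 3 ^ 3) set \<Rightarrow> 'f ^ 3 ^ 3 \<Rightarrow> ('f ^ 3 ^ 3) set \<Rightarrow> bool" where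
  "reps n KK a \<Omega> \<longleftrightarrow> finite \<Omega> \<and> \<Omega> \<subseteq> G \<and> (\<forall>k1\<in>KK. \<forall>k2\<in>KK. \<exists>w\<in>\<Omega>. sim n (k1 ** (a ** k2)) w)"

text \<open>Replacing (k1, k2) by (k1 ga, gb k2) changes the operator only by a scalar, since ga a
  gb is central times a. Reduced modulo the level, such an orbit has \<open>card \<Lambda>\<close>
  points in a set of size (card Y)^2, and pairs with intersecting orbits have proportional
  operators.\<close>

lemma orbit_reps:
  assumes n: "1 \<le> n" "irr n" "fd (VK n)" and KK: "subgrp KK" "KK \<subseteq> G \<inter> Kmax v"
    and Y: "finite Y" "\<And>k. k \<in> KK \<Longrightarrow> f k \<in> Y" "\<And>k k'. k \<in> KK \<Longrightarrow> k' \<in> KK \<Longrightarrow> f k = f k' \<Longrightarrow> k' - k \<in> intm (int n)"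
    and a: "a \<in> G" and \<Lambda>: "finite \<Lambda>" "\<Lambda> \<noteq> {}"
    and g: "\<And>l. l \<in> \<Lambda> \<Longrightarrow> ga l \<in> KK" "\<And>l. l \<in> \<Lambda> \<Longrightarrow> gb l \<in> KK"
      "\<And>l. l \<in> \<Lambda> \<Longrightarrow> \<exists>z\<in>G. (\<forall>g\<in>G. z ** g = g ** z) \<and> ga l ** (a ** gb l) = z ** a"
    and inj: "\<And>l l'. l \<in> \<Lambda> \<Longrightarrow> l' \<in> \<Lambda> \<Longrightarrow> ga l - ga l' \<in> intm (int n) \<Longrightarrow> gb l - gb l' \<in> intm (int n) \<Longrightarrow> l = l'"
  shows "\<exists>\<Omega>. reps n KK a \<Omega> \<and> card \<Omega> * card \<Lambda> \<le> (card Y)\<^sup>2"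
proof -
  have KI: "k \<in> G \<inter> Kmax v" if "k \<in> KK" for k using KK(2) that by blast
  note Km = subgrp_D(3)[OF KK(1)]
  define O' where "O' = (\<lambda>(k1, k2). (\<lambda>l. (f (k1 ** ga l), f (gb l ** k2))) ` \<Lambda>)"
  have "\<exists>\<Omega>\<subseteq>KK \<times> KK. finite \<Omega> \<and> card \<Omega> * card \<Lambda> \<le> card (Y \<times> Y) \<and> (\<forall>p\<in>KK \<times> KK. \<exists>w\<in>\<Omega>. O' p \<inter> O' w \<noteq> {})"
  proof (rule disjoint_family)
    show "finite (Y \<times> Y)" using Y(1) by simp
    show "1 \<le> card \<Lambda>" using \<Lambda> by (simp add: Suc_le_eq card_gt_0_iff)
    fix p assume "p \<in> KK \<times> KK"
    then obtain k1 k2 where p: "p = (k1, k2)" "k1 \<in> KK" "k2 \<in> KK" by blast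
    show "O' p \<subseteq> Y \<times> Y" unfolding O'_def p(1) prod.case using Y(2)[OF Km[OF p(2) g(1)]] Y(2)[OF Km[OF g(2) p(3)]] by blast
    have i: "inv3 k1 \<in> intm 0" "inv3 k2 \<in> intm 0" using KI[OF p(2)] KI[OF p(3)] Kmax_inv Kmax_iff by blast+
    have gl: "k1 \<in> GL3" "k2 \<in> GL3" using KI[OF p(2)] KI[OF p(3)] Kmax_GL3 by blast+
    show "card (O' p) = card \<Lambda>" unfolding O'_def p(1) prod.case
    proof (rule card_image, rule inj_onI)
      fix l l' assume l: "l \<in> \<Lambda>" "l' \<in> \<Lambda>" and e: "(f (k1 ** ga l), f (gb l ** k2)) = (f (k1 ** ga l'), f (gb l' ** k2))"
      have "k1 ** (ga l - ga l') \<in> intm (int n)"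
        unfolding mat_mult_diff by (rule Y(3)[OF Km[OF p(2) g(1)[OF l(2)]] Km[OF p(2) g(1)[OF l(1)]]]) (use e in simp)
      from intm_mult[OF i(1) this] have 1: "ga l - ga l' \<in> intm (int n)" by (simp only: GL3_cancel(1)[OF gl(1)] add_0)
      have "(gb l - gb l') ** k2 \<in> intm (int n)"
        unfolding mat_mult_diff by (rule Y(3)[OF Km[OF g(2)[OF l(2)] p(3)] Km[OF g(2)[OF l(1)] p(3)]]) (use e in simp)
      from intm_mult[OF this i(2)] have "gb l - gb l' \<in> intm (int n)"
        by (simp only: GL3_inv1(1)[OF gl(2)] matrix_mul_assoc[symmetric] matrix_mul_rid add_0_right)
      with 1 show "l = l'" by (rule inj[OF l])
    qed
  qed
  then obtain \<Omega> where \<Omega>: "\<Omega> \<subseteq> KK \<times> KK" "finite \<Omega>" "card \<Omega> * card \<Lambda> \<le> card (Y \<times> Y)" "\<forall>p\<in>KK \<times> KK. \<exists>w\<in>\<Omega>. O' p \<inter> O' w \<noteq> {}" by blast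
  define H where "H = (\<lambda>(k1, k2). k1 ** (a ** k2)) ` \<Omega>"
  have mG: "k1 ** (a ** k2) \<in> G" if "k1 \<in> KK" "k2 \<in> KK" for k1 k2
    using GD(3)[OF _ GD(3)[OF a]] KI[OF that(1)] KI[OF that(2)] by blast
  have "card H * card \<Lambda> \<le> card (Y \<times> Y)" unfolding H_def by (rule order_trans[OF mult_le_mono1[OF card_image_le[OF \<Omega>(2)]] \<Omega>(3)])
  hence cH: "card H * card \<Lambda> \<le> (card Y)\<^sup>2" by (simp add: card_cartesian_product power2_eq_square)
  have shift: "sim n ((k1 ** ga l) ** (a ** (gb l ** k2))) (k1 ** (a ** k2))" if k: "k1 \<in> KK" "k2 \<in> KK" and l: "l \<in> \<Lambda>" for k1 k2 l
  proof -
    obtain z where z: "z \<in> G" "\<forall>g\<in>G. z ** g = g ** z" "ga l ** (a ** gb l) = z ** a" using g(3)[OF l] by blast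
    have "(k1 ** ga l) ** (a ** (gb l ** k2)) = k1 ** ((ga l ** (a ** gb l)) ** k2)" by (simp add: matrix_mul_assoc)
    also have "\<dots> = (k1 ** z) ** (a ** k2)" unfolding z(3) by (simp add: matrix_mul_assoc)
    also have "\<dots> = z ** (k1 ** (a ** k2))" using z(2) KI[OF k(1)] by (simp add: matrix_mul_assoc)
    finally show ?thesis using sim_central[OF n z(1,2) mG[OF k]] by simp
  qed
  have "\<exists>w\<in>H. sim n (k1 ** (a ** k2)) w" if k: "k1 \<in> KK" "k2 \<in> KK" for k1 k2
  proof -
    have "(k1, k2) \<in> KK \<times> KK" using k by blast
    then obtain w1 w2 where w: "(w1, w2) \<in> \<Omega>" "O' (k1, k2) \<inter> O' (w1, w2) \<noteq> {}" using \<Omega>(4) by fast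
    then obtain l l' where l: "l \<in> \<Lambda>" "l' \<in> \<Lambda>" "f (k1 ** ga l) = f (w1 ** ga l')" "f (gb l ** k2) = f (gb l' ** w2)"
      by (auto simp: O'_def)
    have wK: "w1 \<in> KK" "w2 \<in> KK" using w(1) \<Omega>(1) by blast+
    note m = Km[OF k(1) g(1)[OF l(1)]] Km[OF wK(1) g(1)[OF l(2)]] Km[OF g(2)[OF l(1)] k(2)] Km[OF g(2)[OF l(2)] wK(2)]
    have "sim n ((k1 ** ga l) ** (a ** (gb l ** k2))) ((w1 ** ga l') ** (a ** (gb l' ** w2)))"
      by (rule sim_cong[OF n(1) a m[THEN KI] Y(3)[OF m(1,2) l(3)] Y(3)[OF m(3,4) l(4)]])
    hence "sim n (k1 ** (a ** k2)) (w1 ** (a ** w2))"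
      using sim_trans sim_sym[OF shift[OF k l(1)]] shift[OF wK l(2)] by blast
    thus ?thesis unfolding H_def using w(1) by fastforce
  qed
  moreover have "H \<subseteq> G" unfolding H_def using \<Omega>(1) mG by auto
  ultimately show ?thesis using cH \<Omega>(2) unfolding reps_def by (intro exI[of _ H]) (simp add: H_def)
qed

lemma dim_le_cells:
  assumes n: "1 \<le> n" "irr n" "fd (VK n)" and I: "finite I" "\<forall>i\<in>I. \<exists>\<Omega>. reps n KK (a i) \<Omega> \<and> card \<Omega> \<le> N"
    and aG: "\<And>i. a i \<in> G" and KK: "KK \<subseteq> G"
    and cover: "\<And>g. g \<in> G \<Longrightarrow> \<exists>z\<in>G. \<exists>k1\<in>KK. \<exists>k2\<in>KK. \<exists>i. (\<forall>h\<in>G. z ** h = h ** z) \<and> g = z ** (k1 ** (a i ** k2)) \<and>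
      (i \<in> I \<or> (\<forall>x\<in>VK n. A n (k1 ** (a i ** k2)) x = 0))"
  shows "(dim (VK n))\<^sup>2 \<le> card I * N"
proof -
  from bchoice[OF I(2)] obtain \<Omega> where \<Omega>: "\<forall>i\<in>I. reps n KK (a i) (\<Omega> i) \<and> card (\<Omega> i) \<le> N" by blast
  have "(dim (VK n))\<^sup>2 \<le> card (\<Union>i\<in>I. \<Omega> i)"
  proof (rule burnside_count[OF n])
    show "finite (\<Union>i\<in>I. \<Omega> i)" "(\<Union>i\<in>I. \<Omega> i) \<subseteq> G" using \<Omega> I(1) unfolding reps_def by blast+
    fix g assume "g \<in> G"
    from cover[OF this] obtain z k1 k2 i where g: "z \<in> G" "k1 \<in> KK" "k2 \<in> KK" "\<forall>h\<in>G. z ** h = h ** z" "g = z ** (k1 ** (a i ** k2))"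
      "i \<in> I \<or> (\<forall>x\<in>VK n. A n (k1 ** (a i ** k2)) x = 0)" by blast
    have "k1 ** (a i ** k2) \<in> G" using GD(3)[OF _ GD(3)[OF aG]] g(2,3) KK by blast
    hence s: "sim n g (k1 ** (a i ** k2))" unfolding g(5) by (rule sim_central[OF n g(1,4)])
    show "(\<forall>x\<in>VK n. A n g x = 0) \<or> (\<exists>w\<in>(\<Union>i\<in>I. \<Omega> i). \<exists>c. \<forall>x\<in>VK n. A n g x = c \<odot> A n w x)"
    proof (cases "i \<in> I")
      case True
      then obtain w where w: "w \<in> \<Omega> i" "sim n (k1 ** (a i ** k2)) w" using \<Omega> g(2,3) unfolding reps_def by blast
      have "sim n g w" by (rule sim_trans[OF s w(2)])
      thus ?thesis using w(1) True unfolding sim_def by blast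
    next
      case False
      thus ?thesis using s g(6) unfolding sim_def by auto
    qed
  qed
  also have "\<dots> \<le> (\<Sum>i\<in>I. card (\<Omega> i))" by (rule card_UN_le[OF I(1)])
  also have "\<dots> \<le> card I * N" using sum_bounded_above[of I "\<lambda>i. card (\<Omega> i)" N] \<Omega> by simp
  finally show ?thesis .
qed

end

text \<open>\<open>Q\<close> stands for q^n and \<open>w\<close> for the number of unit classes.
  Units are at least half of all classes, so each of the \<open>b\<close> unit parameters costs a
  factor of at most 2.\<close>

lemma cell_count: fixes c :: nat assumes "c * (Q ^ a * w ^ b) \<le> Q ^ d * Q ^ (a + b)" "Q \<le> 2 * w" "0 < Q" shows "c \<le> 2 ^ b * Q ^ d"
proof -
  have "Q ^ b \<le> 2 ^ b * w ^ b" using power_mono[OF assms(2), of b] by (simp add: power_mult_distrib)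
  hence "c * (Q ^ a * Q ^ b) \<le> c * (Q ^ a * (2 ^ b * w ^ b))" by (intro mult_le_mono2)
  also have "\<dots> = 2 ^ b * (c * (Q ^ a * w ^ b))" by simp
  also have "\<dots> \<le> 2 ^ b * (Q ^ d * Q ^ (a + b))" by (rule mult_le_mono2[OF assms(1)])
  also have "\<dots> = (2 ^ b * Q ^ d) * (Q ^ a * Q ^ b)" by (simp add: power_add)
  finally show ?thesis using assms(3) by simp
qed

section \<open>Congruences and LDU coordinates\<close>

context dvf begin

definition cg :: "nat \<Rightarrow> 'f \<Rightarrow> 'f \<Rightarrow> bool" where "cg n x y \<longleftrightarrow> x - y \<in> P (int n)"

lemma cg_mult: assumes "x \<in> P 0" "y' \<in> P 0" "cg n x x'" "cg n y y'" shows "cg n (x*y) (x'*y')"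
proof -
  have "x * (y - y') \<in> P (int n)" "(x - x') * y' \<in> P (int n)"
    using assms P_mult[of x 0 "y - y'" "int n"] P_mult[of "x - x'" "int n" y' 0] by (simp_all add: cg_def)
  hence "x * (y - y') + (x - x') * y' \<in> P (int n)" by (rule P_add)
  thus ?thesis by (simp add: cg_def algebra_simps)
qed

lemma cg_cancel: assumes t: "t \<in> un" "y' \<in> P 0" "cg n t t'" "cg n (t*y) (t'*y')" shows "cg n y y'"
proof -
  have "(t - t') * y' \<in> P (int n)" using assms P_mult[of "t - t'" "int n" y' 0] by (simp add: cg_def)
  hence "(t*y - t'*y') - (t - t') * y' \<in> P (int n)" by (rule P_diff[OF assms(4)[unfolded cg_def]])
  moreover have "(t*y - t'*y') - (t - t') * y' = t * (y - y')" by algebra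
  ultimately show ?thesis using P_mult_un(2)[OF t(1)] by (simp add: cg_def)
qed

lemma cg_addD: assumes "cg n x x'" "cg n (x + y) (x' + y')" shows "cg n y y'"
proof -
  have "(x + y - (x' + y')) - (x - x') \<in> P (int n)" by (rule P_diff[OF assms(2)[unfolded cg_def] assms(1)[unfolded cg_def]])
  moreover have "(x + y - (x' + y')) - (x - x') = y - y'" by simp
  ultimately show ?thesis by (simp only: cg_def)
qed

lemma cg_add: assumes "cg n x x'" "cg n y y'" shows "cg n (x + y) (x' + y')"
  using P_add[of "x - x'" "int n" "y - y'"] assms by (simp add: cg_def add_diff_add)

definition ldu :: "'f \<Rightarrow> 'f \<Rightarrow> 'f \<Rightarrow> 'f \<Rightarrow> 'f \<Rightarrow> 'f \<Rightarrow> 'f \<Rightarrow> 'f \<Rightarrow> 'f \<Rightarrow> 'f ^ 3 ^ 3" where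
  "ldu l21 l31 l32 t1 t2 t3 u12 u13 u23 =
    mat3 1 0 0 l21 1 0 l31 l32 1 ** (mat3 t1 0 0 0 t2 0 0 0 t3 ** mat3 1 u12 u13 0 1 u23 0 0 1)"

lemma ldu_Kmax:
  assumes "l21 \<in> P 0" "l31 \<in> P 0" "l32 \<in> P 0" "t1 \<in> un" "t2 \<in> un" "t3 \<in> un" "u12 \<in> P 0" "u13 \<in> P 0" "u23 \<in> P 0"
  shows "ldu l21 l31 l32 t1 t2 t3 u12 u13 u23 \<in> Kmax v"
proof -
  have "mat3 1 0 0 l21 1 0 l31 l32 1 \<in> Kmax v" "mat3 1 u12 u13 0 1 u23 0 0 1 \<in> Kmax v" "mat3 t1 0 0 0 t2 0 0 0 t3 \<in> Kmax v"
    using assms un_mult[OF un_mult[OF assms(4,5)] assms(6)] un_P unfolding Kmax_iff intm_mat3 by (simp_all add: mat3_det)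
  thus ?thesis unfolding ldu_def by (intro subgrp_D(3)[OF subgrp_Kmax])
qed

text \<open>The coordinates are recovered in the order of Gaussian elimination, and no precision is
  lost because every division is by a unit.\<close>

lemma ldu_cong:
  assumes t: "t1 \<in> un" "t2 \<in> un" "t3 \<in> P 0" "s1 \<in> un" "s2 \<in> un" "s3 \<in> P 0"
    and l: "l21 \<in> P 0" "l31 \<in> P 0" "l32 \<in> P 0" "m21 \<in> P 0" "m31 \<in> P 0" "m32 \<in> P 0"
    and u: "u12 \<in> P 0" "u13 \<in> P 0" "u23 \<in> P 0" "w12 \<in> P 0" "w13 \<in> P 0" "w23 \<in> P 0"
    and c: "ldu l21 l31 l32 t1 t2 t3 u12 u13 u23 - ldu m21 m31 m32 s1 s2 s3 w12 w13 w23 \<in> intm (int n)"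
  shows "cg n l21 m21" "cg n l31 m31" "cg n l32 m32" "cg n t1 s1" "cg n t2 s2" "cg n t3 s3" "cg n u12 w12" "cg n u13 w13" "cg n u23 w23"
proof -
  have c': "cg n t1 s1" "cg n (t1*u12) (s1*w12)" "cg n (t1*u13) (s1*w13)" "cg n (t1*l21) (s1*m21)" "cg n (t1*l31) (s1*m31)"
    "cg n (l21*(t1*u12) + t2) (m21*(s1*w12) + s2)" "cg n (l21*(t1*u13) + t2*u23) (m21*(s1*w13) + s2*w23)"
    "cg n (l31*(t1*u12) + t2*l32) (m31*(s1*w12) + s2*m32)"
    "cg n (l31*(t1*u13) + l32*(t2*u23) + t3) (m31*(s1*w13) + m32*(s2*w23) + s3)"
    using c unfolding ldu_def mat3_mult mat3_diff intm_mat3 cg_def by (simp_all add: mult.commute)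
  note t0 = un_P[OF t(1)] un_P[OF t(2)] un_P[OF t(4)] un_P[OF t(5)]
  have m0: "x * y \<in> P 0" if "x \<in> P 0" "y \<in> P 0" for x y using P_mult[OF that] by simp
  show 1: "cg n t1 s1" by (rule c'(1))
  show u12: "cg n u12 w12" by (rule cg_cancel[OF t(1) u(4) 1 c'(2)])
  show u13: "cg n u13 w13" by (rule cg_cancel[OF t(1) u(5) 1 c'(3)])
  show l21: "cg n l21 m21" by (rule cg_cancel[OF t(1) l(4) 1 c'(4)])
  show l31: "cg n l31 m31" by (rule cg_cancel[OF t(1) l(5) 1 c'(5)])
  show t2: "cg n t2 s2" by (rule cg_addD[OF cg_mult[OF l(1) m0[OF t0(3) u(4)] l21 c'(2)] c'(6)])
  have x: "cg n (t2*u23) (s2*w23)" by (rule cg_addD[OF cg_mult[OF l(1) m0[OF t0(3) u(5)] l21 c'(3)] c'(7)])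
  show u23: "cg n u23 w23" by (rule cg_cancel[OF t(2) u(6) t2 x])
  have y: "cg n (t2*l32) (s2*m32)" by (rule cg_addD[OF cg_mult[OF l(2) m0[OF t0(3) u(4)] l31 c'(2)] c'(8)])
  show l32: "cg n l32 m32" by (rule cg_cancel[OF t(2) l(6) t2 y])
  show "cg n t3 s3"
    by (rule cg_addD[OF cg_add[OF cg_mult[OF l(2) m0[OF t0(3) u(5)] l31 c'(3)] cg_mult[OF l(3) m0[OF t0(4) u(6)] l32 x]] c'(9)])
qed

lemma w_bound: assumes "1 \<le> n" shows "q ^ n \<le> 2 * (q ^ n - q ^ (n - 1))"
proof -
  have "q ^ n = q * q ^ (n - 1)" using assms by (cases n) auto
  moreover have "2 * q ^ (n - 1) \<le> q * q ^ (n - 1)" using q_ge2 by (intro mult_le_mono1)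
  ultimately show ?thesis by linarith
qed

lemma inv3_congr: assumes "h \<in> Kmax v" "h' \<in> Kmax v" "inv3 h - inv3 h' \<in> intm (int n)" shows "h' - h \<in> intm (int n)"
proof -
  have g: "h \<in> GL3" "h' \<in> GL3" using assms Kmax_GL3 by auto
  have i: "h \<in> intm 0" "h' \<in> intm 0" using assms Kmax_iff by auto
  have "h ** (inv3 h - inv3 h') ** h' \<in> intm (0 + int n + 0)" by (intro intm_mult i assms)
  moreover have "h ** (inv3 h - inv3 h') ** h' = h' - h"
    by (simp add: mat_mult_diff GL3_inv1(1)[OF g(1)] GL3_inv1(2)[OF g(2)] matrix_mul_assoc[symmetric])
  ultimately show ?thesis by simp
qed

end

context mrep begin

text \<open>Moving \<open>a\<close> across an LDU product scales lower and upper entries by opposite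
  ratios of its diagonal entries. Since x >= y >= z, the integral ratios \<open>xy\<close>,
  \<open>xz\<close>, \<open>yz\<close> can be put on the upper entries of \<open>g1\<close> and on
  the lower entries of \<open>h2\<close>, so both are integral and \<open>g1\<close> times
  \<open>a\<close> is \<open>s\<close> times \<open>a\<close> times \<open>h2\<close>. Six
  unipotent, three torus and one scalar coordinate make up the orbit.\<close>

lemma cell_reps:
  assumes n: "1 \<le> n" "irr n" "fd (VK n)" and KK: "subgrp KK" "KK \<subseteq> G \<inter> Kmax v"
    and Y: "finite Y" "\<And>k. k \<in> KK \<Longrightarrow> f k \<in> Y" "\<And>k k'. k \<in> KK \<Longrightarrow> k' \<in> KK \<Longrightarrow> f k = f k' \<Longrightarrow> k' - k \<in> intm (int n)"
    and a: "mat3 (pw x) 0 0 0 (pw y) 0 0 0 (pw z) \<in> G" and o: "z \<le> y" "y \<le> x"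
    and X: "\<And>i. finite (X i) \<and> X i \<noteq> {}" "\<And>i r s. r \<in> X i \<Longrightarrow> s \<in> X i \<Longrightarrow> cg n r s \<Longrightarrow> r = s" "\<And>i. X i \<subseteq> P 0" "\<And>i. (6::nat) \<le> i \<Longrightarrow> X i \<subseteq> un"
    and K: "\<And>l1 l2 l3 u1 u2 u3 t1 t2 t3 s xy xz yz. l1 \<in> X 0 \<Longrightarrow> l2 \<in> X 1 \<Longrightarrow> l3 \<in> X 2 \<Longrightarrow> u1 \<in> X 3 \<Longrightarrow> u2 \<in> X 4 \<Longrightarrow> u3 \<in> X 5 \<Longrightarrow>
      t1 \<in> X 6 \<Longrightarrow> t2 \<in> X 7 \<Longrightarrow> t3 \<in> X 8 \<Longrightarrow> s \<in> X 9 \<Longrightarrow> xy \<in> P 0 \<Longrightarrow> xz \<in> P 0 \<Longrightarrow> yz \<in> P 0 \<Longrightarrow>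
      ldu l1 l2 l3 (s*t1) (s*t2) (s*t3) (u1*xy) (u2*xz) (u3*yz) \<in> KK \<and> ldu (l1*xy) (l2*xz) (l3*yz) t1 t2 t3 u1 u2 u3 \<in> KK \<and> mat3 s 0 0 0 s 0 0 0 s \<in> G"
  shows "\<exists>\<Omega>. reps n KK (mat3 (pw x) 0 0 0 (pw y) 0 0 0 (pw z)) \<Omega> \<and> card \<Omega> * (\<Prod>i<10. card (X i)) \<le> (card Y)\<^sup>2"
proof -
  let ?a = "mat3 (pw x) 0 0 0 (pw y) 0 0 0 (pw z) :: 'f ^ 3 ^ 3"
  define La where "La = (X 0 \<times> X 1 \<times> X 2) \<times> (X 3 \<times> X 4 \<times> X 5) \<times> X 6 \<times> X 7 \<times> X 8 \<times> X 9"
  define xy xz yz where "xy = pw (x - y)" and "xz = pw (x - z)" and "yz = pw (y - z)"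
  have e: "xy \<in> P 0" "xz \<in> P 0" "yz \<in> P 0" using o by (simp_all add: xy_def xz_def yz_def)
  define g1 where "g1 = (\<lambda>((l1,l2,l3),(u1,u2,u3),(t1,t2,t3,s)). ldu l1 l2 l3 (s*t1) (s*t2) (s*t3) (u1*xy) (u2*xz) (u3*yz))"
  define h2 where "h2 = (\<lambda>((l1,l2,l3),(u1,u2,u3),(t1,t2,t3,s::'f)). ldu (l1*xy) (l2*xz) (l3*yz) t1 t2 t3 u1 u2 u3)"
  have m0: "r * s \<in> P 0" if "r \<in> P 0" "s \<in> P 0" for r s using P_mult[OF that] by simp
  have "\<exists>\<Omega>. reps n KK ?a \<Omega> \<and> card \<Omega> * card La \<le> (card Y)\<^sup>2"
  proof (rule orbit_reps[OF n KK Y a, where ga = g1 and gb = "\<lambda>l. inv3 (h2 l)"])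
    show "finite La" "La \<noteq> {}" using X(1) by (simp_all add: La_def)
    fix l assume l: "l \<in> La"
    obtain l1 l2 l3 u1 u2 u3 t1 t2 t3 s where L: "l = ((l1,l2,l3),(u1,u2,u3),(t1,t2,t3,s))" by (metis surj_pair)
    have p: "l1 \<in> X 0" "l2 \<in> X 1" "l3 \<in> X 2" "u1 \<in> X 3" "u2 \<in> X 4" "u3 \<in> X 5" "t1 \<in> X 6" "t2 \<in> X 7" "t3 \<in> X 8" "s \<in> X 9"
      using l unfolding L La_def by auto
    have gK: "g1 l \<in> KK" "h2 l \<in> KK" "mat3 s 0 0 0 s 0 0 0 s \<in> G" unfolding g1_def h2_def L prod.case using K[OF p e] by auto
    show "g1 l \<in> KK" "inv3 (h2 l) \<in> KK" using gK subgrp_D(4)[OF KK(1)] by auto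
    have hG: "h2 l \<in> GL3" using subgrp_D(1)[OF KK(1) gK(2)] .
    let ?z = "mat3 s 0 0 0 s 0 0 0 s :: 'f ^ 3 ^ 3"
    have "g1 l ** ?a = ?z ** (?a ** h2 l)"
      unfolding g1_def h2_def L prod.case ldu_def mat3_mult mat3_eq xy_def xz_def yz_def by (simp add: pw_diff field_simps)
    hence "g1 l ** (?a ** inv3 (h2 l)) = ?z ** (?a ** (h2 l ** inv3 (h2 l)))" by (simp add: matrix_mul_assoc)
    hence "g1 l ** (?a ** inv3 (h2 l)) = ?z ** ?a" using GL3_inv1(1)[OF hG] by simp
    moreover have "?z ** g = g ** ?z" for g
      by (rule mat3_cases[of g]) (simp add: mat3_mult mat3_eq mult.commute)
    ultimately show "\<exists>z\<in>G. (\<forall>g\<in>G. z ** g = g ** z) \<and> g1 l ** (?a ** inv3 (h2 l)) = z ** ?a" using gK(3) by blast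
    fix l' assume l': "l' \<in> La" and c: "g1 l - g1 l' \<in> intm (int n)" and c2: "inv3 (h2 l) - inv3 (h2 l') \<in> intm (int n)"
    obtain m1 m2 m3 w1 w2 w3 r1 r2 r3 s' where L': "l' = ((m1,m2,m3),(w1,w2,w3),(r1,r2,r3,s'))" by (metis surj_pair)
    have p': "m1 \<in> X 0" "m2 \<in> X 1" "m3 \<in> X 2" "w1 \<in> X 3" "w2 \<in> X 4" "w3 \<in> X 5" "r1 \<in> X 6" "r2 \<in> X 7" "r3 \<in> X 8" "s' \<in> X 9"
      using l' unfolding L' La_def by auto
    have p0: "l1 \<in> P 0" "l2 \<in> P 0" "l3 \<in> P 0" "u1 \<in> P 0" "u2 \<in> P 0" "u3 \<in> P 0"
      and p0': "m1 \<in> P 0" "m2 \<in> P 0" "m3 \<in> P 0" "w1 \<in> P 0" "w2 \<in> P 0" "w3 \<in> P 0" using p p' X(3) by blast+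
    have t: "t1 \<in> un" "t2 \<in> un" "t3 \<in> un" "s \<in> un" and t': "r1 \<in> un" "r2 \<in> un" "r3 \<in> un" "s' \<in> un"
      using p(7-) p'(7-) X(4)[of 6] X(4)[of 7] X(4)[of 8] X(4)[of 9] by auto
    note q1 = ldu_cong[OF un_mult[OF t(4,1)] un_mult[OF t(4,2)] un_P[OF un_mult[OF t(4,3)]]
        un_mult[OF t'(4,1)] un_mult[OF t'(4,2)] un_P[OF un_mult[OF t'(4,3)]] p0(1-3) p0'(1-3)
        m0[OF p0(4) e(1)] m0[OF p0(5) e(2)] m0[OF p0(6) e(3)] m0[OF p0'(4) e(1)] m0[OF p0'(5) e(2)] m0[OF p0'(6) e(3)]
        c[unfolded L L' g1_def prod.case]]
    have hK: "h2 l \<in> Kmax v" "h2 l' \<in> Kmax v" using gK(2) K[OF p' e] KK(2) unfolding h2_def L' prod.case by auto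
    have c2': "h2 l' - h2 l \<in> intm (int n)" by (rule inv3_congr[OF hK c2])
    note q2 = ldu_cong[OF t'(1,2) un_P[OF t'(3)] t(1,2) un_P[OF t(3)] m0[OF p0'(1) e(1)] m0[OF p0'(2) e(2)] m0[OF p0'(3) e(3)]
        m0[OF p0(1) e(1)] m0[OF p0(2) e(2)] m0[OF p0(3) e(3)] p0'(4-6) p0(4-6) c2'[unfolded L L' h2_def prod.case]]
    have eqs: "l1 = m1" "l2 = m2" "l3 = m3" "r1 = t1" "r2 = t2" "r3 = t3" "w1 = u1" "w2 = u2" "w3 = u3"
      using X(2)[OF p(1) p'(1) q1(1)] X(2)[OF p(2) p'(2) q1(2)] X(2)[OF p(3) p'(3) q1(3)] X(2)[OF p'(7) p(7) q2(4)] X(2)[OF p'(8) p(8) q2(5)]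
        X(2)[OF p'(9) p(9) q2(6)] X(2)[OF p'(4) p(4) q2(7)] X(2)[OF p'(5) p(5) q2(8)] X(2)[OF p'(6) p(6) q2(9)] by simp_all
    have "cg n (t1 * s) (t1 * s')" using q1(4) unfolding eqs by (simp add: mult.commute)
    hence "cg n s s'" by (intro cg_cancel[OF t(1) un_P[OF t'(4)], of n t1]) (simp add: cg_def)
    hence "s = s'" by (rule X(2)[OF p(10) p'(10)])
    thus "l = l'" unfolding L L' eqs by simp
  qed
  moreover have "card La = (\<Prod>i<10. card (X i))"
    by (simp add: La_def card_cartesian_product eval_nat_numeral lessThan_Suc mult_ac)
  ultimately show ?thesis by simp
qed

text \<open>The GL_1 factor is central, so only the 2 by 2 block counts: q^(8n) pairs, in orbits
  with two unipotent and two unit coordinates.\<close>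

lemma GL2_reps:
  assumes GG: "G = LG" and n: "1 \<le> n" "irr n" "fd (VK n)" and o: "0 \<le> x"
  shows "\<exists>\<Omega>. reps n (G2 \<inter> Kmax v) (mat3 (pw x) 0 0 0 1 0 0 0 1) \<Omega> \<and> card \<Omega> \<le> 4 * q ^ (4*n)"
proof -
  let ?D = "Dig n" and ?w = "q ^ n - q ^ (n - 1)"
  \<comment> \<open>Coordinates outside the block, and the scalar, are frozen at 0 or 1.\<close>
  define X where "X = (\<lambda>i::nat. if i = 0 \<or> i = 3 then ?D else if i = 6 \<or> i = 7 then ?D \<inter> un else if i < 6 then {0} else {1})"
  have w: "q ^ n \<le> 2 * ?w" "0 < q ^ n" using w_bound[OF n(1)] q_ge2 by auto
  have ne: "?D \<noteq> {}" "?D \<inter> un \<noteq> {}" using Dig_card[of n] Dig_un_card[OF n(1)] w by auto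
  define f where "f = (\<lambda>k::'f ^ 3 ^ 3. ((red n (k$1$1), red n (k$1$2)), (red n (k$2$1), red n (k$2$2))))"
  let ?Y = "(?D \<times> ?D) \<times> (?D \<times> ?D)"
  have kP: "k$i$j \<in> P 0" if "k \<in> G2 \<inter> Kmax v" for k i j using that unfolding Int_iff Kmax_iff intm_def by blast
  have "\<exists>\<Omega>. reps n (G2 \<inter> Kmax v) (mat3 (pw x) 0 0 0 (pw 0) 0 0 0 (pw 0)) \<Omega> \<and> card \<Omega> * (\<Prod>i<10. card (X i)) \<le> (card ?Y)\<^sup>2"
  proof (rule cell_reps[OF n, where f = f])
    show "subgrp (G2 \<inter> Kmax v)" by (rule subgrp_Int[OF subgrp_patterns(3) subgrp_Kmax])
    show "G2 \<inter> Kmax v \<subseteq> G \<inter> Kmax v" using G2_LG GG by blast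
    show "finite ?Y" by (simp add: Dig_finite)
    show "f k \<in> ?Y" if "k \<in> G2 \<inter> Kmax v" for k using red(1)[OF kP[OF that]] by (simp add: f_def)
    show "k' - k \<in> intm (int n)" if k: "k \<in> G2 \<inter> Kmax v" "k' \<in> G2 \<inter> Kmax v" "f k = f k'" for k k'
      unfolding intm_def using red_eqD[OF kP[OF k(2)] kP[OF k(1)]] k by (auto simp: f_def forall_3 G2_def LG_def P3_def)
    show "mat3 (pw x) 0 0 0 (pw 0) 0 0 0 (pw 0) \<in> G" by (simp add: GG LG_mat3)
    show "finite (X i) \<and> X i \<noteq> {}" for i using ne by (simp add: X_def Dig_finite)
    show "r = s" if "r \<in> X i" "s \<in> X i" "cg n r s" for i r s using that Dig_uniq[of r n s] by (auto simp: X_def cg_def split: if_splits)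
    show "X i \<subseteq> P 0" for i using Dig_P by (auto simp: X_def)
    show "X i \<subseteq> un" if "6 \<le> i" for i using that by (auto simp: X_def)
    fix l1 l2 l3 u1 u2 u3 t1 t2 t3 s xy xz yz assume p: "l1 \<in> X 0" "l2 \<in> X 1" "l3 \<in> X 2" "u1 \<in> X 3" "u2 \<in> X 4" "u3 \<in> X 5"
      "t1 \<in> X 6" "t2 \<in> X 7" "t3 \<in> X 8" "s \<in> X 9" "xy \<in> P 0" "xz \<in> P 0" "yz \<in> P 0"
    have q: "l1 \<in> P 0" "u1 \<in> P 0" "t1 \<in> un" "t2 \<in> un" "l2 = 0" "l3 = 0" "u2 = 0" "u3 = 0" "t3 = 1" "s = 1"
      using p Dig_P by (auto simp: X_def)
    have "ldu l 0 0 t1 t2 1 u 0 0 \<in> G2 \<inter> Kmax v" if "l \<in> P 0" "u \<in> P 0" for l u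
    proof -
      have "ldu l 0 0 t1 t2 1 u 0 0 \<in> G2" unfolding ldu_def mat3_mult using un_nz[OF q(3)] un_nz[OF q(4)] by (simp add: G2_def LG_mat3 algebra_simps)
      thus ?thesis using ldu_Kmax[of l 0 0 t1 t2 1 u 0 0] that q(3,4) by simp
    qed
    thus "ldu l1 l2 l3 (s*t1) (s*t2) (s*t3) (u1*xy) (u2*xz) (u3*yz) \<in> G2 \<inter> Kmax v \<and>
      ldu (l1*xy) (l2*xz) (l3*yz) t1 t2 t3 u1 u2 u3 \<in> G2 \<inter> Kmax v \<and> mat3 s 0 0 0 s 0 0 0 s \<in> G"
      using q(1,2) P_mult[OF q(1) p(11)] P_mult[OF q(2) p(11)] unfolding q(5-) by (simp add: GG LG_mat3)
  qed (use o in simp_all)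
  then obtain \<Omega> where \<Omega>: "reps n (G2 \<inter> Kmax v) (mat3 (pw x) 0 0 0 1 0 0 0 1) \<Omega>" "card \<Omega> * (\<Prod>i<10. card (X i)) \<le> (card ?Y)\<^sup>2" by auto
  have Q: "(Q*Q*(Q*Q))^2 = Q^4 * Q^4" for Q :: nat by algebra
  have "(\<Prod>i<10. card (X i)) = (q ^ n) ^ 2 * ?w ^ 2"
    by (simp add: X_def Dig_card Dig_un_card[OF n(1)] eval_nat_numeral lessThan_Suc mult_ac)
  hence "card \<Omega> * ((q ^ n) ^ 2 * ?w ^ 2) \<le> (q ^ n) ^ 4 * (q ^ n) ^ 4"
    using \<Omega>(2) by (simp add: card_cartesian_product Dig_card Q)
  hence "card \<Omega> \<le> 2 ^ 2 * (q ^ n) ^ 4" by (intro cell_count[OF _ w, where a = 2]) simp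
  hence "card \<Omega> \<le> 4 * q ^ (4*n)" by (simp add: power_mult[symmetric] mult.commute)
  thus ?thesis using \<Omega>(1) by blast
qed

end

text \<open>There are q^(18n) pairs, in orbits with six unipotent and four unit coordinates; this
  leaves 2^4 q^(8n).\<close>

lemma (in gl3) GL3_reps:
  assumes n: "1 \<le> n" "irr n" "fd (VK n)" and o: "z \<le> y" "y \<le> x"
  shows "\<exists>\<Omega>. reps n (Kmax v) (mat3 (pw x) 0 0 0 (pw y) 0 0 0 (pw z)) \<Omega> \<and> card \<Omega> \<le> 16 * q ^ (8*n)"
proof -
  let ?D = "Dig n" and ?w = "q ^ n - q ^ (n - 1)"
  define X where "X = (\<lambda>i::nat. if i < 6 then ?D else ?D \<inter> un)"
  have w: "q ^ n \<le> 2 * ?w" "0 < q ^ n" using w_bound[OF n(1)] q_ge2 by auto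
  have ne: "?D \<noteq> {}" "?D \<inter> un \<noteq> {}" using Dig_card[of n] Dig_un_card[OF n(1)] w by auto
  define f where "f = (\<lambda>k::'f ^ 3 ^ 3. ((red n (k$1$1), red n (k$1$2), red n (k$1$3)), (red n (k$2$1), red n (k$2$2), red n (k$2$3)), (red n (k$3$1), red n (k$3$2), red n (k$3$3))))"
  let ?Y = "(?D \<times> ?D \<times> ?D) \<times> (?D \<times> ?D \<times> ?D) \<times> (?D \<times> ?D \<times> ?D)"
  have kP: "k$i$j \<in> P 0" if "k \<in> Kmax v" for k i j using that unfolding Kmax_iff intm_def by blast
  have "\<exists>\<Omega>. reps n (Kmax v) (mat3 (pw x) 0 0 0 (pw y) 0 0 0 (pw z)) \<Omega> \<and> card \<Omega> * (\<Prod>i<10. card (X i)) \<le> (card ?Y)\<^sup>2"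
  proof (rule cell_reps[OF n, where f = f])
    show "subgrp (Kmax v)" by (rule subgrp_Kmax)
    show "Kmax v \<subseteq> G \<inter> Kmax v" using Kmax_GL3 GG by blast
    show "finite ?Y" by (simp add: Dig_finite)
    show "f k \<in> ?Y" if "k \<in> Kmax v" for k using red(1)[OF kP[OF that]] by (simp add: f_def)
    show "k' - k \<in> intm (int n)" if "k \<in> Kmax v" "k' \<in> Kmax v" "f k = f k'" for k k'
      unfolding intm_def using red_eqD[OF kP[OF that(2)] kP[OF that(1)]] that(3) by (auto simp: f_def forall_3)
    show "mat3 (pw x) 0 0 0 (pw y) 0 0 0 (pw z) \<in> G" by (simp add: GG GL3_def mat3_det)
    show "finite (X i) \<and> X i \<noteq> {}" for i using ne by (simp add: X_def Dig_finite)
    show "r = s" if "r \<in> X i" "s \<in> X i" "cg n r s" for i r s using that Dig_uniq[of r n s] by (simp add: X_def cg_def split: if_splits)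
    show "X i \<subseteq> P 0" for i using Dig_P by (auto simp: X_def)
    show "X i \<subseteq> un" if "6 \<le> i" for i using that by (simp add: X_def)
  qed (use o P_mult[of _ 0 _ 0] Dig_P un_mult in \<open>auto simp: X_def GG GL3_def mat3_det un_def intro!: ldu_Kmax\<close>)
  then obtain \<Omega> where \<Omega>: "reps n (Kmax v) (mat3 (pw x) 0 0 0 (pw y) 0 0 0 (pw z)) \<Omega>" "card \<Omega> * (\<Prod>i<10. card (X i)) \<le> (card ?Y)\<^sup>2" by blast
  have Q: "(Q*(Q*Q)*(Q*(Q*Q)*(Q*(Q*Q))))^2 = Q^8 * Q^10" for Q :: nat by algebra
  have "(\<Prod>i<10. card (X i)) = (q ^ n) ^ 6 * ?w ^ 4"
    by (simp add: X_def Dig_card Dig_un_card[OF n(1)] eval_nat_numeral lessThan_Suc mult_ac)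
  hence "card \<Omega> * ((q ^ n) ^ 6 * ?w ^ 4) \<le> (q ^ n) ^ 8 * (q ^ n) ^ 10"
    using \<Omega>(2) by (simp add: card_cartesian_product Dig_card Q)
  hence "card \<Omega> \<le> 2 ^ 4 * (q ^ n) ^ 8" by (intro cell_count[OF _ w, where a = 6]) simp
  hence "card \<Omega> \<le> 16 * q ^ (8*n)" by (simp add: power_mult[symmetric] mult.commute)
  thus ?thesis using \<Omega>(1) by blast
qed

section \<open>Cartan and Iwasawa decompositions\<close>

context dvf begin

lemma min_entry: assumes "finite S" "x \<in> S" "x \<noteq> 0"
  shows "\<exists>x\<in>S. x \<noteq> 0 \<and> (\<forall>y\<in>S. y \<in> P (v x))"
proof -
  let ?M = "v ` (S - {0})"
  have f: "finite ?M" "?M \<noteq> {}" using assms by auto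
  obtain y where y: "y \<in> S - {0}" "v y = Min ?M" using Min_in[OF f] by (metis imageE)
  have "z \<in> P (v y)" if "z \<in> S" for z using Min_le[OF f(1), of "v z"] that y(2) by (cases "z = 0") (auto simp: P_def)
  thus ?thesis using y(1) by blast
qed

lemma pw_unit: assumes "x \<noteq> 0" obtains u where "u \<in> un" "x = pw (v x) * u"
proof (rule that[of "x / pw (v x)"])
  show "x / pw (v x) \<in> un" using assms by (simp add: un_def v_divide)
  show "x = pw (v x) * (x / pw (v x))" by simp
qed

abbreviation "K2 \<equiv> G2 \<inter> Kmax v"
lemma subgrp_K2: "subgrp K2" by (rule subgrp_Int[OF subgrp_patterns(3) subgrp_Kmax])

lemma K2_I: assumes "a \<in> P 0" "b \<in> P 0" "c \<in> P 0" "d \<in> P 0" "a*d - b*c \<in> un" shows "mat3 a b 0 c d 0 0 0 1 \<in> K2"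
proof -
  have "det (mat3 a b 0 c d 0 0 0 1) = a*d - b*c" by (simp add: mat3_det)
  thus ?thesis using assms un_nz[OF assms(5)] G2_I[of a d b c] unfolding Int_iff Kmax_iff intm_mat3 by simp
qed

text \<open>\<open>w2\<close> and \<open>w3\<close> are permutation matrices that bring a chosen
  entry to the pivot position: the lower right corner of the 2 by 2 block, or of the whole
  matrix.\<close>

definition w2 :: "bool \<Rightarrow> 'f ^ 3 ^ 3" where "w2 s = (if s then mat3 0 1 0 1 0 0 0 0 1 else mat3 1 0 0 0 1 0 0 0 1)"
definition w3 :: "3 \<Rightarrow> 'f ^ 3 ^ 3" where
  "w3 j = (if j = 1 then mat3 0 0 1 0 1 0 1 0 0 else if j = 2 then mat3 1 0 0 0 0 1 0 1 0 else mat3 1 0 0 0 1 0 0 0 1)"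

lemma w2_K2: "w2 s \<in> K2" by (cases s) (simp_all add: w2_def K2_I del: Int_iff)
lemma w2_sq: "w2 s ** w2 s = mat 1" by (simp add: w2_def mat3_mult mat3_1)
lemma w3_Kmax: "w3 j \<in> Kmax v" by (simp add: w3_def Kmax_iff intm_mat3 mat3_det)
lemma w3_sq: "w3 j ** w3 j = mat 1" by (simp add: w3_def mat3_mult mat3_1)
lemma w3_col: "(g ** w3 j)$i$3 = g$i$j" and w3_row: "(w3 i ** g)$3$j = g$i$j"
  using exhaust_3[of i] exhaust_3[of j] by (auto simp: w3_def mat_mult_nth)
lemma w3_entry: "\<exists>k. (g ** w3 j)$i$l = g$i$k" "\<exists>k. (w3 i ** g)$l$j = g$k$j"
  using exhaust_3[of i] exhaust_3[of j] exhaust_3[of l] by (auto simp: w3_def mat_mult_nth)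

text \<open>An entry of least valuation is moved to the lower right of the block, where its row and
  column can be cleared integrally. The diagonal valuations come out ordered because all entries
  stay divisible by the pivot. The (3,3) entry is left untouched.\<close>

lemma cartan2: assumes g: "g \<in> LG"
  shows "\<exists>k1\<in>K2. \<exists>k2\<in>K2. \<exists>x y. y \<le> x \<and> g = k1 ** (mat3 (pw x) 0 0 0 (pw y) 0 0 0 (g$3$3) ** k2)"
proof -
  obtain a b c d e where G: "g = mat3 a b 0 c d 0 0 0 e" "a*d - b*c \<noteq> 0" "e \<noteq> 0" by (rule LG_E[OF g])
  have A: "\<exists>k1\<in>K2. \<exists>k2\<in>K2. \<exists>x y. y \<le> x \<and> mat3 a b 0 c d 0 0 0 e = k1 ** (mat3 (pw x) 0 0 0 (pw y) 0 0 0 e ** k2)"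
    if D: "a*d - b*c \<noteq> 0" and d: "d \<noteq> 0" "a \<in> P (v d)" "b \<in> P (v d)" "c \<in> P (v d)" for a b c d
  proof -
    define \<alpha> where "\<alpha> = a - b*(c/d)"
    have bd: "b/d \<in> P 0" "c/d \<in> P 0" by (rule P_divide[OF d(3) d(1)] P_divide[OF d(4) d(1)], simp)+
    have "b*(c/d) \<in> P (v d)" by (rule P_mult'[OF d(3) bd(2)]) simp
    hence \<alpha>: "\<alpha> \<in> P (v d)" unfolding \<alpha>_def by (rule P_diff[OF d(2)])
    have "\<alpha> * d = a*d - b*c" using d(1) by (simp add: \<alpha>_def field_simps)
    hence \<alpha>0: "\<alpha> \<noteq> 0" using D by auto
    obtain \<mu> where \<mu>: "\<mu> \<in> un" "\<alpha> = pw (v \<alpha>) * \<mu>" by (rule pw_unit[OF \<alpha>0])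
    obtain \<nu> where \<nu>: "\<nu> \<in> un" "d = pw (v d) * \<nu>" by (rule pw_unit[OF d(1)])
    have k1: "mat3 1 (b/d) 0 0 1 0 0 0 1 \<in> K2" by (rule K2_I) (use bd in simp_all)
    have "\<nu>*(c/d) \<in> P 0" using P_mult[OF un_P[OF \<nu>(1)] bd(2)] by simp
    hence k2: "mat3 \<mu> 0 0 (\<nu>*(c/d)) \<nu> 0 0 0 1 \<in> K2"
      by (intro K2_I) (use un_P[OF \<mu>(1)] un_P[OF \<nu>(1)] un_mult[OF \<mu>(1) \<nu>(1)] in simp_all)
    have "pw (v d) * (\<nu>*(c/d)) = c" using \<nu>(2)[symmetric] d(1) by (simp add: mult.assoc[symmetric])
    hence "mat3 (pw (v \<alpha>)) 0 0 0 (pw (v d)) 0 0 0 e ** mat3 \<mu> 0 0 (\<nu>*(c/d)) \<nu> 0 0 0 1 = mat3 \<alpha> 0 0 c d 0 0 0 e"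
      unfolding mat3_mult mat3_eq using \<mu>(2) \<nu>(2) by simp
    hence "mat3 a b 0 c d 0 0 0 e = mat3 1 (b/d) 0 0 1 0 0 0 1 ** (mat3 (pw (v \<alpha>)) 0 0 0 (pw (v d)) 0 0 0 e ** mat3 \<mu> 0 0 (\<nu>*(c/d)) \<nu> 0 0 0 1)"
      unfolding mat3_mult mat3_eq using d(1) by (simp add: \<alpha>_def)
    moreover have "v d \<le> v \<alpha>" using \<alpha> \<alpha>0 by (simp add: P_def)
    ultimately show ?thesis using k1 k2 by blast
  qed
  have fs: "finite {a,b,c,d}" by simp
  have "\<exists>x0\<in>{a,b,c,d}. x0 \<noteq> 0" using G(2) by auto
  then obtain x0 where "x0 \<in> {a,b,c,d}" "x0 \<noteq> 0" by blast
  from min_entry[OF fs this] obtain x where x: "x \<in> {a,b,c,d}" "x \<noteq> 0" "\<forall>y\<in>{a,b,c,d}. y \<in> P (v x)" by blast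
  have "\<exists>s t a' b' c' d'. w2 s ** (g ** w2 t) = mat3 a' b' 0 c' d' 0 0 0 e \<and> a'*d' - b'*c' \<noteq> 0 \<and> d' \<noteq> 0 \<and> a' \<in> P (v d') \<and> b' \<in> P (v d') \<and> c' \<in> P (v d')"
  proof -
    have D: "b*c - a*d \<noteq> 0" "c*b - d*a \<noteq> 0" "d*a - c*b \<noteq> 0" using G(2) by (auto simp: mult.commute)
    consider "x = d" | "x = c" | "x = b" | "x = a" using x(1) by blast
    thus ?thesis
    proof cases
      case 1 thus ?thesis using x(2,3) G by (intro exI[of _ False]) (simp add: w2_def mat3_mult mat3_eq)
    next
      case 2 thus ?thesis using x(2,3) G D by (intro exI[of _ False] exI[of _ True]) (simp add: w2_def mat3_mult mat3_eq)
    next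
      case 3 thus ?thesis using x(2,3) G D by (intro exI[of _ True] exI[of _ False]) (simp add: w2_def mat3_mult mat3_eq)
    next
      case 4 thus ?thesis using x(2,3) G D by (intro exI[of _ True]) (simp add: w2_def mat3_mult mat3_eq)
    qed
  qed
  then obtain s t a' b' c' d' where h: "w2 s ** (g ** w2 t) = mat3 a' b' 0 c' d' 0 0 0 e" "a'*d' - b'*c' \<noteq> 0" "d' \<noteq> 0"
    "a' \<in> P (v d')" "b' \<in> P (v d')" "c' \<in> P (v d')" by blast
  from A[OF h(2-6)] obtain k1 k2 x y where k: "k1 \<in> K2" "k2 \<in> K2" "y \<le> x" "w2 s ** (g ** w2 t) = k1 ** (mat3 (pw x) 0 0 0 (pw y) 0 0 0 e ** k2)"
    unfolding h(1) by blast
  have "g = w2 s ** ((w2 s ** (g ** w2 t)) ** w2 t)" by (simp add: matrix_mul_assoc w2_sq) (simp add: matrix_mul_assoc[symmetric] w2_sq)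
  also have "\<dots> = (w2 s ** k1) ** (mat3 (pw x) 0 0 0 (pw y) 0 0 0 e ** (k2 ** w2 t))" unfolding k(4) by (simp add: matrix_mul_assoc)
  finally have "g = (w2 s ** k1) ** (mat3 (pw x) 0 0 0 (pw y) 0 0 0 e ** (k2 ** w2 t))" .
  moreover have "w2 s ** k1 \<in> K2" "k2 ** w2 t \<in> K2" by (rule subgrp_D(3)[OF subgrp_K2 w2_K2 k(1)] subgrp_D(3)[OF subgrp_K2 k(2) w2_K2])+
  moreover have "g$3$3 = e" by (simp add: G(1))
  ultimately show ?thesis using k(3) by metis
qed

text \<open>Pivoting on an entry of least valuation splits off the last coordinate;
  \<open>cartan2\<close> treats the remaining block.\<close>

lemma cartan3: assumes "g \<in> GL3"
  shows "\<exists>k1\<in>Kmax v. \<exists>k2\<in>Kmax v. \<exists>x y z. z \<le> y \<and> y \<le> x \<and> g = k1 ** (mat3 (pw x) 0 0 0 (pw y) 0 0 0 (pw z) ** k2)"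
proof -
  note KM = subgrp_D(3)[OF subgrp_Kmax]
  have "finite (range (\<lambda>(i, j). g$i$j))" by simp
  moreover have "\<exists>i j. g$i$j \<noteq> 0"
  proof (rule ccontr)
    assume "\<not> ?thesis"
    hence "det g = 0" by (simp add: det_3)
    thus False using assms by (simp add: GL3_def)
  qed
  then obtain i0 j0 where "g$i0$j0 \<in> range (\<lambda>(i, j). g$i$j)" "g$i0$j0 \<noteq> 0" by (metis (mono_tags) case_prod_conv rangeI)
  ultimately obtain m where "m \<in> range (\<lambda>(i, j). g$i$j)" "m \<noteq> 0" "\<forall>y\<in>range (\<lambda>(i, j). g$i$j). y \<in> P (v m)"
    using min_entry by meson
  then obtain i j where m: "m = g$i$j" "m \<noteq> 0" "\<And>k l. g$k$l \<in> P (v m)" by fastforce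
  define h where "h = w3 i ** (g ** w3 j)"
  have hP: "h$k$l \<in> P (v m)" for k l using w3_entry(1)[of g j] w3_entry(2)[of i "g ** w3 j" k l] m(3) by (metis h_def)
  have h33: "h$3$3 = m" by (simp add: h_def w3_row w3_col m(1))
  obtain a b c d e f g' h' p where H: "h = mat3 a b c d e f g' h' p" by (rule mat3_cases)
  have p: "p = m" "p \<noteq> 0" using h33 m(2) by (simp_all add: H)
  have o: "a \<in> P (v p)" "b \<in> P (v p)" "c \<in> P (v p)" "d \<in> P (v p)" "e \<in> P (v p)" "f \<in> P (v p)" "g' \<in> P (v p)" "h' \<in> P (v p)"
    using hP[of 1 1] hP[of 1 2] hP[of 1 3] hP[of 2 1] hP[of 2 2] hP[of 2 3] hP[of 3 1] hP[of 3 2] by (simp_all add: H p(1))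
  have q: "c/p \<in> P 0" "f/p \<in> P 0" "g'/p \<in> P 0" "h'/p \<in> P 0"
    using P_divide[OF o(3) p(2), of 0] P_divide[OF o(6) p(2), of 0] P_divide[OF o(7) p(2), of 0] P_divide[OF o(8) p(2), of 0] by simp_all
  define N where "N = mat3 (a - c*(g'/p)) (b - c*(h'/p)) 0 (d - f*(g'/p)) (e - f*(h'/p)) 0 0 0 p"
  define ku kl where "ku = mat3 1 0 (c/p) 0 1 (f/p) 0 0 1" and "kl = mat3 1 0 0 0 1 0 (g'/p) (h'/p) 1"
  have ku: "ku \<in> Kmax v" "kl \<in> Kmax v" unfolding ku_def kl_def Kmax_iff intm_mat3 using q by (simp_all add: mat3_det)
  have "c*(g'/p) \<in> P (v p)" "c*(h'/p) \<in> P (v p)" "f*(g'/p) \<in> P (v p)" "f*(h'/p) \<in> P (v p)"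
    using P_mult[OF o(3) q(3)] P_mult[OF o(3) q(4)] P_mult[OF o(6) q(3)] P_mult[OF o(6) q(4)] by simp_all
  moreover have "p \<in> P (v p)" by (simp add: P_def)
  ultimately have NP: "N \<in> intm (v p)" unfolding N_def intm_mat3 using o by (simp add: P_diff)
  have e: "h = ku ** (N ** kl)" unfolding H N_def ku_def kl_def mat3_mult mat3_eq using p(2) by simp
  have "det h \<noteq> 0" using assms Kmax_GL3[OF w3_Kmax] by (simp add: h_def det_mul GL3_def)
  hence "det N \<noteq> 0" unfolding e det_mul by auto
  hence "N \<in> LG" by (simp add: N_def LG_def P3_def GL3_def)
  from cartan2[OF this] obtain k1 k2 x y where k: "k1 \<in> K2" "k2 \<in> K2" "y \<le> x" "N = k1 ** (mat3 (pw x) 0 0 0 (pw y) 0 0 0 p ** k2)"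
    by (auto simp: N_def)
  have kK: "k1 \<in> Kmax v" "k2 \<in> Kmax v" using k(1,2) by auto
  \<comment> \<open>The entries of \<open>N\<close> stay divisible by the pivot \<open>p\<close>, a
    property kept by integral factors; so the block contributes diagonal valuations of at least
    \<open>v p\<close>.\<close>
  have "inv3 k1 ** (N ** inv3 k2) = mat3 (pw x) 0 0 0 (pw y) 0 0 0 p"
    unfolding k(4) using GL3_inv1(1)[OF Kmax_GL3[OF kK(2)]] by (simp add: matrix_mul_assoc[symmetric] GL3_cancel(1)[OF Kmax_GL3[OF kK(1)]])
  moreover have "inv3 k1 ** (N ** inv3 k2) \<in> intm (0 + (v p + 0))"
    using Kmax_inv[OF kK(1)] Kmax_inv[OF kK(2)] NP unfolding Kmax_iff by (intro intm_mult) auto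
  ultimately have vy: "v p \<le> y" by (simp add: intm_mat3)
  obtain \<nu> where \<nu>: "\<nu> \<in> un" "p = pw (v p) * \<nu>" by (rule pw_unit[OF p(2)])
  let ?n = "mat3 1 0 0 0 1 0 0 0 \<nu>"
  have nK: "?n \<in> Kmax v" using \<nu>(1) un_P unfolding Kmax_iff intm_mat3 by (simp add: mat3_det)
  have d: "mat3 (pw x) 0 0 0 (pw y) 0 0 0 p = mat3 (pw x) 0 0 0 (pw y) 0 0 0 (pw (v p)) ** ?n"
    unfolding mat3_mult mat3_eq using \<nu>(2) by simp
  have "g = w3 i ** (h ** w3 j)" unfolding h_def by (simp add: matrix_mul_assoc w3_sq) (simp add: matrix_mul_assoc[symmetric] w3_sq)
  also have "\<dots> = (w3 i ** (ku ** k1)) ** (mat3 (pw x) 0 0 0 (pw y) 0 0 0 (pw (v p)) ** (?n ** (k2 ** (kl ** w3 j))))"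
    unfolding e k(4) d by (simp add: matrix_mul_assoc)
  finally have "g = (w3 i ** (ku ** k1)) ** (mat3 (pw x) 0 0 0 (pw y) 0 0 0 (pw (v p)) ** (?n ** (k2 ** (kl ** w3 j))))" .
  moreover have "w3 i ** (ku ** k1) \<in> Kmax v" "?n ** (k2 ** (kl ** w3 j)) \<in> Kmax v" by (intro KM ku w3_Kmax kK nK)+
  ultimately show ?thesis using vy k(3) by blast
qed

text \<open>Representatives for the bottom row up to scaling, that is, for the projective plane over
  the residue ring; \<open>j\<close> is the position of a coordinate made 1. Points with several
  unit coordinates occur more than once, so the count is 3 q^(2n).\<close>

definition R3 :: "nat \<Rightarrow> ('f ^ 3 ^ 3) set" where
  "R3 n = (\<lambda>(x, y, j). mat3 1 0 0 0 1 0 x y 1 ** w3 j) ` (Dig n \<times> Dig n \<times> UNIV)"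
definition R2 :: "nat \<Rightarrow> ('f ^ 3 ^ 3) set" where
  "R2 n = (\<lambda>(x, s). mat3 1 0 0 x 1 0 0 0 1 ** w2 s) ` (Dig n \<times> UNIV)"

lemma R3: "finite (R3 n)" "card (R3 n) \<le> 3 * q ^ (2*n)" "R3 n \<subseteq> Kmax v"
proof -
  have f: "finite (Dig n \<times> Dig n \<times> (UNIV::3 set))" by (simp add: Dig_finite)
  show "finite (R3 n)" unfolding R3_def using f by blast
  have "card (Dig n \<times> Dig n \<times> (UNIV::3 set)) = 3 * q ^ (2*n)" by (simp add: card_cartesian_product Dig_card mult_2 power_add)
  thus "card (R3 n) \<le> 3 * q ^ (2*n)" using card_image_le[OF f] unfolding R3_def by metis
  have "mat3 1 0 0 0 1 0 x y 1 \<in> Kmax v" if "x \<in> Dig n" "y \<in> Dig n" for x y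
    using Dig_P that unfolding Kmax_iff intm_mat3 by (simp add: mat3_det)
  thus "R3 n \<subseteq> Kmax v" unfolding R3_def using subgrp_D(3)[OF subgrp_Kmax _ w3_Kmax] by auto
qed

lemma R2: "finite (R2 n)" "card (R2 n) \<le> 2 * q ^ n" "R2 n \<subseteq> K2"
proof -
  have f: "finite (Dig n \<times> (UNIV::bool set))" by (simp add: Dig_finite)
  show "finite (R2 n)" unfolding R2_def using f by blast
  have "card (Dig n \<times> (UNIV::bool set)) = 2 * q ^ n" by (simp add: card_cartesian_product Dig_card)
  thus "card (R2 n) \<le> 2 * q ^ n" using card_image_le[OF f] unfolding R2_def by metis
  have "mat3 1 0 0 x 1 0 0 0 1 \<in> K2" if "x \<in> Dig n" for x by (rule K2_I) (use Dig_P[OF that] in simp_all)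
  thus "R2 n \<subseteq> K2" unfolding R2_def using subgrp_D(3)[OF subgrp_K2 _ w2_K2] by auto
qed

text \<open>Dividing the bottom row by an entry of least valuation makes it integral with one entry
  1. Reducing the other two entries to digits costs a factor in \<open>Kc n\<close>, and the rest
  lies in the parabolic subgroup.\<close>

lemma iwasawa3: assumes n: "1 \<le> n" and g: "g \<in> GL3"
  shows "\<exists>h u t r k. h \<in> LG \<and> u \<in> U2 t t \<and> r \<in> R3 n \<and> k \<in> Kc n \<and> g = h ** (u ** (r ** k))"
proof -
  have "\<exists>j. g$3$j \<noteq> 0"
  proof (rule ccontr)
    assume "\<not> ?thesis"
    hence "det g = 0" by (simp add: det_3)
    thus False using g by (simp add: GL3_def)
  qed
  then obtain j where j: "g$3$j \<noteq> 0" "\<And>k. g$3$k \<in> P (v (g$3$j))"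
    using min_entry[of "range (\<lambda>j. g$3$j)"] by fastforce
  obtain a b c d e f x y w where G: "g ** w3 j = mat3 a b c d e f x y w" by (rule mat3_cases)
  have w: "w = g$3$j" using w3_col[of g j 3] by (simp add: G)
  have xP: "(g ** w3 j)$3$l \<in> P (v w)" for l using w3_entry(1)[of g j 3 l] j(2) w by metis
  have w0: "w \<noteq> 0" using j(1) w by simp
  have q: "x/w \<in> P 0" "y/w \<in> P 0" using xP[of 1] xP[of 2] P_divide[OF _ w0, of _ "v w" 0] by (simp_all add: G)
  let ?L = "\<lambda>x y. mat3 1 0 0 0 1 0 x y 1 :: 'f ^ 3 ^ 3"
  define r where "r = ?L (red n (x/w)) (red n (y/w)) ** w3 j"
  have r: "r \<in> R3 n" unfolding r_def R3_def using red(1)[OF q(1), of n] red(1)[OF q(2), of n] by (auto intro!: image_eqI[of _ _ "(_, _, j)"])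
  have rK: "r \<in> Kmax v" using r R3(3) by blast
  define k where "k = inv3 r ** (?L (x/w) (y/w) ** w3 j)"
  have "(?L (x/w) (y/w) - ?L (red n (x/w)) (red n (y/w))) ** w3 j \<in> intm (int n + 0)"
    using w3_Kmax[of j] red(2)[OF q(1), of n] red(2)[OF q(2), of n] unfolding Kmax_iff by (intro intm_mult) (simp_all add: mat3_diff intm_mat3)
  hence k: "k \<in> Kc n" unfolding k_def r_def[symmetric] by (intro Kc_congI[OF rK]) (simp add: r_def mat_mult_diff)
  define p where "p = mat3 (a - c*(x/w)) (b - c*(y/w)) c (d - f*(x/w)) (e - f*(y/w)) f 0 0 w"
  have "g ** w3 j = p ** ?L (x/w) (y/w)" unfolding G p_def mat3_mult mat3_eq using w0 by simp
  hence "(g ** w3 j) ** w3 j = (p ** ?L (x/w) (y/w)) ** w3 j" by simp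
  hence gp: "g = p ** (r ** k)" unfolding k_def GL3_cancel(2)[OF Kmax_GL3[OF rK]] by (simp add: matrix_mul_assoc[symmetric] w3_sq)
  have "det g \<noteq> 0" using g by (simp add: GL3_def)
  hence "p \<in> P3" unfolding gp det_mul by (simp add: P3_def GL3_def) (simp add: p_def)
  then obtain p1 p2 p3 p4 p5 p6 w' where p: "p = mat3 p1 p2 p3 p4 p5 p6 0 0 w'" "p1*p5 - p2*p4 \<noteq> 0" "w' \<noteq> 0" by (rule P3_E)
  define E where "E = p1*p5 - p2*p4"
  have E: "E \<noteq> 0" using p(2) by (simp add: E_def)
  \<comment> \<open>Cramer's rule for the radical part of \<open>p\<close> after its Levi part is
    split off on the left.\<close>
  define s t where "s = (p3*p5 - p2*p6)/E" and "t = (p1*p6 - p4*p3)/E"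
  have "p1 * s + p2 * t = p3" "p4 * s + p5 * t = p6" unfolding s_def t_def
    using E by (simp_all add: divide_simps) (simp_all add: E_def algebra_simps)
  hence "p = mat3 p1 p2 0 p4 p5 0 0 0 w' ** mat3 1 0 s 0 1 t 0 0 1" unfolding p(1) mat3_mult mat3_eq by simp
  hence "g = mat3 p1 p2 0 p4 p5 0 0 0 w' ** (mat3 1 0 s 0 1 t 0 0 1 ** (r ** k))" unfolding gp by (simp add: matrix_mul_assoc)
  moreover have "mat3 p1 p2 0 p4 p5 0 0 0 w' \<in> LG" using p(2,3) by (rule LG_I)
  moreover have "mat3 1 0 s 0 1 t 0 0 1 \<in> U2 (min (v s) (v t)) (min (v s) (v t))" by (rule U2_I) (simp_all add: P_def)
  ultimately show ?thesis using r k by blast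
qed

lemma iwasawa2: assumes n: "1 \<le> n" and g: "g \<in> LG"
  shows "\<exists>h u t r k. h \<in> T3 \<and> u \<in> Xp f12 t \<and> r \<in> R2 n \<and> k \<in> LG \<inter> Kc n \<and> g = h ** (u ** (r ** k))"
proof -
  note LM = subgrp_D(3)[OF subgrp_patterns(2)] and LI = subgrp_D(4)[OF subgrp_patterns(2)]
  obtain a b c d e where G: "g = mat3 a b 0 c d 0 0 0 e" "a*d - b*c \<noteq> 0" "e \<noteq> 0" by (rule LG_E[OF g])
  have "c \<noteq> 0 \<or> d \<noteq> 0" using G(2) by auto
  hence "\<exists>s x w. (g ** w2 s)$2$1 = x \<and> (g ** w2 s)$2$2 = w \<and> w \<noteq> 0 \<and> x \<in> P (v w)"
    using linear[of "v c" "v d"] by (cases "c = 0 \<or> (d \<noteq> 0 \<and> v d \<le> v c)") (auto simp: G(1) w2_def mat_mult_nth P_def intro: exI[of _ False] exI[of _ True])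
  then obtain s x w where s: "(g ** w2 s)$2$1 = x" "(g ** w2 s)$2$2 = w" "w \<noteq> 0" "x \<in> P (v w)" by blast
  have wL: "w2 s \<in> LG" "w2 s \<in> Kmax v" using w2_K2 G2_LG by blast+
  obtain a' b' c' d' e' where G': "g ** w2 s = mat3 a' b' 0 c' d' 0 0 0 e'" "a'*d' - b'*c' \<noteq> 0" "e' \<noteq> 0" by (rule LG_E[OF LM[OF g wL(1)]])
  have xw: "c' = x" "d' = w" using s(1,2) by (simp_all add: G'(1))
  have q: "x/w \<in> P 0" using P_divide[OF s(4,3)] by simp
  let ?L = "\<lambda>x. mat3 1 0 0 x 1 0 0 0 1 :: 'f ^ 3 ^ 3"
  have L: "?L x \<in> LG" for x by (rule LG_I) simp_all
  define r where "r = ?L (red n (x/w)) ** w2 s"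
  have r: "r \<in> R2 n" unfolding r_def R2_def using red(1)[OF q, of n] by (auto intro!: image_eqI[of _ _ "(_, s)"])
  have rK: "r \<in> Kmax v" "r \<in> LG" using r R2(3) G2_LG by blast+
  define k where "k = inv3 r ** (?L (x/w) ** w2 s)"
  have "(?L (x/w) - ?L (red n (x/w))) ** w2 s \<in> intm (int n + 0)"
    using wL(2) red(2)[OF q, of n] unfolding Kmax_iff by (intro intm_mult) (simp_all add: mat3_diff intm_mat3)
  hence k: "k \<in> Kc n" "k \<in> LG" unfolding k_def by (intro Kc_congI[OF rK(1)], simp add: r_def mat_mult_diff, intro LM LI rK(2) L wL(1))
  have al: "(a' - b'*(x/w)) * w \<noteq> 0" using G'(2) s(3) unfolding xw by (simp add: field_simps)
  define al where "al = a' - b'*(x/w)"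
  have a0: "al \<noteq> 0" using al by (auto simp: al_def)
  have "mat3 al 0 0 0 w 0 0 0 e' ** f12 1 (b'/al) 0 1 = mat3 al b' 0 0 w 0 0 0 e'" unfolding f12_def mat3_mult mat3_eq using a0 by simp
  moreover have "g ** w2 s = mat3 al b' 0 0 w 0 0 0 e' ** ?L (x/w)" unfolding G'(1) xw mat3_mult mat3_eq using s(3) by (simp add: al_def)
  ultimately have "g ** w2 s = mat3 al 0 0 0 w 0 0 0 e' ** (f12 1 (b'/al) 0 1 ** ?L (x/w))" by (simp only: matrix_mul_assoc)
  hence "(g ** w2 s) ** w2 s = (mat3 al 0 0 0 w 0 0 0 e' ** (f12 1 (b'/al) 0 1 ** ?L (x/w))) ** w2 s" by simp
  hence "g = mat3 al 0 0 0 w 0 0 0 e' ** (f12 1 (b'/al) 0 1 ** (r ** k))"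
    unfolding k_def GL3_cancel(2)[OF Kmax_GL3[OF rK(1)]] by (simp add: matrix_mul_assoc[symmetric] w2_sq)
  moreover have "mat3 al 0 0 0 w 0 0 0 e' \<in> T3" using a0 s(3) G'(3) by (rule T3_I)
  moreover have "f12 1 (b'/al) 0 1 \<in> Xp f12 (v (b'/al))" by (simp add: Xp_def P_def)
  ultimately show ?thesis using r k by blast
qed

end

section \<open>Dimension bounds\<close>

context mrep begin

text \<open>Conjugation by \<open>a\<close> carries \<open>J\<close> into the level subgroup, so
  \<open>eK n\<close> after \<open>a\<close> does not distinguish a vector from its average over
  \<open>J\<close>.\<close>

lemma A_vanish:
  assumes n: "1 \<le> n" and a: "a \<in> G" and k: "k1 \<in> G \<inter> Kmax v" "k2 \<in> G \<inter> Kmax v" and x: "x \<in> VK n"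
    and J: "cpt J" "\<And>j. j \<in> J \<Longrightarrow> a ** j ** inv3 a \<in> Kc n" and z: "avg J (\<pi> k2 x) = 0"
  shows "A n (k1 ** (a ** k2)) x = 0"
proof -
  note xW = VK_W[OF x]
  have kG: "k1 \<in> G" "k2 \<in> G" "k1 \<in> Kmax v" "k2 \<in> Kmax v" using k by auto
  define y where "y = \<pi> k2 x"
  have yW: "y \<in> W" unfolding y_def by (rule pi_W[OF kG(2) xW])
  have l: "lin_on W (\<lambda>x. eK n (\<pi> a x))" by (rule lin_on_comp[OF eK_lin[OF n] pi_lin[OF a] pi_W[OF a]])
  have "(\<lambda>x. eK n (\<pi> a x)) (avg J y) = eK n (\<pi> a y)"
  proof (rule avg_const[OF J(1) yW l])
    fix j assume j: "j \<in> J"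
    have jG: "j \<in> G" using cptD(1)[OF J(1) j] .
    have cG: "a ** j ** inv3 a \<in> G" by (rule GD(3)[OF GD(3)[OF a jG] GD(4)[OF a]])
    have "\<pi> a (\<pi> j y) = \<pi> (a ** j ** inv3 a) (\<pi> a y)"
      by (rule pi_eq2[OF _ a jG cG a yW]) (use GL3_inv1(2)[OF GD(1)[OF a]] in \<open>simp add: matrix_mul_assoc[symmetric]\<close>)
    thus "eK n (\<pi> a (\<pi> j y)) = eK n (\<pi> a y)" using eK_pi[OF n cG J(2)[OF j] pi_W[OF a yW]] by simp
  qed
  moreover have "eK n (\<pi> a 0) = 0" using lin_on_0[OF l W] .
  ultimately have e: "eK n (\<pi> a y) = 0" using z by (simp add: y_def)
  have "A n (k1 ** (a ** k2)) x = eK n (\<pi> k1 (\<pi> a y))" unfolding A_def y_def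
    using pi_mult[OF kG(1) GD(3)[OF a kG(2)] xW] pi_mult[OF a kG(2) xW] by simp
  also have "\<dots> = \<pi> k1 (eK n (\<pi> a y))" by (rule eK_Kmax[OF n kG(1,3) pi_W[OF a yW], symmetric])
  finally show ?thesis using e pi_0[OF kG(1)] by simp
qed

text \<open>Every element is central, so a single representative suffices in
  \<open>burnside_count\<close>.\<close>

lemma abelian_dim:
  assumes n: "1 \<le> n" "irr n" "fd (VK n)" and c: "\<And>g h. g \<in> G \<Longrightarrow> h \<in> G \<Longrightarrow> g ** h = h ** g"
  shows "dim (VK n) \<le> 1"
proof -
  have "(dim (VK n))\<^sup>2 \<le> card {mat 1 :: 'f ^ 3 ^ 3}"
  proof (rule burnside_count[OF n])
    show "finite {mat 1 :: 'f ^ 3 ^ 3}" "{mat 1} \<subseteq> G" using GD(2) by auto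
    fix g assume g: "g \<in> G"
    have "sim n (g ** mat 1) (mat 1)" by (rule sim_central[OF n g _ GD(2)]) (use c[OF g] in blast)
    thus "(\<forall>x\<in>VK n. A n g x = 0) \<or> (\<exists>w\<in>{mat 1}. \<exists>c. \<forall>x\<in>VK n. A n g x = c \<odot> A n w x)" unfolding sim_def by auto
  qed
  thus ?thesis using power2_le_imp_le[of "dim (VK n)" 1] by simp
qed

lemma VK_fx: assumes "x \<in> VK n" "J \<subseteq> G" "J \<subseteq> Kc n" shows "x \<in> fx J"
  using assms fx_anti[of x "G \<inter> Kc n" J] unfolding VK_def by blast

lemma parab_LG:
  assumes GG: "G = LG"
  shows "parab v q smul G W \<pi> T3 B2 (Xp f12) (\<lambda>m. Xm f12 (int m)) (mat3 (pw 1) 0 0 0 1 0 0 0 1)"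
proof -
  let ?a = "mat3 (pw 1) 0 0 0 1 0 0 0 1 :: 'f ^ 3 ^ 3"
  have f12G: "f12 a b c d \<in> G" if "a*d - b*c = 1" for a b c d unfolding GG f12_def using that by (intro LG_I) simp_all
  show ?thesis
  proof (unfold_locales)
    show "subgrp T3" by (rule subgrp_patterns(5))
    show "T3 \<subseteq> G" using T3_LG GG by simp
    show "cpt (Xp f12 t)" for t by (rule cpt_Xp[OF sl2emb_f(1) f12G])
    show "Xp f12 t \<subseteq> Xp f12 s" if "s \<le> t" for s t by (rule Xp_mono[OF that])
    show "Xp f12 (int m) \<subseteq> Kc m" for m by (auto simp: Xp_def f12_def Kc_mat3)
    show "\<exists>s. inv3 h ** u ** h \<in> Xp f12 s" if h: "h \<in> T3" and u: "u \<in> Xp f12 t" for h u t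
    proof -
      obtain a b c where H: "h = mat3 a 0 0 0 b 0 0 0 c" "a \<noteq> 0" "b \<noteq> 0" "c \<noteq> 0" by (rule T3_E[OF h])
      obtain r where r: "u = f12 1 r 0 1" using u by (auto simp: Xp_def)
      have "inv3 h ** u ** h = f12 1 (r*b/a) 0 1" unfolding r H(1) f12_def using H(2-) by (simp add: diag_conj)
      moreover have "f12 1 (r*b/a) 0 1 \<in> Xp f12 (v (r*b/a))" by (auto simp: Xp_def P_def)
      ultimately show ?thesis by auto
    qed
    show "subgrp B2" by (rule subgrp_patterns(4))
    show "B2 \<subseteq> G" using B2_LG GG by simp
    show "?a \<in> T3" by (rule T3_I) simp_all
    show "?a ** h = h ** ?a" if "h \<in> T3" for h
      by (rule T3_E[OF that]) (simp add: mat3_mult mat3_eq mult.commute)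
    show "?a ** u ** inv3 ?a \<in> Xp f12 (t + 1)" if "u \<in> Xp f12 t" for u t
      using that by (auto simp: Xp_def f12_def diag_conj pw_mult_P intro!: imageI)
    show "inv3 ?a ** u ** ?a \<in> Xp f12 t" if "u \<in> Xp f12 (t + 1)" for u t
      using that by (auto simp: Xp_def f12_def diag_conj pw_divide_P intro!: imageI)
    show "?a ** b ** inv3 ?a \<in> Kc m" if "b \<in> B2" "b \<in> Kc m" for b m
      using that(2) by (rule_tac B2_E[OF that(1)]) (auto simp: Kc_mat3 diag_conj pw_mult_P elim: P_mono)
    show "\<exists>b\<in>B2 \<inter> Kc m. \<exists>w\<in>Xm f12 (int m). g = b ** w" if m: "1 \<le> m" and g: "g \<in> G" "g \<in> Kc m" for m g
    proof -
      have gL: "g \<in> LG" using g(1) GG by simp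
      obtain a b c d e where X: "g = mat3 a b 0 c d 0 0 0 e" "a*d - b*c \<noteq> 0" "e \<noteq> 0" by (rule LG_E[OF gL])
      have k: "a \<in> O1 (int m)" "d \<in> O1 (int m)" "e \<in> O1 (int m)" "b \<in> P (int m)" "c \<in> P (int m)" using g(2) unfolding X(1) Kc_mat3 by auto
      have m': "1 \<le> int m" using m by simp
      have du: "d \<in> un" using O1_un[OF k(2) m'] .
      note d0 = un_nz[OF du]
      have cd: "c/d \<in> P (int m)" using k(5) P_divide_un[OF du] by simp
      have bc: "b*(c/d) \<in> P (int m)" by (rule P_mult'[OF k(4) cd]) simp
      have aO: "a - b*(c/d) \<in> O1 (int m)" by (rule O1_addP(2)[OF k(1) bc])
      let ?b = "mat3 (a - b*(c/d)) b 0 0 d 0 0 0 e"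
      have "g = ?b ** f12 1 0 (c/d) 1"
        unfolding X(1) f12_def mat3_mult mat3_eq using d0 by simp
      moreover have "?b \<in> B2" using un_nz[OF O1_un[OF aO m']] d0 X(3) by (intro B2_I)
      moreover have "?b \<in> Kc m" unfolding Kc_mat3 using aO k by simp
      moreover have "f12 1 0 (c/d) 1 \<in> Xm f12 (int m)" using cd by (auto simp: Xm_def)
      ultimately show ?thesis by blast
    qed
    show "Xm f12 (int m) \<subseteq> G \<inter> Kc m" for m using f12G by (auto simp: Xm_def) (auto simp: f12_def Kc_mat3)
    show "Xm f12 (int (Suc m)) \<subseteq> Xm f12 (int m)" for m by (rule Xm_mono) simp
    show "inv3 ?a ** w ** ?a \<in> Xm f12 (int (Suc m))" if "w \<in> Xm f12 (int m)" for w m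
      using that by (auto simp: Xm_def f12_def diag_conj pw_mult_P intro!: imageI)
    show "\<exists>u\<in>Xp f12 (int m). \<exists>h\<in>T3 \<inter> Kc m. b = u ** h" if m: "1 \<le> m" and b: "b \<in> B2" "b \<in> Kc m" for m b
    proof -
      obtain x y z w where B: "b = mat3 x y 0 0 z 0 0 0 w" "x \<noteq> 0" "z \<noteq> 0" "w \<noteq> 0" by (rule B2_E[OF b(1)])
      have k: "x \<in> O1 (int m)" "z \<in> O1 (int m)" "w \<in> O1 (int m)" "y \<in> P (int m)" using b(2) unfolding B(1) Kc_mat3 by auto
      have zu: "z \<in> un" using O1_un[OF k(2)] m by simp
      have "b = f12 1 (y/z) 0 1 ** mat3 x 0 0 0 z 0 0 0 w" unfolding B(1) f12_def mat3_mult mat3_eq using B(3) by simp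
      moreover have "mat3 x 0 0 0 z 0 0 0 w \<in> T3" using B(2-) by (intro T3_I)
      moreover have "mat3 x 0 0 0 z 0 0 0 w \<in> Kc m" unfolding Kc_mat3 using k by simp
      moreover have "f12 1 (y/z) 0 1 \<in> Xp f12 (int m)" using k(4) P_divide_un[OF zu] by (auto simp: Xp_def)
      ultimately show ?thesis by blast
    qed
  qed
qed

end

lemma (in gl3) parab_GL3: "parab v q smul G W \<pi> LG P3 (\<lambda>t. U2 t t) (\<lambda>m. Ub (int m)) (mat3 (pw 1) 0 0 0 (pw 1) 0 0 0 1)"
proof -
  let ?a = "mat3 (pw 1) 0 0 0 (pw 1) 0 0 0 1 :: 'f ^ 3 ^ 3"
  have LGG: "LG \<subseteq> G" using subgrp_D(1)[OF subgrp_patterns(2)] GG by blast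
  show ?thesis
  proof (unfold_locales)
    show "subgrp LG" by (rule subgrp_patterns(2))
    show "LG \<subseteq> G" by (rule LGG)
    show "cpt (U2 t t)" for t by (rule cpt_U2)
    show "U2 t t \<subseteq> U2 s s" if "s \<le> t" for s t by (rule U2_mono[OF that that])
    show "U2 (int m) (int m) \<subseteq> Kc m" for m by (auto simp: Kc_mat3 elim!: U2_E)
    show "\<exists>s. inv3 h ** u ** h \<in> U2 s s" if h: "h \<in> LG" and u: "u \<in> U2 t t" for h u t
    proof -
      obtain a b c d e where H: "h = mat3 a b 0 c d 0 0 0 e" "a*d - b*c \<noteq> 0" "e \<noteq> 0" by (rule LG_E[OF h])
      obtain s r where r: "u = mat3 1 0 s 0 1 r 0 0 1" by (rule U2_E[OF u])
      define D where "D = a*d - b*c"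
      have D: "D \<noteq> 0" using H(2) by (simp add: D_def)
      define s' r' where "s' = e*(d * s - b*r)/D" and "r' = e*(a*r - c * s)/D"
      have "a * s' + b*r' = s * e" "c * s' + d*r' = r*e" unfolding s'_def r'_def
        using D by (simp_all add: divide_simps) (simp_all add: D_def algebra_simps)
      hence "u ** h = h ** mat3 1 0 s' 0 1 r' 0 0 1" unfolding r H(1) mat3_mult mat3_eq by simp
      hence "inv3 h ** u ** h = mat3 1 0 s' 0 1 r' 0 0 1"
        using GL3_cancel(1)[OF GD(1)[OF subsetD[OF LGG h]]] by (simp add: matrix_mul_assoc[symmetric])
      moreover have "mat3 1 0 s' 0 1 r' 0 0 1 \<in> U2 (min (v s') (v r')) (min (v s') (v r'))" by (rule U2_I) (simp_all add: P_def)
      ultimately show ?thesis by auto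
    qed
    show "subgrp P3" by (rule subgrp_patterns(1))
    show "P3 \<subseteq> G" using GG by (auto simp: P3_def)
    show "?a \<in> LG" by (rule LG_I) simp_all
    show "?a ** h = h ** ?a" if "h \<in> LG" for h
      by (rule LG_E[OF that]) (simp add: mat3_mult mat3_eq mult.commute)
    show "?a ** u ** inv3 ?a \<in> U2 (t + 1) (t + 1)" if "u \<in> U2 t t" for u t
      by (rule U2_E[OF that]) (simp add: diag_conj U2_I pw_mult_P)
    show "inv3 ?a ** u ** ?a \<in> U2 t t" if "u \<in> U2 (t + 1) (t + 1)" for u t
      by (rule U2_E[OF that]) (simp add: diag_conj U2_I pw_divide_P)
    show "?a ** b ** inv3 ?a \<in> Kc m" if "b \<in> P3" "b \<in> Kc m" for b m
      using that(2) by (rule_tac P3_E[OF that(1)]) (auto simp: Kc_mat3 diag_conj pw_mult_P elim: P_mono)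
    show "\<exists>b\<in>P3 \<inter> Kc m. \<exists>w\<in>Ub (int m). g = b ** w" if m: "1 \<le> m" and g: "g \<in> G" "g \<in> Kc m" for m g
    proof -
      obtain a b c d e f x y i where X: "g = mat3 a b c d e f x y i" by (rule mat3_cases)
      have k: "a \<in> O1 (int m)" "e \<in> O1 (int m)" "i \<in> O1 (int m)" "b \<in> P (int m)" "c \<in> P (int m)" "d \<in> P (int m)" "f \<in> P (int m)"
        "x \<in> P (int m)" "y \<in> P (int m)" using g(2) unfolding X Kc_mat3 by auto
      have iu: "i \<in> un" using O1_un[OF k(3)] m by simp
      have xi: "x/i \<in> P (int m)" "y/i \<in> P (int m)" using k P_divide_un[OF iu] by simp_all
      have pr: "c*(x/i) \<in> P (int m)" "c*(y/i) \<in> P (int m)" "f*(x/i) \<in> P (int m)" "f*(y/i) \<in> P (int m)"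
        using P_mult'[OF k(5) xi(1)] P_mult'[OF k(5) xi(2)] P_mult'[OF k(7) xi(1)] P_mult'[OF k(7) xi(2)] by simp_all
      let ?b = "mat3 (a - c*(x/i)) (b - c*(y/i)) c (d - f*(x/i)) (e - f*(y/i)) f 0 0 i"
      have "g = ?b ** mat3 1 0 0 0 1 0 (x/i) (y/i) 1"
        unfolding X mat3_mult mat3_eq using un_nz[OF iu] by simp
      moreover have b: "?b \<in> Kc m" unfolding Kc_mat3 using O1_addP(2)[OF k(1) pr(1)] O1_addP(2)[OF k(2) pr(4)] P_diff[OF k(4) pr(2)] P_diff[OF k(6) pr(3)] k by simp
      moreover have "?b \<in> P3" using Kmax_GL3[OF Kc_Kmax[OF m b]] by (simp add: P3_def)
      moreover have "mat3 1 0 0 0 1 0 (x/i) (y/i) 1 \<in> Ub (int m)" using xi by (rule Ub_I)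
      ultimately show ?thesis by blast
    qed
    show "Ub (int m) \<subseteq> G \<inter> Kc m" for m by (auto simp: GG GL3_def mat3_det Kc_mat3 elim!: Ub_E)
    show "Ub (int (Suc m)) \<subseteq> Ub (int m)" for m by (auto elim!: Ub_E intro!: Ub_I intro: P_mono)
    show "inv3 ?a ** w ** ?a \<in> Ub (int (Suc m))" if "w \<in> Ub (int m)" for w m
      by (rule Ub_E[OF that]) (simp add: diag_conj Ub_I pw_mult_P)
    show "\<exists>u\<in>U2 (int m) (int m). \<exists>h\<in>LG \<inter> Kc m. b = u ** h" if m: "1 \<le> m" and b: "b \<in> P3" "b \<in> Kc m" for m b
    proof -
      obtain a b' c d e f i where B: "b = mat3 a b' c d e f 0 0 i" "a*e - b'*d \<noteq> 0" "i \<noteq> 0" by (rule P3_E[OF b(1)])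
      have k: "i \<in> O1 (int m)" "c \<in> P (int m)" "f \<in> P (int m)" using b(2) unfolding B(1) Kc_mat3 by auto
      have iu: "i \<in> un" using O1_un[OF k(1)] m by simp
      have "b = mat3 1 0 (c/i) 0 1 (f/i) 0 0 1 ** mat3 a b' 0 d e 0 0 0 i" unfolding B(1) mat3_mult mat3_eq using B(3) by simp
      moreover have "mat3 a b' 0 d e 0 0 0 i \<in> LG" using B(2,3) by (rule LG_I)
      moreover have "mat3 a b' 0 d e 0 0 0 i \<in> Kc m" using b(2) unfolding B(1) Kc_mat3 by simp
      moreover have "mat3 1 0 (c/i) 0 1 (f/i) 0 0 1 \<in> U2 (int m) (int m)" using k(2,3) P_divide_un[OF iu] by (intro U2_I) simp_all
      ultimately show ?thesis by blast
    qed
  qed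
qed

context mrep begin

text \<open>The dichotomy one rank lower. With a vector whose averages never vanish, the abelian
  torus contributes dimension at most 1 and the bound is the number 2 q^n of Iwasawa
  representatives; otherwise only gaps below 2n - 1 contribute.\<close>

theorem LG_dim:
  assumes GG: "G = LG" and n: "1 \<le> n" "irr n" and fdV: "\<forall>m\<ge>1. fd (VK m)"
  shows "(dim (VK n))\<^sup>2 \<le> (2 * n - 1) * (4 * q ^ (4 * n))"
proof (cases "\<exists>x0\<in>W. \<forall>t. avg (Xp f12 t) x0 \<noteq> 0")
  case True
  then obtain x0 where x0: "x0 \<in> W" "\<And>t. avg (Xp f12 t) x0 \<noteq> 0" by blast
  interpret p: parab v q smul G W \<pi> T3 B2 "Xp f12" "\<lambda>m. Xm f12 (int m)" "mat3 (pw 1) 0 0 0 1 0 0 0 1" by (rule parab_LG[OF GG])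
  have RG: "R2 n \<subseteq> G \<inter> Kmax v" using R2(3) G2_LG GG by blast
  have "\<exists>Z. mrep v q scF T3 Z p.rho \<and> mrep.irr v scF T3 Z p.rho n \<and> (\<forall>m\<ge>1. cvs.fd scF (mrep.VK v T3 Z p.rho m)) \<and>
    dim (VK n) \<le> card (R2 n) * vector_space.dim scF (mrep.VK v T3 Z p.rho n)"
  proof (rule p.jacquet_bound[OF n _ x0 R2(1) RG])
    show "fd (VK m)" if "1 \<le> m" for m using fdV that by blast
    fix g assume "g \<in> G"
    hence "g \<in> LG" using GG by simp
    from iwasawa2[OF n(1) this] show "\<exists>h u t r k. h \<in> T3 \<and> u \<in> Xp f12 t \<and> r \<in> R2 n \<and> k \<in> Kc n \<and> g = h ** (u ** (r ** k))" by blast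
  qed
  then obtain Z where Z: "mrep v q scF T3 Z p.rho" "mrep.irr v scF T3 Z p.rho n" "\<forall>m\<ge>1. cvs.fd scF (mrep.VK v T3 Z p.rho m)"
    "dim (VK n) \<le> card (R2 n) * vector_space.dim scF (mrep.VK v T3 Z p.rho n)" by blast
  interpret z: mrep v q scF T3 Z p.rho by (rule Z(1))
  have "z.dim (z.VK n) \<le> 1"
  proof (rule z.abelian_dim[OF n(1) Z(2)])
    show "z.fd (z.VK n)" using Z(3) n(1) by blast
    fix g h :: "'f ^ 3 ^ 3" assume "g \<in> T3" "h \<in> T3"
    thus "g ** h = h ** g" by (elim T3_E) (simp add: mat3_mult mat3_eq mult.commute)
  qed
  hence "dim (VK n) \<le> card (R2 n) * 1" using Z(4) by (meson le_trans mult_le_mono2)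
  hence "dim (VK n) \<le> 2 * q ^ n" using R2(2)[of n] by simp
  hence "(dim (VK n))\<^sup>2 \<le> (2 * q ^ n)\<^sup>2" by (rule power_mono) simp
  also have "\<dots> = 1 * (4 * q ^ (2 * n))" by (simp add: power_mult_distrib power_mult[symmetric] mult.commute)
  also have "\<dots> \<le> (2 * n - 1) * (4 * q ^ (4 * n))"
    using n(1) q_ge2 by (intro mult_le_mono mult_le_mono2 power_increasing) auto
  finally show ?thesis .
next
  case False
  hence sc: "\<And>x. x \<in> W \<Longrightarrow> \<exists>t. avg (Xp f12 t) x = 0" by blast
  have f12G: "f12 a b c d \<in> G" if "a*d - b*c = 1" for a b c d unfolding GG f12_def using that by (intro LG_I) simp_all
  have fdn: "fd (VK n)" using fdV n(1) by blast
  have KG: "k \<in> G \<inter> Kmax v" if "k \<in> K2" for k using that G2_LG GG by blast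
  let ?a = "\<lambda>x. mat3 (pw x) 0 0 0 1 0 0 0 1 :: 'f ^ 3 ^ 3"
  have aG: "?a x \<in> G" for x unfolding GG by (rule LG_I) simp_all
  \<comment> \<open>Level n gives s = n, and conjugation by \<open>?a x\<close> asks for t = n - x;
    the condition s + t <= 1 of \<open>GL2_vanish\<close> becomes x >= 2n - 1.\<close>
  have van: "A n (k1 ** (?a x ** k2)) \<xi> = 0" if k: "k1 \<in> K2" "k2 \<in> K2" and x: "2 * int n - 1 \<le> x" and \<xi>: "\<xi> \<in> VK n" for k1 k2 x \<xi>
  proof (rule A_vanish[OF n(1) aG KG[OF k(1)] KG[OF k(2)] \<xi>])
    show "cpt (Xp f12 (int n - x))" by (rule cpt_Xp[OF sl2emb_f(1) f12G])
    show "?a x ** j ** inv3 (?a x) \<in> Kc n" if j: "j \<in> Xp f12 (int n - x)" for j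
    proof -
      obtain r where r: "r \<in> P (int n - x)" "j = f12 1 r 0 1" using j by (auto simp: Xp_def)
      have "?a x ** j ** inv3 (?a x) = mat3 1 (pw x * r) 0 0 1 0 0 0 1" unfolding r(2) f12_def by (simp add: diag_conj)
      thus ?thesis using r(1) by (simp add: Kc_mat3 pw_mult_P)
    qed
    have y: "\<pi> k2 \<xi> \<in> VK n" by (rule VK_Kmax[OF \<xi>]) (use KG[OF k(2)] in auto)
    have n1: "1 \<le> int n" using n(1) by simp
    show "avg (Xp f12 (int n - x)) (\<pi> k2 \<xi>) = 0"
    proof (rule GL2_vanish[OF sl2emb_f(1) f12G sc])
      show "\<pi> k2 \<xi> \<in> fx (Hh f12 (int n))"
      proof (rule VK_fx[OF y])
        show "Hh f12 (int n) \<subseteq> G" using cpt_Hh[OF sl2emb_f(1) f12G n1] by (simp add: cpt_def)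
        show "Hh f12 (int n) \<subseteq> Kc n" using O1_divide[OF O1_1 _ n1] by (auto simp: Hh_def f12_def Kc_mat3)
      qed
      show "\<pi> k2 \<xi> \<in> fx (Xm f12 (int n))"
      proof (rule VK_fx[OF y])
        show "Xm f12 (int n) \<subseteq> G" using cpt_Xm[OF sl2emb_f(1) f12G] by (simp add: cpt_def)
        show "Xm f12 (int n) \<subseteq> Kc n" by (auto simp: Xm_def f12_def Kc_mat3)
      qed
    qed (use n(1) x in simp_all)
  qed
  have "(dim (VK n))\<^sup>2 \<le> card {0..<2 * int n - 1} * (4 * q ^ (4*n))"
  proof (rule dim_le_cells[OF n fdn, where a = ?a and KK = K2])
    show "\<forall>x\<in>{0..<2 * int n - 1}. \<exists>\<Omega>. reps n K2 (?a x) \<Omega> \<and> card \<Omega> \<le> 4 * q ^ (4*n)"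
      using GL2_reps[OF GG n fdn] by simp
    show "K2 \<subseteq> G" using KG by blast
    fix g assume "g \<in> G"
    hence gL: "g \<in> LG" using GG by simp
    obtain e where e: "e \<noteq> 0" "g$3$3 = e" by (rule LG_E[OF gL]) simp
    from cartan2[OF gL] obtain k1 k2 x y where k: "k1 \<in> K2" "k2 \<in> K2" "y \<le> x" "g = k1 ** (mat3 (pw x) 0 0 0 (pw y) 0 0 0 e ** k2)"
      unfolding e(2) by blast
    \<comment> \<open>Dividing by this central element of the Levi factor leaves only the gap x -
      y.\<close>
    let ?z = "mat3 (pw y) 0 0 0 (pw y) 0 0 0 e"
    have zc: "?z ** h = h ** ?z" if "h \<in> LG" for h by (rule LG_E[OF that]) (simp add: mat3_mult mat3_eq mult.commute)
    have zG: "?z \<in> G" unfolding GG by (rule LG_I) (use e in simp_all)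
    have k1L: "k1 \<in> LG" using k(1) G2_LG by blast
    have "mat3 (pw x) 0 0 0 (pw y) 0 0 0 e = ?z ** ?a (x - y)" by (simp add: mat3_mult pw_diff)
    hence "g = ?z ** (k1 ** (?a (x - y) ** k2))" unfolding k(4) by (simp add: matrix_mul_assoc zc[OF k1L])
    moreover have "x - y \<in> {0..<2 * int n - 1} \<or> (\<forall>\<xi>\<in>VK n. A n (k1 ** (?a (x - y) ** k2)) \<xi> = 0)" using k(3) van[OF k(1,2)] by auto
    ultimately show "\<exists>z\<in>G. \<exists>k1\<in>K2. \<exists>k2\<in>K2. \<exists>i. (\<forall>h\<in>G. z ** h = h ** z) \<and> g = z ** (k1 ** (?a i ** k2)) \<and>
      (i \<in> {0..<2 * int n - 1} \<or> (\<forall>\<xi>\<in>VK n. A n (k1 ** (?a i ** k2)) \<xi> = 0))" using zG k(1,2) zc GG by blast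
  qed (simp_all add: aG)
  also have "card {0..<2 * int n - 1} = 2 * n - 1" using n(1) by (simp add: nat_diff_distrib)
  finally show ?thesis .
qed

end

text \<open>The factor 3 q^(2n) counts Iwasawa representatives, and the Levi factor contributes the
  rest. The square is at most 36 (2n - 1) q^(8n), and 2n - 1 <= n^2 keeps it below 81 n^4
  q^(8n).\<close>

lemma (in gl3) GL3_noncuspidal:
  assumes n: "1 \<le> n" "irr n" and fdV: "\<forall>m\<ge>1. fd (VK m)"
    and x0: "x0 \<in> W" "\<And>t. avg (U2 t t) x0 \<noteq> 0"
  shows "dim (VK n) \<le> 9 * n\<^sup>2 * q ^ (4 * n)"
proof -
  interpret p: parab v q smul G W \<pi> LG P3 "\<lambda>t. U2 t t" "\<lambda>m. Ub (int m)" "mat3 (pw 1) 0 0 0 (pw 1) 0 0 0 1" by (rule parab_GL3)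
  have RG: "R3 n \<subseteq> G \<inter> Kmax v" using R3(3)[of n] Kmax_GL3 GG by blast
  have "\<exists>Z. mrep v q scF LG Z p.rho \<and> mrep.irr v scF LG Z p.rho n \<and> (\<forall>m\<ge>1. cvs.fd scF (mrep.VK v LG Z p.rho m)) \<and>
    dim (VK n) \<le> card (R3 n) * vector_space.dim scF (mrep.VK v LG Z p.rho n)"
  proof (rule p.jacquet_bound[OF n _ x0 R3(1) RG])
    show "fd (VK m)" if "1 \<le> m" for m using fdV that by blast
    fix g assume "g \<in> G"
    hence "g \<in> GL3" using GG by simp
    from iwasawa3[OF n(1) this] show "\<exists>h u t r k. h \<in> LG \<and> u \<in> U2 t t \<and> r \<in> R3 n \<and> k \<in> Kc n \<and> g = h ** (u ** (r ** k))" .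
  qed
  then obtain Z where Z: "mrep v q scF LG Z p.rho" "mrep.irr v scF LG Z p.rho n" "\<forall>m\<ge>1. cvs.fd scF (mrep.VK v LG Z p.rho m)"
    "dim (VK n) \<le> card (R3 n) * vector_space.dim scF (mrep.VK v LG Z p.rho n)" by blast
  interpret z: mrep v q scF LG Z p.rho by (rule Z(1))
  let ?d = "z.dim (z.VK n)"
  have d: "?d\<^sup>2 \<le> (2 * n - 1) * (4 * q ^ (4 * n))" by (rule z.LG_dim[OF refl n(1) Z(2,3)])
  have "dim (VK n) \<le> 3 * q ^ (2*n) * ?d" using Z(4) mult_le_mono1[OF R3(2)[of n], of ?d] by linarith
  hence "(dim (VK n))\<^sup>2 \<le> (3 * q ^ (2*n) * ?d)\<^sup>2" by (rule power_mono) simp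
  also have "\<dots> = 9 * q ^ (4*n) * ?d\<^sup>2" by (simp add: power_mult_distrib power_mult[symmetric] mult.commute)
  also have "\<dots> \<le> 9 * q ^ (4*n) * ((2 * n - 1) * (4 * q ^ (4 * n)))" by (rule mult_le_mono2[OF d])
  also have "\<dots> = (36 * (2 * n - 1)) * q ^ (8*n)" by (simp add: power_add[symmetric])
  also have "\<dots> \<le> (81 * n ^ 4) * q ^ (8*n)"
  proof (rule mult_le_mono1)
    have "(2::nat) * n - 1 \<le> n ^ 2"
    proof -
      have "0 \<le> (int n - 1)\<^sup>2" by simp
      hence "2 * int n - 1 \<le> (int n)\<^sup>2" by (simp add: power2_diff)
      hence "int (2 * n) \<le> int (n\<^sup>2 + 1)" by simp
      hence "2 * n \<le> n\<^sup>2 + 1" by (simp only: of_nat_le_iff)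
      thus ?thesis by linarith
    qed
    also have "\<dots> \<le> n ^ 4" using n(1) by (intro power_increasing) simp_all
    finally show "36 * (2 * n - 1) \<le> 81 * n ^ 4" by simp
  qed
  also have "\<dots> = (9 * n\<^sup>2 * q ^ (4*n))\<^sup>2" by (simp add: power_mult_distrib power_mult[symmetric] mult.commute)
  finally show ?thesis by (rule power2_le_imp_le) simp
qed

text \<open>For t = n - (y - z), conjugation by the diagonal matrix carries \<open>U2 t t\<close>
  into \<open>Kc n\<close>, because x - z is at least y - z. With s = n, the condition s + t <= 2 -
  n of \<open>GL3_vanish\<close> reads y - z >= 3n - 2.\<close>

lemma (in cuspidal_gl3) GL3_cuspidal_vanish:
  assumes n: "1 \<le> n" and k: "k1 \<in> Kmax v" "k2 \<in> Kmax v" and x: "y \<le> x" "3 * int n - 2 \<le> y - z" and \<xi>: "\<xi> \<in> VK n"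
  shows "A n (k1 ** (mat3 (pw x) 0 0 0 (pw y) 0 0 0 (pw z) ** k2)) \<xi> = 0"
proof -
  let ?a = "mat3 (pw x) 0 0 0 (pw y) 0 0 0 (pw z) :: 'f ^ 3 ^ 3"
  let ?t = "int n - (y - z)"
  have KG: "k \<in> G \<inter> Kmax v" if "k \<in> Kmax v" for k using that Kmax_GL3 GG by blast
  have aG: "?a \<in> G" by (simp add: GG GL3_def mat3_det)
  show ?thesis
  proof (rule A_vanish[OF n aG KG[OF k(1)] KG[OF k(2)] \<xi> cpt_U2])
    show "?a ** j ** inv3 ?a \<in> Kc n" if j: "j \<in> U2 ?t ?t" for j
    proof -
      obtain s r where r: "j = mat3 1 0 s 0 1 r 0 0 1" "s \<in> P ?t" "r \<in> P ?t" by (rule U2_E[OF j])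
      have e: "?a ** j ** inv3 ?a = mat3 1 0 (pw (x - z) * s) 0 1 (pw (y - z) * r) 0 0 1" unfolding r(1) by (simp add: diag_conj pw_diff)
      have "s \<in> P (int n - (x - z))" by (rule P_mono[OF r(2)]) (use x in simp)
      thus ?thesis unfolding e Kc_mat3 using r(3) by (simp add: pw_mult_P)
    qed
    have y: "\<pi> k2 \<xi> \<in> VK n" by (rule VK_Kmax[OF \<xi>]) (use KG[OF k(2)] in auto)
    show "avg (U2 ?t ?t) (\<pi> k2 \<xi>) = 0"
    proof (rule GL3_vanish[OF n])
      show "\<pi> k2 \<xi> \<in> fx (JL (int n) (int n) (int n) (int n) (int n))"
      proof (rule VK_fx[OF y JL_G])
        show "JL (int n) (int n) (int n) (int n) (int n) \<subseteq> Kc n"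
        proof
          fix g assume g: "g \<in> JL (int n) (int n) (int n) (int n) (int n)"
          hence gJ: "g \<in> JJ (int n) (int n) 0 (int n) 0 (int n) (int n)" "g$1$3 = 0" "g$2$3 = 0" by (auto simp: JL_def)
          show "g \<in> Kc n" by (rule JJ_E[OF gJ(1)]) (use gJ(2,3) in \<open>simp add: Kc_mat3\<close>)
        qed
      qed
    qed (use x in simp_all)
  qed
qed

section \<open>The twist by the inverse transpose\<close>

context dvf begin

definition tau :: "'f ^ 3 ^ 3 \<Rightarrow> 'f ^ 3 ^ 3" where "tau g = transpose (inv3 g)"

lemma det_inv3: "g \<in> GL3 \<Longrightarrow> det (inv3 g) \<noteq> 0" using GL3_inv by (simp add: GL3_def)
lemma tau_GL3: "g \<in> GL3 \<Longrightarrow> tau g \<in> GL3" using det_inv3 by (simp add: tau_def GL3_def det_transpose)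
lemma tau_mult: "g \<in> GL3 \<Longrightarrow> h \<in> GL3 \<Longrightarrow> tau (g ** h) = tau g ** tau h"
  by (simp add: tau_def inv3_mult matrix_transpose_mul)
lemma tau_1 [simp]: "tau (mat 1) = mat 1" by (simp add: tau_def transpose_mat)
lemma tau_tau: assumes "g \<in> GL3" shows "tau (tau g) = g"
proof -
  have "tau g ** transpose g = mat 1" unfolding tau_def
    using GL3_inv1(1)[OF assms] by (metis matrix_transpose_mul transpose_mat)
  hence "inv3 (tau g) = transpose g" by (rule inv3_unique)
  thus ?thesis by (simp add: tau_def)
qed
lemma intm_transpose: "g \<in> intm k \<Longrightarrow> transpose g \<in> intm k" by (simp add: intm_def transpose_def)
lemma tau_Kmax: assumes "g \<in> Kmax v" shows "tau g \<in> Kmax v"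
  using Kmax_inv[OF assms] intm_transpose[of "inv3 g" 0] unfolding Kmax_iff tau_def by (simp add: det_transpose)
lemma tau_Kc: assumes "1 \<le> m" "g \<in> Kc m" shows "tau g \<in> Kc m"
proof -
  have "inv3 g \<in> Kc m" by (rule subgrp_D(4)[OF subgrp_Kc[OF assms(1)] assms(2)])
  hence "transpose (inv3 g - mat 1) \<in> intm (int m)" unfolding Kc_def by (intro intm_transpose) simp
  moreover have "transpose (inv3 g - mat 1) = tau g - mat 1" by (simp add: tau_def vec_eq_iff transpose_def mat_def)
  ultimately show ?thesis by (simp add: Kc_def)
qed
lemma tau_diag: "a \<noteq> 0 \<Longrightarrow> b \<noteq> 0 \<Longrightarrow> c \<noteq> 0 \<Longrightarrow> tau (mat3 a 0 0 0 b 0 0 0 c) = mat3 (1/a) 0 0 0 (1/b) 0 0 0 (1/c)"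
  by (simp add: tau_def inv3_diag mat3_transpose)

end

context gl3 begin

text \<open>\<open>tau\<close> maps GL_3 and each congruence subgroup onto itself, so the twist has
  the same level vectors, the same projections and the same set of operators.\<close>

lemma tau_mrep:
  shows "mrep v q smul GL3 W (\<lambda>g. \<pi> (tau g))"
    and "1 \<le> m \<Longrightarrow> mrep.VK v GL3 W (\<lambda>g. \<pi> (tau g)) m = VK m"
    and "1 \<le> m \<Longrightarrow> mrep.irr v smul GL3 W (\<lambda>g. \<pi> (tau g)) m \<longleftrightarrow> irr m"
    and "1 \<le> m \<Longrightarrow> g \<in> GL3 \<Longrightarrow> mrep.A v smul GL3 (\<lambda>g. \<pi> (tau g)) m (tau g) x = A m g x"
proof -
  have tG: "tau g \<in> G" if "g \<in> GL3" for g using tau_GL3[OF that] GG by simp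
  show M: "mrep v q smul GL3 W (\<lambda>g. \<pi> (tau g))"
  proof (unfold_locales)
    show "subgrp (GL3 :: ('f ^ 3 ^ 3) set)" by (rule subgrp_GL3)
    show "subspace W" by (rule W)
    show "lin_on W (\<pi> (tau g))" if "g \<in> GL3" for g by (rule pi_lin[OF tG[OF that]])
    show "\<pi> (tau g) x \<in> W" if "g \<in> GL3" "x \<in> W" for g x by (rule pi_W[OF tG[OF that(1)] that(2)])
    show "\<pi> (tau (mat 1)) x = x" if "x \<in> W" for x using pi_1[OF that] by simp
    show "\<pi> (tau (g ** h)) x = \<pi> (tau g) (\<pi> (tau h) x)" if "g \<in> GL3" "h \<in> GL3" "x \<in> W" for g h x
      using pi_mult[OF tG[OF that(1)] tG[OF that(2)] that(3)] tau_mult[OF that(1,2)] by simp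
    show "\<exists>m\<ge>1. \<forall>k\<in>GL3 \<inter> Kc m. \<pi> (tau k) x = x" if x: "x \<in> W" for x
    proof -
      obtain m where m: "1 \<le> m" "\<forall>k\<in>G \<inter> Kc m. \<pi> k x = x" using smooth[OF x] by blast
      have "\<forall>k\<in>GL3 \<inter> Kc m. \<pi> (tau k) x = x" using m(2) tG tau_Kc[OF m(1)] by blast
      thus ?thesis using m(1) by blast
    qed
  qed
  have invol: "tau ` S = S" if "S \<subseteq> GL3" "\<And>g. g \<in> S \<Longrightarrow> tau g \<in> S" for S
  proof
    show "tau ` S \<subseteq> S" using that(2) by blast
    show "S \<subseteq> tau ` S"
    proof
      fix g assume g: "g \<in> S"
      hence "g = tau (tau g)" using tau_tau that(1) by auto
      thus "g \<in> tau ` S" using that(2)[OF g] by (rule image_eqI)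
    qed
  qed
  have tK: "tau ` (GL3 \<inter> Kc m) = GL3 \<inter> Kc m" if "1 \<le> m" for m
    by (rule invol) (use tau_GL3 tau_Kc[OF that] in auto)
  have tGL: "tau ` GL3 = GL3" by (rule invol[OF order_refl tau_GL3])
  show VK: "mrep.VK v GL3 W (\<lambda>g. \<pi> (tau g)) m = VK m" if "1 \<le> m" for m
  proof -
    have "mrep.VK v GL3 W (\<lambda>g. \<pi> (tau g)) m = {x\<in>W. \<forall>j\<in>tau ` (GL3 \<inter> Kc m). \<pi> j x = x}"
      unfolding mrep.VK_def[OF M] mrep.fx_def[OF M] by simp
    also have "\<dots> = {x\<in>W. \<forall>j\<in>G \<inter> Kc m. \<pi> j x = x}" by (simp only: tK[OF that] GG)
    also have "\<dots> = VK m" by (simp add: VK_def fx_def)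
    finally show ?thesis .
  qed
  show "mrep.irr v smul GL3 W (\<lambda>g. \<pi> (tau g)) m \<longleftrightarrow> irr m" if "1 \<le> m" for m
  proof -
    have "(\<lambda>g. \<pi> (tau g) x) ` GL3 = (\<lambda>g. \<pi> g x) ` tau ` GL3" for x by (simp add: image_image)
    hence "(\<lambda>g. \<pi> (tau g) x) ` GL3 = (\<lambda>g. \<pi> g x) ` GL3" for x by (simp only: tGL)
    hence "mrep.irr v smul GL3 W (\<lambda>g. \<pi> (tau g)) m \<longleftrightarrow> (\<forall>x\<in>VK m. x \<noteq> 0 \<longrightarrow> W \<subseteq> span ((\<lambda>g. \<pi> g x) ` G))"
      unfolding mrep.irr_def[OF M] VK[OF that] by (simp only: GG)
    thus ?thesis unfolding irr_def .
  qed
  show "mrep.A v smul GL3 (\<lambda>g. \<pi> (tau g)) m (tau g) x = A m g x" if m: "1 \<le> m" and g: "g \<in> GL3"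
  proof -
    have "mrep.orb (\<lambda>g. \<pi> (tau g)) (GL3 \<inter> Kc m) y = (\<lambda>j. \<pi> j y) ` tau ` (GL3 \<inter> Kc m)" for y
      unfolding mrep.orb_def[OF M] by (simp add: image_image)
    hence "mrep.orb (\<lambda>g. \<pi> (tau g)) (GL3 \<inter> Kc m) y = orb (GL3 \<inter> Kc m) y" for y by (simp only: tK[OF m] orb_def)
    hence "mrep.A v smul GL3 (\<lambda>g. \<pi> (tau g)) m (tau g) x = eK m (\<pi> g x)"
      unfolding mrep.A_def[OF M] mrep.eK_def[OF M] mrep.avg_def[OF M] eK_def avg_def tau_tau[OF g] by (simp only: GG)
    thus ?thesis unfolding A_def .
  qed
qed

theorem GL3_dim:
  assumes n: "1 \<le> n" "irr n" and fdV: "\<forall>m\<ge>1. fd (VK m)"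
  shows "dim (VK n) \<le> 9 * n\<^sup>2 * q ^ (4 * n)"
proof (cases "\<exists>x0\<in>W. \<forall>t. avg (U2 t t) x0 \<noteq> 0")
  case True
  thus ?thesis using GL3_noncuspidal[OF n fdV] by blast
next
  case False
  hence sc: "\<And>x. x \<in> W \<Longrightarrow> \<exists>t. avg (U2 t t) x = 0" by blast
  interpret c: cuspidal_gl3 v q smul G W \<pi> by unfold_locales (rule sc)
  interpret t: gl3 v q smul GL3 W "\<lambda>g. \<pi> (tau g)" by (intro gl3.intro tau_mrep(1) gl3_axioms.intro refl)
  note tV = tau_mrep(2) and ti = tau_mrep(3) and tA = tau_mrep(4)
  have tfd: "\<forall>m\<ge>1. fd (t.VK m)" using fdV tV by simp
  show ?thesis
  proof (cases "\<exists>x0\<in>W. \<forall>s. t.avg (U2 s s) x0 \<noteq> 0")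
    case True
    then obtain x0 where "x0 \<in> W" "\<And>s. t.avg (U2 s s) x0 \<noteq> 0" by blast
    from t.GL3_noncuspidal[OF n(1) _ tfd this] show ?thesis using ti[OF n(1)] n tV[OF n(1)] by simp
  next
    case False
    then interpret tc: cuspidal_gl3 v q smul GL3 W "\<lambda>g. \<pi> (tau g)" by unfold_locales blast
    have fdn: "fd (VK n)" using fdV n(1) by blast
    let ?a = "\<lambda>x y z. mat3 (pw x) 0 0 0 (pw y) 0 0 0 (pw z) :: 'f ^ 3 ^ 3"
    let ?N = "3 * n - 2"
    have aG: "?a x y z \<in> GL3" for x y z by (simp add: GL3_def mat3_det)
    \<comment> \<open>Up to permutation matrices, \<open>tau\<close> turns the exponents (x, y, z)
      into (-z, -y, -x), so the gap x - y takes the place of y - z in the twisted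
      representation.\<close>
    have van2: "A n (k1 ** (?a x y z ** k2)) \<xi> = 0"
      if k: "k1 \<in> Kmax v" "k2 \<in> Kmax v" and o: "z \<le> y" "3 * int n - 2 \<le> x - y" and \<xi>: "\<xi> \<in> VK n" for k1 k2 x y z \<xi>
    proof -
      let ?w = "mat3 0 0 1 0 1 0 1 0 0 :: 'f ^ 3 ^ 3"
      have wK: "?w \<in> Kmax v" unfolding Kmax_iff intm_mat3 by (simp add: mat3_det)
      have kG: "k1 \<in> GL3" "k2 \<in> GL3" using k Kmax_GL3 by auto
      note KM = subgrp_D(3)[OF subgrp_Kmax]
      have "tau (k1 ** (?a x y z ** k2)) = tau k1 ** (tau (?a x y z) ** tau k2)"
        using tau_mult[OF kG(1) GL3_mult[OF aG kG(2)]] tau_mult[OF aG kG(2)] by simp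
      also have "tau (?a x y z) = ?w ** (?a (-z) (-y) (-x) ** ?w)"
        unfolding tau_diag[OF pw_nz pw_nz pw_nz] mat3_mult mat3_eq by (simp add: pw_minus inverse_eq_divide)
      also have "tau k1 ** ((?w ** (?a (-z) (-y) (-x) ** ?w)) ** tau k2) = (tau k1 ** ?w) ** (?a (-z) (-y) (-x) ** (?w ** tau k2))"
        by (simp add: matrix_mul_assoc)
      finally have e: "tau (k1 ** (?a x y z ** k2)) = (tau k1 ** ?w) ** (?a (-z) (-y) (-x) ** (?w ** tau k2))" .
      have "A n (k1 ** (?a x y z ** k2)) \<xi> = t.A n (tau (k1 ** (?a x y z ** k2))) \<xi>"
        by (rule tA[OF n(1) GL3_mult[OF kG(1) GL3_mult[OF aG kG(2)]], symmetric])
      also have "\<dots> = 0" unfolding e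
        by (rule tc.GL3_cuspidal_vanish[OF n(1) KM[OF tau_Kmax[OF k(1)] wK] KM[OF wK tau_Kmax[OF k(2)]]])
           (use o \<xi> tV[OF n(1)] in simp_all)
      finally show ?thesis .
    qed
    \<comment> \<open>Scalars are central, so a diagonal matrix is normalized to last entry 1 and
      indexed by its two gaps.\<close>
    let ?I = "{0..<int ?N} \<times> {0..<int ?N}" and ?b = "\<lambda>p. ?a (fst p + snd p) (snd p) 0"
    have "(dim (VK n))\<^sup>2 \<le> card ?I * (16 * q ^ (8*n))"
    proof (rule dim_le_cells[OF n fdn, where a = ?b and KK = "Kmax v"])
      show "\<forall>p\<in>?I. \<exists>\<Omega>. reps n (Kmax v) (?b p) \<Omega> \<and> card \<Omega> \<le> 16 * q ^ (8*n)"
        by (intro ballI GL3_reps[OF n fdn]) auto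
      show "?b p \<in> G" for p using aG GG by blast
      show "Kmax v \<subseteq> G" using Kmax_GL3 GG by blast
      fix g assume "g \<in> G"
      hence gL: "g \<in> GL3" using GG by simp
      obtain k1 k2 x y z where k: "k1 \<in> Kmax v" "k2 \<in> Kmax v" "z \<le> y" "y \<le> x" "g = k1 ** (?a x y z ** k2)" using cartan3[OF gL] by blast
      let ?z = "mat3 (pw z) 0 0 0 (pw z) 0 0 0 (pw z) :: 'f ^ 3 ^ 3" and ?p = "(x - y, y - z)"
      have zc: "?z ** h = h ** ?z" for h by (rule mat3_cases[of h]) (simp add: mat3_mult mat3_eq mult.commute)
      have zG: "?z \<in> G" by (simp add: GG GL3_def mat3_det)
      have "?a x y z = ?z ** ?b ?p" unfolding mat3_mult mat3_eq by (simp add: pw_diff)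
      hence ge: "g = ?z ** (k1 ** (?b ?p ** k2))" unfolding k(5) by (simp add: matrix_mul_assoc zc[of k1])
      have van: "?p \<in> ?I \<or> (\<forall>\<xi>\<in>VK n. A n (k1 ** (?b ?p ** k2)) \<xi> = 0)"
      proof (cases "3 * int n - 2 \<le> y - z \<or> 3 * int n - 2 \<le> x - y")
        case True
        have "A n (k1 ** (?b ?p ** k2)) \<xi> = 0" if \<xi>: "\<xi> \<in> VK n" for \<xi>
          using True
        proof
          assume "3 * int n - 2 \<le> y - z"
          thus ?thesis by (intro c.GL3_cuspidal_vanish[OF n(1) k(1,2) _ _ \<xi>]) (use k(4) in simp_all)
        next
          assume "3 * int n - 2 \<le> x - y"
          thus ?thesis by (intro van2[OF k(1,2) _ _ \<xi>]) (use k(3) in simp_all)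
        qed
        thus ?thesis by blast
      qed (use k(3,4) n(1) in auto)
      show "\<exists>z\<in>G. \<exists>k1\<in>Kmax v. \<exists>k2\<in>Kmax v. \<exists>p. (\<forall>h\<in>G. z ** h = h ** z) \<and> g = z ** (k1 ** (?b p ** k2)) \<and>
        (p \<in> ?I \<or> (\<forall>\<xi>\<in>VK n. A n (k1 ** (?b p ** k2)) \<xi> = 0))"
        by (rule bexI[OF _ zG], rule bexI[OF _ k(1)], rule bexI[OF _ k(2)], rule exI[of _ ?p]) (use zc ge van in blast)
    qed simp
    also have "\<dots> = (4 * ?N * q ^ (4*n))\<^sup>2"
      by (simp add: card_cartesian_product power_mult_distrib power_mult[symmetric]) (simp add: power2_eq_square mult_ac)
    finally have "dim (VK n) \<le> 4 * ?N * q ^ (4*n)" by (rule power2_le_imp_le) simp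
    also have "\<dots> \<le> 9 * n\<^sup>2 * q ^ (4*n)"
    proof (rule mult_le_mono1)
      have "0 \<le> (3 * int n - 2)\<^sup>2" by simp
      hence "4 * (3 * int n) \<le> 9 * (int n)\<^sup>2 + 4" by (simp add: power2_diff power_mult_distrib)
      hence "int (4 * (3 * n)) \<le> int (9 * n\<^sup>2 + 4)" by simp
      hence "4 * (3 * n) \<le> 9 * n\<^sup>2 + 4" by (simp only: of_nat_le_iff)
      thus "4 * ?N \<le> 9 * n\<^sup>2" using n(1) by linarith
    qed
    finally show ?thesis .
  qed
qed

end

theorem theorem9p1:
  fixes v :: "'f::field \<Rightarrow> int" and p q :: nat
    and smul :: "complex \<Rightarrow> 'v::ab_group_add \<Rightarrow> 'v"
    and \<pi> :: "'f ^ 3 ^ 3 \<Rightarrow> 'v \<Rightarrow> 'v"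
  assumes "p_adic_field v p q" and "p \<noteq> 2" and "p \<noteq> 3"
    and "admissible_rep v smul \<pi>" and "irreducible_rep smul \<pi>"
  shows "\<forall>n::nat. n \<ge> 1 \<longrightarrow>
     real (vector_space.dim smul (fixed_vectors v \<pi> n))
       \<le> 9 * real n ^ 2 * real q ^ (4 * n) * (1 + 1 / real q) ^ 3"
proof (intro allI impI)
  fix n :: nat assume n: "n \<ge> 1"
  interpret d: dvf v q by (rule p_adic_dvf[OF assms(1)])
  have sm: "smooth_rep v smul \<pi>" using assms(4) by (simp add: admissible_rep_def)
  have vs: "vector_space smul" using sm by (simp add: smooth_rep_def)
  interpret c: cvs smul unfolding cvs_def by (rule vs)
  have lin: "Vector_Spaces.linear smul smul (\<pi> g)" if "g \<in> GL3" for g using sm that by (simp add: smooth_rep_def)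
  interpret r: gl3 v q smul GL3 UNIV \<pi>
  proof (unfold_locales)
    show "subgrp (GL3 :: ('f ^ 3 ^ 3) set)" by (rule subgrp_GL3)
    show "c.subspace UNIV" by simp
    show "c.lin_on UNIV (\<pi> g)" if "g \<in> GL3" for g
    proof -
      interpret l: Vector_Spaces.linear smul smul "\<pi> g" by (rule lin[OF that])
      show ?thesis unfolding c.lin_on_def using l.add l.scale by blast
    qed
    show "\<pi> (mat 1) x = x" for x using sm by (simp add: smooth_rep_def)
    show "\<pi> (g ** h) x = \<pi> g (\<pi> h x)" if "g \<in> GL3" "h \<in> GL3" for g h x using sm that by (simp add: smooth_rep_def)
    show "\<exists>m\<ge>1. \<forall>k\<in>GL3 \<inter> d.Kc m. \<pi> k x = x" for x
    proof -
      obtain m where m: "1 \<le> m" "x \<in> fixed_vectors v \<pi> m" using sm unfolding smooth_rep_def by blast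
      have "\<forall>k\<in>GL3 \<inter> d.Kc m. \<pi> k x = x" using m(2) unfolding fixed_vectors_def d.Kn_Kc[OF m(1)] by blast
      thus ?thesis using m(1) by blast
    qed
  qed simp_all
  \<comment> \<open>For positive m the congruence subgroup already lies in GL_3, so intersecting
    with the acting group changes nothing.\<close>
  have V: "fixed_vectors v \<pi> m = r.VK m" if m: "1 \<le> m" for m
  proof -
    have "d.Kc m \<subseteq> GL3" using d.Kc_Kmax[OF m] d.Kmax_GL3 by blast
    hence "GL3 \<inter> d.Kc m = d.Kc m" by blast
    thus ?thesis unfolding fixed_vectors_def r.VK_def r.fx_def d.Kn_Kc[OF m] by simp
  qed
  have fdV: "\<forall>m\<ge>1. c.fd (r.VK m)"
  proof (intro allI impI)
    fix m :: nat assume m: "1 \<le> m"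
    show "c.fd (r.VK m)" unfolding c.fd_def V[OF m, symmetric] using assms(4) m unfolding admissible_rep_def by blast
  qed
  have irr: "r.irr n" unfolding r.irr_def
  proof (intro ballI impI)
    fix x assume x: "x \<in> r.VK n" "x \<noteq> 0"
    let ?S = "c.span ((\<lambda>g. \<pi> g x) ` GL3)"
    have "\<forall>g\<in>GL3. \<pi> g ` ?S \<subseteq> ?S" using r.span_orbit_stable[of x] by blast
    hence "?S = {0} \<or> ?S = UNIV" using assms(5) unfolding irreducible_rep_def by (meson c.subspace_span)
    moreover have "x \<in> ?S" by (rule c.span_base) (use r.pi_1[of x] in \<open>auto intro!: image_eqI[of _ _ "mat 1"]\<close>)
    ultimately show "UNIV \<subseteq> ?S" using x(2) by blast
  qed
  have "c.dim (fixed_vectors v \<pi> n) \<le> 9 * n\<^sup>2 * q ^ (4 * n)" unfolding V[OF n] by (rule r.GL3_dim[OF n irr fdV])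
  hence "real (c.dim (fixed_vectors v \<pi> n)) \<le> real (9 * n\<^sup>2 * q ^ (4 * n))" by (rule of_nat_mono)
  also have "\<dots> = 9 * real n ^ 2 * real q ^ (4 * n) * 1" by simp
  also have "\<dots> \<le> 9 * real n ^ 2 * real q ^ (4 * n) * (1 + 1 / real q) ^ 3"
    by (rule mult_left_mono) (simp_all add: one_le_power)
  finally show "real (vector_space.dim smul (fixed_vectors v \<pi> n)) \<le> 9 * real n ^ 2 * real q ^ (4 * n) * (1 + 1 / real q) ^ 3" .
qed

end
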